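(* Let $E\in\mathscr K$ with endpoints $l=\inf E$, $r=\sup E$, $\mu$ a fully supported Radon measure on $E$, and $({\mathscr E},{\mathscr F})$ the Dirichlet form on $L^2(E,\mu)$ associated with a quasidiffusion on $E$: \[ {\mathscr F}=\{f\in L^2(E,\mu)\cap H^1_e(E): f(j)=0 \text{ whenever } j\notin E \text{ and } |j|<\infty \text{ for } j=l \text{ or } r\}, \] \[ {\mathscr E}(f,g)=\frac12\int_E f'(x)g'(x)\,dx+\frac12\sum_{k\ge1}\frac{(f(b_k)-f(a_k))(g(b_k)-g(a_k))}{b_k-a_k}. \] Let $\mathfrak S$ be the set of all ${\mathscr F}'$ such that $({\mathscr E}',{\mathscr F}')$ is a Fukushima subspace of $({\mathscr E},{\mathscr F})$, partially ordered by inclusion. Then $\mathfrak S$ admits a minimal element if and only if $E$ is nowhere dense (i.e. has empty interior). In that case the minimal element ${\mathscr F}'$ is unique, its characteristic set is the empty set, and its strongly local part vanishes, i.e. for all $f,g\in{\mathscr F}'$, \[ {\mathscr E}'(f,g)=\frac12\sum_{k\ge1}\frac{(f(b_k)-f(a_k))(g(b_k)-g(a_k))}{b_k-a_k}. \]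
   Context: $\mathscr K$ is the family of $E\subset\mathbb R$ such that $E\cup\{l,r\}$ is closed in $[-\infty,\infty]$, where $l=\inf E<r=\sup E$. $I$ is the interval with endpoints $l,r$ containing $l$ (resp. $r$) iff it belongs to $E$; $I\setminus E=\bigcup_{k\ge1}(a_k,b_k)$ disjoint open intervals. $H^1_e(E)$ is the set of restrictions to $E$ of absolutely continuous $f$ on $(l,r)$ with $f'\in L^2((l,r))$. A Fukushima subspace of $({\mathscr E},{\mathscr F})$ is a regular Dirichlet form $({\mathscr E}',{\mathscr F}')$ on $L^2(E,\mu)$ with ${\mathscr F}'\subset{\mathscr F}$ and ${\mathscr E}'={\mathscr E}$ on ${\mathscr F}'$. A minimal element is ${\mathscr F}'\in\mathfrak S$ such that ${\mathscr F}''\in\mathfrak S$, ${\mathscr F}''\subset{\mathscr F}'$ implies ${\mathscr F}''={\mathscr F}'$. Every Fukushima subspace has the form ${\mathscr F}'=\{f\in L^2(E,\mu)\cap H^1_{e,\mathbf s}(E): f(j)=0$ whenever $j\notin E$, $|\mathbf s(j)|<\infty\}$, ${\mathscr E}'(f,g)=\frac12\int_E\frac{df}{d\mathbf s}\frac{dg}{d\mathbf s}d\mathbf s+\frac12\sum_k\frac{(f(b_k)-f(a_k))(g(b_k)-g(a_k))}{\mathbf s(b_k)-\mathbf s(a_k)}$ for a scale function $\mathbf s=\bar{\mathbf s}|_E$ with $\bar{\mathbf s}$ strictly increasing, absolutely continuous on $I$, $\bar{\mathbf s}'\in\{0,1\}$ a.e., $\bar{\mathbf s}'=1$ on $I\setminus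 E$ (here $H^1_{e,\mathbf s}(E)$ is the set of restrictions to $E$ of $f=g\circ\bar{\mathbf s}$ with $g$ absolutely continuous and $\int_I(g'\circ\bar{\mathbf s})^2d\bar{\mathbf s}<\infty$, $df/d\mathbf s=(g'\circ\bar{\mathbf s})|_E$); its characteristic set is $\{x\in E:\bar{\mathbf s}'(x)=1\}$, a Lebesgue-a.e. equivalence class. *)

theory Defs
  imports "HOL-Analysis.Analysis"
begin

definition lE :: "real set \<Rightarrow> ereal" where
  "lE E = Inf (ereal ` E)"

definition rE :: "real set \<Rightarrow> ereal" where
  "rE E = Sup (ereal ` E)"

text \<open>E is in the class K: l < r and E together with {l,r} is closed in the
  extended real line (for real points this means: every real limit point of E
  lies in E or is a (finite) endpoint).\<close>
definition class_K :: "real set \<Rightarrow> bool" where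
  "class_K E \<longleftrightarrow> lE E < rE E \<and>
     (\<forall>x. x \<in> closure E \<longrightarrow> x \<in> E \<or> ereal x = lE E \<or> ereal x = rE E)"

definition intI :: "real set \<Rightarrow> real set" where
  "intI E = {x. (lE E < ereal x \<or> x \<in> E) \<and> (ereal x < rE E \<or> x \<in> E)}"

text \<open>The gaps (a_k,b_k): connected components of I minus E (their endpoints lie in E).\<close>
definition gaps :: "real set \<Rightarrow> (real \<times> real) set" where
  "gaps E = {(a, b). a \<in> E \<and> b \<in> E \<and> a < b \<and> {a<..<b} \<inter> E = {}}"

definition gap_sum :: "real set \<Rightarrow> (real \<Rightarrow> real) \<Rightarrow> (real \<Rightarrow> real) \<Rightarrow> real" where
  "gap_sum E f g = infsum (\<lambda>(a, b). (f b - f a) * (g b - g a) / (b - a)) (gaps E)"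

definition full_radon_on :: "real set \<Rightarrow> real measure \<Rightarrow> bool" where
  "full_radon_on E \<mu> \<longleftrightarrow>
     sets \<mu> = sets (restrict_space borel E) \<and>
     (\<forall>K. compact K \<and> K \<subseteq> E \<longrightarrow> emeasure \<mu> K < \<infinity>) \<and>
     (\<forall>U. open U \<and> U \<inter> E \<noteq> {} \<longrightarrow> emeasure \<mu> (U \<inter> E) > 0)"

definition L2 :: "real measure \<Rightarrow> (real \<Rightarrow> real) \<Rightarrow> bool" where
  "L2 \<mu> f \<longleftrightarrow> f \<in> borel_measurable \<mu> \<and> integrable \<mu> (\<lambda>x. (f x)\<^sup>2)"

definition scale_fn :: "real set \<Rightarrow> (real \<Rightarrow> real) \<Rightarrow> (real \<Rightarrow> real) \<Rightarrow> bool" where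
  "scale_fn E sb h \<longleftrightarrow>
     h \<in> borel_measurable borel \<and> (\<forall>x. h x = 0 \<or> h x = 1) \<and>
     (\<forall>x \<in> intI E - E. h x = 1) \<and>
     strict_mono_on (intI E) sb \<and>
     (\<forall>x y. x \<in> intI E \<and> y \<in> intI E \<and> x \<le> y \<longrightarrow>
        set_integrable lborel {x..y} h \<and> sb y - sb x = set_lebesgue_integral lborel {x..y} h)"

text \<open>s(l) and s(r) (possibly infinite limits of sb at the endpoints).\<close>
definition s_lo :: "real set \<Rightarrow> (real \<Rightarrow> real) \<Rightarrow> ereal" where
  "s_lo E sb = Inf (ereal ` sb ` intI E)"

definition s_hi :: "real set \<Rightarrow> (real \<Rightarrow> real) \<Rightarrow> ereal" where
  "s_hi E sb = Sup (ereal ` sb ` intI E)"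

definition s_hull :: "real set \<Rightarrow> (real \<Rightarrow> real) \<Rightarrow> real set" where
  "s_hull E sb = {y. s_lo E sb \<le> ereal y \<and> ereal y \<le> s_hi E sb}"

text \<open>f restricted to E equals G o sb, G absolutely continuous (on the closure of sb(I))
  with derivative k, and the integral over I of (k o sb)^2 d sb = (k o sb)^2 h dx is finite.\<close>
definition H1s_rep :: "real set \<Rightarrow> (real \<Rightarrow> real) \<Rightarrow> (real \<Rightarrow> real) \<Rightarrow> (real \<Rightarrow> real)
    \<Rightarrow> (real \<Rightarrow> real) \<Rightarrow> (real \<Rightarrow> real) \<Rightarrow> bool" where
  "H1s_rep E sb h f G k \<longleftrightarrow>
     k \<in> borel_measurable borel \<and>
     (\<forall>y z. y \<in> s_hull E sb \<and> z \<in> s_hull E sb \<and> z \<le> y \<longrightarrow>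
        set_integrable lborel {z..y} k \<and> G y - G z = set_lebesgue_integral lborel {z..y} k) \<and>
     set_integrable lborel (intI E) (\<lambda>x. (k (sb x))\<^sup>2 * h x) \<and>
     (\<forall>x \<in> E. f x = G (sb x))"

definition s_bdry :: "real set \<Rightarrow> (real \<Rightarrow> real) \<Rightarrow> (real \<Rightarrow> real) \<Rightarrow> bool" where
  "s_bdry E sb G \<longleftrightarrow>
     (lE E \<notin> ereal ` E \<and> \<bar>s_lo E sb\<bar> \<noteq> \<infinity> \<longrightarrow> G (real_of_ereal (s_lo E sb)) = 0) \<and>
     (rE E \<notin> ereal ` E \<and> \<bar>s_hi E sb\<bar> \<noteq> \<infinity> \<longrightarrow> G (real_of_ereal (s_hi E sb)) = 0)"

text \<open>Elements of L^2(E,mu) are represented by functions vanishing off E (the elements of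
  all spaces below are continuous on E, and mu has full support, so this is canonical).\<close>
definition Fs_space :: "real set \<Rightarrow> real measure \<Rightarrow> (real \<Rightarrow> real) \<Rightarrow> (real \<Rightarrow> real)
    \<Rightarrow> (real \<Rightarrow> real) set" where
  "Fs_space E \<mu> sb h = {f. (\<forall>x. x \<notin> E \<longrightarrow> f x = 0) \<and> L2 \<mu> f \<and>
      (\<exists>G k. H1s_rep E sb h f G k \<and> s_bdry E sb G)}"

text \<open>H^1_e(E) is the case sb = id (derivative density 1): f is the restriction of an
  absolutely continuous function on (l,r) (extended to finite endpoints) with f' in L^2.\<close>
definition F_space :: "real set \<Rightarrow> real measure \<Rightarrow> (real \<Rightarrow> real) set" where
  "F_space E \<mu> = Fs_space E \<mu> id (\<lambda>_. 1)"

definition H1_der :: "real set \<Rightarrow> (real \<Rightarrow> real) \<Rightarrow> (real \<Rightarrow> real)" where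
  "H1_der E f = (SOME k. \<exists>G. H1s_rep E id (\<lambda>_. 1) f G k)"

definition form :: "real set \<Rightarrow> (real \<Rightarrow> real) \<Rightarrow> (real \<Rightarrow> real) \<Rightarrow> real" where
  "form E f g = 1/2 * set_lebesgue_integral lborel E (\<lambda>x. H1_der E f x * H1_der E g x)
               + 1/2 * gap_sum E f g"

definition E1 :: "real set \<Rightarrow> real measure \<Rightarrow> (real \<Rightarrow> real) \<Rightarrow> real" where
  "E1 E \<mu> f = form E f f + integral\<^sup>L \<mu> (\<lambda>x. (f x)\<^sup>2)"

definition Cc :: "real set \<Rightarrow> (real \<Rightarrow> real) set" where
  "Cc E = {f. continuous_on E f \<and> (\<forall>x. x \<notin> E \<longrightarrow> f x = 0) \<and>
              (\<exists>K. compact K \<and> K \<subseteq> E \<and> (\<forall>x \<in> E - K. f x = 0))}"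

definition regular_dirichlet :: "real set \<Rightarrow> real measure \<Rightarrow> (real \<Rightarrow> real) set \<Rightarrow> bool" where
  "regular_dirichlet E \<mu> S \<longleftrightarrow>
     \<comment> \<open>linear subspace of L^2(E,mu)\<close>
     (\<forall>f \<in> S. (\<forall>x. x \<notin> E \<longrightarrow> f x = 0) \<and> L2 \<mu> f) \<and>
     (\<lambda>_. 0) \<in> S \<and>
     (\<forall>f \<in> S. \<forall>g \<in> S. (\<lambda>x. f x + g x) \<in> S) \<and>
     (\<forall>f \<in> S. \<forall>c. (\<lambda>x. c * f x) \<in> S) \<and>
     \<comment> \<open>dense in L^2(E,mu)\<close>
     (\<forall>u. L2 \<mu> u \<longrightarrow> (\<forall>\<epsilon>>0. \<exists>f \<in> S. integral\<^sup>L \<mu> (\<lambda>x. (u x - f x)\<^sup>2) < \<epsilon>)) \<and>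
     \<comment> \<open>symmetric, nonnegative definite\<close>
     (\<forall>f \<in> S. \<forall>g \<in> S. form E f g = form E g f) \<and>
     (\<forall>f \<in> S. form E f f \<ge> 0) \<and>
     \<comment> \<open>closed: complete w.r.t. the E_1 norm\<close>
     (\<forall>fs. (\<forall>n. fs n \<in> S) \<and>
           (\<forall>\<epsilon>>0. \<exists>N. \<forall>m\<ge>N. \<forall>n\<ge>N. E1 E \<mu> (\<lambda>x. fs n x - fs m x) < \<epsilon>) \<longrightarrow>
           (\<exists>f \<in> S. (\<lambda>n. E1 E \<mu> (\<lambda>x. fs n x - f x)) \<longlonglongrightarrow> 0)) \<and>
     \<comment> \<open>Markovian: the unit contraction operates\<close>
     (\<forall>f \<in> S. (\<lambda>x. min 1 (max 0 (f x))) \<in> S \<and>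
              form E (\<lambda>x. min 1 (max 0 (f x))) (\<lambda>x. min 1 (max 0 (f x))) \<le> form E f f) \<and>
     \<comment> \<open>regular: S \<inter> C_c(E) is a core\<close>
     (\<forall>f \<in> S. \<forall>\<epsilon>>0. \<exists>g \<in> S \<inter> Cc E. E1 E \<mu> (\<lambda>x. f x - g x) < \<epsilon>) \<and>
     (\<forall>u \<in> Cc E. \<forall>\<epsilon>>0. \<exists>g \<in> S \<inter> Cc E. \<forall>x \<in> E. \<bar>u x - g x\<bar> < \<epsilon>)"

text \<open>S is (the domain of) a Fukushima subspace of (form, F_space); its form is the
  restriction of form to S.\<close>
definition fukushima_subspace :: "real set \<Rightarrow> real measure \<Rightarrow> (real \<Rightarrow> real) set \<Rightarrow> bool" where
  "fukushima_subspace E \<mu> S \<longleftrightarrow> S \<subseteq> F_space E \<mu> \<and> regular_dirichlet E \<mu> S"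

definition minimal_fukushima :: "real set \<Rightarrow> real measure \<Rightarrow> (real \<Rightarrow> real) set \<Rightarrow> bool" where
  "minimal_fukushima E \<mu> S \<longleftrightarrow> fukushima_subspace E \<mu> S \<and>
     (\<forall>S'. fukushima_subspace E \<mu> S' \<and> S' \<subseteq> S \<longrightarrow> S' = S)"

definition represented_by :: "real set \<Rightarrow> real measure \<Rightarrow> (real \<Rightarrow> real) set
    \<Rightarrow> (real \<Rightarrow> real) \<Rightarrow> (real \<Rightarrow> real) \<Rightarrow> bool" where
  "represented_by E \<mu> S sb h \<longleftrightarrow> scale_fn E sb h \<and> S = Fs_space E \<mu> sb h"

text \<open>The characteristic set {x in E. sb'(x) = 1} (Lebesgue-a.e. class).\<close>
definition char_set :: "real set \<Rightarrow> (real \<Rightarrow> real) \<Rightarrow> real set" where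
  "char_set E h = {x \<in> E. h x = 1}"

end

theory Submission
  imports Defs
begin

text \<open>Increments of a function in the domain split into a part carried by \<open>E\<close>, with an almost everywhere
unique derivative there, and the jumps over the gaps.

If \<open>E\<close> contains an interval \<open>[c, d]\<close>, any Fukushima subspace \<open>S\<close> contains an \<open>f\<close> whose derivative does not
vanish on a set of positive measure in the interior of \<open>[c, d]\<close>. Removing a small open neighbourhood of the
rationals leaves a closed set \<open>C\<close>, without interior, still meeting that set in positive measure. The elements of
\<open>S\<close> whose derivative vanishes on \<open>C\<close> form a strictly smaller Fukushima subspace, so nothing is minimal.

If \<open>E\<close> has empty interior, the scale function with density \<open>1\<close> exactly off \<open>E\<close> is strictly increasing, and its
space consists of the functions that are sums of their jumps over the gaps. Indicators of compact relatively open
pieces \<open>E \<inter> [b, q]\<close> lie in every Fukushima subspace, since regularity approximates them uniformly and a contraction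
then recovers the exact values \<open>0\<close> and \<open>1\<close>. Their span is a core of this space, which is therefore the least
Fukushima subspace.\<close>

text \<open>Subspaces are never classified by scale functions: an arbitrary one is handled through
  the axioms of a regular Dirichlet form alone. The chain rule is replaced by a calculus of
  increments: if \<open>\<bar>f y - f x\<bar>\<close> is bounded by an integral of \<open>m\<close>
  for all points \<open>x\<close>, \<open>y\<close> of \<open>E\<close>, then the derivative of
  \<open>f\<close> is bounded by \<open>m\<close> almost everywhere on \<open>E\<close>.
  Contractions, maxima and products are thus controlled without being differentiated. The closed set
  \<open>C\<close> avoids the rationals because the smaller subspace needs bump functions that are
  flat on \<open>C\<close>; every interval then has a subinterval free of \<open>C\<close> where
  they can rise or fall. The delicate axiom is the core condition: a compactly supported
  approximation of a function flat on \<open>C\<close> need not be flat there, hence the gluing.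
  When \<open>E\<close> has no interior, the obstacle is an end point outside \<open>E\<close>. A
  function must vanish there exactly when the point is at finite distance in the scale
  \<open>sb\<close>, which can happen even if the end point is infinite. Truncating small values
  treats the finite case, a cutoff in the variable \<open>sb\<close> the infinite one.\<close>

section \<open>End points of a set in the extended line\<close>

lemma lE_le: "x \<in> E \<Longrightarrow> lE E \<le> ereal x"
  unfolding lE_def by (simp add: INF_lower)

lemma rE_ge: "x \<in> E \<Longrightarrow> ereal x \<le> rE E"
  unfolding rE_def by (simp add: SUP_upper)

lemma lE_less_iff: "lE E < ereal x \<longleftrightarrow> (\<exists>e\<in>E. e < x)"
  unfolding lE_def by (simp add: Inf_less_iff)

lemma rE_greater_iff: "ereal x < rE E \<longleftrightarrow> (\<exists>e\<in>E. x < e)"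
  unfolding rE_def by (simp add: less_Sup_iff)

section \<open>Gaps\<close>

definition gapU :: "real set \<Rightarrow> real set" where
  "gapU E = (\<Union>(a, b)\<in>gaps E. {a<..<b})"

definition gap_at :: "real set \<Rightarrow> real \<Rightarrow> real \<times> real" where
  "gap_at E t = (SOME p. p \<in> gaps E \<and> fst p < t \<and> t < snd p)"

text \<open>The derivative of the extension of \<open>f\<close> that is affine across every gap. The
  value 0 elsewhere includes \<open>E\<close> itself, so \<open>f\<close> is a primitive of
  \<open>slope E f\<close> only if it is carried by its jumps.\<close>

definition slope :: "real set \<Rightarrow> (real \<Rightarrow> real) \<Rightarrow> real \<Rightarrow> real" where
  "slope E f t = (if t \<in> gapU E
     then (f (snd (gap_at E t)) - f (fst (gap_at E t))) / (snd (gap_at E t) - fst (gap_at E t)) else 0)"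

lemma gapsD:
  assumes "(a, b) \<in> gaps E"
  shows "a \<in> E" "b \<in> E" "a < b" "\<And>x. a < x \<Longrightarrow> x < b \<Longrightarrow> x \<notin> E"
  using assms by (auto simp: gaps_def)

lemma gaps_unique:
  assumes "(a, b) \<in> gaps E" "(c, d) \<in> gaps E" "a < t" "t < b" "c < t" "t < d"
  shows "a = c \<and> b = d"
  using gapsD[OF assms(1)] gapsD[OF assms(2)] assms(3-) by (metis linorder_neqE_linordered_idom order.strict_trans)

lemma gap_at_eq:
  assumes "(a, b) \<in> gaps E" "a < t" "t < b"
  shows "gap_at E t = (a, b)"
proof -
  have "gap_at E t \<in> gaps E \<and> fst (gap_at E t) < t \<and> t < snd (gap_at E t)"
    unfolding gap_at_def by (rule someI[of _ "(a, b)"]) (use assms in auto)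
  then show ?thesis
    using gaps_unique[of "fst (gap_at E t)" "snd (gap_at E t)" E a b t] assms by (simp add: prod_eq_iff)
qed

lemma gapU_I: "(a, b) \<in> gaps E \<Longrightarrow> a < t \<Longrightarrow> t < b \<Longrightarrow> t \<in> gapU E"
  by (force simp: gapU_def)

lemma gapU_E:
  assumes "t \<in> gapU E"
  obtains a b where "(a, b) \<in> gaps E" "a < t" "t < b" "gap_at E t = (a, b)"
proof -
  from assms obtain a b where "(a, b) \<in> gaps E" "a < t" "t < b" by (auto simp: gapU_def)
  then show thesis using gap_at_eq that by blast
qed

lemma slope_gap:
  assumes "(a, b) \<in> gaps E" "a < t" "t < b"
  shows "slope E f t = (f b - f a) / (b - a)"
  using gap_at_eq[OF assms] gapU_I[OF assms] by (simp add: slope_def)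

lemma slope_outside: "t \<notin> gapU E \<Longrightarrow> slope E f t = 0"
  by (simp add: slope_def)

lemma gapU_disjoint: "t \<in> gapU E \<Longrightarrow> t \<notin> E"
  by (auto simp: gapU_def gaps_def)

lemma slope_in: "t \<in> E \<Longrightarrow> slope E f t = 0"
  using gapU_disjoint slope_outside by blast

lemma open_gapU: "open (gapU E)"
  unfolding gapU_def by auto

text \<open>The slope is constant on each gap, hence continuous on the open set
  \<open>gapU E\<close>, and zero outside it.\<close>

lemma slope_borel [measurable]: "slope E f \<in> borel_measurable borel"
proof -
  have "continuous_on (\<Union>p\<in>gaps E. {fst p<..<snd p}) (slope E f)"
  proof (rule continuous_on_open_UN)
    show "continuous_on {fst p<..<snd p} (slope E f)" if "p \<in> gaps E" for p
      by (rule continuous_on_eq[OF continuous_on_const[of _ "(f (snd p) - f (fst p)) / (snd p - fst p)"]])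
         (use that slope_gap[of "fst p" "snd p" E] in auto)
  qed auto
  moreover have "(\<Union>p\<in>gaps E. {fst p<..<snd p}) = gapU E"
    by (auto simp: gapU_def)
  ultimately have "continuous_on (gapU E) (slope E f)"
    by simp
  then have "(\<lambda>t. indicator (gapU E) t *\<^sub>R slope E f t) \<in> borel_measurable borel"
    by (intro borel_measurable_continuous_on_indicator) (simp add: open_gapU)
  moreover have "(\<lambda>t. indicator (gapU E) t *\<^sub>R slope E f t) = slope E f"
    by (rule ext) (auto simp: indicator_def slope_outside)
  ultimately show ?thesis by (simp only:)
qed

lemma countable_gaps: "countable (gaps E)"
proof -
  have "inj_on (\<lambda>p. {fst p<..<snd p}) (gaps E)"
  proof (rule inj_onI)
    fix p q :: "real \<times> real" assume *: "p \<in> gaps E" "q \<in> gaps E" "{fst p<..<snd p} = {fst q<..<snd q}"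
    obtain t where t: "fst p < t" "t < snd p"
      using dense[of "fst p" "snd p"] gapsD(3)[of "fst p" "snd p" E] * by auto
    then have "t \<in> {fst q<..<snd q}" using *(3) by auto
    then show "p = q"
      using gaps_unique[of "fst p" "snd p" E "fst q" "snd q" t] t * by (auto simp: prod_eq_iff)
  qed
  moreover have "countable ((\<lambda>p. {fst p<..<snd p}) ` gaps E)"
  proof (rule countable_disjoint_open_subsets)
    show "disjoint ((\<lambda>p. {fst p<..<snd p}) ` gaps E)"
      unfolding disjoint_def
    proof (intro ballI impI)
      fix I J assume "I \<in> (\<lambda>p. {fst p<..<snd p}) ` gaps E" "J \<in> (\<lambda>p. {fst p<..<snd p}) ` gaps E" "I \<noteq> J"
      then obtain p q where pq: "p \<in> gaps E" "q \<in> gaps E" "I = {fst p<..<snd p}" "J = {fst q<..<snd q}"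
        by blast
      obtain a b c d where "p = (a, b)" "q = (c, d)" by (meson surj_pair)
      then have *: "(a, b) \<in> gaps E" "(c, d) \<in> gaps E" "I = {a<..<b}" "J = {c<..<d}" "I \<noteq> J"
        using pq \<open>I \<noteq> J\<close> by simp_all
      have "\<not> (t \<in> {a<..<b} \<and> t \<in> {c<..<d})" for t
        using gaps_unique[OF *(1,2), of t] *(3-) by auto
      then show "I \<inter> J = {}" using *(3,4) by blast
    qed
  qed auto
  ultimately show ?thesis
    using countable_image_inj_on by blast
qed

text \<open>Padding with the empty set treats finitely and infinitely many gaps alike.\<close>

definition gap_seq :: "real set \<Rightarrow> nat \<Rightarrow> real set" where
  "gap_seq E n = (if n \<in> to_nat_on (gaps E) ` gaps E
     then {fst (from_nat_into (gaps E) n)<..<snd (from_nat_into (gaps E) n)} else {})"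

lemma gap_seq_to_nat: "p \<in> gaps E \<Longrightarrow> gap_seq E (to_nat_on (gaps E) p) = {fst p<..<snd p}"
  using countable_gaps[of E] by (simp add: gap_seq_def)

lemma gap_seq_cases:
  obtains "gap_seq E n = {}" "n \<notin> to_nat_on (gaps E) ` gaps E"
  | a b where "(a, b) \<in> gaps E" "gap_seq E n = {a<..<b}" "n = to_nat_on (gaps E) (a, b)"
  using gap_seq_to_nat[of _ E] by (cases "n \<in> to_nat_on (gaps E) ` gaps E") (auto simp: gap_seq_def)

lemma gap_seq_borel [measurable]: "gap_seq E n \<in> sets borel"
  by (simp add: gap_seq_def)

lemma gap_seq_UN: "(\<Union>n. gap_seq E n) = gapU E"
proof safe
  fix x n assume "x \<in> gap_seq E n"
  then show "x \<in> gapU E" by (cases rule: gap_seq_cases[of E n]) (auto intro: gapU_I)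
next
  fix x assume "x \<in> gapU E"
  then obtain a b where "(a, b) \<in> gaps E" "a < x" "x < b" by (rule gapU_E)
  then have "x \<in> gap_seq E (to_nat_on (gaps E) (a, b))" by (simp add: gap_seq_to_nat)
  then show "x \<in> (\<Union>n. gap_seq E n)" by blast
qed

lemma disjoint_gap_seq: "disjoint_family (gap_seq E)"
  unfolding disjoint_family_on_def
proof (intro ballI impI)
  fix m n :: nat assume "m \<noteq> n"
  show "gap_seq E m \<inter> gap_seq E n = {}"
  proof (cases rule: gap_seq_cases[of E m])
    case (2 a b)
    note m = 2
    show ?thesis
    proof (cases rule: gap_seq_cases[of E n])
      case (2 c d)
      have "(a, b) = (c, d)" if "t \<in> {a<..<b}" "t \<in> {c<..<d}" for t
        using gaps_unique[OF m(1) 2(1)] that by auto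
      then show ?thesis using m 2 \<open>m \<noteq> n\<close> by blast
    qed auto
  qed auto
qed

section \<open>Integrals over the union of the gaps\<close>

lemma set_integral_sums:
  fixes q :: "real \<Rightarrow> real"
  assumes A: "\<And>n::nat. A n \<in> sets borel" "disjoint_family A"
    and q: "set_integrable lborel (\<Union>n. A n) q"
  shows "(\<lambda>n. set_lebesgue_integral lborel (A n) q) sums set_lebesgue_integral lborel (\<Union>n. A n) q"
proof -
  let ?B = "\<lambda>n. \<Union>i<n. A i"
  have int: "set_integrable lborel (A n) q" for n
    by (rule set_integrable_subset[OF q]) (use A in auto)
  have U: "(\<Union>n. ?B n) = (\<Union>n. A n)" by auto
  have "(\<lambda>n. set_lebesgue_integral lborel (?B n) q) \<longlonglongrightarrow> set_lebesgue_integral lborel (\<Union>n. ?B n) q"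
  proof (rule set_integral_cont_up)
    show "incseq ?B" by (force simp: incseq_def)
    show "set_integrable lborel (\<Union>n. ?B n) q" unfolding U by (rule q)
  qed (use A in auto)
  moreover have "set_lebesgue_integral lborel (?B n) q = (\<Sum>i<n. set_lebesgue_integral lborel (A i) q)" for n
    using A int by (intro set_integral_finite_Union) (auto simp: disjoint_family_on_def)
  ultimately show ?thesis using U by (simp add: sums_def)
qed

text \<open>Countable additivity gives a series along the enumeration. The unordered sum, which is
  what \<open>gap_sum\<close> is built on, follows from absolute convergence, with the integral of
  \<open>\<bar>q\<bar>\<close> as a bound.\<close>

lemma has_sum_gaps:
  fixes q :: "real \<Rightarrow> real"
  assumes q: "set_integrable lborel (gapU E) q"
  shows "((\<lambda>(a, b). set_lebesgue_integral lborel {a<..<b} q) has_sum set_lebesgue_integral lborel (gapU E) q) (gaps E)"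
proof -
  let ?A = "gap_seq E" and ?e = "to_nat_on (gaps E)"
  let ?F = "\<lambda>n. set_lebesgue_integral lborel (?A n) q"
  have "?F sums set_lebesgue_integral lborel (gapU E) q"
    by (rule set_integral_sums[of ?A q, unfolded gap_seq_UN, OF gap_seq_borel disjoint_gap_seq q])
  moreover have "summable (\<lambda>n. norm (?F n))"
  proof (rule summable_comparison_test')
    show "summable (\<lambda>n. set_lebesgue_integral lborel (?A n) (\<lambda>x. \<bar>q x\<bar>))"
      by (rule sums_summable[OF set_integral_sums[of ?A "\<lambda>x. \<bar>q x\<bar>", unfolded gap_seq_UN,
          OF gap_seq_borel disjoint_gap_seq set_integrable_abs[OF q]]])
    show "norm (norm (?F n)) \<le> set_lebesgue_integral lborel (?A n) (\<lambda>x. \<bar>q x\<bar>)" for n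
    proof -
      have "set_integrable lborel (?A n) q"
        by (rule set_integrable_subset[OF q]) (use gap_seq_UN[of E] in auto)
      from set_integral_norm_bound[OF this] show ?thesis by simp
    qed
  qed
  ultimately have "(?F has_sum set_lebesgue_integral lborel (gapU E) q) UNIV"
    by (intro norm_summable_imp_has_sum)
  moreover have "(?F has_sum s) UNIV \<longleftrightarrow> (?F has_sum s) (?e ` gaps E)" for s
    by (rule has_sum_cong_neutral) (simp_all add: gap_seq_def set_lebesgue_integral_def)
  moreover have "(?F has_sum s) (?e ` gaps E) \<longleftrightarrow> (?F \<circ> ?e has_sum s) (gaps E)" for s
    by (rule has_sum_reindex) (rule inj_on_to_nat_on[OF countable_gaps])
  moreover have "(?F \<circ> ?e has_sum s) (gaps E) \<longleftrightarrow>
      ((\<lambda>(a, b). set_lebesgue_integral lborel {a<..<b} q) has_sum s) (gaps E)" for s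
  proof (rule has_sum_cong)
    fix p assume p: "p \<in> gaps E"
    show "(?F \<circ> ?e) p = (case p of (a, b) \<Rightarrow> set_lebesgue_integral lborel {a<..<b} q)"
      unfolding comp_def gap_seq_to_nat[OF p] by (simp add: case_prod_beta)
  qed
  ultimately show ?thesis by (simp only:)
qed

text \<open>Stated for nonnegative extended integrals so that it applies before the smaller function
  is known to be integrable; the integrability of slopes and of their squares is obtained from
  it.\<close>

lemma nn_integral_gaps_mono:
  fixes p q :: "real \<Rightarrow> ennreal"
  assumes [measurable]: "p \<in> borel_measurable borel" "q \<in> borel_measurable borel"
    and le: "\<And>a b. (a, b) \<in> gaps E \<Longrightarrow> (\<integral>\<^sup>+x\<in>{a<..<b}. p x \<partial>lborel) \<le> (\<integral>\<^sup>+x\<in>{a<..<b}. q x \<partial>lborel)"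
  shows "(\<integral>\<^sup>+x\<in>gapU E. p x \<partial>lborel) \<le> (\<integral>\<^sup>+x\<in>gapU E. q x \<partial>lborel)"
proof -
  have "(\<integral>\<^sup>+x\<in>gapU E. p x \<partial>lborel) = (\<Sum>n. \<integral>\<^sup>+x\<in>gap_seq E n. p x \<partial>lborel)"
    unfolding gap_seq_UN[symmetric] by (rule nn_integral_disjoint_family) (auto simp: disjoint_gap_seq)
  also have "\<dots> \<le> (\<Sum>n. \<integral>\<^sup>+x\<in>gap_seq E n. q x \<partial>lborel)"
  proof (rule suminf_le)
    fix n show "(\<integral>\<^sup>+x\<in>gap_seq E n. p x \<partial>lborel) \<le> (\<integral>\<^sup>+x\<in>gap_seq E n. q x \<partial>lborel)"
    proof (cases rule: gap_seq_cases[of E n])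
      case (2 a b)
      show ?thesis unfolding 2(2) by (rule le[OF 2(1)])
    qed simp
  qed auto
  also have "\<dots> = (\<integral>\<^sup>+x\<in>gapU E. q x \<partial>lborel)"
    unfolding gap_seq_UN[symmetric] by (rule nn_integral_disjoint_family[symmetric]) (auto simp: disjoint_gap_seq)
  finally show ?thesis .
qed

lemma set_integral_gap_const:
  assumes "a \<le> b" "\<And>x. a < x \<Longrightarrow> x < b \<Longrightarrow> f x = (c::real)"
  shows "set_integrable lborel {a<..<b} f" "set_lebesgue_integral lborel {a<..<b} f = c * (b - a)"
proof -
  have eq: "(\<lambda>x. indicator {a<..<b} x *\<^sub>R f x) = (\<lambda>x. indicator {a<..<b} x *\<^sub>R c)"
    using assms(2) by (auto simp: indicator_def)
  show "set_integrable lborel {a<..<b} f"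
    unfolding set_integrable_def eq using assms(1) by (intro integrable_scaleR_left) simp
  show "set_lebesgue_integral lborel {a<..<b} f = c * (b - a)"
    unfolding set_lebesgue_integral_def eq using assms(1) by (subst integral_scaleR_left) auto
qed

lemma set_integral_endpoints:
  fixes f :: "real \<Rightarrow> real"
  assumes [measurable]: "f \<in> borel_measurable borel"
  shows "set_lebesgue_integral lborel {a..b} f = set_lebesgue_integral lborel {a<..<b} f"
    and "set_integrable lborel {a..b} f \<longleftrightarrow> set_integrable lborel {a<..<b} f"
proof -
  have ae: "AE x in lborel. indicator {a..b} x *\<^sub>R f x = indicator {a<..<b} x *\<^sub>R f x"
    using AE_lborel_singleton[of a] AE_lborel_singleton[of b] by eventually_elim (auto simp: indicator_def)
  show "set_lebesgue_integral lborel {a..b} f = set_lebesgue_integral lborel {a<..<b} f"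
    unfolding set_lebesgue_integral_def by (rule integral_cong_AE) (use ae in auto)
  show "set_integrable lborel {a..b} f \<longleftrightarrow> set_integrable lborel {a<..<b} f"
    unfolding set_integrable_def by (rule integrable_cong_AE) (use ae in auto)
qed

lemma integrable_set_integrable:
  fixes f :: "'a \<Rightarrow> 'b :: {banach, second_countable_topology}"
  assumes "integrable M f" "A \<in> sets M"
  shows "set_integrable M A f"
  unfolding set_integrable_def by (rule integrable_mult_indicator[OF assms(2,1)])

text \<open>The end points are the last point of \<open>E\<close> before \<open>t\<close> and the
  first one after it, which exist by compactness. Only the piece between \<open>x\<close> and
  \<open>y\<close> has to be compact, so the statement also serves complements of open sets.\<close>

lemma gap_exists:
  assumes "x \<in> E" "y \<in> E" "x < t" "t < y" "t \<notin> E" "compact (E \<inter> {x..y})"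
  obtains a b where "(a, b) \<in> gaps E" "a < t" "t < b" "x \<le> a" "b \<le> y"
proof -
  have L: "compact (E \<inter> {x..y} \<inter> {..t})" and R: "compact (E \<inter> {x..y} \<inter> {t..})"
    using assms(6) by (auto intro: compact_Int_closed)
  have "E \<inter> {x..y} \<inter> {..t} \<noteq> {}" "E \<inter> {x..y} \<inter> {t..} \<noteq> {}"
    using assms by auto
  with L R obtain a b where a: "a \<in> E \<inter> {x..y} \<inter> {..t}" "\<And>s. s \<in> E \<inter> {x..y} \<inter> {..t} \<Longrightarrow> s \<le> a"
    and b: "b \<in> E \<inter> {x..y} \<inter> {t..}" "\<And>s. s \<in> E \<inter> {x..y} \<inter> {t..} \<Longrightarrow> b \<le> s"
    by (metis compact_attains_inf compact_attains_sup)
  have "a < t" "t < b" using a(1) b(1) assms(5) by (auto simp: less_le)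
  moreover have "s \<notin> E" if "a < s" "s < b" for s
    using a(2)[of s] b(2)[of s] a(1) b(1) that by (cases "s \<le> t") auto
  ultimately have "(a, b) \<in> gaps E"
    using a(1) b(1) by (auto simp: gaps_def)
  then show thesis
    using that[of a b] a(1) b(1) \<open>a < t\<close> \<open>t < b\<close> by auto
qed

section \<open>The sign of a function from its integrals over intervals\<close>

text \<open>The components of a bounded open set are the gaps of its complement, so the summation
  over gaps applies to them.\<close>

lemma set_integral_open_nonneg:
  fixes v :: "real \<Rightarrow> real"
  assumes v: "integrable lborel v" and I: "\<And>a b. a \<le> b \<Longrightarrow> 0 \<le> set_lebesgue_integral lborel {a<..<b} v"
    and U: "open U" "U \<subseteq> {p<..<q}"
  shows "0 \<le> set_lebesgue_integral lborel U v"
proof -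
  have "gapU (- U) = U"
  proof safe
    fix t assume "t \<in> gapU (- U)" then show "t \<in> U" using gapU_disjoint by blast
  next
    fix t assume t: "t \<in> U"
    have "compact (- U \<inter> {p..q})" using U(1) by (intro closed_Int_compact) auto
    moreover have "p \<in> - U" "q \<in> - U" "p < t" "t < q" "t \<notin> - U" using U(2) t by auto
    ultimately obtain a b where "(a, b) \<in> gaps (- U)" "a < t" "t < b"
      using gap_exists by metis
    then show "t \<in> gapU (- U)" by (rule gapU_I)
  qed
  then have "((\<lambda>(a, b). set_lebesgue_integral lborel {a<..<b} v) has_sum set_lebesgue_integral lborel U v) (gaps (- U))"
    using has_sum_gaps[of "- U" v] integrable_mult_indicator[OF _ v, of U] U by (auto simp: set_integrable_def)
  then show ?thesis
    by (rule has_sum_nonneg) (auto intro!: I dest: gapsD)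
qed

text \<open>The set where \<open>v\<close> is negative is enclosed in an open set by outer
  regularity of the finite measure with density \<open>\<bar>v\<bar>\<close>. Over the open set the
  integral of \<open>v\<close> is nonnegative, and the choice of this measure makes the excess
  contribute less than \<open>e\<close>; so \<open>v\<close> has integral 0 over the set where it is
  negative.\<close>

lemma AE_nonneg_intervals:
  fixes v :: "real \<Rightarrow> real"
  assumes v: "integrable lborel v" and I: "\<And>a b. a \<le> b \<Longrightarrow> 0 \<le> set_lebesgue_integral lborel {a<..<b} v"
    and supp: "\<And>t. t \<notin> {p..q} \<Longrightarrow> v t = 0"
  shows "AE t in lborel. 0 \<le> v t"
proof -
  have [measurable]: "v \<in> borel_measurable borel" using v by auto
  let ?B = "{t. v t < 0}"
  have B[measurable]: "?B \<in> sets borel" by simp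
  let ?M = "density lborel (\<lambda>t. ennreal \<bar>v t\<bar>)"
  have M: "emeasure ?M A = ennreal (set_lebesgue_integral lborel A (\<lambda>t. \<bar>v t\<bar>))" if [measurable]: "A \<in> sets borel" for A
  proof -
    have "emeasure ?M A = (\<integral>\<^sup>+t. ennreal (indicator A t * \<bar>v t\<bar>) \<partial>lborel)"
      by (subst emeasure_density) (auto intro!: nn_integral_cong simp: indicator_def)
    also have "\<dots> = ennreal (set_lebesgue_integral lborel A (\<lambda>t. \<bar>v t\<bar>))"
      unfolding set_lebesgue_integral_def using integrable_mult_indicator[OF _ integrable_abs[OF v], of A]
      by (subst nn_integral_eq_integral) auto
    finally show ?thesis .
  qed
  have int: "set_integrable lborel A v" "set_integrable lborel A (\<lambda>t. \<bar>v t\<bar>)" if "A \<in> sets borel" for A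
    using that by (auto intro!: integrable_set_integrable integrable_abs v)
  have "0 \<le> set_lebesgue_integral lborel ?B v"
  proof (rule field_le_epsilon)
    fix e :: real assume e: "0 < e"
    have "emeasure ?M ?B = (INF U \<in> {U. ?B \<subseteq> U \<and> open U}. emeasure ?M U)"
      by (rule outer_regular) (auto simp: M simp del: emeasure_density)
    moreover have "emeasure ?M ?B < emeasure ?M ?B + ennreal e"
      using e by (simp add: M del: emeasure_density)
    ultimately have "(INF U \<in> {U. ?B \<subseteq> U \<and> open U}. emeasure ?M U) < emeasure ?M ?B + ennreal e"
      by (simp only:)
    then obtain U where U: "?B \<subseteq> U" "open U" "emeasure ?M U < emeasure ?M ?B + ennreal e"
      unfolding INF_less_iff by blast
    \<comment> \<open>The cut makes the open set bounded, and the margin 1 keeps all of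
      \<open>{p..q}\<close>, outside of which \<open>v\<close> vanishes.\<close>
    let ?U = "U \<inter> {p-1<..<q+1}"
    have sub: "?B \<subseteq> ?U" 
    proof
      fix t assume t: "t \<in> ?B"
      then have "t \<in> {p..q}" using supp[of t] by force
      then show "t \<in> ?U" using t U(1) by auto
    qed
    have [measurable]: "U \<in> sets borel" using U(2) by simp
    have "emeasure ?M ?U \<le> emeasure ?M U"
      by (rule emeasure_mono) auto
    with U(3) have "emeasure ?M ?U < emeasure ?M ?B + ennreal e" by (rule le_less_trans[rotated])
    moreover have nn: "0 \<le> set_lebesgue_integral lborel A (\<lambda>t. \<bar>v t\<bar>)" for A
      unfolding set_lebesgue_integral_def by (rule integral_nonneg_AE) simp
    ultimately have "ennreal (set_lebesgue_integral lborel ?U (\<lambda>t. \<bar>v t\<bar>)) < ennreal (set_lebesgue_integral lborel ?B (\<lambda>t. \<bar>v t\<bar>) + e)"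
      using e M[of ?B] M[of ?U] by (simp only: ennreal_plus[OF nn less_imp_le]) simp
    then have "set_lebesgue_integral lborel ?U (\<lambda>t. \<bar>v t\<bar>) < set_lebesgue_integral lborel ?B (\<lambda>t. \<bar>v t\<bar>) + e"
      using nn[of ?U] by (simp only: ennreal_less_iff)
    moreover have split: "set_lebesgue_integral lborel ?U w = set_lebesgue_integral lborel ?B w + set_lebesgue_integral lborel (?U - ?B) w"
      if "integrable lborel w" for w :: "real \<Rightarrow> real"
    proof -
      have "?U = ?B \<union> (?U - ?B)" using sub by auto
      then have "set_lebesgue_integral lborel ?U w = set_lebesgue_integral lborel (?B \<union> (?U - ?B)) w" by simp
      also have "\<dots> = set_lebesgue_integral lborel ?B w + set_lebesgue_integral lborel (?U - ?B) w"
        by (intro set_integral_Un integrable_set_integrable that) auto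
      finally show ?thesis .
    qed
    ultimately have "set_lebesgue_integral lborel (?U - ?B) (\<lambda>t. \<bar>v t\<bar>) < e"
      using integrable_abs[OF v] by simp
    moreover have "\<bar>set_lebesgue_integral lborel (?U - ?B) v\<bar> \<le> set_lebesgue_integral lborel (?U - ?B) (\<lambda>t. \<bar>v t\<bar>)"
      using set_integral_norm_bound[OF int(1)[of "?U - ?B"]] by simp
    moreover have "0 \<le> set_lebesgue_integral lborel ?U v"
      by (rule set_integral_open_nonneg[OF v I]) (use U(2) in auto)
    ultimately show "0 \<le> set_lebesgue_integral lborel ?B v + e"
      using split[OF v] by linarith
  qed
  then have "set_lebesgue_integral lborel ?B (\<lambda>t. - v t) \<le> 0"
    by (simp add: set_lebesgue_integral_def)
  moreover have nn: "AE t in lborel. 0 \<le> indicator ?B t *\<^sub>R (- v t)"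
    by (rule AE_I2) (simp add: indicator_def)
  moreover have ii: "integrable lborel (\<lambda>t. indicator ?B t *\<^sub>R (- v t))"
    by (intro integrable_mult_indicator integrable_minus v) auto
  ultimately have "AE t in lborel. indicator ?B t *\<^sub>R (- v t) = 0"
    using integral_nonneg_eq_0_iff_AE[OF ii nn] integral_nonneg_AE[OF nn] by (simp add: set_lebesgue_integral_def)
  then show ?thesis
    by (rule AE_mp) (rule AE_I2, simp add: indicator_def not_less[symmetric])
qed

section \<open>Topology of a set in the class K\<close>

locale classK =
  fixes E :: "real set"
  assumes K: "class_K E"
begin

abbreviation "\<Omega> \<equiv> gapU E"

text \<open>A limit point outside \<open>E\<close> could only be an end point of \<open>E\<close>;
  between two points of \<open>E\<close> it would coincide with one of them.\<close>

lemma compact_Int: "x \<in> E \<Longrightarrow> y \<in> E \<Longrightarrow> compact (E \<inter> {x..y})"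
proof -
  assume xy: "x \<in> E" "y \<in> E"
  have "t \<in> E" if "t \<in> closure E" "x \<le> t" "t \<le> y" for t
  proof -
    have "t \<in> E \<or> ereal t = lE E \<or> ereal t = rE E" using K that(1) by (auto simp: class_K_def)
    moreover have "t = x" if "ereal t = lE E" using lE_le[OF xy(1)] that \<open>x \<le> t\<close> by (metis ereal_less_eq(3) order_antisym)
    moreover have "t = y" if "ereal t = rE E" using rE_ge[OF xy(2)] that \<open>t \<le> y\<close> by (metis ereal_less_eq(3) order_antisym)
    ultimately show "t \<in> E" using xy by metis
  qed
  then have "E \<inter> {x..y} = closure E \<inter> {x..y}" using closure_subset by auto
  then show ?thesis by (simp add: closed_Int_compact)
qed

text \<open>Only the two end points can be missing from \<open>E\<close>. Finiteness of this set
  makes \<open>E\<close> Borel and, later, locally compact.\<close>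

lemma finite_boundary: "finite (closure E - E)"
proof -
  have "closure E - E \<subseteq> {real_of_ereal (lE E), real_of_ereal (rE E)}"
    using K by (auto simp: class_K_def) (metis real_of_ereal.simps(1))+
  then show ?thesis by (rule finite_subset) auto
qed

lemma E_borel [measurable]: "E \<in> sets borel"
proof -
  have "E = closure E - (closure E - E)" using closure_subset by auto
  moreover have "closure E - E \<in> sets borel" using finite_boundary by (simp add: finite_imp_closed)
  ultimately show ?thesis by (metis borel_closed closed_closure sets.Diff)
qed

lemma gap_between:
  assumes "x \<in> E" "y \<in> E" "x < t" "t < y" "t \<notin> E"
  obtains a b where "(a, b) \<in> gaps E" "a < t" "t < b" "x \<le> a" "b \<le> y"
  using gap_exists[OF assms compact_Int[OF assms(1,2)]] by blast

lemma intI_minus: "intI E - E = \<Omega>"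
proof safe
  fix t assume "t \<in> intI E" "t \<notin> E"
  then obtain x y where "x \<in> E" "y \<in> E" "x < t" "t < y"
    by (auto simp: intI_def lE_less_iff rE_greater_iff)
  then obtain a b where "(a, b) \<in> gaps E" "a < t" "t < b"
    using gap_between \<open>t \<notin> E\<close> by metis
  then show "t \<in> \<Omega>" by (rule gapU_I)
next
  fix t assume "t \<in> \<Omega>"
  then obtain a b where *: "(a, b) \<in> gaps E" "a < t" "t < b" by (rule gapU_E)
  then show "t \<in> intI E" using gapsD[OF *(1)] by (auto simp: intI_def lE_less_iff rE_greater_iff)
qed (use gapU_disjoint in blast)

lemma intI_eq: "intI E = E \<union> \<Omega>"
  using intI_minus by (auto simp: intI_def)

lemma intI_borel [measurable]: "intI E \<in> sets borel"
  unfolding intI_eq using open_gapU by auto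

lemma gapU_borel [measurable]: "\<Omega> \<in> sets borel"
  using open_gapU by auto

lemma Icc_subset: "x \<in> E \<Longrightarrow> y \<in> E \<Longrightarrow> {x..y} \<subseteq> E \<union> \<Omega>"
  unfolding intI_eq[symmetric] intI_def lE_less_iff rE_greater_iff by (auto simp: less_le)

lemma gap_cases:
  assumes "(a, b) \<in> gaps E" "x \<in> E" "y \<in> E"
  shows "x \<le> a \<and> b \<le> y \<or> b \<le> x \<or> y \<le> a"
  using gapsD[OF assms(1)] assms(2,3) by (meson linorder_not_le)

end

section \<open>Increments controlled by integrals\<close>

text \<open>Weaker than having a derivative: \<open>m\<close> has to majorise increments between
  points of \<open>E\<close> and says nothing about \<open>f\<close> elsewhere.\<close>

definition dominated :: "real set \<Rightarrow> (real \<Rightarrow> real) \<Rightarrow> (real \<Rightarrow> real) \<Rightarrow> bool" where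
  "dominated E f m \<longleftrightarrow> m \<in> borel_measurable borel \<and> (\<forall>t. 0 \<le> m t) \<and>
     (\<forall>x\<in>E. \<forall>y\<in>E. x \<le> y \<longrightarrow> set_integrable lborel {x..y} m \<and> \<bar>f y - f x\<bar> \<le> set_lebesgue_integral lborel {x..y} m)"

text \<open>Testing only points of \<open>E\<close> determines \<open>k\<close> almost everywhere on
  \<open>E\<close>, whereas in a gap only the integral of \<open>k\<close> over the whole gap is
  fixed.\<close>

definition primitive :: "real set \<Rightarrow> (real \<Rightarrow> real) \<Rightarrow> (real \<Rightarrow> real) \<Rightarrow> bool" where
  "primitive E f k \<longleftrightarrow> k \<in> borel_measurable borel \<and>
     (\<forall>x\<in>E. \<forall>y\<in>E. x \<le> y \<longrightarrow> set_integrable lborel {x..y} k \<and> f y - f x = set_lebesgue_integral lborel {x..y} k)"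

lemma dominatedD:
  assumes "dominated E f m"
  shows "m \<in> borel_measurable borel" "0 \<le> m t"
    "x \<in> E \<Longrightarrow> y \<in> E \<Longrightarrow> x \<le> y \<Longrightarrow> set_integrable lborel {x..y} m"
    "x \<in> E \<Longrightarrow> y \<in> E \<Longrightarrow> x \<le> y \<Longrightarrow> \<bar>f y - f x\<bar> \<le> set_lebesgue_integral lborel {x..y} m"
  using assms by (auto simp: dominated_def)

lemma primitiveD:
  assumes "primitive E f k"
  shows "k \<in> borel_measurable borel"
    "x \<in> E \<Longrightarrow> y \<in> E \<Longrightarrow> x \<le> y \<Longrightarrow> set_integrable lborel {x..y} k"
    "x \<in> E \<Longrightarrow> y \<in> E \<Longrightarrow> x \<le> y \<Longrightarrow> f y - f x = set_lebesgue_integral lborel {x..y} k"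
  using assms by (auto simp: primitive_def)

lemma primitive_dominated:
  assumes "primitive E f k"
  shows "dominated E f (\<lambda>t. \<bar>k t\<bar>)"
  unfolding dominated_def
proof (intro conjI ballI impI allI)
  note [measurable] = primitiveD(1)[OF assms]
  show "(\<lambda>t. \<bar>k t\<bar>) \<in> borel_measurable borel" by simp
  fix x y assume xy: "x \<in> E" "y \<in> E" "x \<le> y"
  note i = primitiveD(2)[OF assms xy]
  show "set_integrable lborel {x..y} (\<lambda>t. \<bar>k t\<bar>)" by (rule set_integrable_abs[OF i])
  show "\<bar>f y - f x\<bar> \<le> set_lebesgue_integral lborel {x..y} (\<lambda>t. \<bar>k t\<bar>)"
    unfolding primitiveD(3)[OF assms xy] using set_integral_norm_bound[OF i] by simp
qed simp

context classK
begin

text \<open>Taking out a gap \<open>(a, b)\<close> splits the interval into \<open>[x, a]\<close>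
  and \<open>[b, y]\<close>, whose end points are again in \<open>E\<close>. The induction
  hypothesis is used on both halves, which is why \<open>x\<close> and \<open>y\<close> are
  generalised.\<close>

lemma dominated_finite_gaps:
  assumes dom: "dominated E f m" and "finite D" "D \<subseteq> gaps E" "x \<in> E" "y \<in> E" "x \<le> y"
  shows "\<bar>f y - f x - (\<Sum>p\<in>{p\<in>D. x \<le> fst p \<and> snd p \<le> y}. f (snd p) - f (fst p))\<bar>
    \<le> set_lebesgue_integral lborel ({x..y} - (\<Union>p\<in>D. {fst p<..<snd p})) m"
  using assms(2-)
proof (induction D arbitrary: x y rule: finite_induct)
  case empty
  then show ?case using dominatedD(4)[OF dom, of x y] by simp
next
  case (insert p D)
  obtain a b where p: "p = (a, b)" by (cases p)
  let ?S = "\<lambda>x y D. (\<Sum>p\<in>{p\<in>D. x \<le> fst p \<and> snd p \<le> y}. f (snd p) - f (fst p))"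
  let ?X = "\<lambda>x y D. {x..y} - (\<Union>p\<in>D. {fst p<..<snd p})"
  have g: "(a, b) \<in> gaps E" using insert.prems p by auto
  have ab: "a \<in> E" "b \<in> E" "a < b" using gapsD[OF g] by auto
  show ?case
  proof (cases "x \<le> a \<and> b \<le> y")
    case True
    \<comment> \<open>Distinct gaps do not overlap, so each remaining gap lies entirely to the left
      or to the right of \<open>(a, b)\<close>.\<close>
    have *: "snd q \<le> a \<or> b \<le> fst q" "fst q < snd q" if "q \<in> D" for q
    proof -
      have q: "(fst q, snd q) \<in> gaps E" using that insert.prems by auto
      then show "fst q < snd q" by (rule gapsD)
      have "q \<noteq> p" using insert.hyps that by auto
      show "snd q \<le> a \<or> b \<le> fst q"
      proof (rule ccontr)
        assume "\<not> (snd q \<le> a \<or> b \<le> fst q)"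
        then have "max a (fst q) < min b (snd q)" using ab \<open>fst q < snd q\<close> by auto
        then obtain t where "max a (fst q) < t" "t < min b (snd q)" using dense by blast
        then show False using gaps_unique[OF g q, of t] \<open>q \<noteq> p\<close> p by (auto simp: prod_eq_iff)
      qed
    qed
    have "?S x y (insert p D) = (f b - f a) + ?S x y D"
    proof -
      have "{q \<in> insert p D. x \<le> fst q \<and> snd q \<le> y} = insert p {q \<in> D. x \<le> fst q \<and> snd q \<le> y}"
        using True p by auto
      then show ?thesis using insert.hyps p by simp
    qed
    also have "?S x y D = ?S x a D + ?S b y D"
    proof -
      have "{q \<in> D. x \<le> fst q \<and> snd q \<le> y} = {q \<in> D. x \<le> fst q \<and> snd q \<le> a} \<union> {q \<in> D. b \<le> fst q \<and> snd q \<le> y}"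
        using * True ab by fastforce
      moreover have "{q \<in> D. x \<le> fst q \<and> snd q \<le> a} \<inter> {q \<in> D. b \<le> fst q \<and> snd q \<le> y} = {}"
        using * ab by fastforce
      ultimately show ?thesis using insert.hyps by (simp add: sum.union_disjoint)
    qed
    finally have S: "?S x y (insert p D) = (f b - f a) + ?S x a D + ?S b y D" by simp
    have X[simp]: "?X u v D \<in> sets borel" for u v
      by (intro sets.Diff borel_open[OF open_UN]) auto
    have "?X x y (insert p D) = ?X x a D \<union> ?X b y D"
      using True ab p * by fastforce
    moreover have "set_lebesgue_integral lborel (?X x a D \<union> ?X b y D) m =
       set_lebesgue_integral lborel (?X x a D) m + set_lebesgue_integral lborel (?X b y D) m"
    proof (rule set_integral_Un)
      show "?X x a D \<inter> ?X b y D = {}" using ab by auto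
      show "set_integrable lborel (?X x a D) m"
        by (rule set_integrable_subset[OF dominatedD(3)[OF dom, of x a]]) (use True ab insert in auto)
      show "set_integrable lborel (?X b y D) m"
        by (rule set_integrable_subset[OF dominatedD(3)[OF dom, of b y]]) (use True ab insert in auto)
    qed
    moreover have "\<bar>f a - f x - ?S x a D\<bar> \<le> set_lebesgue_integral lborel (?X x a D) m"
      "\<bar>f y - f b - ?S b y D\<bar> \<le> set_lebesgue_integral lborel (?X b y D) m"
      using insert True ab by auto
    ultimately show ?thesis using S by simp
  next
    case False
    then have "{q \<in> insert p D. x \<le> fst q \<and> snd q \<le> y} = {q \<in> D. x \<le> fst q \<and> snd q \<le> y}"
      using p by auto
    moreover have "?X x y (insert p D) = ?X x y D"
      using gap_cases[OF g, of x y] insert.prems False p by auto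
    ultimately show ?thesis using insert by auto
  qed
qed

lemma set_integral_split_gaps:
  fixes k :: "real \<Rightarrow> real"
  assumes "x \<in> E" "y \<in> E" and k: "set_integrable lborel {x..y} k"
  shows "set_lebesgue_integral lborel {x..y} k =
    set_lebesgue_integral lborel (E \<inter> {x..y}) k + set_lebesgue_integral lborel (\<Omega> \<inter> {x..y}) k"
proof -
  have "{x..y} = (E \<inter> {x..y}) \<union> (\<Omega> \<inter> {x..y})" using Icc_subset[OF assms(1,2)] by auto
  then have "set_lebesgue_integral lborel {x..y} k = set_lebesgue_integral lborel ((E \<inter> {x..y}) \<union> (\<Omega> \<inter> {x..y})) k"
    by simp
  also have "\<dots> = set_lebesgue_integral lborel (E \<inter> {x..y}) k + set_lebesgue_integral lborel (\<Omega> \<inter> {x..y}) k"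
    by (rule set_integral_Un) (use gapU_disjoint in \<open>auto intro!: set_integrable_subset[OF k]\<close>)
  finally show ?thesis .
qed

text \<open>No gap straddles \<open>x\<close> or \<open>y\<close>, since both lie in
  \<open>E\<close>: a gap is either contained in the interval or contributes nothing.\<close>

lemma has_sum_gaps_Icc:
  fixes k :: "real \<Rightarrow> real"
  assumes "x \<in> E" "y \<in> E" and k: "set_integrable lborel {x..y} k"
  shows "((\<lambda>p. set_lebesgue_integral lborel {fst p<..<snd p} k) has_sum
    set_lebesgue_integral lborel (\<Omega> \<inter> {x..y}) k) {p\<in>gaps E. x \<le> fst p \<and> snd p \<le> y}"
proof -
  let ?q = "\<lambda>t. indicator {x..y} t *\<^sub>R k t"
  have "integrable lborel ?q" using k by (simp add: set_integrable_def)
  then have "set_integrable lborel \<Omega> ?q" by (rule integrable_set_integrable) simp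
  then have "((\<lambda>(a, b). set_lebesgue_integral lborel {a<..<b} ?q) has_sum set_lebesgue_integral lborel \<Omega> ?q) (gaps E)"
    by (rule has_sum_gaps)
  moreover have "set_lebesgue_integral lborel \<Omega> ?q = set_lebesgue_integral lborel (\<Omega> \<inter> {x..y}) k"
    unfolding set_lebesgue_integral_def by (rule Bochner_Integration.integral_cong) (auto simp: indicator_def)
  moreover have "((\<lambda>(a, b). set_lebesgue_integral lborel {a<..<b} ?q) has_sum s) (gaps E) \<longleftrightarrow>
     ((\<lambda>p. set_lebesgue_integral lborel {fst p<..<snd p} k) has_sum s) {p\<in>gaps E. x \<le> fst p \<and> snd p \<le> y}" for s
  proof (rule has_sum_cong_neutral)
    fix p assume p: "p \<in> gaps E - {p\<in>gaps E. x \<le> fst p \<and> snd p \<le> y}"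
    then have "snd p \<le> x \<or> y \<le> fst p" using gap_cases[of "fst p" "snd p" x y] assms by auto
    then have "{fst p<..<snd p} \<inter> {x..y} = {}" by auto
    then have "set_lebesgue_integral lborel {fst p<..<snd p} ?q = 0"
      unfolding set_lebesgue_integral_def
      by (intro integral_eq_zero_AE AE_I2) (auto simp: indicator_def)
    then show "(case p of (a, b) \<Rightarrow> set_lebesgue_integral lborel {a<..<b} ?q) = 0"
      by (simp add: case_prod_beta)
  next
    fix p assume p: "p \<in> gaps E \<inter> {p\<in>gaps E. x \<le> fst p \<and> snd p \<le> y}"
    then have "set_lebesgue_integral lborel {fst p<..<snd p} ?q = set_lebesgue_integral lborel {fst p<..<snd p} k"
      unfolding set_lebesgue_integral_def
      by (intro Bochner_Integration.integral_cong) (auto simp: indicator_def)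
    then show "(case p of (a, b) \<Rightarrow> set_lebesgue_integral lborel {a<..<b} ?q) = set_lebesgue_integral lborel {fst p<..<snd p} k"
      by (simp add: case_prod_beta)
  qed auto
  ultimately show ?thesis by (simp only:)
qed

lemma dominated_gap:
  assumes dom: "dominated E f m" and g: "(a, b) \<in> gaps E"
  shows "\<bar>f b - f a\<bar> \<le> set_lebesgue_integral lborel {a<..<b} m" "set_integrable lborel {a<..<b} m"
  using dominatedD(3,4)[OF dom, of a b] gapsD[OF g] set_integral_endpoints[OF dominatedD(1)[OF dom], of a b] by auto

text \<open>Over a gap \<open>(a, b)\<close> the integral of \<open>\<bar>slope E f\<bar>\<close> is
  \<open>\<bar>f b - f a\<bar>\<close>, which is at most the integral of \<open>m\<close> over that
  gap.\<close>

lemma slope_integrable_Icc: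
  assumes dom: "dominated E f m" and xy: "x \<in> E" "y \<in> E" "x \<le> y"
  shows "set_integrable lborel {x..y} (slope E f)"
proof -
  note [measurable] = dominatedD(1)[OF dom]
  note m0 = dominatedD(2)[OF dom]
  let ?p = "\<lambda>t. ennreal (indicator {x..y} t * \<bar>slope E f t\<bar>)" and ?q = "\<lambda>t. ennreal (indicator {x..y} t * m t)"
  have "(\<integral>\<^sup>+t\<in>\<Omega>. ?p t \<partial>lborel) \<le> (\<integral>\<^sup>+t\<in>\<Omega>. ?q t \<partial>lborel)"
  proof (rule nn_integral_gaps_mono)
    fix a b assume g: "(a, b) \<in> gaps E"
    show "(\<integral>\<^sup>+t\<in>{a<..<b}. ?p t \<partial>lborel) \<le> (\<integral>\<^sup>+t\<in>{a<..<b}. ?q t \<partial>lborel)"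
    proof (cases "x \<le> a \<and> b \<le> y")
      case True
      let ?c = "\<bar>f b - f a\<bar> / (b - a)"
      have "(\<integral>\<^sup>+t\<in>{a<..<b}. ?p t \<partial>lborel) = (\<integral>\<^sup>+t. ennreal ?c * indicator {a<..<b} t \<partial>lborel)"
        using True slope_gap[OF g, of _ f] gapsD[OF g] by (intro nn_integral_cong) (auto simp: indicator_def abs_divide)
      also have "\<dots> = ennreal \<bar>f b - f a\<bar>"
        using gapsD(3)[OF g] by (simp add: nn_integral_cmult ennreal_mult[symmetric])
      also have "\<dots> \<le> ennreal (set_lebesgue_integral lborel {a<..<b} m)"
        by (rule ennreal_leI[OF dominated_gap(1)[OF dom g]])
      also have "\<dots> = (\<integral>\<^sup>+t. ennreal (indicator {a<..<b} t *\<^sub>R m t) \<partial>lborel)"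
        unfolding set_lebesgue_integral_def using dominated_gap(2)[OF dom g] m0
        by (subst nn_integral_eq_integral) (auto simp: set_integrable_def)
      also have "\<dots> = (\<integral>\<^sup>+t\<in>{a<..<b}. ?q t \<partial>lborel)"
        using True by (intro nn_integral_cong) (auto simp: indicator_def)
      finally show ?thesis .
    next
      case False
      then have "b \<le> x \<or> y \<le> a" using gap_cases[OF g, of x y] xy by auto
      then have "(\<integral>\<^sup>+t\<in>{a<..<b}. ?p t \<partial>lborel) = (\<integral>\<^sup>+t. 0 \<partial>(lborel::real measure))"
        by (intro nn_integral_cong) (auto simp: indicator_def)
      then show ?thesis by simp
    qed
  qed auto
  also have "\<dots> \<le> (\<integral>\<^sup>+t. ?q t \<partial>lborel)"
    by (intro nn_integral_mono) (auto simp: indicator_def)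
  also have "\<dots> < \<infinity>"
    using dominatedD(3)[OF dom xy] m0 by (subst nn_integral_eq_integral) (auto simp: set_integrable_def)
  also have "(\<integral>\<^sup>+t\<in>\<Omega>. ?p t \<partial>lborel) = (\<integral>\<^sup>+t. ennreal (norm (indicator {x..y} t *\<^sub>R slope E f t)) \<partial>lborel)"
    by (intro nn_integral_cong) (auto simp: indicator_def slope_outside)
  finally show ?thesis
    unfolding set_integrable_def by (intro integrableI_bounded) auto
qed

lemma slope_integral_gap:
  assumes "(a, b) \<in> gaps E"
  shows "set_lebesgue_integral lborel {a<..<b} (slope E f) = f b - f a"
    "set_integrable lborel {a<..<b} (slope E f)"
  using set_integral_gap_const[of a b "slope E f" "(f b - f a) / (b - a)"] slope_gap[OF assms] gapsD(3)[OF assms] by auto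

lemma slope_integral_split:
  assumes "x \<in> E" "y \<in> E"
  shows "set_lebesgue_integral lborel {x..y} (slope E f) = set_lebesgue_integral lborel (\<Omega> \<inter> {x..y}) (slope E f)"
  unfolding set_lebesgue_integral_def
  by (rule Bochner_Integration.integral_cong) (auto simp: indicator_def slope_outside)

text \<open>Removing the gaps one at a time, the increment of \<open>f\<close> not explained by the removed gaps is
  controlled by the mass of \<open>m\<close> on what is left of the interval; in the limit only \<open>E\<close> is left.\<close>

lemma dominated_slope:
  assumes dom: "dominated E f m" and xy: "x \<in> E" "y \<in> E" "x \<le> y"
  shows "\<bar>f y - f x - set_lebesgue_integral lborel {x..y} (slope E f)\<bar> \<le> set_lebesgue_integral lborel (E \<inter> {x..y}) m"
proof -
  let ?G = "{p\<in>gaps E. x \<le> fst p \<and> snd p \<le> y}"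
  let ?F = "finite_subsets_at_top ?G"
  note mint = dominatedD(3)[OF dom xy]
  have *: "(sum (\<lambda>p. set_lebesgue_integral lborel {fst p<..<snd p} m) \<longlongrightarrow> set_lebesgue_integral lborel (\<Omega> \<inter> {x..y}) m) ?F"
    using has_sum_gaps_Icc[OF xy(1,2) mint] by (simp add: has_sum_def)
  have "((\<lambda>p. set_lebesgue_integral lborel {fst p<..<snd p} (slope E f)) has_sum
    set_lebesgue_integral lborel (\<Omega> \<inter> {x..y}) (slope E f)) ?G"
    by (rule has_sum_gaps_Icc[OF xy(1,2) slope_integrable_Icc[OF dom xy]])
  then have "((\<lambda>p. f (snd p) - f (fst p)) has_sum set_lebesgue_integral lborel {x..y} (slope E f)) ?G"
    unfolding slope_integral_split[OF xy(1,2)]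
    by (rule has_sum_cong[THEN iffD1, rotated]) (auto simp: slope_integral_gap)
  then have **: "(sum (\<lambda>p. f (snd p) - f (fst p)) \<longlongrightarrow> set_lebesgue_integral lborel {x..y} (slope E f)) ?F"
    by (simp add: has_sum_def)
  have "\<bar>f y - f x - set_lebesgue_integral lborel {x..y} (slope E f)\<bar>
     \<le> set_lebesgue_integral lborel {x..y} m - set_lebesgue_integral lborel (\<Omega> \<inter> {x..y}) m"
  proof (rule tendsto_le[OF finite_subsets_at_top_neq_bot])
    show "((\<lambda>D. set_lebesgue_integral lborel {x..y} m - sum (\<lambda>p. set_lebesgue_integral lborel {fst p<..<snd p} m) D) \<longlongrightarrow>
       set_lebesgue_integral lborel {x..y} m - set_lebesgue_integral lborel (\<Omega> \<inter> {x..y}) m) ?F"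
      by (intro tendsto_intros *)
    show "((\<lambda>D. \<bar>f y - f x - sum (\<lambda>p. f (snd p) - f (fst p)) D\<bar>) \<longlongrightarrow>
       \<bar>f y - f x - set_lebesgue_integral lborel {x..y} (slope E f)\<bar>) ?F"
      by (intro tendsto_intros **)
    show "\<forall>\<^sub>F D in ?F. \<bar>f y - f x - sum (\<lambda>p. f (snd p) - f (fst p)) D\<bar>
       \<le> set_lebesgue_integral lborel {x..y} m - sum (\<lambda>p. set_lebesgue_integral lborel {fst p<..<snd p} m) D"
    proof (rule eventually_finite_subsets_at_top_weakI)
      fix D assume D: "finite D" "D \<subseteq> ?G"
      let ?U = "\<Union>p\<in>D. {fst p<..<snd p}"
      have [simp]: "?U \<in> sets borel" by (intro borel_open open_UN) auto
      have "?U \<subseteq> {x..y}" using D by auto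
      have "{p\<in>D. x \<le> fst p \<and> snd p \<le> y} = D" using D by auto
      then have "\<bar>f y - f x - sum (\<lambda>p. f (snd p) - f (fst p)) D\<bar> \<le> set_lebesgue_integral lborel ({x..y} - ?U) m"
        using dominated_finite_gaps[OF dom D(1) _ xy] D by auto
      \<comment> \<open>Passing to a difference of integrals makes the bound depend on
        \<open>D\<close> only through a finite sum over gaps, which has a limit.\<close>
      also have "\<dots> = set_lebesgue_integral lborel {x..y} m - set_lebesgue_integral lborel ?U m"
      proof -
        have "{x..y} = ({x..y} - ?U) \<union> ?U" using \<open>?U \<subseteq> {x..y}\<close> by auto
        then have "set_lebesgue_integral lborel {x..y} m = set_lebesgue_integral lborel (({x..y} - ?U) \<union> ?U) m"
          by simp
        also have "\<dots> = set_lebesgue_integral lborel ({x..y} - ?U) m + set_lebesgue_integral lborel ?U m"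
          by (rule set_integral_Un) (use \<open>?U \<subseteq> {x..y}\<close> in \<open>auto intro!: set_integrable_subset[OF mint]\<close>)
        finally show ?thesis by simp
      qed
      also have "set_lebesgue_integral lborel ?U m = sum (\<lambda>p. set_lebesgue_integral lborel {fst p<..<snd p} m) D"
      proof (rule set_integral_finite_UN_AE)
        show "AE t in lborel. t \<in> {fst p<..<snd p} \<and> t \<in> {fst q<..<snd q} \<longrightarrow> p = q" if "p \<in> D" "q \<in> D" for p q
        proof (rule AE_I2)
          fix t
          show "t \<in> {fst p<..<snd p} \<and> t \<in> {fst q<..<snd q} \<longrightarrow> p = q"
            using gaps_unique[of "fst p" "snd p" E "fst q" "snd q" t] that D by (auto simp: prod_eq_iff)
        qed
        show "set_integrable lborel {fst p<..<snd p} m" if "p \<in> D" for p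
          using that D by (intro set_integrable_subset[OF mint]) auto
      qed (use D in auto)
      finally show "\<bar>f y - f x - sum (\<lambda>p. f (snd p) - f (fst p)) D\<bar>
       \<le> set_lebesgue_integral lborel {x..y} m - sum (\<lambda>p. set_lebesgue_integral lborel {fst p<..<snd p} m) D" .
    qed
  qed
  then show ?thesis using set_integral_split_gaps[OF xy(1,2) mint] by simp
qed

text \<open>The error in \<open>dominated_slope\<close> is the mass of \<open>m\<close> on
  \<open>E\<close>, here zero: such a function is the sum of its jumps. All memberships in the
  minimal domain are proved in this way.\<close>

lemma dominated_slope_null:
  assumes dom: "dominated E f m" and m: "\<And>t. t \<in> E \<Longrightarrow> m t = 0"
  shows "primitive E f (slope E f)"
  unfolding primitive_def
proof (intro conjI ballI impI)
  fix x y assume xy: "x \<in> E" "y \<in> E" "x \<le> y"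
  show "set_integrable lborel {x..y} (slope E f)" by (rule slope_integrable_Icc[OF dom xy])
  have "set_lebesgue_integral lborel (E \<inter> {x..y}) m = 0"
    unfolding set_lebesgue_integral_def using m by (intro integral_eq_zero_AE AE_I2) (auto simp: indicator_def)
  then show "f y - f x = set_lebesgue_integral lborel {x..y} (slope E f)"
    using dominated_slope[OF dom xy] by simp
qed simp

text \<open>Reduces an uncountable family of intervals to a countable one. Every point of
  \<open>E\<close> other than a least or greatest element lies in one of countably many intervals
  with end points in \<open>E\<close>, chosen by means of rational numbers.\<close>

lemma AE_E_I:
  assumes "\<And>x y. x \<in> E \<Longrightarrow> y \<in> E \<Longrightarrow> x \<le> y \<Longrightarrow> AE t in lborel. t \<in> E \<inter> {x..y} \<longrightarrow> P t"
  shows "AE t in lborel. t \<in> E \<longrightarrow> P t"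
proof -
  \<comment> \<open>\<open>l p\<close> is some point of \<open>E\<close> below \<open>p\<close> and
    \<open>r q\<close> some point of \<open>E\<close> above \<open>q\<close>, whenever such points
    exist.\<close>
  have "\<forall>p. \<exists>x. (\<exists>x\<in>E. x \<le> p) \<longrightarrow> x \<in> E \<and> x \<le> p" "\<forall>q. \<exists>y. (\<exists>y\<in>E. q \<le> y) \<longrightarrow> y \<in> E \<and> q \<le> y"
    by blast+
  then obtain l r where l: "\<And>p x. x \<in> E \<Longrightarrow> x \<le> p \<Longrightarrow> l p \<in> E \<and> l p \<le> p"
    and r: "\<And>q y. y \<in> E \<Longrightarrow> q \<le> y \<Longrightarrow> r q \<in> E \<and> q \<le> r q"
    unfolding choice_iff by blast
  let ?Q = "{z \<in> \<rat> \<times> \<rat>. l (fst z) \<in> E \<and> r (snd z) \<in> E \<and> l (fst z) \<le> r (snd z)}"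
  have "countable ?Q"
    by (rule countable_subset[of _ "\<rat> \<times> \<rat>"]) (auto simp: countable_rat)
  moreover have "\<forall>z\<in>?Q. AE t in lborel. t \<in> E \<inter> {l (fst z)..r (snd z)} \<longrightarrow> P t"
    using assms by blast
  ultimately have "AE t in lborel. \<forall>z\<in>?Q. t \<in> E \<inter> {l (fst z)..r (snd z)} \<longrightarrow> P t"
    by (rule AE_ball_countable[THEN iffD2])
  \<comment> \<open>A least or greatest element of \<open>E\<close> is not strictly between two
    points of \<open>E\<close>; there are at most two such exceptions.\<close>
  moreover have "AE t in lborel. t \<notin> {t\<in>E. (\<forall>x\<in>E. t \<le> x) \<or> (\<forall>x\<in>E. x \<le> t)}"
  proof -
    have "{t\<in>E. (\<forall>x\<in>E. t \<le> x) \<or> (\<forall>x\<in>E. x \<le> t)} \<subseteq> {Inf E, Sup E}"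
    proof
      fix t assume "t \<in> {t\<in>E. (\<forall>x\<in>E. t \<le> x) \<or> (\<forall>x\<in>E. x \<le> t)}"
      then have "t \<in> E" "(\<forall>x\<in>E. t \<le> x) \<or> (\<forall>x\<in>E. x \<le> t)" by simp_all
      then have "Inf E = t \<or> Sup E = t"
        using cInf_eq_minimum[of t E] cSup_eq_maximum[of t E] by blast
      then show "t \<in> {Inf E, Sup E}" by blast
    qed
    then have "finite {t\<in>E. (\<forall>x\<in>E. t \<le> x) \<or> (\<forall>x\<in>E. x \<le> t)}"
      by (rule finite_subset) simp
    then have "{t\<in>E. (\<forall>x\<in>E. t \<le> x) \<or> (\<forall>x\<in>E. x \<le> t)} \<in> null_sets lborel"
      by (rule finite_imp_null_set_lborel)
    then show ?thesis by (rule AE_not_in)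
  qed
  ultimately show ?thesis
  proof eventually_elim
    case (elim t)
    show ?case
    proof
      assume t: "t \<in> E"
      then obtain x y where "x \<in> E" "y \<in> E" "x < t" "t < y" using elim(2) by (auto simp: not_le)
      then obtain p q where pq: "p \<in> \<rat>" "q \<in> \<rat>" "x < p" "p < t" "t < q" "q < y"
        using Rats_dense_in_real by metis
      have lr: "l p \<in> E" "l p \<le> t" "r q \<in> E" "t \<le> r q"
        using l[OF \<open>x \<in> E\<close>, of p] r[OF \<open>y \<in> E\<close>, of q] pq by auto
      then have "(p, q) \<in> ?Q" using pq by auto
      then show "P t" using elim(1) lr t by force
    qed
  qed
qed

section \<open>Comparison and uniqueness of derivatives on the set\<close>

text \<open>Gap by gap both integrals equal the jump of \<open>f\<close>.\<close>

lemma primitive_gap_integral: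
  assumes pr: "primitive E f k" and uv: "u \<in> E" "v \<in> E" "u \<le> v"
  shows "set_lebesgue_integral lborel (\<Omega> \<inter> {u..v}) k = set_lebesgue_integral lborel (\<Omega> \<inter> {u..v}) (slope E f)"
  proof (rule has_sum_unique[OF has_sum_gaps_Icc[OF uv(1,2) primitiveD(2)[OF pr uv]]])
    have "((\<lambda>p. set_lebesgue_integral lborel {fst p<..<snd p} (slope E f)) has_sum
      set_lebesgue_integral lborel (\<Omega> \<inter> {u..v}) (slope E f)) {p\<in>gaps E. u \<le> fst p \<and> snd p \<le> v}"
      by (rule has_sum_gaps_Icc[OF uv(1,2) slope_integrable_Icc[OF primitive_dominated[OF pr] uv]])
    then show "((\<lambda>p. set_lebesgue_integral lborel {fst p<..<snd p} k) has_sum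
      set_lebesgue_integral lborel (\<Omega> \<inter> {u..v}) (slope E f)) {p\<in>gaps E. u \<le> fst p \<and> snd p \<le> v}"
    proof (rule has_sum_cong[THEN iffD1, rotated])
      fix p assume "p \<in> {p\<in>gaps E. u \<le> fst p \<and> snd p \<le> v}"
      then have p: "(fst p, snd p) \<in> gaps E" by simp
      show "set_lebesgue_integral lborel {fst p<..<snd p} (slope E f) = set_lebesgue_integral lborel {fst p<..<snd p} k"
        using slope_integral_gap(1)[OF p, of f] primitiveD(3)[OF pr, of "fst p" "snd p"] gapsD[OF p]
          set_integral_endpoints(1)[OF primitiveD(1)[OF pr], of "fst p" "snd p"] by simp
    qed
  qed

text \<open>Since \<open>k\<close> and the slope have the same integral over the gaps,
  \<open>dominated_slope\<close> compares the integrals of \<open>k\<close> and \<open>m\<close>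
  over \<open>E\<close> between any two of its points. The criterion for signs, applied to
  \<open>m + k\<close> and to \<open>m - k\<close> on \<open>E\<close>, makes this comparison
  pointwise.\<close>

lemma primitive_le_dominated:
  assumes dom: "dominated E f m" and pr: "primitive E f k"
  shows "AE t in lborel. t \<in> E \<longrightarrow> \<bar>k t\<bar> \<le> m t"
proof (rule AE_E_I[where P = "\<lambda>t. \<bar>k t\<bar> \<le> m t"])
  fix x y assume xy: "x \<in> E" "y \<in> E" "x \<le> y"
  note [measurable] = dominatedD(1)[OF dom] primitiveD(1)[OF pr]
  have bound: "\<bar>set_lebesgue_integral lborel (E \<inter> {u..v}) k\<bar> \<le> set_lebesgue_integral lborel (E \<inter> {u..v}) m"
    if uv: "u \<in> E" "v \<in> E" "u \<le> v" for u v
  proof -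
    show ?thesis
      using dominated_slope[OF dom uv] set_integral_split_gaps[OF uv(1,2) primitiveD(2)[OF pr uv]]
        primitiveD(3)[OF pr uv] slope_integral_split[OF uv(1,2), of f] primitive_gap_integral[OF pr uv] by simp
  qed
  \<comment> \<open>With \<open>s\<close> equal to 1 or -1, both signs of \<open>k\<close> are
    treated at once.\<close>
  let ?v = "\<lambda>s t. indicator (E \<inter> {x..y}) t *\<^sub>R (m t + s * k t)"
  have mi: "set_integrable lborel {x..y} m" and ki: "set_integrable lborel {x..y} k"
    by (fact dominatedD(3)[OF dom xy] primitiveD(2)[OF pr xy])+
  have ae: "AE t in lborel. 0 \<le> ?v s t" if s: "s = 1 \<or> s = -1" for s
  proof (rule AE_nonneg_intervals[of _ x y])
    have "set_integrable lborel {x..y} (\<lambda>t. m t + s * k t)"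
      using mi ki by (intro set_integral_add) auto
    then have i: "set_integrable lborel (E \<inter> {x..y}) (\<lambda>t. m t + s * k t)"
      by (rule set_integrable_subset) auto
    then show "integrable lborel (?v s)" by (simp add: set_integrable_def)
    fix a b :: real assume "a \<le> b"
    have eq: "set_lebesgue_integral lborel {a<..<b} (?v s) = set_lebesgue_integral lborel (E \<inter> {x..y} \<inter> {a<..<b}) (\<lambda>t. m t + s * k t)"
      unfolding set_lebesgue_integral_def by (rule Bochner_Integration.integral_cong) (auto simp: indicator_def)
    \<comment> \<open>The end points \<open>a\<close> and \<open>b\<close> are arbitrary. The
      interval is shrunk to the one between the extreme points \<open>u\<close> and \<open>v\<close>
      of this compact set, which has the same intersection with \<open>E\<close> and to which
      \<open>bound\<close> applies.\<close>
    let ?C = "E \<inter> {x..y} \<inter> {a..b}"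
    show "0 \<le> set_lebesgue_integral lborel {a<..<b} (?v s)"
    proof (cases "?C = {}")
      case True
      then have "E \<inter> {x..y} \<inter> {a<..<b} = {}" by auto
      then show ?thesis unfolding eq by (simp add: set_lebesgue_integral_def)
    next
      case False
      have "compact ?C" by (intro compact_Int_closed compact_Int xy) auto
      then obtain u v where u: "u \<in> ?C" "\<And>t. t \<in> ?C \<Longrightarrow> u \<le> t" and v: "v \<in> ?C" "\<And>t. t \<in> ?C \<Longrightarrow> t \<le> v"
        using compact_attains_inf[of ?C] compact_attains_sup[of ?C] False by blast
      have uv: "u \<in> E" "v \<in> E" "u \<le> v" using u v by auto
      have C: "?C = E \<inter> {u..v}" using u v by auto
      have mi': "set_integrable lborel (E \<inter> {u..v}) m" and ki': "set_integrable lborel (E \<inter> {u..v}) k"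
        using dominatedD(3)[OF dom uv] primitiveD(2)[OF pr uv] by (auto elim: set_integrable_subset)
      have "set_lebesgue_integral lborel (E \<inter> {x..y} \<inter> {a<..<b}) (\<lambda>t. m t + s * k t) = set_lebesgue_integral lborel ?C (\<lambda>t. m t + s * k t)"
        unfolding set_lebesgue_integral_def
      proof (rule integral_cong_AE)
        show "AE t in lborel. indicator (E \<inter> {x..y} \<inter> {a<..<b}) t *\<^sub>R (m t + s * k t) = indicator ?C t *\<^sub>R (m t + s * k t)"
          using AE_lborel_singleton[of a] AE_lborel_singleton[of b] by eventually_elim (auto simp: indicator_def)
      qed (measurable, measurable)
      also have "\<dots> = set_lebesgue_integral lborel (E \<inter> {u..v}) m + s * set_lebesgue_integral lborel (E \<inter> {u..v}) k"
        unfolding C using set_integral_add(2)[OF mi' set_integrable_mult_right[of s, OF ki']] by simp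
      finally have e: "set_lebesgue_integral lborel (E \<inter> {x..y} \<inter> {a<..<b}) (\<lambda>t. m t + s * k t) =
        set_lebesgue_integral lborel (E \<inter> {u..v}) m + s * set_lebesgue_integral lborel (E \<inter> {u..v}) k" .
      have abs: "\<bar>X\<bar> \<le> Y \<Longrightarrow> 0 \<le> Y + s * X" for X Y :: real
        using s by (elim disjE) simp_all
      show ?thesis unfolding eq e by (rule abs[OF bound[OF uv]])
    qed
  next
    fix t assume "t \<notin> {x..y}"
    then show "?v s t = 0" by simp
  qed
  show "AE t in lborel. t \<in> E \<inter> {x..y} \<longrightarrow> \<bar>k t\<bar> \<le> m t"
  proof -
    have *: "P \<in> S \<longrightarrow> \<bar>b\<bar> \<le> a" if "0 \<le> indicator S P *\<^sub>R (a + 1 * b)" "0 \<le> indicator S P *\<^sub>R (a + - 1 * b)"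
      for S and P a b :: real
      using that by (cases "P \<in> S") (simp_all add: abs_le_iff)
    from ae[OF disjI1[OF refl]] ae[OF disjI2[OF refl]] show ?thesis
      by eventually_elim (rule *)
  qed
qed

lemma primitive_diff:
  assumes "primitive E f k" "primitive E g k'"
  shows "primitive E (\<lambda>x. f x - g x) (\<lambda>t. k t - k' t)"
  unfolding primitive_def
proof (intro conjI ballI impI)
  show "(\<lambda>t. k t - k' t) \<in> borel_measurable borel"
    by (intro borel_measurable_diff primitiveD(1)[OF assms(1)] primitiveD(1)[OF assms(2)])
  fix x y assume xy: "x \<in> E" "y \<in> E" "x \<le> y"
  show "set_integrable lborel {x..y} (\<lambda>t. k t - k' t)"
    by (rule set_integral_diff(1)[OF primitiveD(2)[OF assms(1) xy] primitiveD(2)[OF assms(2) xy]])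
  show "f y - g y - (f x - g x) = set_lebesgue_integral lborel {x..y} (\<lambda>t. k t - k' t)"
    using set_integral_diff(2)[OF primitiveD(2)[OF assms(1) xy] primitiveD(2)[OF assms(2) xy]]
      primitiveD(3)[OF assms(1) xy] primitiveD(3)[OF assms(2) xy] by simp
qed

text \<open>The difference of the two densities is a density of the zero function, which is
  dominated by 0.\<close>

lemma primitive_unique:
  assumes "primitive E f k" "primitive E f k'"
  shows "AE t in lborel. t \<in> E \<longrightarrow> k t = k' t"
proof -
  have "dominated E (\<lambda>x. f x - f x) (\<lambda>_. 0)"
    by (simp add: dominated_def set_integrable_def)
  from primitive_le_dominated[OF this primitive_diff[OF assms]] show ?thesis
    by (rule AE_mp) (rule AE_I2, simp)
qed

end

section \<open>Square-integrable derivatives and the form\<close>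

lemma square_integrable_imp_set_integrable:
  fixes k :: "real \<Rightarrow> real"
  assumes "k \<in> borel_measurable borel" "integrable lborel (\<lambda>t. (k t)\<^sup>2)"
  shows "set_integrable lborel {a..b} k"
  unfolding set_integrable_def
proof (rule Bochner_Integration.integrable_bound)
  show "integrable lborel (\<lambda>t. indicator {a..b} t + (k t)\<^sup>2)"
    by (intro Bochner_Integration.integrable_add assms(2)) (simp add: emeasure_lborel_Icc_eq)
  show "(\<lambda>t. indicator {a..b} t *\<^sub>R k t) \<in> borel_measurable lborel"
    using assms(1) by simp
  have *: "\<bar>c\<bar> \<le> 1 + c\<^sup>2" for c :: real
    using zero_le_power2[of "\<bar>c\<bar> - 1"] by (simp add: power2_eq_square algebra_simps)
  have "norm (indicator {a..b} t *\<^sub>R k t) \<le> norm (indicator {a..b} t + (k t)\<^sup>2)" for t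
    using *[of "k t"] by (cases "t \<in> {a..b}") simp_all
  then show "AE t in lborel. norm (indicator {a..b} t *\<^sub>R k t) \<le> norm (indicator {a..b} t + (k t)\<^sup>2)"
    by (intro AE_I2)
qed

lemma set_integral_combine:
  fixes k :: "real \<Rightarrow> real"
  assumes [measurable]: "k \<in> borel_measurable borel" and k: "set_integrable lborel {a..c} k" and "a \<le> b" "b \<le> c"
  shows "set_lebesgue_integral lborel {a..c} k = set_lebesgue_integral lborel {a..b} k + set_lebesgue_integral lborel {b..c} k"
proof -
  have eq: "{a..c} = {a..b} \<union> {b<..c}" using assms(3,4) by auto
  have "set_lebesgue_integral lborel {a..c} k = set_lebesgue_integral lborel {a..b} k + set_lebesgue_integral lborel {b<..c} k"
    unfolding eq by (rule set_integral_Un) (use assms(3,4) in \<open>auto intro: set_integrable_subset[OF k]\<close>)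
  also have "set_lebesgue_integral lborel {b<..c} k = set_lebesgue_integral lborel {b..c} k"
    unfolding set_lebesgue_integral_def
  proof (rule integral_cong_AE)
    show "AE t in lborel. indicator {b<..c} t *\<^sub>R k t = indicator {b..c} t *\<^sub>R k t"
      using AE_lborel_singleton[of b] by (rule AE_mp) (rule AE_I2, simp add: indicator_def)
  qed measurable
  finally show ?thesis .
qed

definition antideriv :: "(real \<Rightarrow> real) \<Rightarrow> real \<Rightarrow> real \<Rightarrow> real" where
  "antideriv k x0 y = (if x0 \<le> y then set_lebesgue_integral lborel {x0..y} k else - set_lebesgue_integral lborel {y..x0} k)"

lemma antideriv_diff:
  assumes k: "k \<in> borel_measurable borel" "\<And>a b. set_integrable lborel {a..b} k" and "z \<le> y"
  shows "antideriv k x0 y - antideriv k x0 z = set_lebesgue_integral lborel {z..y} k"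
proof -
  note c = set_integral_combine[OF k(1) k(2)]
  consider "x0 \<le> z" | "z < x0" "x0 \<le> y" | "y < x0" by linarith
  then show ?thesis
  proof cases
    case 1
    then show ?thesis using c[of x0 z y] \<open>z \<le> y\<close> by (simp add: antideriv_def)
  next
    case 2
    then show ?thesis using c[of z x0 y] by (simp add: antideriv_def)
  next
    case 3
    then show ?thesis using c[of z y x0] \<open>z \<le> y\<close> by (simp add: antideriv_def)
  qed
qed

lemma antideriv_base [simp]: "antideriv k x0 x0 = 0"
proof -
  have "set_lebesgue_integral lborel {x0..x0} k = 0"
    unfolding set_lebesgue_integral_def
    by (rule integral_eq_zero_AE, rule AE_mp[OF AE_lborel_singleton[of x0]], rule AE_I2) simp
  then show ?thesis unfolding antideriv_def by simp
qed

definition sqint :: "(real \<Rightarrow> real) \<Rightarrow> bool" where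
  "sqint k \<longleftrightarrow> k \<in> borel_measurable borel \<and> integrable lborel (\<lambda>t. (k t)\<^sup>2)"

lemma sqintD:
  assumes "sqint k"
  shows "k \<in> borel_measurable borel" "integrable lborel (\<lambda>t. (k t)\<^sup>2)" "set_integrable lborel {a..b} k"
  using assms square_integrable_imp_set_integrable by (auto simp: sqint_def)

lemma sqint_bound:
  assumes "sqint k" "sqint k'" "l \<in> borel_measurable borel" "AE t in lborel. \<bar>l t\<bar> \<le> \<bar>k t\<bar> + \<bar>k' t\<bar>"
  shows "sqint l" "(\<integral>t. (l t)\<^sup>2 \<partial>lborel) \<le> 2 * (\<integral>t. (k t)\<^sup>2 \<partial>lborel) + 2 * (\<integral>t. (k' t)\<^sup>2 \<partial>lborel)"
proof -
  have *: "l\<^sup>2 \<le> 2 * k\<^sup>2 + 2 * k'\<^sup>2" if "\<bar>l\<bar> \<le> \<bar>k\<bar> + \<bar>k'\<bar>" for l k k' :: real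
  proof -
    have "l\<^sup>2 \<le> (\<bar>k\<bar> + \<bar>k'\<bar>)\<^sup>2" using power_mono[OF that abs_ge_zero, of 2] by simp
    also have "\<dots> \<le> 2 * k\<^sup>2 + 2 * k'\<^sup>2"
      using sum_squares_bound[of "\<bar>k\<bar>" "\<bar>k'\<bar>"] by (simp add: power2_sum)
    finally show ?thesis .
  qed
  have i: "integrable lborel (\<lambda>t. 2 * (k t)\<^sup>2 + 2 * (k' t)\<^sup>2)"
    using assms(1,2) by (intro Bochner_Integration.integrable_add integrable_mult_right) (simp_all add: sqint_def)
  have ae: "AE t in lborel. (l t)\<^sup>2 \<le> 2 * (k t)\<^sup>2 + 2 * (k' t)\<^sup>2"
    using assms(4) by (rule AE_mp) (intro AE_I2 impI *)
  have li: "integrable lborel (\<lambda>t. (l t)\<^sup>2)"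
  proof (rule Bochner_Integration.integrable_bound[OF i])
    show "(\<lambda>t. (l t)\<^sup>2) \<in> borel_measurable lborel" using assms(3) by simp
    show "AE t in lborel. norm ((l t)\<^sup>2) \<le> norm (2 * (k t)\<^sup>2 + 2 * (k' t)\<^sup>2)"
      using ae by (rule AE_mp) (rule AE_I2, simp)
  qed
  then show "sqint l" using assms(3) by (simp add: sqint_def)
  have "(\<integral>t. (l t)\<^sup>2 \<partial>lborel) \<le> (\<integral>t. 2 * (k t)\<^sup>2 + 2 * (k' t)\<^sup>2 \<partial>lborel)"
    by (rule integral_mono_AE[OF li i ae])
  also have "\<dots> = 2 * (\<integral>t. (k t)\<^sup>2 \<partial>lborel) + 2 * (\<integral>t. (k' t)\<^sup>2 \<partial>lborel)"
    using assms(1,2) by (subst Bochner_Integration.integral_add) (simp_all add: sqint_def)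
  finally show "(\<integral>t. (l t)\<^sup>2 \<partial>lborel) \<le> 2 * (\<integral>t. (k t)\<^sup>2 \<partial>lborel) + 2 * (\<integral>t. (k' t)\<^sup>2 \<partial>lborel)" .
qed

lemma sqint_zero: "sqint (\<lambda>_. 0)"
  by (simp add: sqint_def)

lemma sqint_mult_integrable:
  assumes "sqint k" "sqint k'"
  shows "integrable lborel (\<lambda>t. k t * k' t)"
proof (rule Bochner_Integration.integrable_bound)
  show "integrable lborel (\<lambda>t. (k t)\<^sup>2 + (k' t)\<^sup>2)"
    by (intro Bochner_Integration.integrable_add sqintD(2)[OF assms(1)] sqintD(2)[OF assms(2)])
  show "(\<lambda>t. k t * k' t) \<in> borel_measurable lborel"
    using sqintD(1)[OF assms(1)] sqintD(1)[OF assms(2)] by simp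
  have "\<bar>a * b\<bar> \<le> a\<^sup>2 + b\<^sup>2" for a b :: real
  proof -
    have "2 * (\<bar>a\<bar> * \<bar>b\<bar>) \<le> a\<^sup>2 + b\<^sup>2" using sum_squares_bound[of "\<bar>a\<bar>" "\<bar>b\<bar>"] by simp
    moreover have "0 \<le> \<bar>a\<bar> * \<bar>b\<bar>" by simp
    ultimately show ?thesis unfolding abs_mult by linarith
  qed
  then show "AE t in lborel. norm (k t * k' t) \<le> norm ((k t)\<^sup>2 + (k' t)\<^sup>2)"
    by (intro AE_I2) simp
qed

text \<open>Obtained by expanding the nonnegative integral of \<open>(k - c)\<^sup>2\<close>, where
  \<open>c\<close> is the mean value of \<open>k\<close> on the interval.\<close>

lemma Cauchy_Schwarz_Icc:
  assumes "sqint k" "a \<le> b"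
  shows "(set_lebesgue_integral lborel {a..b} k)\<^sup>2 \<le> (b - a) * set_lebesgue_integral lborel {a..b} (\<lambda>t. (k t)\<^sup>2)"
proof (cases "a = b")
  case True
  have "set_lebesgue_integral lborel {b..b} k = 0"
    using antideriv_base[of k b] unfolding antideriv_def by (simp only: if_True order_refl)
  then show ?thesis using True by (simp only:) simp
next
  case False
  then have ab: "0 < b - a" using assms(2) by simp
  define I where "I = set_lebesgue_integral lborel {a..b} k"
  define c where "c = I / (b - a)"
  have k2: "set_integrable lborel {a..b} (\<lambda>t. (k t)\<^sup>2)" by (rule integrable_set_integrable[OF sqintD(2)[OF assms(1)]]) simp
  have "0 \<le> set_lebesgue_integral lborel {a..b} (\<lambda>t. (k t - c)\<^sup>2)"
    unfolding set_lebesgue_integral_def by (rule integral_nonneg_AE) simp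
  also have "(\<lambda>t. (k t - c)\<^sup>2) = (\<lambda>t. (k t)\<^sup>2 - 2 * c * k t + c\<^sup>2)"
    by (auto simp: power2_diff algebra_simps)
  also have "set_lebesgue_integral lborel {a..b} (\<lambda>t. (k t)\<^sup>2 - 2 * c * k t + c\<^sup>2) =
     set_lebesgue_integral lborel {a..b} (\<lambda>t. (k t)\<^sup>2) - 2 * c * I + c\<^sup>2 * (b - a)"
  proof -
    have ck: "set_integrable lborel {a..b} (\<lambda>t. 2 * c * k t)"
      by (rule set_integrable_mult_right[OF sqintD(3)[OF assms(1)]])
    have cc: "set_integrable lborel {a..b} (\<lambda>t. c\<^sup>2)"
      unfolding set_integrable_def by (intro integrable_scaleR_left) (simp add: emeasure_lborel_Icc_eq)
    have "set_lebesgue_integral lborel {a..b} (\<lambda>t. c\<^sup>2) = c\<^sup>2 * (b - a)"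
      using assms(2) unfolding set_lebesgue_integral_def by (subst integral_scaleR_left) (auto simp: emeasure_lborel_Icc_eq)
    then show ?thesis
      using set_integral_add(2)[OF set_integral_diff(1)[OF k2 ck] cc] set_integral_diff(2)[OF k2 ck]
      by (simp add: I_def)
  qed
  also have "\<dots> = set_lebesgue_integral lborel {a..b} (\<lambda>t. (k t)\<^sup>2) - I\<^sup>2 / (b - a)"
    using ab by (simp add: c_def power2_eq_square)
  finally show ?thesis using ab by (simp add: I_def field_simps)
qed

context classK
begin

section \<open>The space H1 and a canonical derivative\<close>

definition H1 :: "(real \<Rightarrow> real) \<Rightarrow> bool" where
  "H1 f \<longleftrightarrow> (\<exists>G k. H1s_rep E id (\<lambda>_. 1) f G k)"

text \<open>The arbitrary density chosen by \<open>H1_der\<close> is kept on \<open>E\<close>, where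
  it is unique almost everywhere. In the gaps, where it is not determined, it is replaced by the
  slope, which is what the jump part of the form sees.\<close>

definition der :: "(real \<Rightarrow> real) \<Rightarrow> real \<Rightarrow> real" where
  "der f t = (if t \<in> E then H1_der E f t else slope E f t)"

lemma E_nonempty: "E \<noteq> {}"
  using K by (auto simp: class_K_def lE_def rE_def top_ereal_def bot_ereal_def)

lemma s_lo_id: "s_lo E id = lE E"
proof (rule antisym)
  show "s_lo E id \<le> lE E"
    unfolding s_lo_def lE_def by (rule Inf_superset_mono) (auto simp: intI_def)
  show "lE E \<le> s_lo E id"
    unfolding s_lo_def by (rule Inf_greatest) (auto simp: intI_def intro: lE_le)
qed

lemma s_hi_id: "s_hi E id = rE E"
proof (rule antisym)
  show "rE E \<le> s_hi E id"
    unfolding s_hi_def rE_def by (rule Sup_subset_mono) (auto simp: intI_def)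
  show "s_hi E id \<le> rE E"
    unfolding s_hi_def by (rule Sup_least) (auto simp: intI_def intro: rE_ge)
qed

lemma E_subset_hull: "x \<in> E \<Longrightarrow> x \<in> s_hull E id"
  by (simp add: s_hull_def s_lo_id s_hi_id lE_le rE_ge)

text \<open>The indicator of \<open>intI E\<close> turns square integrability on the interval into
  square integrability on the line and changes nothing between points of \<open>E\<close>.\<close>

lemma H1s_rep_id_primitive:
  assumes rep: "H1s_rep E id (\<lambda>_. 1) f G k"
  shows "sqint (\<lambda>t. indicator (intI E) t * k t)" "primitive E f (\<lambda>t. indicator (intI E) t * k t)"
proof -
  have k[measurable]: "k \<in> borel_measurable borel" using rep by (simp add: H1s_rep_def)
  let ?k = "\<lambda>t. indicator (intI E) t * k t"
  have "(\<lambda>t. indicator (intI E) t *\<^sub>R ((k (id t))\<^sup>2 * 1)) = (\<lambda>t. (?k t)\<^sup>2)"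
    by (auto simp: indicator_def)
  then show "sqint ?k"
    using rep by (simp add: sqint_def H1s_rep_def set_integrable_def)
  show "primitive E f ?k"
    unfolding primitive_def
  proof (intro conjI ballI impI)
    fix x y assume xy: "x \<in> E" "y \<in> E" "x \<le> y"
    have eq: "indicator {x..y} t *\<^sub>R ?k t = indicator {x..y} t *\<^sub>R k t" for t
      using Icc_subset[OF xy(1,2)] by (auto simp: indicator_def intI_eq)
    show "set_integrable lborel {x..y} ?k"
      using rep E_subset_hull[OF xy(1)] E_subset_hull[OF xy(2)] xy unfolding set_integrable_def eq
      by (simp add: H1s_rep_def set_integrable_def)
    show "f y - f x = set_lebesgue_integral lborel {x..y} ?k"
      using rep E_subset_hull[OF xy(1)] E_subset_hull[OF xy(2)] xy unfolding set_lebesgue_integral_def eq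
      by (simp add: H1s_rep_def set_lebesgue_integral_def)
  qed measurable
qed

text \<open>The extension \<open>G\<close> and the hull disappear: a square-integrable density on
  the line is integrable on bounded intervals, so its antiderivative is an extension defined
  everywhere. Membership can then be tested on points of \<open>E\<close> alone.\<close>

lemma H1_iff: "H1 f \<longleftrightarrow> (\<exists>k. sqint k \<and> primitive E f k)"
proof
  assume "H1 f"
  then show "\<exists>k. sqint k \<and> primitive E f k"
    unfolding H1_def using H1s_rep_id_primitive by blast
next
  assume "\<exists>k. sqint k \<and> primitive E f k"
  then obtain k where k: "sqint k" "primitive E f k" by blast
  obtain x0 where x0: "x0 \<in> E"
    using E_nonempty by blast
  have d: "antideriv k x0 y - antideriv k x0 z = set_lebesgue_integral lborel {z..y} k" if "z \<le> y" for y z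
    by (rule antideriv_diff[OF sqintD(1)[OF k(1)] sqintD(3)[OF k(1)] that])
  have "f x = f x0 + antideriv k x0 x" if "x \<in> E" for x
    using primitiveD(3)[OF k(2), of x0 x] primitiveD(3)[OF k(2), of x x0] that x0
    by (cases "x0 \<le> x") (auto simp: antideriv_def)
  moreover have "set_integrable lborel (intI E) (\<lambda>x. (k (id x))\<^sup>2 * 1)"
    using integrable_set_integrable[OF sqintD(2)[OF k(1)], of "intI E"] by simp
  ultimately have "H1s_rep E id (\<lambda>_. 1) f (\<lambda>y. f x0 + antideriv k x0 y) k"
    using d sqintD[OF k(1)] by (simp add: H1s_rep_def)
  then show "H1 f" by (auto simp: H1_def)
qed

text \<open>By Cauchy-Schwarz, among all majorants of a given jump across a gap the constant one has
  the least square integral.\<close>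

lemma slope_square_le:
  assumes dom: "dominated E f m" and m: "sqint m"
  shows "sqint (slope E f)" "(\<integral>t. (slope E f t)\<^sup>2 \<partial>lborel) \<le> (\<integral>t. (m t)\<^sup>2 \<partial>lborel)"
proof -
  note [measurable] = dominatedD(1)[OF dom]
  have "(\<integral>\<^sup>+t\<in>\<Omega>. ennreal ((slope E f t)\<^sup>2) \<partial>lborel) \<le> (\<integral>\<^sup>+t\<in>\<Omega>. ennreal ((m t)\<^sup>2) \<partial>lborel)"
  proof (rule nn_integral_gaps_mono)
    fix a b assume g: "(a, b) \<in> gaps E"
    note ab = gapsD[OF g]
    let ?c = "((f b - f a) / (b - a))\<^sup>2"
    have "(\<integral>\<^sup>+t\<in>{a<..<b}. ennreal ((slope E f t)\<^sup>2) \<partial>lborel) = (\<integral>\<^sup>+t. ennreal ?c * indicator {a<..<b} t \<partial>lborel)"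
    proof (rule nn_integral_cong)
      fix t :: real
      show "ennreal ((slope E f t)\<^sup>2) * indicator {a<..<b} t = ennreal ?c * indicator {a<..<b} t"
        using slope_gap[OF g, of t f] by (cases "t \<in> {a<..<b}") simp_all
    qed
    also have "\<dots> = ennreal (?c * (b - a))"
    proof -
      have "(\<integral>\<^sup>+t. ennreal ?c * indicator {a<..<b} t \<partial>lborel) = ennreal ?c * emeasure lborel {a<..<b}"
        by (rule nn_integral_cmult_indicator) simp
      also have "emeasure lborel {a<..<b} = ennreal (b - a)" using ab(3) by simp
      also have "ennreal ?c * ennreal (b - a) = ennreal (?c * (b - a))"
        by (rule ennreal_mult[symmetric]) (use ab(3) in simp_all)
      finally show ?thesis .
    qed
    also have "\<dots> \<le> ennreal (set_lebesgue_integral lborel {a<..<b} (\<lambda>t. (m t)\<^sup>2))"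
    proof (rule ennreal_leI)
      have "(f b - f a)\<^sup>2 \<le> (set_lebesgue_integral lborel {a..b} m)\<^sup>2"
        using dominatedD(4)[OF dom ab(1,2) less_imp_le[OF ab(3)]]
        by (intro abs_le_square_iff[THEN iffD1]) (rule order_trans[OF _ abs_ge_self])
      also have "\<dots> \<le> (b - a) * set_lebesgue_integral lborel {a..b} (\<lambda>t. (m t)\<^sup>2)"
        by (rule Cauchy_Schwarz_Icc[OF m]) (use ab in simp)
      also have "set_lebesgue_integral lborel {a..b} (\<lambda>t. (m t)\<^sup>2) = set_lebesgue_integral lborel {a<..<b} (\<lambda>t. (m t)\<^sup>2)"
        by (rule set_integral_endpoints) measurable
      finally have *: "(f b - f a)\<^sup>2 \<le> (b - a) * set_lebesgue_integral lborel {a<..<b} (\<lambda>t. (m t)\<^sup>2)" .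
      have "?c * (b - a) = (f b - f a)\<^sup>2 / (b - a)"
        using ab(3) by (simp add: power_divide power2_eq_square)
      also have "\<dots> \<le> set_lebesgue_integral lborel {a<..<b} (\<lambda>t. (m t)\<^sup>2)"
        using * ab(3) by (simp add: pos_divide_le_eq mult.commute)
      finally show "?c * (b - a) \<le> set_lebesgue_integral lborel {a<..<b} (\<lambda>t. (m t)\<^sup>2)" .
    qed
    also have "\<dots> = (\<integral>\<^sup>+t. ennreal (indicator {a<..<b} t *\<^sub>R (m t)\<^sup>2) \<partial>lborel)"
      unfolding set_lebesgue_integral_def
      using integrable_mult_indicator[OF _ sqintD(2)[OF m], of "{a<..<b}"]
      by (subst nn_integral_eq_integral) auto
    also have "\<dots> = (\<integral>\<^sup>+t\<in>{a<..<b}. ennreal ((m t)\<^sup>2) \<partial>lborel)"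
      by (intro nn_integral_cong) (auto simp: indicator_def)
    finally show "(\<integral>\<^sup>+t\<in>{a<..<b}. ennreal ((slope E f t)\<^sup>2) \<partial>lborel) \<le> (\<integral>\<^sup>+t\<in>{a<..<b}. ennreal ((m t)\<^sup>2) \<partial>lborel)" .
  qed auto
  also have "\<dots> \<le> (\<integral>\<^sup>+t. ennreal ((m t)\<^sup>2) \<partial>lborel)"
    by (intro nn_integral_mono) (auto simp: indicator_def)
  also have "\<dots> = ennreal (\<integral>t. (m t)\<^sup>2 \<partial>lborel)"
    by (rule nn_integral_eq_integral[OF sqintD(2)[OF m]]) simp
  also have "(\<integral>\<^sup>+t\<in>\<Omega>. ennreal ((slope E f t)\<^sup>2) \<partial>lborel) = (\<integral>\<^sup>+t. ennreal ((slope E f t)\<^sup>2) \<partial>lborel)"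
    by (intro nn_integral_cong) (auto simp: indicator_def slope_outside)
  finally have *: "(\<integral>\<^sup>+t. ennreal ((slope E f t)\<^sup>2) \<partial>lborel) \<le> ennreal (\<integral>t. (m t)\<^sup>2 \<partial>lborel)" .
  have "integrable lborel (\<lambda>t. (slope E f t)\<^sup>2)"
    by (rule integrableI_bounded) (use le_less_trans[OF *] in simp_all)
  then show s: "sqint (slope E f)" by (simp add: sqint_def)
  have "ennreal (\<integral>t. (slope E f t)\<^sup>2 \<partial>lborel) \<le> ennreal (\<integral>t. (m t)\<^sup>2 \<partial>lborel)"
    using * by (subst nn_integral_eq_integral[OF sqintD(2)[OF s], symmetric]) simp_all
  then show "(\<integral>t. (slope E f t)\<^sup>2 \<partial>lborel) \<le> (\<integral>t. (m t)\<^sup>2 \<partial>lborel)"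
    by (subst (asm) ennreal_le_iff) simp_all
qed

end

lemma primitive_scale:
  assumes "primitive E f k"
  shows "primitive E (\<lambda>x. c * f x) (\<lambda>t. c * k t)"
  unfolding primitive_def
proof (intro conjI ballI impI)
  show "(\<lambda>t. c * k t) \<in> borel_measurable borel"
    by (intro borel_measurable_times borel_measurable_const primitiveD(1)[OF assms])
  fix x y assume xy: "x \<in> E" "y \<in> E" "x \<le> y"
  show "set_integrable lborel {x..y} (\<lambda>t. c * k t)"
    by (rule set_integrable_mult_right[OF primitiveD(2)[OF assms xy]])
  show "c * f y - c * f x = set_lebesgue_integral lborel {x..y} (\<lambda>t. c * k t)"
    using primitiveD(3)[OF assms xy] by (simp add: right_diff_distrib[symmetric])
qed

lemma sqint_scale: "sqint k \<Longrightarrow> sqint (\<lambda>t. c * k t)"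
  by (auto simp: sqint_def power_mult_distrib)

lemma sqint_abs: "sqint k \<Longrightarrow> sqint (\<lambda>t. \<bar>k t\<bar>)"
  by (auto simp: sqint_def intro: borel_measurable_abs)

lemma sqint_diff:
  assumes "sqint k" "sqint k'"
  shows "sqint (\<lambda>t. k t - k' t)"
  by (rule sqint_bound(1)[OF assms])
    (auto intro: borel_measurable_diff sqintD(1)[OF assms(1)] sqintD(1)[OF assms(2)])

lemma primitive_increment:
  assumes "primitive E f k" "sqint k" "x \<in> E" "y \<in> E" "x \<le> y"
  shows "(f y - f x)\<^sup>2 \<le> (y - x) * (\<integral>t. (k t)\<^sup>2 \<partial>lborel)"
proof -
  have "(f y - f x)\<^sup>2 \<le> (y - x) * set_lebesgue_integral lborel {x..y} (\<lambda>t. (k t)\<^sup>2)"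
    using Cauchy_Schwarz_Icc[OF assms(2,5)] primitiveD(3)[OF assms(1,3,4,5)] by simp
  also have "\<dots> \<le> (y - x) * (\<integral>t. (k t)\<^sup>2 \<partial>lborel)"
  proof (rule mult_left_mono)
    show "set_lebesgue_integral lborel {x..y} (\<lambda>t. (k t)\<^sup>2) \<le> (\<integral>t. (k t)\<^sup>2 \<partial>lborel)"
      unfolding set_lebesgue_integral_def
    proof (rule integral_mono_AE)
      show "integrable lborel (\<lambda>t. indicator {x..y} t *\<^sub>R (k t)\<^sup>2)"
        by (rule integrable_mult_indicator[OF _ sqintD(2)[OF assms(2)]]) simp
      show "AE t in lborel. indicator {x..y} t *\<^sub>R (k t)\<^sup>2 \<le> (k t)\<^sup>2"
        by (rule AE_I2) (simp add: indicator_def)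
    qed (rule sqintD(2)[OF assms(2)])
  qed (use assms(5) in simp)
  finally show ?thesis .
qed

context classK
begin

lemma slope_linear: "slope E (\<lambda>x. a * f x - b * g x) t = a * slope E f t - b * slope E g t"
  by (simp add: slope_def diff_divide_distrib right_diff_distrib)

lemma H1_scale: "H1 f \<Longrightarrow> H1 (\<lambda>x. c * f x)"
  unfolding H1_iff using primitive_scale sqint_scale by blast

lemma H1_diff: "H1 f \<Longrightarrow> H1 g \<Longrightarrow> H1 (\<lambda>x. f x - g x)"
  unfolding H1_iff using primitive_diff sqint_diff by blast

text \<open>Exchanging the chosen density for the slope inside the gaps preserves all integrals
  between points of \<open>E\<close>, and square integrability by
  \<open>slope_square_le\<close>.\<close>

lemma der_props:
  assumes "H1 f"
  shows "sqint (der f)" "primitive E f (der f)"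
proof -
  have "\<exists>G. H1s_rep E id (\<lambda>_. 1) f G (H1_der E f)"
    unfolding H1_der_def
    by (rule someI_ex[of "\<lambda>k. \<exists>G. H1s_rep E id (\<lambda>_. 1) f G k"]) (use assms in \<open>auto simp: H1_def\<close>)
  then obtain G where "H1s_rep E id (\<lambda>_. 1) f G (H1_der E f)" by blast
  note k = H1s_rep_id_primitive[OF this]
  let ?k = "\<lambda>t. indicator (intI E) t * H1_der E f t"
  have Ek: "der f t = ?k t" if "t \<in> E" for t
  proof -
    have "t \<in> intI E" using that by (simp add: intI_def)
    then show ?thesis using that by (simp add: der_def)
  qed
  have "der f = (\<lambda>t. if t \<in> E then ?k t else slope E f t)"
    using Ek by (auto simp: der_def)
  then have meas[measurable]: "der f \<in> borel_measurable borel"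
    using primitiveD(1)[OF k(2)] by simp
  show sq: "sqint (der f)"
  proof (rule sqint_bound(1)[OF k(1) slope_square_le(1)[OF primitive_dominated[OF k(2)]] meas])
    show "sqint (\<lambda>t. \<bar>?k t\<bar>)" by (rule sqint_abs[OF k(1)])
    show "AE t in lborel. \<bar>der f t\<bar> \<le> \<bar>?k t\<bar> + \<bar>slope E f t\<bar>"
    proof (rule AE_I2)
      fix t show "\<bar>der f t\<bar> \<le> \<bar>?k t\<bar> + \<bar>slope E f t\<bar>"
      proof (cases "t \<in> E")
        case True
        then show ?thesis by (simp add: Ek)
      qed (simp add: der_def)
    qed
  qed
  show "primitive E f (der f)"
    unfolding primitive_def
  proof (intro conjI ballI impI)
    fix x y assume xy: "x \<in> E" "y \<in> E" "x \<le> y"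
    show i: "set_integrable lborel {x..y} (der f)" by (rule sqintD(3)[OF sq])
    have "set_lebesgue_integral lborel (E \<inter> {x..y}) (der f) = set_lebesgue_integral lborel (E \<inter> {x..y}) ?k"
      unfolding set_lebesgue_integral_def using Ek by (intro Bochner_Integration.integral_cong) (auto simp: indicator_def)
    moreover have "set_lebesgue_integral lborel (\<Omega> \<inter> {x..y}) (der f) = set_lebesgue_integral lborel (\<Omega> \<inter> {x..y}) (slope E f)"
      unfolding set_lebesgue_integral_def using gapU_disjoint[of _ E]
      by (intro Bochner_Integration.integral_cong) (auto simp: indicator_def der_def)
    ultimately show "f y - f x = set_lebesgue_integral lborel {x..y} (der f)"
      using primitive_gap_integral[OF k(2) xy] primitiveD(3)[OF k(2) xy]
        set_integral_split_gaps[OF xy(1,2) primitiveD(2)[OF k(2) xy]] set_integral_split_gaps[OF xy(1,2) i] by simp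
  qed (rule meas)
qed

lemma der_gap: "t \<notin> E \<Longrightarrow> der f t = slope E f t"
  by (simp add: der_def)

lemma der_linear:
  assumes "H1 f" "H1 g"
  shows "AE t in lborel. der (\<lambda>x. a * f x - b * g x) t = a * der f t - b * der g t"
proof -
  have "AE t in lborel. t \<in> E \<longrightarrow> der (\<lambda>x. a * f x - b * g x) t = a * der f t - b * der g t"
    by (rule primitive_unique[OF der_props(2) primitive_diff])
      (intro H1_diff H1_scale primitive_scale der_props(2) assms)+
  then show ?thesis
    by (rule AE_mp) (rule AE_I2, auto simp: der_gap slope_linear)
qed

lemma slope_abs_le:
  assumes "\<And>x y. x \<in> E \<Longrightarrow> y \<in> E \<Longrightarrow> x \<le> y \<Longrightarrow> \<bar>w y - w x\<bar> \<le> \<bar>u y - u x\<bar> + \<bar>v y - v x\<bar>"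
  shows "\<bar>slope E w t\<bar> \<le> \<bar>slope E u t\<bar> + \<bar>slope E v t\<bar>"
proof (cases "t \<in> \<Omega>")
  case True
  then obtain a b where g: "(a, b) \<in> gaps E" "a < t" "t < b" by (rule gapU_E)
  note ab = gapsD[OF g(1)]
  show ?thesis
    using assms[OF ab(1,2)] ab(3) slope_gap[OF g] by (simp add: abs_divide divide_right_mono flip: add_divide_distrib)
qed (simp add: slope_outside)

text \<open>The substitute for the chain rule. The increments of \<open>w\<close> are dominated by
  the sum of the two derivatives, so \<open>primitive_le_dominated\<close> gives the bound on
  \<open>E\<close>; in the gaps it is the bound on increments itself.\<close>

lemma der_abs_le:
  assumes "H1 u" "H1 v" "H1 w"
    and le: "\<And>x y. x \<in> E \<Longrightarrow> y \<in> E \<Longrightarrow> x \<le> y \<Longrightarrow> \<bar>w y - w x\<bar> \<le> \<bar>u y - u x\<bar> + \<bar>v y - v x\<bar>"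
  shows "AE t in lborel. \<bar>der w t\<bar> \<le> \<bar>der u t\<bar> + \<bar>der v t\<bar>"
proof -
  note du = primitive_dominated[OF der_props(2)[OF assms(1)]] and dv = primitive_dominated[OF der_props(2)[OF assms(2)]]
  have "dominated E w (\<lambda>t. \<bar>der u t\<bar> + \<bar>der v t\<bar>)"
    unfolding dominated_def
  proof (intro conjI ballI impI allI)
    show "(\<lambda>t. \<bar>der u t\<bar> + \<bar>der v t\<bar>) \<in> borel_measurable borel"
      by (intro borel_measurable_add dominatedD(1)[OF du] dominatedD(1)[OF dv])
    fix x y assume xy: "x \<in> E" "y \<in> E" "x \<le> y"
    note a = set_integral_add[OF dominatedD(3)[OF du xy] dominatedD(3)[OF dv xy]]
    show "set_integrable lborel {x..y} (\<lambda>t. \<bar>der u t\<bar> + \<bar>der v t\<bar>)" by (rule a(1))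
    show "\<bar>w y - w x\<bar> \<le> set_lebesgue_integral lborel {x..y} (\<lambda>t. \<bar>der u t\<bar> + \<bar>der v t\<bar>)"
      unfolding a(2) using le[OF xy] dominatedD(4)[OF du xy] dominatedD(4)[OF dv xy] by linarith
  qed simp
  from primitive_le_dominated[OF this der_props(2)[OF assms(3)]] show ?thesis
  proof (rule AE_mp, intro AE_I2 impI)
    fix t assume "t \<in> E \<longrightarrow> \<bar>der w t\<bar> \<le> \<bar>der u t\<bar> + \<bar>der v t\<bar>"
    then show "\<bar>der w t\<bar> \<le> \<bar>der u t\<bar> + \<bar>der v t\<bar>"
      using slope_abs_le[of w u v t, OF le] by (cases "t \<in> E") (simp_all add: der_gap)
  qed
qed

lemma der_abs_le1:
  assumes "H1 u" "H1 w"
    and le: "\<And>x y. x \<in> E \<Longrightarrow> y \<in> E \<Longrightarrow> x \<le> y \<Longrightarrow> \<bar>w y - w x\<bar> \<le> \<bar>u y - u x\<bar>"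
  shows "AE t in lborel. \<bar>der w t\<bar> \<le> \<bar>der u t\<bar>"
proof -
  \<comment> \<open>The zero function is written as a combination of \<open>u\<close> with itself so
    that \<open>der_linear\<close> evaluates its derivative.\<close>
  have 0: "H1 (\<lambda>x. 1 * u x - 1 * u x)" by (intro H1_diff H1_scale assms)
  have "AE t in lborel. \<bar>der w t\<bar> \<le> \<bar>der u t\<bar> + \<bar>der (\<lambda>x. 1 * u x - 1 * u x) t\<bar>"
    by (rule der_abs_le[OF assms(1) 0 assms(2)]) (use le in simp)
  with der_linear[OF assms(1,1), of 1 1] show ?thesis
  proof eventually_elim
    case (elim t)
    show ?case using elim(2) unfolding elim(1) by simp
  qed
qed

section \<open>The form as an integral of derivatives\<close>

text \<open>The product of the slopes is constant on a gap; multiplying by the length of the gap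
  cancels one of the two denominators.\<close>

lemma gap_sum_eq:
  assumes "sqint (slope E f)" "sqint (slope E g)"
  shows "gap_sum E f g = (\<integral>t. slope E f t * slope E g t \<partial>lborel)"
proof -
  let ?q = "\<lambda>t. slope E f t * slope E g t"
  have "integrable lborel ?q" by (rule sqint_mult_integrable[OF assms])
  then have "set_integrable lborel \<Omega> ?q" by (rule integrable_set_integrable) simp
  from has_sum_gaps[OF this]
  have "((\<lambda>(a, b). (f b - f a) * (g b - g a) / (b - a)) has_sum set_lebesgue_integral lborel \<Omega> ?q) (gaps E)"
  proof (rule has_sum_cong[THEN iffD1, rotated])
    fix p assume p: "p \<in> gaps E"
    obtain a b where [simp]: "p = (a, b)" by (cases p)
    have g: "(a, b) \<in> gaps E" using p by simp
    have "set_lebesgue_integral lborel {a<..<b} ?q = ((f b - f a) / (b - a) * ((g b - g a) / (b - a))) * (b - a)"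
      by (rule set_integral_gap_const(2)) (use gapsD(3)[OF g] slope_gap[OF g] in simp_all)
    moreover have "x / c * (y / c) * c = x * y / c" if "c \<noteq> 0" for x y c :: real
      using that by simp
    ultimately show "(case p of (a, b) \<Rightarrow> set_lebesgue_integral lborel {a<..<b} ?q) = (case p of (a, b) \<Rightarrow> (f b - f a) * (g b - g a) / (b - a))"
      using gapsD(3)[OF g] by simp
  qed
  then have "gap_sum E f g = set_lebesgue_integral lborel \<Omega> ?q"
    unfolding gap_sum_def by (rule infsumI)
  also have "\<dots> = (\<integral>t. ?q t \<partial>lborel)"
    unfolding set_lebesgue_integral_def
    by (rule Bochner_Integration.integral_cong) (auto simp: indicator_def slope_outside)
  finally show ?thesis .
qed

text \<open>Strongly local part and jump part merge into half an inner product of derivatives on the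
  whole line; all estimates of the energy go through this formula.\<close>

lemma form_eq:
  assumes "H1 f" "H1 g"
  shows "form E f g = (\<integral>t. der f t * der g t \<partial>lborel) / 2"
proof -
  note sf = slope_square_le(1)[OF primitive_dominated[OF der_props(2)]]
  have s: "sqint (slope E f)" "sqint (slope E g)"
    by (intro sf assms sqint_abs der_props)+
  have i: "set_integrable lborel E (\<lambda>t. der f t * der g t)"
    by (rule integrable_set_integrable[OF sqint_mult_integrable]) (intro der_props assms E_borel | simp)+
  have "(\<integral>t. der f t * der g t \<partial>lborel) = (\<integral>t. indicator E t *\<^sub>R (der f t * der g t) + slope E f t * slope E g t \<partial>lborel)"
    by (rule Bochner_Integration.integral_cong) (auto simp: indicator_def der_gap slope_in)
  also have "\<dots> = set_lebesgue_integral lborel E (\<lambda>t. der f t * der g t) + (\<integral>t. slope E f t * slope E g t \<partial>lborel)"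
    using i sqint_mult_integrable[OF s] unfolding set_integrable_def set_lebesgue_integral_def
    by (rule Bochner_Integration.integral_add)
  also have "set_lebesgue_integral lborel E (\<lambda>t. der f t * der g t) = set_lebesgue_integral lborel E (\<lambda>t. H1_der E f t * H1_der E g t)"
    unfolding set_lebesgue_integral_def
    by (rule Bochner_Integration.integral_cong) (auto simp: indicator_def der_def)
  finally show ?thesis
    by (simp add: form_def gap_sum_eq[OF s])
qed

lemma form_self:
  assumes "H1 f"
  shows "form E f f = (\<integral>t. (der f t)\<^sup>2 \<partial>lborel) / 2"
  using form_eq[OF assms assms] by (simp add: power2_eq_square)

text \<open>A divergent integral or sum has the default value 0, so this holds for every
  function.\<close>

lemma form_nonneg: "0 \<le> form E f f"
proof -
  have "0 \<le> set_lebesgue_integral lborel E (\<lambda>x. H1_der E f x * H1_der E f x)"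
    unfolding set_lebesgue_integral_def by (rule integral_nonneg_AE) simp
  moreover have "0 \<le> gap_sum E f f"
    unfolding gap_sum_def by (rule infsum_nonneg) (auto dest: gapsD)
  ultimately show ?thesis by (simp add: form_def)
qed

lemma form_commute: "form E f g = form E g f"
  by (simp add: form_def gap_sum_def mult.commute)

lemma form_le2:
  assumes "H1 u" "H1 v" "H1 w"
    and le: "\<And>x y. x \<in> E \<Longrightarrow> y \<in> E \<Longrightarrow> x \<le> y \<Longrightarrow> \<bar>w y - w x\<bar> \<le> \<bar>u y - u x\<bar> + \<bar>v y - v x\<bar>"
  shows "form E w w \<le> 2 * form E u u + 2 * form E v v"
proof -
  have "AE t in lborel. \<bar>der w t\<bar> \<le> \<bar>der u t\<bar> + \<bar>der v t\<bar>"
    by (rule der_abs_le[OF assms(1-3)]) (rule le)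
  from sqint_bound(2)[OF der_props(1)[OF assms(1)] der_props(1)[OF assms(2)] sqintD(1)[OF der_props(1)[OF assms(3)]] this]
  show ?thesis using form_self[OF assms(1)] form_self[OF assms(2)] form_self[OF assms(3)] by simp
qed

text \<open>The Markov property in general form: normal contractions do not increase the
  energy.\<close>

lemma form_le1:
  assumes "H1 u" "H1 w"
    and le: "\<And>x y. x \<in> E \<Longrightarrow> y \<in> E \<Longrightarrow> x \<le> y \<Longrightarrow> \<bar>w y - w x\<bar> \<le> \<bar>u y - u x\<bar>"
  shows "form E w w \<le> form E u u"
proof -
  have "(\<integral>t. (der w t)\<^sup>2 \<partial>lborel) \<le> (\<integral>t. (der u t)\<^sup>2 \<partial>lborel)"
  proof (rule integral_mono_AE)
    have "AE t in lborel. \<bar>der w t\<bar> \<le> \<bar>der u t\<bar>"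
      by (rule der_abs_le1[OF assms(1,2)]) (rule le)
    then show "AE t in lborel. (der w t)\<^sup>2 \<le> (der u t)\<^sup>2"
      by (rule AE_mp) (intro AE_I2 impI, simp only: abs_le_square_iff)
  qed (intro sqintD(2) der_props assms)+
  then show ?thesis by (simp add: form_self assms)
qed

lemma form_scale:
  assumes "H1 f"
  shows "form E (\<lambda>x. c * f x) (\<lambda>x. c * f x) = c\<^sup>2 * form E f f"
proof -
  have "(\<integral>t. (der (\<lambda>x. c * f x) t)\<^sup>2 \<partial>lborel) = (\<integral>t. c\<^sup>2 * (der f t)\<^sup>2 \<partial>lborel)"
  proof (rule integral_cong_AE)
    show "AE t in lborel. (der (\<lambda>x. c * f x) t)\<^sup>2 = c\<^sup>2 * (der f t)\<^sup>2"
      using der_linear[OF assms assms, of c 0] by (rule AE_mp) (intro AE_I2 impI, simp add: power_mult_distrib)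
  qed (use sqintD(1)[OF der_props(1)[OF assms]] sqintD(1)[OF der_props(1)[OF H1_scale[OF assms]]] in simp_all)
  then show ?thesis by (simp add: form_self assms H1_scale)
qed

end

section \<open>Continuous functions with compact support and regularity\<close>

abbreviation unit_part :: "(real \<Rightarrow> real) \<Rightarrow> real \<Rightarrow> real" where
  "unit_part f \<equiv> (\<lambda>x. min 1 (max 0 (f x)))"

abbreviation clamp_to :: "real \<Rightarrow> real \<Rightarrow> real" where
  "clamp_to c t \<equiv> max (- c) (min c t)"

text \<open>The unit contraction is the only nonlinear operation that the axioms grant; the
  two-sided truncation is built from it by scaling and by treating positive and negative parts
  separately.\<close>

lemma clamp_to_unit: "0 < c \<Longrightarrow> clamp_to c t = c * min 1 (max 0 (inverse c * t)) - c * min 1 (max 0 (inverse c * - t))"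
  by (auto simp: min_def max_def field_simps)

locale radonK = classK +
  fixes \<mu> :: "real measure"
  assumes R: "full_radon_on E \<mu>"
begin

section \<open>The measure, and pointwise bounds by the energy\<close>

lemma sets_mu: "sets \<mu> = sets (restrict_space borel E)"
  using R by (simp add: full_radon_on_def)

lemma space_mu: "space \<mu> = E"
  using sets_eq_imp_space_eq[OF sets_mu] by (simp add: space_restrict_space)

lemma sets_mu_iff: "A \<in> sets \<mu> \<longleftrightarrow> A \<subseteq> E \<and> A \<in> sets borel"
  unfolding sets_mu by (subst sets_restrict_space_iff) auto

lemma compact_finite: "compact A \<Longrightarrow> A \<subseteq> E \<Longrightarrow> emeasure \<mu> A < \<infinity>"
  using R by (simp add: full_radon_on_def)

lemma compact_sets: "compact A \<Longrightarrow> A \<subseteq> E \<Longrightarrow> A \<in> sets \<mu>"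
  by (simp add: sets_mu_iff borel_compact)

lemma borel_mu: "f \<in> borel_measurable borel \<Longrightarrow> f \<in> borel_measurable \<mu>"
  unfolding measurable_cong_sets[OF sets_mu refl] by (rule measurable_restrict_space1)

lemma continuous_mu: "continuous_on E f \<Longrightarrow> f \<in> borel_measurable \<mu>"
  unfolding measurable_cong_sets[OF sets_mu refl] by (rule borel_measurable_continuous_on_restrict)

lemma integrable_bounded_compact:
  fixes f :: "real \<Rightarrow> real"
  assumes "f \<in> borel_measurable \<mu>" "compact A" "A \<subseteq> E" "\<And>x. x \<in> A \<Longrightarrow> \<bar>f x\<bar> \<le> B" "\<And>x. x \<in> E \<Longrightarrow> x \<notin> A \<Longrightarrow> f x = 0"
  shows "integrable \<mu> f" "(\<integral>x. f x \<partial>\<mu>) \<le> B * measure \<mu> A"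
proof -
  show i: "integrable \<mu> f"
  proof (rule integrableI_bounded_set[of A])
    show "AE x in \<mu>. x \<in> A \<longrightarrow> norm (f x) \<le> B" using assms(4) by (intro AE_I2) simp
    show "AE x in \<mu>. x \<notin> A \<longrightarrow> f x = 0" using assms(5) by (intro AE_I2) (simp add: space_mu)
  qed (use assms compact_finite compact_sets in auto)
  have iA: "integrable \<mu> (\<lambda>x. B * indicator A x)"
    using compact_finite[OF assms(2,3)] compact_sets[OF assms(2,3)] by (intro integrable_mult_right) simp
  have "(\<integral>x. f x \<partial>\<mu>) \<le> (\<integral>x. B * indicator A x \<partial>\<mu>)"
  proof (rule integral_mono[OF i iA])
    fix x assume "x \<in> space \<mu>"
    then show "f x \<le> B * indicator A x"
      using assms(4)[of x] assms(5)[of x] by (cases "x \<in> A") (auto simp: space_mu)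
  qed
  also have "\<dots> = B * measure \<mu> A"
    using compact_sets[OF assms(2,3)] assms(3) by (simp add: space_mu Int_absorb2)
  finally show "(\<integral>x. f x \<partial>\<mu>) \<le> B * measure \<mu> A" .
qed

lemma CcD:
  assumes "f \<in> Cc E"
  obtains A B where "compact A" "A \<subseteq> E" "\<And>x. x \<notin> A \<Longrightarrow> f x = 0" "0 \<le> B" "\<And>x. \<bar>f x\<bar> \<le> B"
proof -
  from assms obtain A where A: "continuous_on E f" "\<forall>x. x \<notin> E \<longrightarrow> f x = 0" "compact A" "A \<subseteq> E" "\<forall>x\<in>E - A. f x = 0"
    by (auto simp: Cc_def)
  have "bounded (f ` A)"
    by (intro compact_imp_bounded compact_continuous_image continuous_on_subset[OF A(1,4)] A(3))
  then obtain B where B: "\<forall>y\<in>f ` A. norm y \<le> B" by (auto simp: bounded_iff)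
  have z: "f x = 0" if "x \<notin> A" for x using A that by blast
  show thesis
  proof (rule that[of A "max 0 B"])
    show "\<bar>f x\<bar> \<le> max 0 B" for x using B z[of x] by (cases "x \<in> A") auto
  qed (use A z in auto)
qed

lemma Cc_measurable: "f \<in> Cc E \<Longrightarrow> f \<in> borel_measurable \<mu>"
  by (rule continuous_mu) (simp add: Cc_def)

lemma Cc_integrable:
  assumes "f \<in> Cc E"
  shows "integrable \<mu> f" "L2 \<mu> f"
proof -
  obtain A B where A: "compact A" "A \<subseteq> E" "\<And>x. x \<notin> A \<Longrightarrow> f x = 0" "0 \<le> B" "\<And>x. \<bar>f x\<bar> \<le> B"
    using CcD[OF assms] by metis
  show "integrable \<mu> f"
    by (rule integrable_bounded_compact(1)[OF Cc_measurable[OF assms] A(1,2) A(5)]) (use A in auto)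
  have "\<bar>(f x)\<^sup>2\<bar> \<le> B\<^sup>2" for x using power_mono[OF A(5)[of x] abs_ge_zero, of 2] by simp
  then have "integrable \<mu> (\<lambda>x. (f x)\<^sup>2)"
    by (intro integrable_bounded_compact(1)[OF _ A(1,2)]) (use A Cc_measurable[OF assms] in auto)
  then show "L2 \<mu> f" using Cc_measurable[OF assms] by (simp add: L2_def)
qed

lemma Cc_comp:
  assumes f: "f \<in> Cc E" and h: "continuous_on UNIV h" "h 0 = (0::real)"
  shows "(\<lambda>x. h (f x)) \<in> Cc E"
proof -
  from f obtain A where A: "continuous_on E f" "\<forall>x. x \<notin> E \<longrightarrow> f x = 0" "compact A" "A \<subseteq> E" "\<forall>x\<in>E - A. f x = 0"
    by (auto simp: Cc_def)
  have "continuous_on E (\<lambda>x. h (f x))"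
    by (rule continuous_on_compose2[OF h(1) A(1)]) simp
  then show ?thesis
    unfolding Cc_def using A h(2) by (auto intro!: exI[of _ A])
qed

lemma Cc_add:
  assumes "f \<in> Cc E" "g \<in> Cc E"
  shows "(\<lambda>x. f x + g x) \<in> Cc E"
proof -
  from assms obtain A B where "compact A" "A \<subseteq> E" "\<forall>x\<in>E - A. f x = 0" "compact B" "B \<subseteq> E" "\<forall>x\<in>E - B. g x = 0"
    unfolding Cc_def by blast
  then have "compact (A \<union> B) \<and> A \<union> B \<subseteq> E \<and> (\<forall>x\<in>E - (A \<union> B). f x + g x = 0)"
    by (simp add: compact_Un)
  then have "\<exists>K. compact K \<and> K \<subseteq> E \<and> (\<forall>x\<in>E - K. f x + g x = 0)" by (rule exI)
  moreover have "continuous_on E (\<lambda>x. f x + g x)"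
    using assms by (intro continuous_on_add) (auto simp: Cc_def)
  ultimately show ?thesis using assms by (simp add: Cc_def)
qed

lemma Cc_scale: "f \<in> Cc E \<Longrightarrow> (\<lambda>x. c * f x) \<in> Cc E"
  using Cc_comp[of f "\<lambda>t. c * t"] by (simp add: continuous_on_mult_left continuous_on_id)

lemma Cc_unit: "f \<in> Cc E \<Longrightarrow> unit_part f \<in> Cc E"
  using Cc_comp[of f "\<lambda>t. min 1 (max 0 t)"] by (simp add: continuous_on_min continuous_on_max continuous_on_id continuous_on_const)

lemma Cc_clamp: "0 \<le> c \<Longrightarrow> f \<in> Cc E \<Longrightarrow> (\<lambda>x. clamp_to c (f x)) \<in> Cc E"
  using Cc_comp[of f "\<lambda>t. clamp_to c t"] by (simp add: continuous_on_min continuous_on_max continuous_on_id continuous_on_const)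

text \<open>The radius stays below the distance to the finitely many points of the closure that are
  missing from \<open>E\<close>, so the neighbourhood is the same in \<open>E\<close> as in its
  closure.\<close>

lemma locally_compact_E:
  assumes "x \<in> E"
  obtains d where "d > 0" "compact (E \<inter> {x-d..x+d})"
proof -
  obtain d where d: "d > 0" "\<forall>z\<in>closure E - E. z \<noteq> x \<longrightarrow> d \<le> dist x z"
    using finite_set_avoid[OF finite_boundary, of x] by blast
  have "E \<inter> {x-d/2..x+d/2} = closure E \<inter> {x-d/2..x+d/2}"
  proof (rule antisym)
    show "closure E \<inter> {x-d/2..x+d/2} \<subseteq> E \<inter> {x-d/2..x+d/2}"
    proof
      fix z assume z: "z \<in> closure E \<inter> {x-d/2..x+d/2}"
      then have "\<bar>x - z\<bar> \<le> d/2" by (intro abs_leI) auto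
      then have "dist x z \<le> d/2" by (simp only: dist_real_def)
      then have "z \<notin> closure E - E" using d assms by force
      then show "z \<in> E \<inter> {x-d/2..x+d/2}" using z by blast
    qed
  qed (use closure_subset in auto)
  then have "compact (E \<inter> {x-d/2..x+d/2})" by (simp add: closed_Int_compact)
  then show thesis using that[of "d/2"] d by simp
qed

lemma H1_increment:
  assumes "H1 f" "x \<in> E" "y \<in> E"
  shows "(f y - f x)\<^sup>2 \<le> \<bar>y - x\<bar> * (2 * form E f f)"
proof -
  have *: "(f y - f x)\<^sup>2 \<le> (y - x) * (2 * form E f f)" if "x \<in> E" "y \<in> E" "x \<le> y" for x y
  proof -
    have "2 * form E f f = (\<integral>t. (der f t)\<^sup>2 \<partial>lborel)" using form_self[OF assms(1)] by simp
    then show ?thesis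
      using primitive_increment[OF der_props(2)[OF assms(1)] der_props(1)[OF assms(1)] that] by (simp only:)
  qed
  show ?thesis
  proof (cases "x \<le> y")
    case True
    then show ?thesis using *[OF assms(2,3)] by simp
  next
    case False
    then show ?thesis using *[OF assms(3,2)] by (simp add: power2_commute)
  qed
qed

lemma H1_continuous:
  assumes "H1 f"
  shows "continuous_on E f"
proof -
  have "((\<lambda>y. f y) \<longlongrightarrow> f x) (at x within E)" if x: "x \<in> E" for x
  proof -
    have "((\<lambda>y. \<bar>f y - f x\<bar>) \<longlongrightarrow> 0) (at x within E)"
    proof (rule tendsto_sandwich[of "\<lambda>_. 0" _ _ "\<lambda>y. sqrt (\<bar>y - x\<bar> * (2 * form E f f))"])
      show "((\<lambda>y. sqrt (\<bar>y - x\<bar> * (2 * form E f f))) \<longlongrightarrow> 0) (at x within E)"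
        by (rule tendsto_eq_rhs, (rule tendsto_intros)+) simp
      show "\<forall>\<^sub>F y in at x within E. \<bar>f y - f x\<bar> \<le> sqrt (\<bar>y - x\<bar> * (2 * form E f f))"
        unfolding eventually_at_filter
        by (rule always_eventually) (auto intro!: real_le_rsqrt H1_increment[OF assms x])
    qed auto
    then show ?thesis using tendsto_rabs_zero_iff LIM_zero_iff by blast
  qed
  then show ?thesis by (simp add: continuous_on_def)
qed

lemma E1_nonneg: "0 \<le> E1 E \<mu> f"
  unfolding E1_def by (intro add_nonneg_nonneg form_nonneg integral_nonneg_AE) simp

lemma form_le_E1: "form E f f \<le> E1 E \<mu> f"
proof -
  have "0 \<le> (\<integral>x. (f x)\<^sup>2 \<partial>\<mu>)" by (rule integral_nonneg_AE) simp
  then show ?thesis by (simp add: E1_def)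
qed

lemma L2_le_E1: "(\<integral>x. (f x)\<^sup>2 \<partial>\<mu>) \<le> E1 E \<mu> f"
  using form_nonneg[of f] by (simp add: E1_def)

text \<open>Average \<open>(f x)\<^sup>2 \<le> 2 * (f y)\<^sup>2 + 2 * (f y - f x)\<^sup>2\<close>
  over a compact neighbourhood of \<open>x\<close>, which has positive measure by full support; the
  increment is at most \<open>2 * d\<close> times the energy by Cauchy-Schwarz, whence the two terms
  of the constant. Convergence in \<open>E1\<close> therefore implies pointwise convergence on
  \<open>E\<close>.\<close>

lemma point_bound:
  assumes x: "x \<in> E"
  obtains C where "0 \<le> C" "\<And>f. H1 f \<Longrightarrow> L2 \<mu> f \<Longrightarrow> (f x)\<^sup>2 \<le> C * E1 E \<mu> f"
proof -
  obtain d where d: "d > 0" "compact (E \<inter> {x-d..x+d})" using locally_compact_E[OF x] by metis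
  let ?N = "E \<inter> {x-d..x+d}"
  note fin = compact_finite[OF d(2) Int_lower1] and N = compact_sets[OF d(2) Int_lower1]
  have "x \<in> {x-d<..<x+d} \<inter> E" using x d by simp
  then have "emeasure \<mu> ({x-d<..<x+d} \<inter> E) > 0"
    using R unfolding full_radon_on_def by (metis empty_iff open_greaterThanLessThan)
  also have "emeasure \<mu> ({x-d<..<x+d} \<inter> E) \<le> emeasure \<mu> ?N"
    by (rule emeasure_mono[OF _ N]) auto
  finally have pos: "0 < measure \<mu> ?N"
    using fin by (simp add: measure_def enn2real_positive_iff less_top)
  show thesis
  proof (rule that[of "2 / measure \<mu> ?N + 4 * d"])
    show "0 \<le> 2 / measure \<mu> ?N + 4 * d" using pos d by simp
    fix f assume f: "H1 f" "L2 \<mu> f"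
    let ?F = "form E f f"
    have fi: "integrable \<mu> (\<lambda>y. (f y)\<^sup>2)" using f(2) by (simp add: L2_def)
    have i1: "integrable \<mu> (\<lambda>y. (f x)\<^sup>2 * indicator ?N y)" and i2: "integrable \<mu> (\<lambda>y. (4 * d * ?F) * indicator ?N y)"
      using fin N by (intro integrable_mult_right; simp)+
    have "(f x)\<^sup>2 * measure \<mu> ?N = (\<integral>y. (f x)\<^sup>2 * indicator ?N y \<partial>\<mu>)"
      using N by (simp add: space_mu Int_assoc[symmetric] Int_absorb2)
    also have "\<dots> \<le> (\<integral>y. 2 * (f y)\<^sup>2 + (4 * d * ?F) * indicator ?N y \<partial>\<mu>)"
    proof (rule integral_mono[OF i1 Bochner_Integration.integrable_add[OF integrable_mult_right[OF fi] i2]])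
      fix y assume "y \<in> space \<mu>"
      then have y: "y \<in> E" by (simp add: space_mu)
      show "(f x)\<^sup>2 * indicator ?N y \<le> 2 * (f y)\<^sup>2 + (4 * d * ?F) * indicator ?N y"
      proof (cases "y \<in> ?N")
        case True
        have "(f x)\<^sup>2 \<le> 2 * (f y)\<^sup>2 + 2 * (f y - f x)\<^sup>2"
          using zero_le_power2[of "2 * f y - f x"] by (simp add: power2_eq_square algebra_simps)
        moreover have "(f y - f x)\<^sup>2 \<le> \<bar>y - x\<bar> * (2 * ?F)" by (rule H1_increment[OF f(1) x y])
        moreover have "\<bar>y - x\<bar> * (2 * ?F) \<le> d * (2 * ?F)"
          using True form_nonneg[of f] by (intro mult_right_mono) auto
        ultimately have "(f x)\<^sup>2 \<le> 2 * (f y)\<^sup>2 + 4 * d * ?F" by linarith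
        then show ?thesis using True by simp
      qed simp
    qed
    also have "\<dots> = 2 * (\<integral>y. (f y)\<^sup>2 \<partial>\<mu>) + (4 * d * ?F) * measure \<mu> ?N"
      using Bochner_Integration.integral_add[OF integrable_mult_right[OF fi, of 2] i2] N
      by (simp add: space_mu Int_assoc[symmetric] Int_absorb2)
    finally have "(f x)\<^sup>2 * measure \<mu> ?N \<le> 2 * (\<integral>y. (f y)\<^sup>2 \<partial>\<mu>) + (4 * d * ?F) * measure \<mu> ?N" .
    then have "(f x)\<^sup>2 \<le> (2 * (\<integral>y. (f y)\<^sup>2 \<partial>\<mu>) + (4 * d * ?F) * measure \<mu> ?N) / measure \<mu> ?N"
      using pos by (simp add: pos_le_divide_eq)
    also have "\<dots> = 2 / measure \<mu> ?N * (\<integral>y. (f y)\<^sup>2 \<partial>\<mu>) + 4 * d * ?F"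
      using pos by (simp add: add_divide_distrib)
    also have "\<dots> \<le> 2 / measure \<mu> ?N * E1 E \<mu> f + 4 * d * E1 E \<mu> f"
      using pos d L2_le_E1[of f] form_le_E1[of f] by (intro add_mono mult_left_mono) auto
    also have "\<dots> = (2 / measure \<mu> ?N + 4 * d) * E1 E \<mu> f"
      by (simp add: distrib_right)
    finally show "(f x)\<^sup>2 \<le> (2 / measure \<mu> ?N + 4 * d) * E1 E \<mu> f" .
  qed
qed

lemma E1_le2:
  assumes H: "H1 u" "H1 v" "H1 w" and L: "L2 \<mu> u" "L2 \<mu> v" "L2 \<mu> w"
    and le: "\<And>x y. x \<in> E \<Longrightarrow> y \<in> E \<Longrightarrow> x \<le> y \<Longrightarrow> \<bar>w y - w x\<bar> \<le> \<bar>u y - u x\<bar> + \<bar>v y - v x\<bar>"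
    and le': "\<And>x. x \<in> E \<Longrightarrow> \<bar>w x\<bar> \<le> \<bar>u x\<bar> + \<bar>v x\<bar>"
  shows "E1 E \<mu> w \<le> 2 * E1 E \<mu> u + 2 * E1 E \<mu> v"
proof -
  have "form E w w \<le> 2 * form E u u + 2 * form E v v"
    by (rule form_le2[OF H]) (rule le)
  moreover have "(\<integral>x. (w x)\<^sup>2 \<partial>\<mu>) \<le> (\<integral>x. 2 * (u x)\<^sup>2 + 2 * (v x)\<^sup>2 \<partial>\<mu>)"
  proof (rule integral_mono)
    fix x assume "x \<in> space \<mu>"
    then have "(w x)\<^sup>2 \<le> (\<bar>u x\<bar> + \<bar>v x\<bar>)\<^sup>2"
      using power_mono[OF le'[of x] abs_ge_zero, of 2] by (simp add: space_mu)
    also have "\<dots> \<le> 2 * (u x)\<^sup>2 + 2 * (v x)\<^sup>2"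
      using sum_squares_bound[of "\<bar>u x\<bar>" "\<bar>v x\<bar>"] by (simp add: power2_sum)
    finally show "(w x)\<^sup>2 \<le> 2 * (u x)\<^sup>2 + 2 * (v x)\<^sup>2" .
  qed (use L in \<open>auto simp: L2_def\<close>)
  moreover have "(\<integral>x. 2 * (u x)\<^sup>2 + 2 * (v x)\<^sup>2 \<partial>\<mu>) = 2 * (\<integral>x. (u x)\<^sup>2 \<partial>\<mu>) + 2 * (\<integral>x. (v x)\<^sup>2 \<partial>\<mu>)"
    using L by (subst Bochner_Integration.integral_add) (auto simp: L2_def)
  ultimately show ?thesis by (simp add: E1_def)
qed

lemma E1_scale:
  assumes "H1 f"
  shows "E1 E \<mu> (\<lambda>x. c * f x) = c\<^sup>2 * E1 E \<mu> f"
  by (simp add: E1_def form_scale[OF assms] power_mult_distrib distrib_left)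

lemma L2_dominated:
  assumes "w \<in> borel_measurable \<mu>" "L2 \<mu> u" "L2 \<mu> v" "\<And>x. x \<in> E \<Longrightarrow> \<bar>w x\<bar> \<le> \<bar>u x\<bar> + \<bar>v x\<bar>"
  shows "L2 \<mu> w"
proof -
  have "integrable \<mu> (\<lambda>x. (w x)\<^sup>2)"
  proof (rule Bochner_Integration.integrable_bound)
    show "integrable \<mu> (\<lambda>x. 2 * (u x)\<^sup>2 + 2 * (v x)\<^sup>2)"
      using assms(2,3) by (auto simp: L2_def)
    show "(\<lambda>x. (w x)\<^sup>2) \<in> borel_measurable \<mu>" using assms(1) by simp
    show "AE x in \<mu>. norm ((w x)\<^sup>2) \<le> norm (2 * (u x)\<^sup>2 + 2 * (v x)\<^sup>2)"
    proof (rule AE_I2)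
      fix x assume "x \<in> space \<mu>"
      then have "(w x)\<^sup>2 \<le> (\<bar>u x\<bar> + \<bar>v x\<bar>)\<^sup>2"
        using power_mono[OF assms(4)[of x] abs_ge_zero, of 2] by (simp add: space_mu)
      also have "\<dots> \<le> 2 * (u x)\<^sup>2 + 2 * (v x)\<^sup>2"
        using sum_squares_bound[of "\<bar>u x\<bar>" "\<bar>v x\<bar>"] by (simp add: power2_sum)
      finally show "norm ((w x)\<^sup>2) \<le> norm (2 * (u x)\<^sup>2 + 2 * (v x)\<^sup>2)" by simp
    qed
  qed
  then show ?thesis using assms(1) by (simp add: L2_def)
qed

end

lemma clamp_to_abs: "0 \<le> c \<Longrightarrow> \<bar>clamp_to c t\<bar> \<le> c"
  by (simp add: min_def max_def abs_if)

lemma clamp_to_rest: "0 \<le> c \<Longrightarrow> \<bar>t - clamp_to c t\<bar> \<le> \<bar>t\<bar>"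
  by (simp add: min_def max_def abs_if)

lemma clamp_to_contract: "\<bar>clamp_to c s - clamp_to c t\<bar> \<le> \<bar>s - t\<bar>"
  by (simp add: min_def max_def abs_if)

lemma clamp_to_id: "\<bar>t\<bar> \<le> c \<Longrightarrow> clamp_to c t = t"
  by (simp add: min_def max_def abs_le_iff)

context radonK
begin

section \<open>Density of compactly supported continuous functions\<close>

text \<open>For large \<open>M\<close> the neighbourhood of radius \<open>1 / M\<close> of
  \<open>A\<close> avoids the finitely many points missing from \<open>E\<close>, so that it is
  compact within \<open>E\<close> and contains the supports of all later cutoffs.\<close>

lemma infdist_cutoff:
  assumes A: "compact A" "A \<subseteq> E" "A \<noteq> {}"
  obtains M :: nat where "\<And>m. M \<le> m \<Longrightarrow> (\<lambda>x. if x \<in> E then max 0 (1 - real m * infdist x A) else 0) \<in> Cc E"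
    "0 < M" "compact {x\<in>E. infdist x A \<le> 1 / real M}"
proof -
  let ?Z = "closure E - E"
  have "\<forall>z\<in>?Z. \<forall>\<^sub>F m in sequentially. 1 / real m < infdist z A"
  proof
    fix z assume z: "z \<in> ?Z"
    have "infdist z A \<noteq> 0"
      using z A in_closed_iff_infdist_zero[OF compact_imp_closed[OF A(1)] A(3), of z] by auto
    then have "0 < infdist z A" using infdist_nonneg[of z A] by simp
    then show "\<forall>\<^sub>F m in sequentially. 1 / real m < infdist z A"
      using lim_1_over_n[where 'a = real] by (intro order_tendstoD(2)) 
  qed
  then have "\<forall>\<^sub>F m in sequentially. \<forall>z\<in>?Z. 1 / real m < infdist z A"
    by (rule eventually_ball_finite[OF finite_boundary])
  then obtain M0 where M0: "\<And>m. M0 \<le> m \<Longrightarrow> \<forall>z\<in>?Z. 1 / real m < infdist z A"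
    by (auto simp: eventually_sequentially)
  define M where "M = max 1 M0"
  have M: "M0 \<le> M" "0 < M" by (auto simp: M_def)
  let ?N = "{x\<in>E. infdist x A \<le> 1 / M}"
  have "?N = {x\<in>closure E. infdist x A \<le> 1 / M}"
    using M0[OF M(1)] closure_subset by force
  moreover have "closed {x\<in>closure E. infdist x A \<le> 1 / M}"
  proof -
    have "{x\<in>closure E. infdist x A \<le> 1 / M} = closure E \<inter> {x. infdist x A \<le> 1 / M}" by blast
    then show ?thesis by (auto intro!: closed_Collect_le continuous_intros)
  qed
  moreover have "bounded ?N"
  proof -
    obtain a e where ae: "\<And>y. y \<in> A \<Longrightarrow> dist a y \<le> e" using compact_imp_bounded[OF A(1)] by (auto simp: bounded_def)
    have "dist a x \<le> e + (1 / M + 1)" if "infdist x A \<le> 1 / M" for x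
    proof -
      obtain y where y: "y \<in> A" "infdist x A = dist x y"
        using infdist_attains_inf[OF compact_imp_closed[OF A(1)] A(3)] by metis
      then show ?thesis using ae[OF y(1)] dist_triangle2[of a x y] that by simp
    qed
    then show ?thesis unfolding bounded_def by blast
  qed
  ultimately have N: "compact ?N" by (simp add: compact_eq_bounded_closed)
  show thesis
  proof (rule that[OF _ M(2) N])
    fix m assume m: "M \<le> m"
    let ?f = "\<lambda>x. if x \<in> E then max 0 (1 - real m * infdist x A) else 0"
    have "continuous_on E (\<lambda>x. max 0 (1 - real m * infdist x A))"
      by (intro continuous_intros)
    then have "continuous_on E ?f" by (rule continuous_on_eq) simp
    moreover have "?f x = 0" if "x \<in> E - ?N" for x
    proof -
      have "\<not> infdist x A \<le> 1 / real M" using that by blast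
      then have "1 / real M < infdist x A" by linarith
      then have "1 < real M * infdist x A" using M(2) by (simp add: field_simps)
      also have "\<dots> \<le> real m * infdist x A" using m infdist_nonneg by (intro mult_right_mono) auto
      finally show ?thesis by simp
    qed
    ultimately show "?f \<in> Cc E"
      unfolding Cc_def using N by (auto intro!: exI[of _ ?N])
  qed
qed

text \<open>Inner regularity is applied to a finite Borel measure on the line, namely the
  restriction of \<open>\<mu>\<close> to \<open>A\<close> transported by the identity map.\<close>

lemma inner_compact:
  assumes A: "A \<in> sets \<mu>" "emeasure \<mu> A < \<infinity>" and "0 < e"
  obtains C where "compact C" "C \<subseteq> A" "measure \<mu> A - measure \<mu> C < e"
proof -
  define \<nu> where "\<nu> = distr (density \<mu> (indicator A)) borel (\<lambda>x. x)"
  have id: "(\<lambda>x. x) \<in> measurable (density \<mu> (indicator A)) borel"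
    using borel_mu[of "\<lambda>x. x"] by simp
  have AE: "A \<subseteq> E" using A(1) by (simp add: sets_mu_iff)
  have nu: "emeasure \<nu> B = emeasure \<mu> (A \<inter> B)" if "B \<in> sets borel" for B
  proof -
    have B: "B \<inter> E \<in> sets \<mu>" using that by (simp add: sets_mu_iff)
    have "emeasure \<nu> B = emeasure (density \<mu> (indicator A)) (B \<inter> E)"
      unfolding \<nu>_def using that by (subst emeasure_distr[OF id]) (auto simp: space_mu)
    also have "\<dots> = (\<integral>\<^sup>+x. indicator A x * indicator (B \<inter> E) x \<partial>\<mu>)"
      using A(1) B by (subst emeasure_density) auto
    also have "\<dots> = (\<integral>\<^sup>+x. indicator (A \<inter> B) x \<partial>\<mu>)"
      using AE by (intro nn_integral_cong) (auto simp: indicator_def)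
    also have "\<dots> = emeasure \<mu> (A \<inter> B)"
      using A(1) that by (intro nn_integral_indicator) (auto simp: sets_mu_iff)
    finally show ?thesis .
  qed
  have Ab: "A \<in> sets borel" using A(1) by (simp add: sets_mu_iff)
  have "emeasure \<nu> A = (SUP C\<in>{C. C \<subseteq> A \<and> compact C}. emeasure \<nu> C)"
  proof (rule inner_regular)
    show "sets \<nu> = sets borel" by (simp add: \<nu>_def)
    show "emeasure \<nu> (space \<nu>) \<noteq> \<infinity>" using nu[of UNIV] A(2) by (simp add: \<nu>_def)
  qed (rule Ab)
  then have eq: "emeasure \<mu> A = (SUP C\<in>{C. C \<subseteq> A \<and> compact C}. emeasure \<nu> C)"
    using nu[OF Ab] by simp
  show thesis
  proof (cases "measure \<mu> A = 0")
    case True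
    then show thesis using that[of "{}"] \<open>0 < e\<close> by simp
  next
    case False
    then have "0 < measure \<mu> A" using measure_nonneg[of \<mu> A] by linarith
    then have "ennreal (measure \<mu> A - e) < ennreal (measure \<mu> A)"
      using \<open>0 < e\<close> by (intro ennreal_lessI) simp_all
    also have "\<dots> = emeasure \<mu> A" using A(2) by (intro emeasure_eq_ennreal_measure[symmetric]) simp
    finally have "ennreal (measure \<mu> A - e) < emeasure \<mu> A" .
    then obtain C where C: "C \<subseteq> A" "compact C" "ennreal (measure \<mu> A - e) < emeasure \<nu> C"
      unfolding eq less_SUP_iff by blast
    have "emeasure \<nu> C = emeasure \<mu> C" using nu[of C] C by (simp add: borel_compact Int_absorb1)
    also have "\<dots> = ennreal (measure \<mu> C)"
      using compact_finite[OF C(2) order_trans[OF C(1) AE]] by (intro emeasure_eq_ennreal_measure) simp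
    finally have "measure \<mu> A - e < measure \<mu> C"
      using C(3) by (metis ennreal_leI not_le)
    then show thesis using that[of C] C by simp
  qed
qed

text \<open>A compact \<open>C\<close> inside \<open>A\<close> carries almost all the mass, and
  distance cutoffs shrink to the indicator of \<open>C\<close>. They live on one compact
  neighbourhood, whose indicator dominates.\<close>

lemma Cc_dense_indicator:
  assumes A: "A \<in> sets \<mu>" "emeasure \<mu> A < \<infinity>" and e: "0 < e"
  shows "\<exists>g\<in>Cc E. (\<integral>x. \<bar>indicat_real A x - g x\<bar> \<partial>\<mu>) < e"
proof -
  obtain C where C: "compact C" "C \<subseteq> A" "measure \<mu> A - measure \<mu> C < e / 2"
    using inner_compact[OF A, of "e/2"] e by auto
  have CE: "C \<subseteq> E" using C A by (auto simp: sets_mu_iff)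
  note Cs = compact_sets[OF C(1) CE] and Cf = compact_finite[OF C(1) CE]
  have iA: "integrable \<mu> (indicator A :: real \<Rightarrow> real)" and iC: "integrable \<mu> (indicator C :: real \<Rightarrow> real)"
    using A Cs Cf by simp_all
  have "(\<integral>x. \<bar>indicat_real A x - indicat_real C x\<bar> \<partial>\<mu>) = (\<integral>x. indicat_real A x - indicat_real C x \<partial>\<mu>)"
    using C(2) by (intro Bochner_Integration.integral_cong) (auto simp: indicator_def)
  also have "\<dots> = measure \<mu> A - measure \<mu> C"
    using Bochner_Integration.integral_diff[OF iA iC] A Cs by (simp add: sets.Int_space_eq2)
  finally have AC: "(\<integral>x. \<bar>indicat_real A x - indicat_real C x\<bar> \<partial>\<mu>) < e / 2" using C(3) by simp
  have "\<exists>g\<in>Cc E. (\<integral>x. \<bar>indicat_real C x - g x\<bar> \<partial>\<mu>) < e / 2"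
  proof (cases "C = {}")
    case True
    have "(\<lambda>_. 0) \<in> Cc E" by (auto simp: Cc_def intro!: exI[of _ "{}"])
    then show ?thesis using True e by (intro bexI[of _ "\<lambda>_. 0"]) simp_all
  next
    case False
    let ?g = "\<lambda>m x. if x \<in> E then max 0 (1 - real m * infdist x C) else 0"
    obtain M :: nat where M: "\<And>m. M \<le> m \<Longrightarrow> ?g m \<in> Cc E" "0 < M" "compact {x\<in>E. infdist x C \<le> 1 / real M}"
      by (rule infdist_cutoff[OF C(1) CE False]) (rule that)
    let ?N = "{x\<in>E. infdist x C \<le> 1 / real M}"
    have NE: "?N \<subseteq> E" by blast
    have "(\<lambda>m. \<integral>x. \<bar>indicat_real C x - ?g (m + M) x\<bar> \<partial>\<mu>) \<longlonglongrightarrow> (\<integral>x. 0 \<partial>\<mu>)"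
    proof (rule integral_dominated_convergence[where w = "indicator ?N"])
      show "integrable \<mu> (indicator ?N :: real \<Rightarrow> real)"
        using compact_sets[OF M(3) NE] compact_finite[OF M(3) NE] by simp
      show "(\<lambda>x. \<bar>indicat_real C x - ?g (m + M) x\<bar>) \<in> borel_measurable \<mu>" for m
        using Cc_measurable[OF M(1)[of "m + M"]] Cs by (intro borel_measurable_abs borel_measurable_diff) auto
      show "AE x in \<mu>. norm \<bar>indicat_real C x - ?g (m + M) x\<bar> \<le> indicator ?N x" for m
      proof (rule AE_I2)
        fix x assume "x \<in> space \<mu>"
        then have x: "x \<in> E" by (simp add: space_mu)
        have d: "0 \<le> infdist x C" by (rule infdist_nonneg)
        show "norm \<bar>indicat_real C x - ?g (m + M) x\<bar> \<le> indicator ?N x"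
        proof (cases "x \<in> ?N")
          case True
          have "0 \<le> ?g (m + M) x" "?g (m + M) x \<le> 1" using x d by auto
          then show ?thesis using True by (auto simp: indicator_def abs_le_iff)
        next
          case False
          then have "\<not> infdist x C \<le> 1 / real M" using x by blast
          then have "1 / real M < infdist x C" by linarith
          then have "1 < real M * infdist x C" using M(2) by (simp add: field_simps)
          also have "\<dots> \<le> real (m + M) * infdist x C" using d by (intro mult_right_mono) auto
          finally have "?g (m + M) x = 0" using x by simp
          moreover have "x \<notin> C" using False x M(2) infdist_zero[of x C] by force
          ultimately show ?thesis using False by simp
        qed
      qed
      show "AE x in \<mu>. (\<lambda>m. \<bar>indicat_real C x - ?g (m + M) x\<bar>) \<longlonglongrightarrow> 0"
      proof (rule AE_I2)
        fix x assume "x \<in> space \<mu>"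
        then have x: "x \<in> E" by (simp add: space_mu)
        show "(\<lambda>m. \<bar>indicat_real C x - ?g (m + M) x\<bar>) \<longlonglongrightarrow> 0"
        proof (cases "x \<in> C")
          case True
          then have "\<bar>indicat_real C x - ?g (m + M) x\<bar> = 0" for m using x by simp
          then show ?thesis by simp
        next
          case nC: False
          have "infdist x C \<noteq> 0"
            using in_closed_iff_infdist_zero[OF compact_imp_closed[OF C(1)] False, of x] nC by simp
          then have d: "0 < infdist x C" using infdist_nonneg[of x C] by simp
          obtain n :: nat where n: "1 / infdist x C < n" using reals_Archimedean2 by blast
          have "\<bar>indicat_real C x - ?g (m + M) x\<bar> = 0" if "n \<le> m" for m
          proof -
            have "1 < real n * infdist x C" using n d by (simp add: field_simps)
            also have "\<dots> \<le> real (m + M) * infdist x C" using d that by (intro mult_right_mono) auto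
            finally show ?thesis using x nC by simp
          qed
          then have "\<forall>\<^sub>F m in sequentially. \<bar>indicat_real C x - ?g (m + M) x\<bar> = 0"
            by (rule eventually_sequentiallyI)
          then show ?thesis by (rule tendsto_eventually)
        qed
      qed
    qed simp
    then have "(\<lambda>m. \<integral>x. \<bar>indicat_real C x - ?g (m + M) x\<bar> \<partial>\<mu>) \<longlonglongrightarrow> 0" by simp
    then have "\<forall>\<^sub>F m in sequentially. (\<integral>x. \<bar>indicat_real C x - ?g (m + M) x\<bar> \<partial>\<mu>) < e / 2"
      by (rule order_tendstoD(2)) (use e in simp)
    then obtain m where "(\<integral>x. \<bar>indicat_real C x - ?g (m + M) x\<bar> \<partial>\<mu>) < e / 2"
      by (auto simp: eventually_sequentially)
    then show ?thesis using M(1)[of "m + M"] by (intro bexI[of _ "?g (m + M)"]) simp_all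
  qed
  then obtain g where g: "g \<in> Cc E" "(\<integral>x. \<bar>indicat_real C x - g x\<bar> \<partial>\<mu>) < e / 2" by blast
  have ig: "integrable \<mu> g" by (rule Cc_integrable(1)[OF g(1)])
  have "(\<integral>x. \<bar>indicat_real A x - g x\<bar> \<partial>\<mu>) \<le> (\<integral>x. \<bar>indicat_real A x - indicat_real C x\<bar> + \<bar>indicat_real C x - g x\<bar> \<partial>\<mu>)"
    using iA iC ig by (intro integral_mono) auto
  also have "\<dots> = (\<integral>x. \<bar>indicat_real A x - indicat_real C x\<bar> \<partial>\<mu>) + (\<integral>x. \<bar>indicat_real C x - g x\<bar> \<partial>\<mu>)"
    using iA iC ig by (intro Bochner_Integration.integral_add) auto
  finally show ?thesis using g AC by (intro bexI[OF _ g(1)]) linarith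
qed

lemma Cc_dense_L1:
  assumes "integrable \<mu> (w :: real \<Rightarrow> real)"
  shows "\<forall>e>0. \<exists>g\<in>Cc E. (\<integral>x. \<bar>w x - g x\<bar> \<partial>\<mu>) < e"
  using assms
proof (induction rule: integrable_induct)
  case (base A c)
  show ?case
  proof (intro allI impI)
    fix e :: real assume e: "0 < e"
    obtain g where g: "g \<in> Cc E" "(\<integral>x. \<bar>indicator A x - g x\<bar> \<partial>\<mu>) < e / (\<bar>c\<bar> + 1)"
      using Cc_dense_indicator[OF base, of "e / (\<bar>c\<bar> + 1)"] e by auto
    have "(\<integral>x. \<bar>indicator A x *\<^sub>R c - c * g x\<bar> \<partial>\<mu>) = (\<integral>x. \<bar>c\<bar> * \<bar>indicator A x - g x\<bar> \<partial>\<mu>)"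
      by (intro Bochner_Integration.integral_cong refl) (simp add: abs_mult[symmetric] right_diff_distrib mult.commute)
    also have "\<dots> = \<bar>c\<bar> * (\<integral>x. \<bar>indicator A x - g x\<bar> \<partial>\<mu>)" by simp
    also have "\<dots> \<le> \<bar>c\<bar> * (e / (\<bar>c\<bar> + 1))" using g(2) by (intro mult_left_mono) auto
    also have "\<dots> < e" using e by (simp add: field_simps)
    finally show "\<exists>g\<in>Cc E. (\<integral>x. \<bar>indicator A x *\<^sub>R c - g x\<bar> \<partial>\<mu>) < e"
      using Cc_scale[OF g(1), of c] by (intro bexI[of _ "\<lambda>x. c * g x"])
  qed
next
  case (add f1 f2)
  show ?case
  proof (intro allI impI)
    fix e :: real assume e: "0 < e"
    obtain g1 where g1: "g1 \<in> Cc E" "(\<integral>x. \<bar>f1 x - g1 x\<bar> \<partial>\<mu>) < e / 2" using add(3) e half_gt_zero by blast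
    obtain g2 where g2: "g2 \<in> Cc E" "(\<integral>x. \<bar>f2 x - g2 x\<bar> \<partial>\<mu>) < e / 2" using add(4) e half_gt_zero by blast
    note i = add(1,2) Cc_integrable(1)[OF g1(1)] Cc_integrable(1)[OF g2(1)]
    have "(\<integral>x. \<bar>f1 x + f2 x - (g1 x + g2 x)\<bar> \<partial>\<mu>) \<le> (\<integral>x. \<bar>f1 x - g1 x\<bar> + \<bar>f2 x - g2 x\<bar> \<partial>\<mu>)"
      using i by (intro integral_mono) auto
    also have "\<dots> = (\<integral>x. \<bar>f1 x - g1 x\<bar> \<partial>\<mu>) + (\<integral>x. \<bar>f2 x - g2 x\<bar> \<partial>\<mu>)"
      using i by (intro Bochner_Integration.integral_add) auto
    finally show "\<exists>g\<in>Cc E. (\<integral>x. \<bar>f1 x + f2 x - g x\<bar> \<partial>\<mu>) < e"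
      using g1 g2 by (intro bexI[OF _ Cc_add[OF g1(1) g2(1)]]) linarith
  qed
next
  case (lim f s)
  show ?case
  proof (intro allI impI)
    fix e :: real assume e: "0 < e"
    have "(\<lambda>i. \<integral>x. \<bar>f x - s i x\<bar> \<partial>\<mu>) \<longlonglongrightarrow> (\<integral>x. 0 \<partial>\<mu>)"
    \<comment> \<open>In this case of the induction the approximants satisfy
      \<open>\<bar>s i x\<bar> \<le> 2 * \<bar>f x\<bar>\<close>, hence the factor 3.\<close>
    proof (rule integral_dominated_convergence[where w = "\<lambda>x. 3 * \<bar>f x\<bar>"])
      show "AE x in \<mu>. (\<lambda>i. \<bar>f x - s i x\<bar>) \<longlonglongrightarrow> 0"
      proof (rule AE_I2)
        fix x assume "x \<in> space \<mu>"
        then have "(\<lambda>i. f x - s i x) \<longlonglongrightarrow> f x - f x" by (intro tendsto_diff tendsto_const lim)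
        then show "(\<lambda>i. \<bar>f x - s i x\<bar>) \<longlonglongrightarrow> 0" using tendsto_rabs_zero by simp
      qed
      show "AE x in \<mu>. norm \<bar>f x - s i x\<bar> \<le> 3 * \<bar>f x\<bar>" for i
      proof (rule AE_I2)
        fix x assume "x \<in> space \<mu>"
        then have "\<bar>s i x\<bar> \<le> 2 * \<bar>f x\<bar>" using lim(3)[of x i] by simp
        then show "norm \<bar>f x - s i x\<bar> \<le> 3 * \<bar>f x\<bar>" by simp
      qed
    qed (use lim(1,4) in \<open>auto intro!: integrable_mult_right integrable_abs borel_measurable_abs borel_measurable_diff\<close>)
    then have "(\<lambda>i. \<integral>x. \<bar>f x - s i x\<bar> \<partial>\<mu>) \<longlonglongrightarrow> 0" by simp
    then have "\<forall>\<^sub>F i in sequentially. (\<integral>x. \<bar>f x - s i x\<bar> \<partial>\<mu>) < e / 2"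
      by (rule order_tendstoD(2)) (use e in simp)
    then obtain i where i: "(\<integral>x. \<bar>f x - s i x\<bar> \<partial>\<mu>) < e / 2" by (auto simp: eventually_sequentially)
    obtain g where g: "g \<in> Cc E" "(\<integral>x. \<bar>s i x - g x\<bar> \<partial>\<mu>) < e / 2" using lim(5) e half_gt_zero by blast
    note ii = lim(1,4) Cc_integrable(1)[OF g(1)]
    have "(\<integral>x. \<bar>f x - g x\<bar> \<partial>\<mu>) \<le> (\<integral>x. \<bar>f x - s i x\<bar> + \<bar>s i x - g x\<bar> \<partial>\<mu>)"
      using ii by (intro integral_mono) auto
    also have "\<dots> = (\<integral>x. \<bar>f x - s i x\<bar> \<partial>\<mu>) + (\<integral>x. \<bar>s i x - g x\<bar> \<partial>\<mu>)"
      using ii by (intro Bochner_Integration.integral_add) auto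
    finally show "\<exists>g\<in>Cc E. (\<integral>x. \<bar>f x - g x\<bar> \<partial>\<mu>) < e"
      using g i by (intro bexI[OF _ g(1)]) linarith
  qed
qed

text \<open>The sets are bounded parts of the closure that keep a distance
  \<open>1 / real (Suc n)\<close> from the points missing from \<open>E\<close>.\<close>

lemma compact_exhaustion:
  obtains A :: "nat \<Rightarrow> real set" where "\<And>n. compact (A n)" "\<And>n. A n \<subseteq> E" "\<And>x. x \<in> E \<Longrightarrow> \<forall>\<^sub>F n in sequentially. x \<in> A n"
proof -
  let ?Z = "closure E - E"
  define A where "A n = {x\<in>closure E. \<bar>x\<bar> \<le> real n \<and> (\<forall>z\<in>?Z. 1 / real (Suc n) \<le> \<bar>x - z\<bar>)}" for n
  show thesis
  proof (rule that[of A])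
    fix n
    have "A n = closure E \<inter> cball 0 (real n) \<inter> (\<Inter>z\<in>?Z. {x. 1 / real (Suc n) \<le> \<bar>x - z\<bar>})"
      by (auto simp: A_def dist_real_def)
    moreover have "closed (\<Inter>z\<in>?Z. {x. 1 / real (Suc n) \<le> \<bar>x - z\<bar>})"
      by (intro closed_INT ballI closed_Collect_le continuous_intros)
    ultimately show "compact (A n)"
      by (simp add: closed_Int_compact compact_Int_closed)
    show "A n \<subseteq> E"
    proof
      fix x assume x: "x \<in> A n"
      show "x \<in> E"
      proof (rule ccontr)
        assume "x \<notin> E"
        then have "x \<in> ?Z" using x by (simp add: A_def)
        then have "1 / real (Suc n) \<le> \<bar>x - x\<bar>" using x unfolding A_def by blast
        then show False by simp
      qed
    qed
  next
    fix x assume x: "x \<in> E"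
    have 1: "\<forall>\<^sub>F n in sequentially. \<bar>x\<bar> \<le> real n"
      using filterlim_real_sequentially by (auto simp: filterlim_at_top)
    have "\<forall>z\<in>?Z. \<forall>\<^sub>F n in sequentially. 1 / real (Suc n) < \<bar>x - z\<bar>"
    proof
      fix z assume "z \<in> ?Z"
      then have "0 < \<bar>x - z\<bar>" using x by auto
      then show "\<forall>\<^sub>F n in sequentially. 1 / real (Suc n) < \<bar>x - z\<bar>"
        using LIMSEQ_inverse_real_of_nat by (intro order_tendstoD(2)[of _ 0]) (simp_all add: inverse_eq_divide)
    qed
    then have "\<forall>\<^sub>F n in sequentially. \<forall>z\<in>?Z. 1 / real (Suc n) < \<bar>x - z\<bar>"
      by (rule eventually_ball_finite[OF finite_boundary])
    with 1 show "\<forall>\<^sub>F n in sequentially. x \<in> A n"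
      by eventually_elim (use x closure_subset in \<open>auto simp: A_def intro: less_imp_le\<close>)
  qed
qed

text \<open>Density in L1 suffices after truncation. Once \<open>u\<close> is replaced by a function
  \<open>w\<close> bounded by \<open>n\<close>, the approximant may be clamped at \<open>n\<close>
  too, and the squared error is then at most \<open>2 * n\<close> times the error in L1.\<close>

lemma Cc_dense_L2:
  assumes u: "L2 \<mu> u" and e: "0 < e"
  shows "\<exists>g\<in>Cc E. (\<integral>x. (u x - g x)\<^sup>2 \<partial>\<mu>) < e"
proof -
  obtain A where A: "\<And>n. compact (A n)" "\<And>n. A n \<subseteq> E" "\<And>x. x \<in> E \<Longrightarrow> \<forall>\<^sub>F n in sequentially. x \<in> A n"
    by (rule compact_exhaustion) (rule that)
  have [measurable]: "u \<in> borel_measurable \<mu>" and ui: "integrable \<mu> (\<lambda>x. (u x)\<^sup>2)" using u by (auto simp: L2_def)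
  have As[measurable]: "A n \<in> sets \<mu>" for n by (rule compact_sets[OF A(1,2)])
  let ?w = "\<lambda>n x. indicat_real (A n) x * clamp_to (real n) (u x)"
  have wle: "\<bar>u x - ?w n x\<bar> \<le> \<bar>u x\<bar>" for n x
    using clamp_to_rest[of "real n" "u x"] by (cases "x \<in> A n") simp_all
  have "(\<lambda>n. \<integral>x. (u x - ?w n x)\<^sup>2 \<partial>\<mu>) \<longlonglongrightarrow> (\<integral>x. 0 \<partial>\<mu>)"
  proof (rule integral_dominated_convergence[where w = "\<lambda>x. (u x)\<^sup>2"])
    show "AE x in \<mu>. (\<lambda>n. (u x - ?w n x)\<^sup>2) \<longlonglongrightarrow> 0"
    proof (rule AE_I2)
      fix x assume "x \<in> space \<mu>"
      then have "\<forall>\<^sub>F n in sequentially. x \<in> A n" using A(3) by (simp add: space_mu)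
      moreover have "\<forall>\<^sub>F n in sequentially. \<bar>u x\<bar> \<le> real n"
        using filterlim_real_sequentially by (auto simp: filterlim_at_top)
      ultimately have "\<forall>\<^sub>F n in sequentially. (u x - ?w n x)\<^sup>2 = 0"
      proof eventually_elim
        case (elim n)
        then have "clamp_to (real n) (u x) = u x" by (intro clamp_to_id)
        then show ?case using elim(1) by simp
      qed
      then show "(\<lambda>n. (u x - ?w n x)\<^sup>2) \<longlonglongrightarrow> 0" by (rule tendsto_eventually)
    qed
    show "AE x in \<mu>. norm ((u x - ?w n x)\<^sup>2) \<le> (u x)\<^sup>2" for n
      using wle by (intro AE_I2) (simp only: real_norm_def abs_power2 abs_le_square_iff[symmetric])
  qed (use ui in measurable)
  then have "(\<lambda>n. \<integral>x. (u x - ?w n x)\<^sup>2 \<partial>\<mu>) \<longlonglongrightarrow> 0" by simp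
  then have "\<forall>\<^sub>F n in sequentially. (\<integral>x. (u x - ?w n x)\<^sup>2 \<partial>\<mu>) < e / 4"
    by (rule order_tendstoD(2)) (use e in simp)
  then obtain n where n: "(\<integral>x. (u x - ?w n x)\<^sup>2 \<partial>\<mu>) < e / 4" by (auto simp: eventually_sequentially)
  define w where "w = ?w n"
  have wb: "\<bar>w x\<bar> \<le> real n" for x
    unfolding w_def using clamp_to_abs[of "real n" "u x"] by (cases "x \<in> A n") simp_all
  have wm[measurable]: "w \<in> borel_measurable \<mu>" unfolding w_def by measurable
  have wi: "integrable \<mu> w"
    by (rule integrable_bounded_compact(1)[OF wm A(1,2)[of n] wb]) (simp add: w_def)
  \<comment> \<open>This tolerance yields
    \<open>2 * n * (e / (8 * (n + 1))) < e / 4\<close>.\<close>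
  obtain g0 where g0: "g0 \<in> Cc E" "(\<integral>x. \<bar>w x - g0 x\<bar> \<partial>\<mu>) < e / (8 * (real n + 1))"
    using Cc_dense_L1[OF wi] e by (metis divide_pos_pos mult_pos_pos of_nat_0_le_iff add_nonneg_pos zero_less_numeral zero_less_one)
  define g where "g x = clamp_to (real n) (g0 x)" for x
  have g: "g \<in> Cc E" unfolding g_def by (rule Cc_clamp[OF _ g0(1)]) simp
  have gb: "\<bar>g x\<bar> \<le> real n" for x
    unfolding g_def by (rule clamp_to_abs) simp
  have wg: "\<bar>w x - g x\<bar> \<le> \<bar>w x - g0 x\<bar>" for x
    unfolding g_def using clamp_to_contract[of "real n" "w x" "g0 x"] clamp_to_id[OF wb[of x]] by (simp only:)
  have sq: "(w x - g x)\<^sup>2 \<le> (2 * real n) * \<bar>w x - g0 x\<bar>" for x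
  proof -
    have "(w x - g x)\<^sup>2 = \<bar>w x - g x\<bar> * \<bar>w x - g x\<bar>" by (simp add: power2_eq_square)
    also have "\<dots> \<le> (2 * real n) * \<bar>w x - g0 x\<bar>"
      using wg[of x] wb[of x] gb[of x] by (intro mult_mono) auto
    finally show ?thesis .
  qed
  have gi: "integrable \<mu> (\<lambda>x. (w x - g x)\<^sup>2)"
  proof (rule Bochner_Integration.integrable_bound)
    show "integrable \<mu> (\<lambda>x. (2 * real n) * \<bar>w x - g0 x\<bar>)" using wi Cc_integrable(1)[OF g0(1)] by auto
    show "(\<lambda>x. (w x - g x)\<^sup>2) \<in> borel_measurable \<mu>" using Cc_measurable[OF g] by measurable
    show "AE x in \<mu>. norm ((w x - g x)\<^sup>2) \<le> norm ((2 * real n) * \<bar>w x - g0 x\<bar>)" using sq by (intro AE_I2) simp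
  qed
  have "(\<integral>x. (w x - g x)\<^sup>2 \<partial>\<mu>) \<le> (\<integral>x. (2 * real n) * \<bar>w x - g0 x\<bar> \<partial>\<mu>)"
    using gi wi Cc_integrable(1)[OF g0(1)] sq by (intro integral_mono) auto
  also have "\<dots> = (2 * real n) * (\<integral>x. \<bar>w x - g0 x\<bar> \<partial>\<mu>)" by simp
  also have "\<dots> \<le> (2 * real n) * (e / (8 * (real n + 1)))" using g0(2) by (intro mult_left_mono) auto
  also have "\<dots> < e / 4" using e by (simp add: field_simps)
  finally have gw: "(\<integral>x. (w x - g x)\<^sup>2 \<partial>\<mu>) < e / 4" .
  have uwi: "integrable \<mu> (\<lambda>x. (u x - w x)\<^sup>2)"
  proof (rule Bochner_Integration.integrable_bound[OF ui])
    show "AE x in \<mu>. norm ((u x - w x)\<^sup>2) \<le> norm ((u x)\<^sup>2)"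
      using wle unfolding w_def by (intro AE_I2) (simp only: real_norm_def abs_power2 abs_le_square_iff[symmetric])
  qed measurable
  have ugi: "integrable \<mu> (\<lambda>x. 2 * (u x - w x)\<^sup>2 + 2 * (w x - g x)\<^sup>2)" using uwi gi by auto
  have tri: "(a - c)\<^sup>2 \<le> 2 * (a - b)\<^sup>2 + 2 * (b - c)\<^sup>2" for a b c :: real
    using zero_le_power2[of "(a - b) - (b - c)"] by (simp add: power2_eq_square algebra_simps)
  have "(\<integral>x. (u x - g x)\<^sup>2 \<partial>\<mu>) \<le> (\<integral>x. 2 * (u x - w x)\<^sup>2 + 2 * (w x - g x)\<^sup>2 \<partial>\<mu>)"
  proof (rule integral_mono_AE[OF _ ugi])
    show "integrable \<mu> (\<lambda>x. (u x - g x)\<^sup>2)"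
    proof (rule Bochner_Integration.integrable_bound[OF ugi])
      show "(\<lambda>x. (u x - g x)\<^sup>2) \<in> borel_measurable \<mu>" using Cc_measurable[OF g] by measurable
      show "AE x in \<mu>. norm ((u x - g x)\<^sup>2) \<le> norm (2 * (u x - w x)\<^sup>2 + 2 * (w x - g x)\<^sup>2)"
        using tri by (intro AE_I2) simp
    qed
  qed (use tri in simp)
  also have "\<dots> = 2 * (\<integral>x. (u x - w x)\<^sup>2 \<partial>\<mu>) + 2 * (\<integral>x. (w x - g x)\<^sup>2 \<partial>\<mu>)"
    using uwi gi by (subst Bochner_Integration.integral_add) auto
  also have "\<dots> < e" using gw n unfolding w_def by linarith
  finally show ?thesis using g by blast
qed

lemma Cc_zero: "(\<lambda>_. 0) \<in> Cc E"
  by (auto simp: Cc_def intro!: exI[of _ "{}"])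

section \<open>Linear spaces stable under the unit contraction, with enough bumps\<close>

context
  fixes L :: "(real \<Rightarrow> real) set"
  assumes sub: "L \<subseteq> Cc E" and zero: "(\<lambda>_. 0) \<in> L"
    and add: "\<And>f g. f \<in> L \<Longrightarrow> g \<in> L \<Longrightarrow> (\<lambda>x. f x + g x) \<in> L"
    and scale: "\<And>f c. f \<in> L \<Longrightarrow> (\<lambda>x. c * f x) \<in> L"
    and unit: "\<And>f. f \<in> L \<Longrightarrow> unit_part f \<in> L"
    and bump: "\<And>x d. x \<in> E \<Longrightarrow> 0 < d \<Longrightarrow> \<exists>\<theta>\<in>L. \<exists>\<eta>>0. \<forall>y\<in>E. 0 \<le> \<theta> y \<and> \<theta> y \<le> 1 \<and>
       (\<bar>y - x\<bar> < \<eta> \<longrightarrow> \<theta> y = 1) \<and> (d \<le> \<bar>y - x\<bar> \<longrightarrow> \<theta> y = 0)"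
begin

text \<open>The maximum is \<open>f\<close> plus the positive part of \<open>g - f\<close>. For
  values in \<open>[0, 1]\<close> this positive part is a unit contraction.\<close>

lemma max_closed:
  assumes "f \<in> L" "g \<in> L" "\<And>y. y \<in> E \<Longrightarrow> 0 \<le> f y \<and> f y \<le> 1" "\<And>y. y \<in> E \<Longrightarrow> 0 \<le> g y \<and> g y \<le> 1"
  shows "(\<lambda>x. max (f x) (g x)) \<in> L"
proof -
  have "(\<lambda>x. f x + min 1 (max 0 (g x + -1 * f x))) \<in> L"
    by (intro add scale unit assms)
  moreover have "f x + min 1 (max 0 (g x + -1 * f x)) = max (f x) (g x)" for x
  proof (cases "x \<in> E")
    case True
    then show ?thesis using assms(3,4)[of x] by (simp add: min_def max_def)
  next
    case False
    then have "f x = 0" "g x = 0" using assms(1,2) sub by (auto simp: Cc_def)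
    then show ?thesis by simp
  qed
  ultimately show ?thesis by (simp only:)
qed

text \<open>Finitely many bumps supported in \<open>V\<close> have plateaus that cover the compact
  set \<open>A\<close>; their maximum is the separating function.\<close>

lemma urysohn:
  assumes A: "compact A" "A \<subseteq> E" and V: "open V" "A \<subseteq> V"
  shows "\<exists>\<theta>\<in>L. \<forall>y\<in>E. 0 \<le> \<theta> y \<and> \<theta> y \<le> 1 \<and> (y \<in> A \<longrightarrow> \<theta> y = 1) \<and> (y \<notin> V \<longrightarrow> \<theta> y = 0)"
proof -
  have "\<exists>\<theta> \<eta>. \<theta> \<in> L \<and> 0 < \<eta> \<and> (\<forall>y\<in>E. 0 \<le> \<theta> y \<and> \<theta> y \<le> 1 \<and> (\<bar>y - x\<bar> < \<eta> \<longrightarrow> \<theta> y = 1) \<and> (y \<notin> V \<longrightarrow> \<theta> y = 0))"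
    if x: "x \<in> A" for x
  proof -
    have "x \<in> V" using x V by blast
    then obtain d where d: "0 < d" "\<And>y. dist y x < d \<Longrightarrow> y \<in> V"
      using V(1) unfolding open_dist by blast
    have "x \<in> E" using x A by blast
    from bump[OF this d(1)] obtain \<theta> \<eta> where "\<theta> \<in> L" "0 < \<eta>"
      and *: "\<forall>y\<in>E. 0 \<le> \<theta> y \<and> \<theta> y \<le> 1 \<and> (\<bar>y - x\<bar> < \<eta> \<longrightarrow> \<theta> y = 1) \<and> (d \<le> \<bar>y - x\<bar> \<longrightarrow> \<theta> y = 0)" by blast
    moreover have "d \<le> \<bar>y - x\<bar>" if "y \<notin> V" for y
      using d(2)[of y] that by (simp only: dist_real_def not_less[symmetric]) blast
    ultimately show ?thesis by blast
  qed
  then obtain \<theta> \<eta> where th: "\<And>x. x \<in> A \<Longrightarrow> \<theta> x \<in> L \<and> 0 < \<eta> x \<and>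
      (\<forall>y\<in>E. 0 \<le> \<theta> x y \<and> \<theta> x y \<le> 1 \<and> (\<bar>y - x\<bar> < \<eta> x \<longrightarrow> \<theta> x y = 1) \<and> (y \<notin> V \<longrightarrow> \<theta> x y = 0))"
    by metis
  have "A \<subseteq> (\<Union>x\<in>A. ball x (\<eta> x))" using th by force
  then obtain F where F: "F \<subseteq> A" "finite F" "A \<subseteq> (\<Union>x\<in>F. ball x (\<eta> x))"
    using compactE_image[OF A(1), of A "\<lambda>x. ball x (\<eta> x)"] by auto
  have "\<exists>\<phi>\<in>L. \<forall>y\<in>E. 0 \<le> \<phi> y \<and> \<phi> y \<le> 1 \<and> (y \<in> (\<Union>x\<in>F. ball x (\<eta> x)) \<longrightarrow> \<phi> y = 1) \<and> (y \<notin> V \<longrightarrow> \<phi> y = 0)"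
    using F(2,1)
  proof (induction F)
    case empty
    then show ?case using zero by (intro bexI[of _ "\<lambda>_. 0"]) simp_all
  next
    case (insert a F)
    then obtain \<phi> where p: "\<phi> \<in> L" "\<forall>y\<in>E. 0 \<le> \<phi> y \<and> \<phi> y \<le> 1 \<and> (y \<in> (\<Union>x\<in>F. ball x (\<eta> x)) \<longrightarrow> \<phi> y = 1) \<and> (y \<notin> V \<longrightarrow> \<phi> y = 0)"
      by blast
    have a: "\<theta> a \<in> L" "\<forall>y\<in>E. 0 \<le> \<theta> a y \<and> \<theta> a y \<le> 1 \<and> (\<bar>y - a\<bar> < \<eta> a \<longrightarrow> \<theta> a y = 1) \<and> (y \<notin> V \<longrightarrow> \<theta> a y = 0)"
      using th[of a] insert.prems by auto
    have m: "(\<lambda>x. max (\<theta> a x) (\<phi> x)) \<in> L"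
      by (rule max_closed[OF a(1) p(1)]) (use a(2) p(2) in auto)
    show ?case
    proof (rule bexI[OF _ m], rule ballI)
      fix y assume y: "y \<in> E"
      have "\<bar>y - a\<bar> < \<eta> a" if "y \<in> ball a (\<eta> a)"
        using that by (simp add: dist_real_def abs_minus_commute)
      then show "0 \<le> max (\<theta> a y) (\<phi> y) \<and> max (\<theta> a y) (\<phi> y) \<le> 1 \<and>
        (y \<in> (\<Union>x\<in>insert a F. ball x (\<eta> x)) \<longrightarrow> max (\<theta> a y) (\<phi> y) = 1) \<and> (y \<notin> V \<longrightarrow> max (\<theta> a y) (\<phi> y) = 0)"
        using bspec[OF a(2) y] bspec[OF p(2) y] by auto
    qed
  qed
  then obtain \<phi> where "\<phi> \<in> L" "\<forall>y\<in>E. 0 \<le> \<phi> y \<and> \<phi> y \<le> 1 \<and> (y \<in> (\<Union>x\<in>F. ball x (\<eta> x)) \<longrightarrow> \<phi> y = 1) \<and> (y \<notin> V \<longrightarrow> \<phi> y = 0)"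
    by blast
  then show ?thesis using F(3) by blast
qed

text \<open>A nonnegative function is approximated by the layers \<open>e \<theta>\<^sub>0 + \<dots> + e \<theta>\<^bsub>N-1\<^esub>\<close>, where \<open>\<theta>\<^sub>j\<close>
  separates \<open>{u \<ge> (j+1)e}\<close> from \<open>{u \<le> j e}\<close>.\<close>

lemma uniform_dense_nonneg:
  assumes u: "u \<in> Cc E" "\<And>x. 0 \<le> u x" and e: "0 < e"
  shows "\<exists>g\<in>L. \<forall>x\<in>E. \<bar>u x - g x\<bar> \<le> e"
proof -
  obtain A B where A: "compact A" "A \<subseteq> E" "\<And>x. x \<notin> A \<Longrightarrow> u x = 0" and B: "0 \<le> B" "\<And>x. \<bar>u x\<bar> \<le> B"
    by (rule CcD[OF u(1)]) (rule that)
  have cont: "continuous_on E u" using u(1) by (simp add: Cc_def)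
  have layer: "\<exists>\<theta>\<in>L. \<forall>y\<in>E. 0 \<le> \<theta> y \<and> \<theta> y \<le> 1 \<and> (real (Suc j) * e \<le> u y \<longrightarrow> \<theta> y = 1) \<and> (u y \<le> real j * e \<longrightarrow> \<theta> y = 0)" for j :: nat
  proof -
    let ?A = "{y\<in>A. real (Suc j) * e \<le> u y}"
    have "closedin (top_of_set A) (A \<inter> u -` {real (Suc j) * e..})"
      by (intro continuous_closedin_preimage continuous_on_subset[OF cont A(2)]) simp
    then have "compact (A \<inter> u -` {real (Suc j) * e..})"
      by (rule closedin_compact[OF A(1)])
    moreover have "A \<inter> u -` {real (Suc j) * e..} = ?A" by auto
    ultimately have cA: "compact ?A" by simp
    obtain V where V: "open V" "V \<inter> E = u -` {real j * e<..} \<inter> E"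
      using cont open_greaterThan unfolding continuous_on_open_invariant by blast
    have "?A \<subseteq> V"
    proof
      fix y assume y: "y \<in> ?A"
      then have "real j * e < u y" using e by (simp add: distrib_right)
      then show "y \<in> V" using V(2) y A(2) by blast
    qed
    moreover have "?A \<subseteq> E" using A(2) by blast
    ultimately obtain \<theta> where th: "\<theta> \<in> L" "\<forall>y\<in>E. 0 \<le> \<theta> y \<and> \<theta> y \<le> 1 \<and> (y \<in> ?A \<longrightarrow> \<theta> y = 1) \<and> (y \<notin> V \<longrightarrow> \<theta> y = 0)"
      using urysohn[OF cA _ V(1)] by blast
    have "y \<in> ?A" if "real (Suc j) * e \<le> u y" for y
    proof -
      have "0 < real (Suc j) * e" using e by simp
      then have "u y \<noteq> 0" using that by linarith
      then show ?thesis using A(3) that by blast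
    qed
    moreover have "y \<notin> V" if "y \<in> E" "u y \<le> real j * e" for y
      using V(2) that by force
    ultimately show ?thesis using th by blast
  qed
  then obtain \<theta> where th: "\<And>j. \<theta> j \<in> L"
     "\<And>j y. y \<in> E \<Longrightarrow> 0 \<le> \<theta> j y \<and> \<theta> j y \<le> 1 \<and> (real (Suc j) * e \<le> u y \<longrightarrow> \<theta> j y = 1) \<and> (u y \<le> real j * e \<longrightarrow> \<theta> j y = 0)"
    by metis
  define g where "g N x = (\<Sum>j<N. e * \<theta> j x)" for N :: nat and x
  have gL: "g N \<in> L" for N
  proof (induction N)
    case 0
    have "g 0 = (\<lambda>_. 0)" by (simp add: g_def fun_eq_iff)
    then show ?case using zero by simp
  next
    case (Suc N)
    have "g (Suc N) = (\<lambda>x. g N x + e * \<theta> N x)" by (simp add: g_def fun_eq_iff)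
    then show ?case using add[OF Suc scale[OF th(1)]] by simp
  qed
  \<comment> \<open>Below the level \<open>N * e\<close> the error is already at most
    \<open>e\<close> and all further layers vanish; above it the sum has exactly the value
    \<open>N * e\<close>. For \<open>N > B / e\<close> every point is in the first
    situation.\<close>
  have inv: "(real N * e \<le> u x \<longrightarrow> g N x = real N * e) \<and> (u x < real N * e \<longrightarrow> \<bar>u x - g N x\<bar> \<le> e)"
    if x: "x \<in> E" for N x
  proof (induction N)
    case 0
    show ?case using u(2)[of x] by (simp add: g_def)
  next
    case (Suc N)
    note t = th(2)[OF x, of N]
    have S: "g (Suc N) x = g N x + e * \<theta> N x" by (simp add: g_def)
    have e1: "real (Suc N) * e = real N * e + e" by (simp add: distrib_right)
    have et: "0 \<le> e * \<theta> N x" "e * \<theta> N x \<le> e" using t e by (simp_all add: mult_left_le)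
    consider "real (Suc N) * e \<le> u x" | "real N * e \<le> u x" "u x < real (Suc N) * e" | "u x < real N * e" by linarith
    then show ?case
    proof cases
      case 1
      then have "real N * e \<le> u x" using e e1 by linarith
      then have "g N x = real N * e" using Suc by blast
      moreover have "\<theta> N x = 1" using t 1 by blast
      ultimately show ?thesis using S e1 1 by simp
    next
      case 2
      then have "g N x = real N * e" using Suc by blast
      then have "\<bar>u x - g (Suc N) x\<bar> \<le> e" using S e1 et 2 by linarith
      then show ?thesis using 2 by linarith
    next
      case 3
      then have "\<theta> N x = 0" using t by simp
      then have "g (Suc N) x = g N x" using S by simp
      moreover have "u x < real (Suc N) * e" using 3 e e1 by linarith
      ultimately show ?thesis using Suc 3 by linarith
    qed
  qed
  obtain N :: nat where N: "B / e < real N" using reals_Archimedean2 by blast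
  then have "B < real N * e" using e by (simp add: pos_divide_less_eq)
  then have "u x < real N * e" for x using B(2)[of x] by linarith
  then show ?thesis using inv gL[of N] by (intro bexI[of _ "g N"]) blast+
qed

lemma uniform_dense:
  assumes u: "u \<in> Cc E" and e: "0 < e"
  shows "\<exists>g\<in>L. \<forall>x\<in>E. \<bar>u x - g x\<bar> < e"
proof -
  have p: "(\<lambda>x. max 0 (u x)) \<in> Cc E"
    by (rule Cc_comp[OF u, of "max 0"]) (auto intro!: continuous_intros)
  have n: "(\<lambda>x. max 0 (- u x)) \<in> Cc E"
    by (rule Cc_comp[OF u, of "\<lambda>t. max 0 (- t)"]) (auto intro!: continuous_intros)
  obtain g where g: "g \<in> L" "\<forall>x\<in>E. \<bar>max 0 (u x) - g x\<bar> \<le> e / 3"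
    using uniform_dense_nonneg[OF p, of "e/3"] e by auto
  obtain h where h: "h \<in> L" "\<forall>x\<in>E. \<bar>max 0 (- u x) - h x\<bar> \<le> e / 3"
    using uniform_dense_nonneg[OF n, of "e/3"] e by auto
  have "(\<lambda>x. g x + -1 * h x) \<in> L" by (intro add scale g h)
  moreover have "\<bar>u x - (g x + -1 * h x)\<bar> < e" if x: "x \<in> E" for x
  proof -
    have "u x = max 0 (u x) - max 0 (- u x)" by simp
    then show ?thesis using bspec[OF g(2) x] bspec[OF h(2) x] e by linarith
  qed
  ultimately show ?thesis by (intro bexI[where x = "\<lambda>x. g x + -1 * h x"] ballI)
qed

text \<open>Uniform closeness does not control the norm when \<open>\<mu>\<close> is infinite.
  Subtracting from \<open>g\<close> its truncation at height \<open>d\<close> makes the approximant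
  vanish off the compact support \<open>A\<close> of \<open>v\<close>, at the price of an error
  \<open>2 * d\<close> on \<open>A\<close>.\<close>

lemma L2_dense:
  assumes u: "L2 \<mu> u" and e: "0 < e"
  shows "\<exists>f\<in>L. (\<integral>x. (u x - f x)\<^sup>2 \<partial>\<mu>) < e"
proof -
  obtain v where v: "v \<in> Cc E" "(\<integral>x. (u x - v x)\<^sup>2 \<partial>\<mu>) < e / 4"
    using Cc_dense_L2[OF u, of "e/4"] e by auto
  obtain A B where A: "compact A" "A \<subseteq> E" "\<And>x. x \<notin> A \<Longrightarrow> v x = 0" and B: "0 \<le> B" "\<And>x. \<bar>v x\<bar> \<le> B"
    by (rule CcD[OF v(1)]) (rule that)
  \<comment> \<open>Chosen so that \<open>(2 * d)\<^sup>2 * measure \<mu> A \<le> e / 4\<close>; the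
    added 1 covers a null set \<open>A\<close>.\<close>
  define d where "d = sqrt (e / (16 * (measure \<mu> A + 1)))"
  have m0: "0 \<le> measure \<mu> A" by (rule measure_nonneg)
  have d: "0 < d" "d\<^sup>2 = e / (16 * (measure \<mu> A + 1))"
  proof -
    have "0 < 16 * (measure \<mu> A + 1)" by (intro mult_pos_pos add_nonneg_pos m0) simp_all
    then have "0 < e / (16 * (measure \<mu> A + 1))" by (rule divide_pos_pos[OF e])
    then show "0 < d" "d\<^sup>2 = e / (16 * (measure \<mu> A + 1))" unfolding d_def by (simp_all only: real_sqrt_gt_0_iff real_sqrt_pow2 less_imp_le)
  qed
  obtain g where g: "g \<in> L" "\<forall>x\<in>E. \<bar>v x - g x\<bar> < d" using uniform_dense[OF v(1) d(1)] by blast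
  let ?f = "\<lambda>x. g x + -1 * (d * unit_part (\<lambda>x. inverse d * g x) x + -1 * (d * unit_part (\<lambda>x. inverse d * (-1 * g x)) x))"
  have fL: "?f \<in> L" by (intro add scale unit g)
  have f: "?f x = g x - clamp_to d (g x)" for x
    unfolding clamp_to_unit[OF d(1)] by simp
  have bound: "\<bar>v x - ?f x\<bar> \<le> 2 * d" "x \<notin> A \<Longrightarrow> ?f x = 0" if x: "x \<in> E" for x
  proof -
    have "\<bar>v x - g x\<bar> < d" using g(2) x by blast
    moreover have "\<bar>clamp_to d (g x)\<bar> \<le> d" by (rule clamp_to_abs) (use d in simp)
    ultimately show "\<bar>v x - ?f x\<bar> \<le> 2 * d" unfolding f by linarith
    assume "x \<notin> A"
    then have "\<bar>g x\<bar> \<le> d" using g(2) x A(3)[of x] by force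
    then show "?f x = 0" unfolding f using clamp_to_id by simp
  qed
  have fC: "?f \<in> Cc E" using fL sub by blast
  have vf: "(\<lambda>x. (v x - ?f x)\<^sup>2) \<in> borel_measurable \<mu>"
    using Cc_measurable[OF v(1)] Cc_measurable[OF fC] by (intro borel_measurable_power borel_measurable_diff)
  have b2: "\<bar>(v x - ?f x)\<^sup>2\<bar> \<le> 4 * d\<^sup>2" if "x \<in> A" for x
    using power_mono[OF bound(1)[of x] abs_ge_zero, of 2] that A(2) by (auto simp: power_mult_distrib)
  have z2: "(v x - ?f x)\<^sup>2 = 0" if "x \<in> E" "x \<notin> A" for x
    using bound(2)[OF that] A(3)[OF that(2)] by simp
  note vfi = integrable_bounded_compact[OF vf A(1,2) b2 z2]
  have "4 * d\<^sup>2 * measure \<mu> A \<le> e / 4"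
  proof -
    have "4 * (e / (16 * (q + 1))) * q \<le> e / 4" if "0 \<le> q" for q :: real
      using that e by (simp add: field_simps)
    from this[OF m0] show ?thesis unfolding d(2) .
  qed
  with vfi(2) have v2: "(\<integral>x. (v x - ?f x)\<^sup>2 \<partial>\<mu>) \<le> e / 4" by linarith
  have um: "u \<in> borel_measurable \<mu>" using u by (simp add: L2_def)
  have tri: "(a - c)\<^sup>2 \<le> 2 * (a - b)\<^sup>2 + 2 * (b - c)\<^sup>2" for a b c :: real
    using zero_le_power2[of "(a - b) - (b - c)"] by (simp add: power2_eq_square algebra_simps)
  have "L2 \<mu> (\<lambda>x. u x - v x)"
    by (rule L2_dominated[OF _ u Cc_integrable(2)[OF v(1)]])
      (use um Cc_measurable[OF v(1)] in \<open>auto intro: abs_triangle_ineq4\<close>)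
  then have uvi: "integrable \<mu> (\<lambda>x. (u x - v x)\<^sup>2)" by (simp add: L2_def)
  have ufi: "integrable \<mu> (\<lambda>x. 2 * (u x - v x)\<^sup>2 + 2 * (v x - ?f x)\<^sup>2)"
    by (intro Bochner_Integration.integrable_add integrable_mult_right uvi vfi(1))
  have "(\<integral>x. (u x - ?f x)\<^sup>2 \<partial>\<mu>) \<le> (\<integral>x. 2 * (u x - v x)\<^sup>2 + 2 * (v x - ?f x)\<^sup>2 \<partial>\<mu>)"
  proof (rule integral_mono_AE[OF _ ufi])
    show "integrable \<mu> (\<lambda>x. (u x - ?f x)\<^sup>2)"
    proof (rule Bochner_Integration.integrable_bound[OF ufi])
      show "(\<lambda>x. (u x - ?f x)\<^sup>2) \<in> borel_measurable \<mu>"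
        by (intro borel_measurable_power borel_measurable_diff um Cc_measurable[OF fC])
      show "AE x in \<mu>. norm ((u x - ?f x)\<^sup>2) \<le> norm (2 * (u x - v x)\<^sup>2 + 2 * (v x - ?f x)\<^sup>2)"
      proof (rule AE_I2)
        fix x
        show "norm ((u x - ?f x)\<^sup>2) \<le> norm (2 * (u x - v x)\<^sup>2 + 2 * (v x - ?f x)\<^sup>2)"
          using tri[of "u x" "?f x" "v x"] by (simp only: real_norm_def abs_power2) linarith
      qed
    qed
    show "AE x in \<mu>. (u x - ?f x)\<^sup>2 \<le> 2 * (u x - v x)\<^sup>2 + 2 * (v x - ?f x)\<^sup>2" by (intro AE_I2 tri)
  qed
  also have "\<dots> = 2 * (\<integral>x. (u x - v x)\<^sup>2 \<partial>\<mu>) + 2 * (\<integral>x. (v x - ?f x)\<^sup>2 \<partial>\<mu>)"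
    using Bochner_Integration.integral_add[OF integrable_mult_right[OF uvi, of 2] integrable_mult_right[OF vfi(1), of 2]] by simp
  also have "\<dots> < e" using v(2) v2 by linarith
  finally show ?thesis by (rule bexI[where x = ?f, OF _ fL])
qed

end

section \<open>A criterion for regular Dirichlet forms\<close>

text \<open>Density in L2 and uniform density of the core both reduce to the existence of bumps, and
  the Markov inequality holds in all of \<open>H1\<close>. What remains for a concrete space is
  closedness, energy density of the core, and bumps.\<close>

lemma regular_dirichletI:
  assumes S: "\<And>f. f \<in> S \<Longrightarrow> (\<forall>x. x \<notin> E \<longrightarrow> f x = 0) \<and> L2 \<mu> f \<and> H1 f"
    and zero: "(\<lambda>_. 0) \<in> S"
    and add: "\<And>f g. f \<in> S \<Longrightarrow> g \<in> S \<Longrightarrow> (\<lambda>x. f x + g x) \<in> S"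
    and scale: "\<And>f c. f \<in> S \<Longrightarrow> (\<lambda>x. c * f x) \<in> S"
    and unit: "\<And>f. f \<in> S \<Longrightarrow> unit_part f \<in> S"
    and complete: "\<And>fs. (\<And>n. fs n \<in> S) \<Longrightarrow> (\<And>\<epsilon>. \<epsilon> > 0 \<Longrightarrow> \<exists>N. \<forall>m\<ge>N. \<forall>n\<ge>N. E1 E \<mu> (\<lambda>x. fs n x - fs m x) < \<epsilon>) \<Longrightarrow>
       \<exists>f\<in>S. (\<lambda>n. E1 E \<mu> (\<lambda>x. fs n x - f x)) \<longlonglongrightarrow> 0"
    and core: "\<And>f \<epsilon>. f \<in> S \<Longrightarrow> \<epsilon> > 0 \<Longrightarrow> \<exists>g\<in>S \<inter> Cc E. E1 E \<mu> (\<lambda>x. f x - g x) < \<epsilon>"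
    and bump: "\<And>x d. x \<in> E \<Longrightarrow> 0 < d \<Longrightarrow> \<exists>\<theta>\<in>S \<inter> Cc E. \<exists>\<eta>>0. \<forall>y\<in>E. 0 \<le> \<theta> y \<and> \<theta> y \<le> 1 \<and>
       (\<bar>y - x\<bar> < \<eta> \<longrightarrow> \<theta> y = 1) \<and> (d \<le> \<bar>y - x\<bar> \<longrightarrow> \<theta> y = 0)"
  shows "regular_dirichlet E \<mu> S"
proof -
  let ?L = "S \<inter> Cc E"
  have L: "?L \<subseteq> Cc E" "(\<lambda>_. 0) \<in> ?L" "\<And>f g. f \<in> ?L \<Longrightarrow> g \<in> ?L \<Longrightarrow> (\<lambda>x. f x + g x) \<in> ?L"
    "\<And>f c. f \<in> ?L \<Longrightarrow> (\<lambda>x. c * f x) \<in> ?L" "\<And>f. f \<in> ?L \<Longrightarrow> unit_part f \<in> ?L"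
    using zero add scale unit Cc_zero Cc_add Cc_scale Cc_unit by auto
  have 1: "\<exists>f\<in>S. (\<integral>x. (u x - f x)\<^sup>2 \<partial>\<mu>) < \<epsilon>" if "L2 \<mu> u" "\<epsilon> > 0" for u \<epsilon>
  proof -
    have "\<exists>f\<in>?L. (\<integral>x. (u x - f x)\<^sup>2 \<partial>\<mu>) < \<epsilon>"
    proof (rule L2_dense[of ?L, OF L(1,2) _ _ _ _ that])
    qed (fact L(3) L(4) L(5) bump)+
    then show ?thesis by blast
  qed
  have 2: "form E (unit_part f) (unit_part f) \<le> form E f f" if "f \<in> S" for f
  proof (rule form_le1)
    show "H1 f" "H1 (unit_part f)" using S[OF that] S[OF unit[OF that]] by blast+
    show "\<bar>unit_part f y - unit_part f x\<bar> \<le> \<bar>f y - f x\<bar>" for x y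
      by (simp add: min_def max_def abs_if)
  qed
  have 3: "\<exists>g\<in>S \<inter> Cc E. \<forall>x\<in>E. \<bar>u x - g x\<bar> < \<epsilon>" if "u \<in> Cc E" "\<epsilon> > 0" for u \<epsilon>
  proof (rule uniform_dense[of ?L, OF L(1,2) _ _ _ _ that])
  qed (fact L(3) L(4) L(5) bump)+
  show ?thesis
    unfolding regular_dirichlet_def
  proof (intro conjI)
    show "\<forall>f\<in>S. (\<forall>x. x \<notin> E \<longrightarrow> f x = 0) \<and> L2 \<mu> f" using S by blast
    show "(\<lambda>_. 0) \<in> S" by (rule zero)
    show "\<forall>f\<in>S. \<forall>g\<in>S. (\<lambda>x. f x + g x) \<in> S" using add by blast
    show "\<forall>f\<in>S. \<forall>c. (\<lambda>x. c * f x) \<in> S" using scale by blast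
    show "\<forall>u. L2 \<mu> u \<longrightarrow> (\<forall>\<epsilon>>0. \<exists>f\<in>S. (\<integral>x. (u x - f x)\<^sup>2 \<partial>\<mu>) < \<epsilon>)" using 1 by blast
    show "\<forall>f\<in>S. \<forall>g\<in>S. form E f g = form E g f" using form_commute by blast
    show "\<forall>f\<in>S. 0 \<le> form E f f" using form_nonneg by blast
    show "\<forall>fs. (\<forall>n. fs n \<in> S) \<and> (\<forall>\<epsilon>>0. \<exists>N. \<forall>m\<ge>N. \<forall>n\<ge>N. E1 E \<mu> (\<lambda>x. fs n x - fs m x) < \<epsilon>) \<longrightarrow>
        (\<exists>f\<in>S. (\<lambda>n. E1 E \<mu> (\<lambda>x. fs n x - f x)) \<longlonglongrightarrow> 0)"
      using complete by blast
    show "\<forall>f\<in>S. unit_part f \<in> S \<and> form E (unit_part f) (unit_part f) \<le> form E f f"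
      using unit 2 by blast
    show "\<forall>f\<in>S. \<forall>\<epsilon>>0. \<exists>g\<in>S \<inter> Cc E. E1 E \<mu> (\<lambda>x. f x - g x) < \<epsilon>" using core by blast
    show "\<forall>u\<in>Cc E. \<forall>\<epsilon>>0. \<exists>g\<in>S \<inter> Cc E. \<forall>x\<in>E. \<bar>u x - g x\<bar> < \<epsilon>" using 3 by blast
  qed
qed

end

section \<open>Sets with nonempty interior\<close>

lemma F_space_H1:
  assumes "class_K E" "f \<in> F_space E \<mu>"
  shows "\<forall>x. x \<notin> E \<longrightarrow> f x = 0" "L2 \<mu> f" "\<exists>G k. H1s_rep E id (\<lambda>_. 1) f G k"
  using assms(2) unfolding F_space_def Fs_space_def by blast+

context radonK
begin

section \<open>Operations inside a Fukushima subspace\<close>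

context
  fixes S assumes S: "fukushima_subspace E \<mu> S"
begin

lemma S_reg: "regular_dirichlet E \<mu> S"
  using S by (simp add: fukushima_subspace_def)

lemma S_F: "f \<in> S \<Longrightarrow> f \<in> F_space E \<mu>"
  using S unfolding fukushima_subspace_def by blast

lemma S_off: "f \<in> S \<Longrightarrow> x \<notin> E \<Longrightarrow> f x = 0"
  using F_space_H1(1)[OF K S_F] by blast

lemma S_L2: "f \<in> S \<Longrightarrow> L2 \<mu> f"
  using F_space_H1(2)[OF K S_F] by blast

lemma S_H1: "f \<in> S \<Longrightarrow> H1 f"
  unfolding H1_def by (rule F_space_H1(3)[OF K S_F])

lemma S_zero: "(\<lambda>_. 0) \<in> S"
  using S_reg unfolding regular_dirichlet_def by blast

lemma S_add: "f \<in> S \<Longrightarrow> g \<in> S \<Longrightarrow> (\<lambda>x. f x + g x) \<in> S"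
  using S_reg unfolding regular_dirichlet_def by blast

lemma S_scale: "f \<in> S \<Longrightarrow> (\<lambda>x. c * f x) \<in> S"
  using S_reg unfolding regular_dirichlet_def by blast

lemma S_minus:
  assumes "f \<in> S" "g \<in> S"
  shows "(\<lambda>x. f x - g x) \<in> S"
  using S_add[OF assms(1) S_scale[OF assms(2), of "-1"]] by simp

lemma S_unit: "f \<in> S \<Longrightarrow> unit_part f \<in> S"
  using S_reg unfolding regular_dirichlet_def by blast

lemma S_uniform: "u \<in> Cc E \<Longrightarrow> 0 < e \<Longrightarrow> \<exists>g\<in>S \<inter> Cc E. \<forall>x\<in>E. \<bar>u x - g x\<bar> < e"
  using S_reg unfolding regular_dirichlet_def by blast

lemma S_core: "f \<in> S \<Longrightarrow> 0 < e \<Longrightarrow> \<exists>g\<in>S \<inter> Cc E. E1 E \<mu> (\<lambda>x. f x - g x) < e"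
  using S_reg unfolding regular_dirichlet_def by blast

lemma S_complete:
  assumes "\<And>n. fs n \<in> S" "\<And>e. 0 < e \<Longrightarrow> \<exists>N. \<forall>m\<ge>N. \<forall>n\<ge>N. E1 E \<mu> (\<lambda>x. fs n x - fs m x) < e"
  shows "\<exists>f\<in>S. (\<lambda>n. E1 E \<mu> (\<lambda>x. fs n x - f x)) \<longlonglongrightarrow> 0"
proof -
  have "\<forall>fs. (\<forall>n. fs n \<in> S) \<and> (\<forall>\<epsilon>>0. \<exists>N. \<forall>m\<ge>N. \<forall>n\<ge>N. E1 E \<mu> (\<lambda>x. fs n x - fs m x) < \<epsilon>) \<longrightarrow>
           (\<exists>f \<in> S. (\<lambda>n. E1 E \<mu> (\<lambda>x. fs n x - f x)) \<longlonglongrightarrow> 0)"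
    using S_reg unfolding regular_dirichlet_def by (elim conjE)
  from spec[OF this, of fs] show ?thesis using assms by blast
qed

lemma S_clip:
  assumes "f \<in> S" "0 < c"
  shows "(\<lambda>x. min c (max 0 (f x))) \<in> S"
proof -
  have "(\<lambda>x. c * unit_part (\<lambda>x. inverse c * f x) x) \<in> S" by (intro S_scale S_unit assms(1))
  moreover have "c * unit_part (\<lambda>x. inverse c * f x) x = min c (max 0 (f x))" for x
    using assms(2) by (auto simp: min_def max_def field_simps)
  ultimately show ?thesis by (simp only:)
qed

lemma S_clamp:
  assumes "f \<in> S" "0 < c"
  shows "(\<lambda>x. clamp_to c (f x)) \<in> S"
proof -
  have "(\<lambda>x. min c (max 0 (f x)) - min c (max 0 (-1 * f x))) \<in> S"
    by (intro S_minus S_clip S_scale assms)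
  moreover have "min c (max 0 t) - min c (max 0 (-1 * t)) = clamp_to c t" for t
    using assms(2) by (auto simp: min_def max_def)
  ultimately show ?thesis by (simp only:)
qed

text \<open>Again \<open>f\<close> plus the positive part of \<open>g - f\<close>; the bound
  \<open>N\<close> makes the cut at \<open>2 * N\<close> ineffective.\<close>

lemma S_max:
  assumes "f \<in> S" "g \<in> S" "0 < N" "\<And>x. \<bar>f x\<bar> \<le> N" "\<And>x. \<bar>g x\<bar> \<le> N"
  shows "(\<lambda>x. max (f x) (g x)) \<in> S"
proof -
  have "(\<lambda>x. f x + min (2 * N) (max 0 (g x - f x))) \<in> S"
    by (intro S_add S_clip S_minus assms) (use assms(3) in simp)
  moreover have "f x + min (2 * N) (max 0 (g x - f x)) = max (f x) (g x)" for x
    using assms(4,5)[of x] by (auto simp: min_def max_def)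
  ultimately show ?thesis by (simp only:)
qed

text \<open>Truncation at a variable height \<open>w\<close>. Clamping \<open>v\<close> at the
  constant \<open>N\<close> beforehand does not change the result, because \<open>w \<le> N\<close>,
  and brings everything under the rule for maxima of bounded functions.\<close>

lemma S_clamp_fun:
  assumes v: "v \<in> S" and w: "w \<in> S" "0 < N" "\<And>x. 0 \<le> w x" "\<And>x. w x \<le> N"
  shows "(\<lambda>x. max (- w x) (min (v x) (w x))) \<in> S"
proof -
  let ?v = "\<lambda>x. clamp_to N (v x)"
  have v': "(\<lambda>x. -1 * ?v x) \<in> S" by (intro S_scale S_clamp v w)
  have w': "(\<lambda>x. -1 * w x) \<in> S" by (intro S_scale w)
  have b: "\<bar>-1 * ?v x\<bar> \<le> N" for x using clamp_to_abs[of N "v x"] w(2) by simp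
  have bw: "\<bar>-1 * w x\<bar> \<le> N" for x using w(3,4)[of x] by simp
  have 1: "(\<lambda>x. -1 * max (-1 * ?v x) (-1 * w x)) \<in> S"
    by (intro S_scale S_max[OF v' w' w(2) b bw])
  have "\<bar>-1 * max (-1 * ?v x) (-1 * w x)\<bar> \<le> N" for x
    using b[of x] bw[of x] by (auto simp: max_def)
  from S_max[OF w' 1 w(2) bw this]
  have "(\<lambda>x. max (-1 * w x) (-1 * max (-1 * ?v x) (-1 * w x))) \<in> S" .
  moreover have "max (-1 * w x) (-1 * max (-1 * ?v x) (-1 * w x)) = max (- w x) (min (v x) (w x))" for x
    using w(3,4)[of x] by (simp add: min_def max_def)
  ultimately show ?thesis by (simp only:)
qed

text \<open>Slicing a uniform approximation of \<open>u\<close> between the levels 1/3 and 2/3 keeps the exact values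
  where \<open>u\<close> is 0 or 1.\<close>

lemma S_threshold:
  assumes u: "u \<in> Cc E"
  shows "\<exists>\<theta>\<in>S \<inter> Cc E. \<forall>y\<in>E. 0 \<le> \<theta> y \<and> \<theta> y \<le> 1 \<and> (u y = 1 \<longrightarrow> \<theta> y = 1) \<and> (u y = 0 \<longrightarrow> \<theta> y = 0)"
proof -
  obtain g where g: "g \<in> S" "g \<in> Cc E" "\<forall>x\<in>E. \<bar>u x - g x\<bar> < 1/3"
    using S_uniform[OF u, of "1/3"] by auto
  define h :: "real \<Rightarrow> real" where "h t = 3 * (min (2/3) (max 0 t) - min (1/3) (max 0 t))" for t
  have 1: "(\<lambda>x. h (g x)) \<in> S" unfolding h_def by (intro S_scale S_minus S_clip g) simp_all
  have 2: "(\<lambda>x. h (g x)) \<in> Cc E"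
    by (rule Cc_comp[OF g(2), of h]) (auto simp: h_def intro!: continuous_intros)
  have "0 \<le> h t \<and> h t \<le> 1 \<and> (2/3 \<le> t \<longrightarrow> h t = 1) \<and> (t \<le> 1/3 \<longrightarrow> h t = 0)" for t
    by (auto simp: h_def min_def max_def)
  note h = this
  have "0 \<le> h (g y) \<and> h (g y) \<le> 1 \<and> (u y = 1 \<longrightarrow> h (g y) = 1) \<and> (u y = 0 \<longrightarrow> h (g y) = 0)" if y: "y \<in> E" for y
    using h[of "g y"] bspec[OF g(3) y] by auto
  then show ?thesis using 1 2 by (intro bexI[where x = "\<lambda>x. h (g x)"] ballI) simp_all
qed

text \<open>Approximants from \<open>S\<close> form a Cauchy sequence, so completeness gives a limit
  \<open>g\<close> in \<open>S\<close> with \<open>E1 E \<mu> (\<lambda>x. f x - g x) = 0\<close>;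
  the pointwise bound turns this into equality at every point of \<open>E\<close>.\<close>

lemma S_closed:
  assumes f: "H1 f" "L2 \<mu> f" "\<And>x. x \<notin> E \<Longrightarrow> f x = 0"
    and approx: "\<And>e. 0 < e \<Longrightarrow> \<exists>g\<in>S. E1 E \<mu> (\<lambda>x. f x - g x) < e"
  shows "f \<in> S"
proof -
  have "\<exists>g\<in>S. E1 E \<mu> (\<lambda>x. f x - g x) < inverse (real (Suc n))" for n by (rule approx) simp
  then obtain \<sigma> where s: "\<And>n. \<sigma> n \<in> S" "\<And>n. E1 E \<mu> (\<lambda>x. f x - \<sigma> n x) < inverse (real (Suc n))" by metis
  have L2d: "L2 \<mu> (\<lambda>x. a x - b x)" if "L2 \<mu> a" "L2 \<mu> b" for a b
    by (rule L2_dominated[OF _ that]) (use that in \<open>auto simp: L2_def intro: abs_triangle_ineq4\<close>)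
  have tri: "E1 E \<mu> (\<lambda>x. a x - c x) \<le> 2 * E1 E \<mu> (\<lambda>x. b x - a x) + 2 * E1 E \<mu> (\<lambda>x. b x - c x)"
    if "H1 a" "L2 \<mu> a" "H1 b" "L2 \<mu> b" "H1 c" "L2 \<mu> c" for a b c
    by (rule E1_le2) (intro H1_diff L2d that | arith)+
  have tends: "(\<lambda>n. E1 E \<mu> (\<lambda>x. f x - \<sigma> n x)) \<longlonglongrightarrow> 0"
  proof (rule tendsto_sandwich[of "\<lambda>_. 0" _ _ "\<lambda>n. inverse (real (Suc n))"])
    show "\<forall>\<^sub>F n in sequentially. 0 \<le> E1 E \<mu> (\<lambda>x. f x - \<sigma> n x)" by (intro always_eventually allI E1_nonneg)
    show "\<forall>\<^sub>F n in sequentially. E1 E \<mu> (\<lambda>x. f x - \<sigma> n x) \<le> inverse (real (Suc n))"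
      by (intro always_eventually allI less_imp_le s(2))
  qed (rule tendsto_const LIMSEQ_inverse_real_of_nat)+
  have "\<exists>g\<in>S. (\<lambda>n. E1 E \<mu> (\<lambda>x. \<sigma> n x - g x)) \<longlonglongrightarrow> 0"
  proof (rule S_complete[OF s(1)])
    fix e :: real assume e: "0 < e"
    have "\<forall>\<^sub>F n in sequentially. E1 E \<mu> (\<lambda>x. f x - \<sigma> n x) < e / 4"
      using tends by (rule order_tendstoD(2)) (use e in simp)
    then obtain N where N: "\<And>n. N \<le> n \<Longrightarrow> E1 E \<mu> (\<lambda>x. f x - \<sigma> n x) < e / 4"
      by (auto simp: eventually_sequentially)
    have "E1 E \<mu> (\<lambda>x. \<sigma> n x - \<sigma> m x) < e" if "N \<le> m" "N \<le> n" for m n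
      using tri[OF S_H1[OF s(1)] S_L2[OF s(1)] f(1,2) S_H1[OF s(1)] S_L2[OF s(1)], of n m] N[OF that(1)] N[OF that(2)]
      by linarith
    then show "\<exists>N. \<forall>m\<ge>N. \<forall>n\<ge>N. E1 E \<mu> (\<lambda>x. \<sigma> n x - \<sigma> m x) < e" by blast
  qed
  then obtain g where g: "g \<in> S" "(\<lambda>n. E1 E \<mu> (\<lambda>x. \<sigma> n x - g x)) \<longlonglongrightarrow> 0" by blast
  note gH = S_H1[OF g(1)] S_L2[OF g(1)]
  have swap: "E1 E \<mu> (\<lambda>x. \<sigma> n x - f x) = E1 E \<mu> (\<lambda>x. f x - \<sigma> n x)" for n
    using E1_scale[OF H1_diff[OF f(1) S_H1[OF s(1)]], of "-1" n] by (simp add: power2_eq_square)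
  have lim: "(\<lambda>n. 2 * E1 E \<mu> (\<lambda>x. f x - \<sigma> n x) + 2 * E1 E \<mu> (\<lambda>x. \<sigma> n x - g x)) \<longlonglongrightarrow> 2 * 0 + 2 * 0"
    by (intro tendsto_add tendsto_mult tendsto_const tends g(2))
  have "E1 E \<mu> (\<lambda>x. f x - g x) \<le> 2 * 0 + 2 * 0"
  proof (rule LIMSEQ_le_const[OF lim], intro exI[of _ 0] allI impI)
    fix n show "E1 E \<mu> (\<lambda>x. f x - g x) \<le> 2 * E1 E \<mu> (\<lambda>x. f x - \<sigma> n x) + 2 * E1 E \<mu> (\<lambda>x. \<sigma> n x - g x)"
      using tri[OF f(1,2) S_H1[OF s(1)] S_L2[OF s(1)] gH, of n] swap[of n] by linarith
  qed
  then have z: "E1 E \<mu> (\<lambda>x. f x - g x) = 0" using E1_nonneg[of "\<lambda>x. f x - g x"] by linarith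
  have "f x = g x" for x
  proof (cases "x \<in> E")
    case True
    obtain C where "\<And>f. H1 f \<Longrightarrow> L2 \<mu> f \<Longrightarrow> (f x)\<^sup>2 \<le> C * E1 E \<mu> f" by (rule point_bound[OF True]) (rule that)
    from this[OF H1_diff[OF f(1) gH(1)] L2d[OF f(2) gH(2)]] have "(f x - g x)\<^sup>2 \<le> 0" unfolding z by simp
    then show ?thesis by simp
  qed (simp add: f(3) S_off[OF g(1)])
  then have "f = g" by (rule ext)
  then show ?thesis using g(1) by simp
qed

end

text \<open>The set \<open>E \<inter> {x..y}\<close> is closed and again in the class K, and there
  \<open>k\<close> and \<open>k'\<close> are densities of one function; uniqueness is applied to
  this smaller set.\<close>

lemma der_local:
  assumes xy: "x \<in> E" "y \<in> E" "x < y" and eq: "\<And>t. t \<in> E \<Longrightarrow> x \<le> t \<Longrightarrow> t \<le> y \<Longrightarrow> f t = g t"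
    and pr: "primitive E f k" "primitive E g k'"
  shows "AE t in lborel. t \<in> E \<inter> {x..y} \<longrightarrow> k t = k' t"
proof -
  let ?E = "E \<inter> {x..y}"
  have "closed ?E" using compact_Int[OF xy(1,2)] by (rule compact_imp_closed)
  then have cl: "closure ?E = ?E" by (rule closure_closed)
  have "lE ?E < ereal y" unfolding lE_less_iff using xy by (intro bexI[of _ x]) simp_all
  also have "ereal y \<le> rE ?E" by (rule rE_ge) (use xy in simp)
  finally have "class_K ?E" unfolding class_K_def cl by blast
  then interpret loc: classK ?E by unfold_locales
  have "primitive ?E f k" using pr(1) unfolding primitive_def by blast
  moreover have "primitive ?E f k'" using pr(2) eq unfolding primitive_def by auto
  ultimately show ?thesis by (rule loc.primitive_unique)
qed

end

definition trapezoid :: "real \<Rightarrow> real \<Rightarrow> real \<Rightarrow> real \<Rightarrow> real \<Rightarrow> real" where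
  "trapezoid p q p' q' t = max 0 (min 1 (min ((t - p) / (q - p)) ((q' - t) / (q' - p'))))"

lemma trapezoid:
  assumes "p < q" "q \<le> p'" "p' < q'"
  shows "continuous_on A (trapezoid p q p' q')" "t \<le> p \<Longrightarrow> trapezoid p q p' q' t = 0" "q' \<le> t \<Longrightarrow> trapezoid p q p' q' t = 0"
    "q \<le> t \<Longrightarrow> t \<le> p' \<Longrightarrow> trapezoid p q p' q' t = 1"
proof -
  show "continuous_on A (trapezoid p q p' q')"
    unfolding trapezoid_def using assms by (intro continuous_intros) auto
  show "trapezoid p q p' q' t = 0" if "t \<le> p"
  proof -
    have "(t - p) / (q - p) \<le> 0" using that assms by (intro divide_nonpos_pos) auto
    then show ?thesis by (simp add: trapezoid_def)
  qed
  show "trapezoid p q p' q' t = 0" if "q' \<le> t"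
  proof -
    have "(q' - t) / (q' - p') \<le> 0" using that assms by (intro divide_nonpos_pos) auto
    then show ?thesis by (simp add: trapezoid_def)
  qed
  show "trapezoid p q p' q' t = 1" if "q \<le> t" "t \<le> p'"
  proof -
    have "1 \<le> (t - p) / (q - p)" "1 \<le> (q' - t) / (q' - p')" using that assms by (simp_all add: pos_le_divide_eq)
    then show ?thesis by (simp add: trapezoid_def)
  qed
qed

context radonK
begin

section \<open>Flat parts and gluing\<close>

lemma trapezoid_Cc:
  assumes "p < q" "q \<le> p'" "p' < q'" "compact (E \<inter> {p..q'})"
  shows "(\<lambda>t. if t \<in> E then trapezoid p q p' q' t else 0) \<in> Cc E"
proof -
  have "continuous_on E (\<lambda>t. if t \<in> E then trapezoid p q p' q' t else 0)"
    by (rule continuous_on_eq[OF trapezoid(1)[OF assms(1-3)]]) simp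
  moreover have "(if t \<in> E then trapezoid p q p' q' t else 0) = 0" if "t \<in> E - (E \<inter> {p..q'})" for t
  proof -
    have "t \<le> p \<or> q' \<le> t" using that by auto
    then show ?thesis using trapezoid(2,3)[OF assms(1-3), of t] by auto
  qed
  moreover have "E \<inter> {p..q'} \<subseteq> E" by blast
  ultimately show ?thesis
    unfolding Cc_def using assms(4) by (intro CollectI conjI exI[of _ "E \<inter> {p..q'}"] ballI) simp_all
qed

lemma L2_diff: "L2 \<mu> a \<Longrightarrow> L2 \<mu> b \<Longrightarrow> L2 \<mu> (\<lambda>x. a x - b x)"
  by (rule L2_dominated[of _ a b]) (auto simp: L2_def intro: abs_triangle_ineq4)

lemma der_flat:
  assumes uv: "{u..v} \<subseteq> E" and f: "H1 f" and flat: "\<And>t. u \<le> t \<Longrightarrow> t \<le> v \<Longrightarrow> f t = c"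
  shows "AE t in lborel. t \<in> {u..v} \<longrightarrow> der f t = 0"
proof (cases "u < v")
  case True
  have pz: "primitive E (\<lambda>_. c) (\<lambda>_. 0)" by (simp add: primitive_def set_integrable_def)
  have "AE t in lborel. t \<in> E \<inter> {u..v} \<longrightarrow> der f t = 0"
    by (rule der_local[OF _ _ True _ der_props(2)[OF f] pz]) (use uv True flat in auto)
  then show ?thesis by (rule AE_mp) (intro AE_I2 impI, use uv in blast)
next
  case False
  have "AE t in lborel. t \<noteq> u" by (rule AE_lborel_singleton)
  then show ?thesis by (rule AE_mp) (rule AE_I2, use False in auto)
qed

text \<open>On \<open>C\<close> the derivative of \<open>f\<close> is bounded by that of
  \<open>g n - f\<close>, so the integral of its square over \<open>C\<close> is at most
  \<open>2 * E1 E \<mu> (\<lambda>x. g n x - f x)\<close>, which tends to 0.\<close>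

lemma flat_closed:
  assumes H: "H1 f" "\<And>n. H1 (g n)"
    and lim: "(\<lambda>n. E1 E \<mu> (\<lambda>x. g n x - f x)) \<longlonglongrightarrow> 0" and C: "C \<in> sets borel"
    and flat: "\<And>n. AE t in lborel. t \<in> C \<longrightarrow> der (g n) t = 0"
  shows "AE t in lborel. t \<in> C \<longrightarrow> der f t = 0"
proof -
  have i: "integrable lborel (\<lambda>t. indicator C t * (der f t)\<^sup>2)"
    using integrable_mult_indicator[OF _ sqintD(2)[OF der_props(1)[OF H(1)]], of C] C by simp
  have le: "(\<integral>t. indicator C t * (der f t)\<^sup>2 \<partial>lborel) \<le> 2 * E1 E \<mu> (\<lambda>x. g n x - f x)" for n
  proof -
    have d: "H1 (\<lambda>x. g n x - f x)" by (intro H1_diff H)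
    have "AE t in lborel. \<bar>der f t\<bar> \<le> \<bar>der (\<lambda>x. g n x - f x) t\<bar> + \<bar>der (g n) t\<bar>"
      by (rule der_abs_le[OF d H(2) H(1)]) arith
    with flat[of n] have ae: "AE t in lborel. indicator C t * (der f t)\<^sup>2 \<le> (der (\<lambda>x. g n x - f x) t)\<^sup>2"
    proof eventually_elim
      case (elim t)
      show ?case
      proof (cases "t \<in> C")
        case True
        then have "\<bar>der f t\<bar> \<le> \<bar>der (\<lambda>x. g n x - f x) t\<bar>" using elim by simp
        then show ?thesis using True by (simp only: abs_le_square_iff indicator_simps mult_1_left)
      qed simp
    qed
    have "(\<integral>t. indicator C t * (der f t)\<^sup>2 \<partial>lborel) \<le> (\<integral>t. (der (\<lambda>x. g n x - f x) t)\<^sup>2 \<partial>lborel)"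
      by (rule integral_mono_AE[OF i sqintD(2)[OF der_props(1)[OF d]] ae])
    also have "\<dots> = 2 * form E (\<lambda>x. g n x - f x) (\<lambda>x. g n x - f x)" using form_self[OF d] by simp
    also have "\<dots> \<le> 2 * E1 E \<mu> (\<lambda>x. g n x - f x)" using form_le_E1 by simp
    finally show ?thesis .
  qed
  have "(\<lambda>n. 2 * E1 E \<mu> (\<lambda>x. g n x - f x)) \<longlonglongrightarrow> 2 * 0" by (intro tendsto_mult tendsto_const lim)
  then have "(\<integral>t. indicator C t * (der f t)\<^sup>2 \<partial>lborel) \<le> 2 * 0"
    by (rule LIMSEQ_le_const) (use le in blast)
  moreover have nn: "AE t in lborel. 0 \<le> indicator C t * (der f t)\<^sup>2" by (rule AE_I2) simp
  ultimately have "(\<integral>t. indicator C t * (der f t)\<^sup>2 \<partial>lborel) = 0"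
    using integral_nonneg_AE[OF nn] by linarith
  then have "AE t in lborel. indicator C t * (der f t)\<^sup>2 = 0"
    using integral_nonneg_eq_0_iff_AE[OF i nn] by blast
  then show ?thesis
  proof (rule AE_mp, intro AE_I2 impI)
    fix t assume "indicator C t * (der f t)\<^sup>2 = 0" "t \<in> C"
    then show "der f t = 0" by simp
  qed
qed

lemma clamp_fun_contract:
  "\<bar>max (- b) (min a b) - max (- b') (min a' b')\<bar> \<le> \<bar>a - a'\<bar> + \<bar>b - (b'::real)\<bar>"
  by (simp add: min_def max_def abs_if)

text \<open>Combines the bound at the single point \<open>c\<close> with the estimate of increments
  over a distance of at most \<open>d - c\<close>.\<close>

lemma sup_bound:
  assumes cd: "c \<in> E" "d \<in> E" "c \<le> d"
  obtains C where "0 \<le> C" "\<And>f x. H1 f \<Longrightarrow> L2 \<mu> f \<Longrightarrow> x \<in> E \<Longrightarrow> c \<le> x \<Longrightarrow> x \<le> d \<Longrightarrow> (f x)\<^sup>2 \<le> C * E1 E \<mu> f"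
proof -
  obtain C where C: "0 \<le> C" "\<And>f. H1 f \<Longrightarrow> L2 \<mu> f \<Longrightarrow> (f c)\<^sup>2 \<le> C * E1 E \<mu> f" by (rule point_bound[OF cd(1)]) (rule that)
  show thesis
  proof (rule that[of "2 * C + 4 * (d - c)"])
    show "0 \<le> 2 * C + 4 * (d - c)" using C(1) cd(3) by simp
    fix f x assume f: "H1 f" "L2 \<mu> f" and x: "x \<in> E" "c \<le> x" "x \<le> d"
    have "(f x - f c)\<^sup>2 \<le> \<bar>x - c\<bar> * (2 * form E f f)" by (rule H1_increment[OF f(1) cd(1) x(1)])
    also have "\<dots> \<le> (d - c) * (2 * E1 E \<mu> f)"
      using x form_le_E1[of f] form_nonneg[of f] by (intro mult_mono) auto
    finally have 1: "(f x - f c)\<^sup>2 \<le> (d - c) * (2 * E1 E \<mu> f)" .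
    have "(f x)\<^sup>2 \<le> 2 * (f c)\<^sup>2 + 2 * (f x - f c)\<^sup>2"
      using zero_le_power2[of "2 * f c - f x"] by (simp add: power2_eq_square algebra_simps)
    also have "\<dots> \<le> 2 * (C * E1 E \<mu> f) + 2 * ((d - c) * (2 * E1 E \<mu> f))"
      using 1 C(2)[OF f] by linarith
    also have "\<dots> = (2 * C + 4 * (d - c)) * E1 E \<mu> f" by (simp add: algebra_simps)
    finally show "(f x)\<^sup>2 \<le> (2 * C + 4 * (d - c)) * E1 E \<mu> f" .
  qed
qed

text \<open>Gluing: \<open>f\<close> is kept on \<open>[c1,d1]\<close>, and off \<open>[c,d]\<close> it is replaced by a compactly supported approximation
  \<open>\<phi>\<close>; in between one interpolates by truncating \<open>f - \<phi>\<close> at height \<open>\<delta> \<psi>\<close>, which stays in \<open>S\<close>.\<close>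

lemma glue_core:
  assumes S: "fukushima_subspace E \<mu> S" and cd: "{c..d} \<subseteq> E" "c < c1" "c1 < d1" "d1 < d"
    and f: "f \<in> S" and e: "0 < e"
  shows "\<exists>h\<in>S \<inter> Cc E. E1 E \<mu> (\<lambda>x. f x - h x) < e \<and> (\<forall>x. c1 \<le> x \<and> x \<le> d1 \<longrightarrow> h x = f x)"
proof -
  note SH = S_H1[OF S] and SL = S_L2[OF S]
  have cdE: "c \<in> E" "d \<in> E" "c \<le> d" using cd by auto
  obtain C where C: "0 \<le> C" "\<And>f x. H1 f \<Longrightarrow> L2 \<mu> f \<Longrightarrow> x \<in> E \<Longrightarrow> c \<le> x \<Longrightarrow> x \<le> d \<Longrightarrow> (f x)\<^sup>2 \<le> C * E1 E \<mu> f"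
    by (rule sup_bound[OF cdE]) (rule that)
  let ?u = "\<lambda>t. if t \<in> E then trapezoid c c1 d1 d t else 0"
  have tr: "c < c1" "c1 \<le> d1" "d1 < d" using cd by auto
  have "?u \<in> Cc E" by (rule trapezoid_Cc[OF tr compact_Int[OF cdE(1,2)]])
  from S_threshold[OF S this] obtain \<psi> where psi: "\<psi> \<in> S" "\<psi> \<in> Cc E"
     "\<forall>y\<in>E. 0 \<le> \<psi> y \<and> \<psi> y \<le> 1 \<and> (?u y = 1 \<longrightarrow> \<psi> y = 1) \<and> (?u y = 0 \<longrightarrow> \<psi> y = 0)"
    by blast
  have p01: "0 \<le> \<psi> x" "\<psi> x \<le> 1" for x
    using bspec[OF psi(3), of x] S_off[OF S psi(1), of x] by (cases "x \<in> E"; simp)+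
  have p1: "\<psi> x = 1" if "c1 \<le> x" "x \<le> d1" for x
  proof -
    have "x \<in> E" using that cd by auto
    then show ?thesis using bspec[OF psi(3) \<open>x \<in> E\<close>] trapezoid(4)[OF tr that] by simp
  qed
  have p0: "\<psi> x = 0" if "x \<notin> {c..d}" for x
  proof (cases "x \<in> E")
    case True
    have "trapezoid c c1 d1 d x = 0" using trapezoid(2,3)[OF tr, of x] that by auto
    then show ?thesis using bspec[OF psi(3) True] True by simp
  qed (rule S_off[OF S psi(1)])
  \<comment> \<open>Two applications of \<open>E1_le2\<close> bound the total error by
    \<open>2 * e1 + 2 * (2 * e1 + 2 * C * e1 * E1 E \<mu> \<psi>)\<close>, that is
    \<open>a * e1\<close>.\<close>
  define a where "a = 6 + 4 * C * E1 E \<mu> \<psi>"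
  have a: "0 < a" unfolding a_def using C(1) E1_nonneg[of \<psi>] by (intro add_pos_nonneg mult_nonneg_nonneg) auto
  obtain \<phi> where phi: "\<phi> \<in> S" "\<phi> \<in> Cc E" "E1 E \<mu> (\<lambda>x. f x - \<phi> x) < e / a"
    using S_core[OF S f, of "e / a"] e a by auto
  let ?v = "\<lambda>x. f x - \<phi> x"
  define e1 where "e1 = E1 E \<mu> ?v"
  have e10: "0 \<le> e1" unfolding e1_def by (rule E1_nonneg)
  have v: "?v \<in> S" by (rule S_minus[OF S f phi(1)])
  \<comment> \<open>The uniform bound for \<open>f - \<phi>\<close> on \<open>[c, d]\<close>. Where
    \<open>\<psi>\<close> is 1 the truncation at height \<open>\<delta> * \<psi>\<close> therefore
    leaves \<open>f - \<phi>\<close> unchanged, while the energy of \<open>\<delta> * \<psi>\<close>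
    is still proportional to \<open>e1\<close>.\<close>
  define \<delta> where "\<delta> = sqrt (C * e1)"
  have d0: "0 \<le> \<delta>" "\<delta>\<^sup>2 = C * e1" unfolding \<delta>_def using C(1) e10 by simp_all
  have vb: "\<bar>?v x\<bar> \<le> \<delta>" if "c \<le> x" "x \<le> d" for x
  proof -
    have "x \<in> E" using that cd by auto
    from C(2)[OF SH[OF v] SL[OF v] this that] have "(?v x)\<^sup>2 \<le> C * e1" by (simp add: e1_def)
    then show ?thesis unfolding \<delta>_def using real_sqrt_le_mono by fastforce
  qed
  let ?w = "\<lambda>x. \<delta> * \<psi> x"
  have w: "?w \<in> S" by (rule S_scale[OF S psi(1)])
  let ?z = "\<lambda>x. max (- ?w x) (min (?v x) (?w x))"
  have z: "?z \<in> S"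
  proof (rule S_clamp_fun[OF S v w, of "\<delta> + 1"])
    show "0 < \<delta> + 1" using d0 by linarith
    show "0 \<le> ?w x" for x by (rule mult_nonneg_nonneg[OF d0(1) p01(1)])
    show "?w x \<le> \<delta> + 1" for x using mult_left_mono[OF p01(2)[of x] d0(1)] by simp
  qed
  have zC: "?z \<in> Cc E"
  proof -
    have "?z x = 0" if "x \<notin> {c..d}" for x using p0[OF that] by simp
    moreover have "compact {c..d}" by simp
    ultimately show ?thesis
      unfolding Cc_def using H1_continuous[OF SH[OF z]] S_off[OF S z] cd(1) by blast
  qed
  let ?h = "\<lambda>x. \<phi> x + ?z x"
  have h: "?h \<in> S \<inter> Cc E" using S_add[OF S phi(1) z] Cc_add[OF phi(2) zC] by blast
  have Ez: "E1 E \<mu> ?z \<le> 2 * e1 + 2 * E1 E \<mu> ?w"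
    unfolding e1_def
  proof (rule E1_le2)
    show "\<bar>?z x - ?z y\<bar> \<le> \<bar>?v x - ?v y\<bar> + \<bar>?w x - ?w y\<bar>" for x y by (rule clamp_fun_contract)
    show "\<bar>?z x\<bar> \<le> \<bar>?v x\<bar> + \<bar>?w x\<bar>" for x by (simp add: min_def max_def abs_if)
  qed (intro SH SL v w z)+
  have Ew: "E1 E \<mu> ?w = C * e1 * E1 E \<mu> \<psi>"
    using E1_scale[OF SH[OF psi(1)], of \<delta>] d0(2) by simp
  have Er: "E1 E \<mu> (\<lambda>x. ?v x - ?z x) \<le> 2 * e1 + 2 * E1 E \<mu> ?z"
    unfolding e1_def
    by (rule E1_le2) (intro SH SL v z S_minus[OF S v z] | arith)+
  have "E1 E \<mu> (\<lambda>x. ?v x - ?z x) \<le> 2 * e1 + 2 * (2 * e1 + 2 * (C * e1 * E1 E \<mu> \<psi>))"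
  proof (rule order_trans[OF Er])
    have "E1 E \<mu> ?z \<le> 2 * e1 + 2 * (C * e1 * E1 E \<mu> \<psi>)" using Ez unfolding Ew .
    then show "2 * e1 + 2 * E1 E \<mu> ?z \<le> 2 * e1 + 2 * (2 * e1 + 2 * (C * e1 * E1 E \<mu> \<psi>))"
      by (intro add_left_mono mult_left_mono) simp_all
  qed
  also have "\<dots> = a * e1" by (simp add: a_def algebra_simps)
  also have "\<dots> < e" using phi(3) a by (simp add: e1_def pos_less_divide_eq mult.commute)
  finally have "E1 E \<mu> (\<lambda>x. f x - ?h x) < e" by (simp only: diff_diff_add)
  moreover have "?h x = f x" if "c1 \<le> x" "x \<le> d1" for x
  proof -
    have "\<bar>?v x\<bar> \<le> \<delta>" by (rule vb) (use that cd in auto)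
    then show ?thesis using p1[OF that] by (simp add: min_def max_def abs_if split: if_splits)
  qed
  ultimately show ?thesis using h by (intro bexI[where x = ?h] conjI allI impI) blast+
qed

text \<open>Linear operations, contractions and limits preserve flatness by comparison of
  derivatives. For the core, \<open>glue_core\<close> provides approximations equal to
  \<open>f\<close> on an interval containing \<open>C\<close>; the bumps have their flanks in
  intervals disjoint from \<open>C\<close>.\<close>

lemma flat_subspace:
  assumes S: "fukushima_subspace E \<mu> S" and cd: "{c..d} \<subseteq> E" "c < c1" "c1 < d1" "d1 < d"
    and C: "closed C" "C \<subseteq> {c1..d1}" "C \<inter> \<rat> = {}"
  shows "fukushima_subspace E \<mu> {f\<in>S. AE t in lborel. t \<in> C \<longrightarrow> der f t = 0}" (is "fukushima_subspace E \<mu> ?S")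
proof -
  note SH = S_H1[OF S] and SL = S_L2[OF S]
  have CE: "C \<subseteq> E" using C(2) cd by fastforce
  have "regular_dirichlet E \<mu> ?S"
  proof (rule regular_dirichletI)
    fix f assume "f \<in> ?S"
    then have "f \<in> S" by simp
    then show "(\<forall>x. x \<notin> E \<longrightarrow> f x = 0) \<and> L2 \<mu> f \<and> H1 f"
      using S_off[OF S] SL SH by blast
  next
    have "primitive E (\<lambda>_. 0) (\<lambda>_. 0)" by (simp add: primitive_def set_integrable_def)
    from primitive_unique[OF der_props(2)[OF SH[OF S_zero[OF S]]] this]
    have "AE t in lborel. t \<in> C \<longrightarrow> der (\<lambda>_. 0) t = 0"
      by (rule AE_mp) (intro AE_I2 impI, use CE in blast)
    then show "(\<lambda>_. 0) \<in> ?S" using S_zero[OF S] by simp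
  next
    fix f g assume "f \<in> ?S" "g \<in> ?S"
    then have f: "f \<in> S" "AE t in lborel. t \<in> C \<longrightarrow> der f t = 0" and g: "g \<in> S" "AE t in lborel. t \<in> C \<longrightarrow> der g t = 0"
      by simp_all
    have fg: "(\<lambda>x. f x + g x) \<in> S" by (rule S_add[OF S f(1) g(1)])
    have "AE t in lborel. \<bar>der (\<lambda>x. f x + g x) t\<bar> \<le> \<bar>der f t\<bar> + \<bar>der g t\<bar>"
      by (rule der_abs_le[OF SH[OF f(1)] SH[OF g(1)] SH[OF fg]]) arith
    with f(2) g(2) have "AE t in lborel. t \<in> C \<longrightarrow> der (\<lambda>x. f x + g x) t = 0"
      by eventually_elim auto
    then show "(\<lambda>x. f x + g x) \<in> ?S" using fg by simp
  next
    fix f and c :: real assume "f \<in> ?S"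
    then have f: "f \<in> S" "AE t in lborel. t \<in> C \<longrightarrow> der f t = 0" by simp_all
    have "AE t in lborel. der (\<lambda>x. c * f x - 0 * f x) t = c * der f t - 0 * der f t"
      by (rule der_linear[OF SH[OF f(1)] SH[OF f(1)]])
    with f(2) have "AE t in lborel. t \<in> C \<longrightarrow> der (\<lambda>x. c * f x) t = 0"
      by eventually_elim auto
    then show "(\<lambda>x. c * f x) \<in> ?S" using S_scale[OF S f(1)] by simp
  next
    fix f assume "f \<in> ?S"
    then have f: "f \<in> S" "AE t in lborel. t \<in> C \<longrightarrow> der f t = 0" by simp_all
    have u: "unit_part f \<in> S" by (rule S_unit[OF S f(1)])
    have "AE t in lborel. \<bar>der (unit_part f) t\<bar> \<le> \<bar>der f t\<bar>"
      by (rule der_abs_le1[OF SH[OF f(1)] SH[OF u]]) (simp add: min_def max_def abs_if)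
    with f(2) have "AE t in lborel. t \<in> C \<longrightarrow> der (unit_part f) t = 0"
      by eventually_elim auto
    then show "unit_part f \<in> ?S" using u by simp
  next
    fix fs :: "nat \<Rightarrow> real \<Rightarrow> real"
    assume fs: "\<And>n. fs n \<in> ?S" and cau: "\<And>\<epsilon>. \<epsilon> > 0 \<Longrightarrow> \<exists>N. \<forall>m\<ge>N. \<forall>n\<ge>N. E1 E \<mu> (\<lambda>x. fs n x - fs m x) < \<epsilon>"
    have fsS: "fs n \<in> S" and flat: "AE t in lborel. t \<in> C \<longrightarrow> der (fs n) t = 0" for n using fs[of n] by simp_all
    obtain f where f: "f \<in> S" "(\<lambda>n. E1 E \<mu> (\<lambda>x. fs n x - f x)) \<longlonglongrightarrow> 0"
      using S_complete[OF S fsS cau] by blast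
    have "AE t in lborel. t \<in> C \<longrightarrow> der f t = 0"
      by (rule flat_closed[OF SH[OF f(1)] SH[OF fsS] f(2) borel_closed[OF C(1)] flat])
    then show "\<exists>f\<in>?S. (\<lambda>n. E1 E \<mu> (\<lambda>x. fs n x - f x)) \<longlonglongrightarrow> 0" using f by blast
  next
    fix f and e :: real assume "f \<in> ?S" and e: "0 < e"
    then have f: "f \<in> S" "AE t in lborel. t \<in> C \<longrightarrow> der f t = 0" by simp_all
    obtain h where h: "h \<in> S" "h \<in> Cc E" "E1 E \<mu> (\<lambda>x. f x - h x) < e" "\<forall>x. c1 \<le> x \<and> x \<le> d1 \<longrightarrow> h x = f x"
      using glue_core[OF S cd f(1) e] by blast
    have "AE t in lborel. t \<in> E \<inter> {c1..d1} \<longrightarrow> der h t = der f t"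
      by (rule der_local[OF _ _ cd(3) _ der_props(2)[OF SH[OF h(1)]] der_props(2)[OF SH[OF f(1)]]]) (use h(4) cd in auto)
    with f(2) have "AE t in lborel. t \<in> C \<longrightarrow> der h t = 0"
      by eventually_elim (use C(2) CE in auto)
    then show "\<exists>g\<in>?S \<inter> Cc E. E1 E \<mu> (\<lambda>x. f x - g x) < e" using h by blast
  next
    fix x b assume x: "x \<in> E" and b: "(0::real) < b"
    obtain b0 where b0: "0 < b0" "compact (E \<inter> {x-b0..x+b0})" by (rule locally_compact_E[OF x]) (rule that)
    \<comment> \<open>\<open>b\<close> is the prescribed radius of the bump, while \<open>b0\<close>
      guarantees a compact support within \<open>E\<close>.\<close>
    define \<delta> where "\<delta> = min b b0"
    have \<delta>: "0 < \<delta>" "\<delta> \<le> b" "\<delta> \<le> b0" using b b0 by (auto simp: \<delta>_def)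
    \<comment> \<open>A rational point of the interval is outside the closed set \<open>C\<close>,
      together with a neighbourhood.\<close>
    have free: "\<exists>p q. u < p \<and> p < q \<and> q < v \<and> {p..q} \<inter> C = {}" if uv: "u < v" for u v :: real
    proof -
      obtain r where r: "r \<in> \<rat>" "u < r" "r < v" using Rats_dense_in_real[OF uv] by blast
      have "open ({u<..<v} - C)" using C(1) by (intro open_Diff) auto
      moreover have "r \<in> {u<..<v} - C" using r C(3) by auto
      ultimately obtain e where e: "0 < e" "cball r e \<subseteq> {u<..<v} - C"
        unfolding open_contains_cball by blast
      have sub: "{r..r+e} \<subseteq> {u<..<v} - C" using e(2) by (force simp: dist_real_def)
      moreover have "r + e \<in> {r..r+e}" using e(1) by simp
      ultimately have "r + e \<in> {u<..<v} - C" by (rule subsetD)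
      then have "u < r \<and> r < r + e \<and> r + e < v \<and> {r..r+e} \<inter> C = {}"
        using sub r e(1) by auto
      then show ?thesis by blast
    qed
    obtain p q where pq: "x - \<delta> < p" "p < q" "q < x" "{p..q} \<inter> C = {}" using free[of "x-\<delta>" x] \<delta> by auto
    obtain p' q' where pq': "x < p'" "p' < q'" "q' < x + \<delta>" "{p'..q'} \<inter> C = {}" using free[of x "x+\<delta>"] \<delta> by auto
    have le: "p < q" "q \<le> p'" "p' < q'" using pq pq' by auto
    have "E \<inter> {p..q'} = E \<inter> {x-b0..x+b0} \<inter> {p..q'}" using pq pq' \<delta> by auto
    then have "compact (E \<inter> {p..q'})" using compact_Int_closed[OF b0(2), of "{p..q'}"] by simp
    from S_threshold[OF S trapezoid_Cc[OF le this]]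
    obtain \<theta> where th: "\<theta> \<in> S" "\<theta> \<in> Cc E" and "\<forall>y\<in>E. 0 \<le> \<theta> y \<and> \<theta> y \<le> 1 \<and>
       ((if y \<in> E then trapezoid p q p' q' y else 0) = 1 \<longrightarrow> \<theta> y = 1) \<and> ((if y \<in> E then trapezoid p q p' q' y else 0) = 0 \<longrightarrow> \<theta> y = 0)"
      by blast
    then have th': "0 \<le> \<theta> y" "\<theta> y \<le> 1" "trapezoid p q p' q' y = 1 \<Longrightarrow> \<theta> y = 1" "trapezoid p q p' q' y = 0 \<Longrightarrow> \<theta> y = 0"
      if "y \<in> E" for y using that by (metis (full_types))+
    have t1: "\<theta> y = 1" if "y \<in> E" "q \<le> y" "y \<le> p'" for y using th'(3)[OF that(1)] trapezoid(4)[OF le that(2,3)] by simp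
    have t0: "\<theta> y = 0" if "y \<in> E" "y \<le> p \<or> q' \<le> y" for y
      using th'(4)[OF that(1)] trapezoid(2,3)[OF le, of y] that(2) by blast
    have cdE: "t \<in> E" if "c \<le> t" "t \<le> d" for t using that cd(1) by auto
    \<comment> \<open>The three parts of \<open>[c, d]\<close> on which \<open>\<theta>\<close> is
      constant; together they cover \<open>C\<close>. The minima and maxima allow for flanks that
      are partly or wholly outside \<open>[c, d]\<close>, and reversed intervals are
      harmless.\<close>
    have f1: "AE t in lborel. t \<in> {c..min p d} \<longrightarrow> der \<theta> t = 0"
      by (rule der_flat[OF _ SH[OF th(1)]]) (use cdE t0 in auto)
    have f2: "AE t in lborel. t \<in> {max q c..min p' d} \<longrightarrow> der \<theta> t = 0"
      by (rule der_flat[OF _ SH[OF th(1)]]) (use cdE t1 in auto)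
    have f3: "AE t in lborel. t \<in> {max q' c..d} \<longrightarrow> der \<theta> t = 0"
      by (rule der_flat[OF _ SH[OF th(1)]]) (use cdE t0 in auto)
    have flat: "AE t in lborel. t \<in> C \<longrightarrow> der \<theta> t = 0"
      using f1 f2 f3
    proof eventually_elim
      case (elim t)
      show ?case
      proof
        assume t: "t \<in> C"
        then have "c \<le> t" "t \<le> d" using C(2) cd by auto
        moreover have "t \<notin> {p..q}" "t \<notin> {p'..q'}" using t pq(4) pq'(4) by blast+
        then have "t < p \<or> (q < t \<and> t < p') \<or> q' < t" by auto
        ultimately show "der \<theta> t = 0" using elim by auto
      qed
    qed
    show "\<exists>\<theta>\<in>?S \<inter> Cc E. \<exists>\<eta>>0. \<forall>y\<in>E. 0 \<le> \<theta> y \<and> \<theta> y \<le> 1 \<and>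
       (\<bar>y - x\<bar> < \<eta> \<longrightarrow> \<theta> y = 1) \<and> (b \<le> \<bar>y - x\<bar> \<longrightarrow> \<theta> y = 0)"
    proof (intro bexI[of _ \<theta>] exI[of _ "min (x - q) (p' - x)"] conjI ballI impI)
      show "\<theta> \<in> ?S \<inter> Cc E" using th flat by simp
      show "0 < min (x - q) (p' - x)" using pq pq' by simp
      fix y assume y: "y \<in> E"
      show "0 \<le> \<theta> y" "\<theta> y \<le> 1" using th'(1,2)[OF y] .
      show "\<theta> y = 1" if "\<bar>y - x\<bar> < min (x - q) (p' - x)"
        by (rule t1[OF y]) (use that in \<open>auto simp: abs_less_iff\<close>)
      show "\<theta> y = 0" if "b \<le> \<bar>y - x\<bar>"
        by (rule t0[OF y]) (use that pq pq' \<delta> in arith)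
    qed
  qed
  moreover have "?S \<subseteq> F_space E \<mu>" using S_F[OF S] by blast
  ultimately show ?thesis by (simp add: fukushima_subspace_def)
qed

text \<open>A function \<open>g\<close> in \<open>S\<close> rises from 0 at \<open>c1\<close> to 1
  at \<open>d1\<close>, so its derivative is nonzero on a set of positive measure in between. The
  open set \<open>U\<close> around the rationals has smaller measure than that, so \<open>g\<close>
  is not flat on the rest and the flat subspace is strictly smaller.\<close>

lemma not_minimal:
  assumes int: "interior E \<noteq> {}" and S: "fukushima_subspace E \<mu> S"
  shows "\<not> minimal_fukushima E \<mu> S"
proof -
  note SH = S_H1[OF S]
  obtain x0 where "x0 \<in> interior E" using int by blast
  then obtain e where "0 < e" "cball x0 e \<subseteq> E" unfolding mem_interior_cball by blast
  then have sub: "{x0 - e..x0 + e} \<subseteq> E" by (force simp: dist_real_def)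
  define c d c1 d1 where "c = x0 - e" and "d = x0 + e" and "c1 = x0 - e/2" and "d1 = x0 + e/2"
  have cd: "{c..d} \<subseteq> E" "c < c1" "c1 < d1" "d1 < d" using sub \<open>0 < e\<close> by (auto simp: c_def d_def c1_def d1_def)
  have inE: "c1 \<in> E" "d1 \<in> E" "x0 \<in> E" "d \<in> E" using cd by (auto simp: d1_def c1_def d_def)
  \<comment> \<open>The rising flank lies inside \<open>[c1, d1]\<close>; the falling one lies to
    the right of \<open>d1\<close>.\<close>
  let ?m = "x0 + e/4"
  have tr: "x0 < ?m" "?m \<le> d1" "d1 < d" using \<open>0 < e\<close> by (auto simp: d1_def d_def)
  from S_threshold[OF S trapezoid_Cc[OF tr compact_Int[OF inE(3,4)]]]
  obtain g where g: "g \<in> S" and "\<forall>y\<in>E. 0 \<le> g y \<and> g y \<le> 1 \<and>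
       ((if y \<in> E then trapezoid x0 ?m d1 d y else 0) = 1 \<longrightarrow> g y = 1) \<and> ((if y \<in> E then trapezoid x0 ?m d1 d y else 0) = 0 \<longrightarrow> g y = 0)"
    by blast
  then have gd: "g d1 = 1" "g c1 = 0"
    using trapezoid(4)[OF tr, of d1] trapezoid(2)[OF tr, of c1] inE \<open>0 < e\<close> by (auto simp: c1_def d1_def)
  have [measurable]: "der g \<in> borel_measurable borel" by (rule sqintD(1)[OF der_props(1)[OF SH[OF g]]])
  let ?A = "{t. c1 \<le> t \<and> t \<le> d1 \<and> der g t \<noteq> 0}"
  have A[measurable]: "?A \<in> sets borel" by measurable
  have Apos: "0 < emeasure lborel ?A"
  proof (rule ccontr)
    assume "\<not> 0 < emeasure lborel ?A"
    then have "?A \<in> null_sets lborel" using A by (auto simp: null_sets_def)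
    then have "AE t in lborel. t \<notin> ?A" by (rule AE_not_in)
    then have "AE t in lborel. indicator {c1..d1} t *\<^sub>R der g t = 0"
      by (rule AE_mp) (rule AE_I2, simp add: indicator_def)
    then have "set_lebesgue_integral lborel {c1..d1} (der g) = 0"
      unfolding set_lebesgue_integral_def by (rule integral_eq_zero_AE)
    then show False
      using primitiveD(3)[OF der_props(2)[OF SH[OF g]] inE(1,2)] cd gd by simp
  qed
  have "emeasure lborel ?A \<le> emeasure lborel {c1..d1}" by (rule emeasure_mono) auto
  also have "\<dots> < \<infinity>" by (simp add: emeasure_lborel_Icc_eq)
  finally have Afin: "emeasure lborel ?A < \<infinity>" .
  then obtain a where a: "emeasure lborel ?A = ennreal a" "0 < a"
    using Apos by (cases "emeasure lborel ?A") auto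
  have Qn: "(\<rat> :: real set) \<in> null_sets lborel" by (rule countable_imp_null_set_lborel) (rule countable_rat)
  have Rb[measurable]: "(\<rat> :: real set) \<in> sets borel" using null_setsD2[OF Qn] by simp
  have "\<exists>U::real set. open U \<and> \<rat> \<subseteq> U \<and> emeasure lborel (U - \<rat>) < ennreal a"
  proof (rule outer_regular_lborel[OF Rb a(2)])
    fix U :: "real set" assume "open U" "\<rat> \<subseteq> U" "emeasure lborel (U - \<rat>) < ennreal a"
    then show ?thesis by (intro exI[of _ U] conjI)
  qed
  then obtain U :: "real set" where U: "open U" "\<rat> \<subseteq> U" "emeasure lborel (U - \<rat>) < ennreal a"
    by (elim exE conjE)
  have [measurable]: "U \<in> sets borel" using U(1) by simp
  have Um: "emeasure lborel U < ennreal a"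
  proof -
    \<comment> \<open>Outer regularity only bounds the excess over the rationals; as they form a
      null set, it bounds \<open>U\<close> itself.\<close>
    have "emeasure lborel (U - \<rat>) = emeasure lborel U" using Qn by (intro emeasure_Diff_null_set) simp_all
    then show ?thesis using U(3) by simp
  qed
  let ?C = "{c1..d1} - U"
  have C: "closed ?C" "?C \<subseteq> {c1..d1}" "?C \<inter> \<rat> = {}" using U(1,2) by (auto intro: closed_Diff)
  let ?S = "{f\<in>S. AE t in lborel. t \<in> ?C \<longrightarrow> der f t = 0}"
  have "g \<notin> ?S"
  proof
    assume "g \<in> ?S"
    then have "AE t in lborel. t \<in> ?C \<longrightarrow> der g t = 0" by simp
    then have "AE t in lborel. t \<notin> ?A - U" by (rule AE_mp) (rule AE_I2, auto)
    then have "emeasure lborel (?A - U) = 0"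
      by (subst (asm) AE_iff_measurable[of "?A - U"]) auto
    moreover have "emeasure lborel ?A \<le> emeasure lborel (?A - U) + emeasure lborel U"
    proof -
      have "emeasure lborel ?A \<le> emeasure lborel ((?A - U) \<union> U)" by (rule emeasure_mono) auto
      also have "\<dots> \<le> emeasure lborel (?A - U) + emeasure lborel U" by (rule emeasure_subadditive) auto
      finally show ?thesis .
    qed
    ultimately show False using Um a(1) by simp
  qed
  moreover have "fukushima_subspace E \<mu> ?S" by (rule flat_subspace[OF S cd C])
  ultimately show ?thesis using g unfolding minimal_fukushima_def by blast
qed

end

section \<open>The scale function with density supported off the set\<close>

text \<open>Convergence to 0 at the lower end along points of \<open>E\<close>. The formulation
  applies to finite and infinite ends and does not refer to a scale, so it serves \<open>id\<close>
  and \<open>sb\<close> alike.\<close>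

definition near_lo :: "real set \<Rightarrow> (real \<Rightarrow> real) \<Rightarrow> bool" where
  "near_lo E f \<longleftrightarrow> (\<forall>e>0. \<exists>c\<in>E. \<forall>x\<in>E. x \<le> c \<longrightarrow> \<bar>f x\<bar> < e)"

definition near_hi :: "real set \<Rightarrow> (real \<Rightarrow> real) \<Rightarrow> bool" where
  "near_hi E f \<longleftrightarrow> (\<forall>e>0. \<exists>c\<in>E. \<forall>x\<in>E. c \<le> x \<longrightarrow> \<bar>f x\<bar> < e)"

lemma continuous_on_indefinite:
  fixes G k :: "real \<Rightarrow> real"
  assumes k: "set_integrable lborel {a..b} k"
    and G: "\<And>y. y \<in> {a..b} \<Longrightarrow> G y - G a = set_lebesgue_integral lborel {a..y} k"
  shows "continuous_on {a..b} G"
proof -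
  have "continuous_on {a..b} (\<lambda>y. G a + integral {a..y} k)"
    by (intro continuous_on_add continuous_on_const indefinite_integral_continuous_1 set_borel_integral_eq_integral(1)[OF k])
  then show ?thesis
  proof (rule continuous_on_eq)
    fix y assume y: "y \<in> {a..b}"
    have "set_integrable lborel {a..y} k" by (rule set_integrable_subset[OF k]) (use y in auto)
    from set_borel_integral_eq_integral(2)[OF this] G[OF y] show "G a + integral {a..y} k = G y" by simp
  qed
qed

context classK
begin

section \<open>Boundary values in an arbitrary scale\<close>

lemma s_lo_le: "x \<in> intI E \<Longrightarrow> s_lo E \<sigma> \<le> ereal (\<sigma> x)"
  unfolding s_lo_def by (intro Inf_lower imageI)

lemma s_hi_ge: "x \<in> intI E \<Longrightarrow> ereal (\<sigma> x) \<le> s_hi E \<sigma>"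
  unfolding s_hi_def by (intro Sup_upper imageI)

lemma intI_I: "x \<in> E \<Longrightarrow> x \<in> intI E"
  by (simp add: intI_def)

lemma lE_less_intI:
  assumes "t \<in> intI E" "lE E \<notin> ereal ` E"
  shows "lE E < ereal t"
proof (cases "t \<in> E")
  case True
  then have "lE E \<noteq> ereal t" using assms(2) by force
  then show ?thesis using lE_le[OF True] by simp
qed (use assms(1) in \<open>simp add: intI_def\<close>)

lemma rE_greater_intI:
  assumes "t \<in> intI E" "rE E \<notin> ereal ` E"
  shows "ereal t < rE E"
proof (cases "t \<in> E")
  case True
  then have "rE E \<noteq> ereal t" using assms(2) by force
  then show ?thesis using rE_ge[OF True] by simp
qed (use assms(1) in \<open>simp add: intI_def\<close>)

lemma below_lo:
  assumes mono: "mono_on (intI E) \<sigma>"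
    and l: "lE E \<notin> ereal ` E" and lt: "s_lo E \<sigma> < ereal y"
  obtains c where "c \<in> E" "\<sigma> c < y"
proof -
  obtain t where t: "t \<in> intI E" "\<sigma> t < y" using lt unfolding s_lo_def Inf_less_iff by auto
  have "lE E < ereal t" by (rule lE_less_intI[OF t(1) l])
  then obtain c where c: "c \<in> E" "c < t" unfolding lE_less_iff by blast
  then have "\<sigma> c \<le> \<sigma> t" using mono_onD[OF mono intI_I[OF c(1)] t(1)] by simp
  then show thesis using that[OF c(1)] t(2) by simp
qed

lemma above_hi:
  assumes mono: "mono_on (intI E) \<sigma>"
    and r: "rE E \<notin> ereal ` E" and lt: "ereal y < s_hi E \<sigma>"
  obtains c where "c \<in> E" "y < \<sigma> c"
proof -
  obtain t where t: "t \<in> intI E" "y < \<sigma> t" using lt unfolding s_hi_def less_Sup_iff by auto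
  have "ereal t < rE E" by (rule rE_greater_intI[OF t(1) r])
  then obtain c where c: "c \<in> E" "t < c" unfolding rE_greater_iff by blast
  then have "\<sigma> t \<le> \<sigma> c" using mono_onD[OF mono t(1) intI_I[OF c(1)]] by simp
  then show thesis using that[OF c(1)] t(2) by simp
qed

text \<open>Since the lower end is not attained, the values of \<open>\<sigma>\<close> on
  \<open>E\<close> come arbitrarily close to \<open>s\<close>, and \<open>G\<close> is continuous up
  to \<open>s\<close>; hence \<open>f\<close> has the limit \<open>G s\<close> at the lower
  end.\<close>

lemma near_lo_iff:
  assumes mono: "mono_on (intI E) \<sigma>"
    and l: "lE E \<notin> ereal ` E" and s: "s_lo E \<sigma> = ereal s"
    and x1: "x1 \<in> E" "s < \<sigma> x1" and G: "continuous_on {s..\<sigma> x1} G" and f: "\<And>x. x \<in> E \<Longrightarrow> f x = G (\<sigma> x)"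
  shows "near_lo E f \<longleftrightarrow> G s = 0"
proof -
  have ge: "s \<le> \<sigma> x" if "x \<in> E" for x using s_lo_le[OF intI_I[OF that], of \<sigma>] s by simp
  have cont: "\<exists>c\<in>E. \<forall>x\<in>E. x \<le> c \<longrightarrow> \<bar>f x - G s\<bar> < e" if e: "0 < e" for e
  proof -
    obtain d where d: "0 < d" "\<And>y. y \<in> {s..\<sigma> x1} \<Longrightarrow> dist y s < d \<Longrightarrow> dist (G y) (G s) < e"
      using G[unfolded continuous_on_iff] e x1(2) by force
    have "s_lo E \<sigma> < ereal (min (\<sigma> x1) (s + d))" unfolding s using d x1 by simp
    then obtain c where c: "c \<in> E" "\<sigma> c < min (\<sigma> x1) (s + d)" by (rule below_lo[OF mono l]) (rule that)
    have "\<bar>f x - G s\<bar> < e" if x: "x \<in> E" "x \<le> c" for x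
    proof -
      have "\<sigma> x \<le> \<sigma> c" by (rule mono_onD[OF mono intI_I[OF x(1)] intI_I[OF c(1)] x(2)])
      then have "\<sigma> x \<in> {s..\<sigma> x1}" "dist (\<sigma> x) s < d" using c(2) ge[OF x(1)] by (auto simp: dist_real_def)
      from d(2)[OF this] show ?thesis using f[OF x(1)] by (simp add: dist_real_def)
    qed
    then show ?thesis using c(1) by blast
  qed
  show ?thesis
  proof
    assume "G s = 0"
    then show "near_lo E f" unfolding near_lo_def using cont by simp
  next
    assume nl: "near_lo E f"
    have "\<bar>G s\<bar> \<le> 0 + e" if e: "0 < e" for e
    proof -
      have e2: "0 < e / 2" using e by simp
      obtain c where c: "c \<in> E" "\<forall>x\<in>E. x \<le> c \<longrightarrow> \<bar>f x - G s\<bar> < e / 2" using cont[OF e2] by blast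
      obtain c' where c': "c' \<in> E" "\<forall>x\<in>E. x \<le> c' \<longrightarrow> \<bar>f x\<bar> < e / 2" using nl e2 unfolding near_lo_def by blast
      have "min c c' \<in> E" using c c' by (simp add: min_def)
      then have "\<bar>f (min c c') - G s\<bar> < e / 2" "\<bar>f (min c c')\<bar> < e / 2" using c c' by auto
      then show ?thesis by linarith
    qed
    then have "\<bar>G s\<bar> \<le> 0" by (rule field_le_epsilon)
    then show "G s = 0" by simp
  qed
qed

lemma near_hi_iff:
  assumes mono: "mono_on (intI E) \<sigma>"
    and r: "rE E \<notin> ereal ` E" and s: "s_hi E \<sigma> = ereal s"
    and x1: "x1 \<in> E" "\<sigma> x1 < s" and G: "continuous_on {\<sigma> x1..s} G" and f: "\<And>x. x \<in> E \<Longrightarrow> f x = G (\<sigma> x)"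
  shows "near_hi E f \<longleftrightarrow> G s = 0"
proof -
  have ge: "\<sigma> x \<le> s" if "x \<in> E" for x using s_hi_ge[OF intI_I[OF that], of \<sigma>] s by simp
  have cont: "\<exists>c\<in>E. \<forall>x\<in>E. c \<le> x \<longrightarrow> \<bar>f x - G s\<bar> < e" if e: "0 < e" for e
  proof -
    obtain d where d: "0 < d" "\<And>y. y \<in> {\<sigma> x1..s} \<Longrightarrow> dist y s < d \<Longrightarrow> dist (G y) (G s) < e"
      using G[unfolded continuous_on_iff] e x1(2) by force
    have "ereal (max (\<sigma> x1) (s - d)) < s_hi E \<sigma>" unfolding s using d x1 by simp
    then obtain c where c: "c \<in> E" "max (\<sigma> x1) (s - d) < \<sigma> c" by (rule above_hi[OF mono r]) (rule that)
    have "\<bar>f x - G s\<bar> < e" if x: "x \<in> E" "c \<le> x" for x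
    proof -
      have "\<sigma> c \<le> \<sigma> x" by (rule mono_onD[OF mono intI_I[OF c(1)] intI_I[OF x(1)] x(2)])
      then have "\<sigma> x \<in> {\<sigma> x1..s}" "dist (\<sigma> x) s < d" using c(2) ge[OF x(1)] by (auto simp: dist_real_def)
      from d(2)[OF this] show ?thesis using f[OF x(1)] by (simp add: dist_real_def)
    qed
    then show ?thesis using c(1) by blast
  qed
  show ?thesis
  proof
    assume "G s = 0"
    then show "near_hi E f" unfolding near_hi_def using cont by simp
  next
    assume nl: "near_hi E f"
    have "\<bar>G s\<bar> \<le> 0 + e" if e: "0 < e" for e
    proof -
      have e2: "0 < e / 2" using e by simp
      obtain c where c: "c \<in> E" "\<forall>x\<in>E. c \<le> x \<longrightarrow> \<bar>f x - G s\<bar> < e / 2" using cont[OF e2] by blast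
      obtain c' where c': "c' \<in> E" "\<forall>x\<in>E. c' \<le> x \<longrightarrow> \<bar>f x\<bar> < e / 2" using nl e2 unfolding near_hi_def by blast
      have "max c c' \<in> E" using c c' by (simp add: max_def)
      then have "\<bar>f (max c c') - G s\<bar> < e / 2" "\<bar>f (max c c')\<bar> < e / 2" using c c' by auto
      then show ?thesis by linarith
    qed
    then have "\<bar>G s\<bar> \<le> 0" by (rule field_le_epsilon)
    then show "G s = 0" by simp
  qed
qed

section \<open>The scale function and its change of variables\<close>

definition off_E :: "real \<Rightarrow> real" where "off_E = indicator (- E)"

text \<open>Defined on the whole line, with the arbitrary base point 0, so that it is finite at
  every real number, including finite end points outside \<open>E\<close>.\<close>

definition sb :: "real \<Rightarrow> real" where "sb = antideriv off_E 0"

lemma off_E_borel [measurable]: "off_E \<in> borel_measurable borel"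
  unfolding off_E_def by measurable

lemma off_E_integrable: "set_integrable lborel {a..b} off_E"
  unfolding set_integrable_def
proof (rule Bochner_Integration.integrable_bound)
  show "integrable lborel (indicator {a..b} :: real \<Rightarrow> real)" by (simp add: emeasure_lborel_Icc_eq)
  show "AE t in lborel. norm (indicator {a..b} t *\<^sub>R off_E t) \<le> norm (indicat_real {a..b} t)"
    by (rule AE_I2) (simp add: off_E_def indicator_def)
qed measurable

lemma sb_diff: "x \<le> y \<Longrightarrow> sb y - sb x = set_lebesgue_integral lborel {x..y} off_E"
  unfolding sb_def by (rule antideriv_diff[OF off_E_borel off_E_integrable])

lemma emeasure_sb:
  assumes "x \<le> y" shows "emeasure lborel ({x..y} - E) = ennreal (sb y - sb x)"
proof -
  have fin: "emeasure lborel ({x..y} - E) < \<infinity>"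
    by (rule le_less_trans[OF emeasure_mono[of _ "{x..y}"]]) (auto simp: emeasure_lborel_Icc_eq)
  have "sb y - sb x = (\<integral>t. indicator ({x..y} - E) t \<partial>lborel)"
    unfolding sb_diff[OF assms] set_lebesgue_integral_def off_E_def
    by (rule Bochner_Integration.integral_cong) (auto simp: indicator_def)
  also have "\<dots> = measure lborel ({x..y} - E)" by simp
  finally show ?thesis using fin by (simp add: emeasure_eq_ennreal_measure)
qed

lemma sb_mono: "x \<le> y \<Longrightarrow> sb x \<le> sb y"
proof -
  assume "x \<le> y"
  moreover have "0 \<le> set_lebesgue_integral lborel {x..y} off_E"
    unfolding set_lebesgue_integral_def by (rule integral_nonneg_AE) (simp add: off_E_def)
  ultimately show ?thesis using sb_diff[of x y] by simp
qed

lemma sb_lipschitz: "x \<le> y \<Longrightarrow> sb y - sb x \<le> y - x"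
proof -
  assume xy: "x \<le> y"
  have "ennreal (sb y - sb x) \<le> emeasure lborel {x..y}"
    unfolding emeasure_sb[OF xy, symmetric] by (rule emeasure_mono) auto
  then show ?thesis using xy by (simp add: ennreal_le_iff)
qed

lemma sb_continuous: "continuous_on A sb"
proof (rule lipschitz_on_continuous_on[of 1], rule lipschitz_onI)
  show "dist (sb x) (sb y) \<le> 1 * dist x y" for x y
    using sb_lipschitz[of x y] sb_lipschitz[of y x] sb_mono[of x y] sb_mono[of y x]
    by (cases "x \<le> y") (simp_all add: dist_real_def)
qed simp

lemma sb_borel [measurable]: "sb \<in> borel_measurable borel"
  by (rule borel_measurable_continuous_onI[OF sb_continuous])

text \<open>It suffices to compare both measures on half-lines \<open>{u<..}\<close>. For
  \<open>u\<close> between the extreme values, the part of \<open>{x..y} - E\<close> above level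
  \<open>u\<close> is, up to a point, what lies to the right of the last \<open>v\<close> with
  \<open>sb v = u\<close>, and that has measure \<open>sb y - u\<close>.\<close>

lemma distr_sb:
  assumes xy: "x \<le> y"
  shows "distr (density lborel (\<lambda>t. ennreal (indicator ({x..y} - E) t))) borel sb = density lborel (\<lambda>s. ennreal (indicator {sb x..sb y} s))"
    (is "?N = ?P")
proof (rule measure_eqI_lessThan)
  have N: "emeasure ?N {u<..} = emeasure lborel ({t. u < sb t} \<inter> ({x..y} - E))" for u
  proof -
    have m: "{t. u < sb t} \<in> sets borel" by measurable
    have "emeasure ?N {u<..} = emeasure (density lborel (\<lambda>t. ennreal (indicator ({x..y} - E) t))) {t. u < sb t}"
      by (subst emeasure_distr) (auto intro!: arg_cong2[where f = emeasure])
    also have "\<dots> = (\<integral>\<^sup>+t. ennreal (indicator ({x..y} - E) t) * indicator {t. u < sb t} t \<partial>lborel)"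
      using m by (intro emeasure_density) auto
    also have "\<dots> = (\<integral>\<^sup>+t. indicator ({t. u < sb t} \<inter> ({x..y} - E)) t \<partial>lborel)"
      by (intro nn_integral_cong) (auto simp: indicator_def)
    also have "\<dots> = emeasure lborel ({t. u < sb t} \<inter> ({x..y} - E))"
      using m by (intro nn_integral_indicator) auto
    finally show ?thesis .
  qed
  have P: "emeasure ?P {u<..} = emeasure lborel ({u<..} \<inter> {sb x..sb y})" for u
  proof -
    have "emeasure ?P {u<..} = (\<integral>\<^sup>+t. ennreal (indicator {sb x..sb y} t) * indicator {u<..} t \<partial>lborel)"
      by (intro emeasure_density) auto
    also have "\<dots> = (\<integral>\<^sup>+t. indicator ({u<..} \<inter> {sb x..sb y}) t \<partial>lborel)"
      by (intro nn_integral_cong) (auto simp: indicator_def)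
    also have "\<dots> = emeasure lborel ({u<..} \<inter> {sb x..sb y})"
      by (intro nn_integral_indicator) auto
    finally show ?thesis .
  qed
  have s: "sb x \<le> sb y" by (rule sb_mono[OF xy])
  show "emeasure ?N {u<..} = emeasure ?P {u<..}" for u
  proof -
    consider "u < sb x" | "sb y \<le> u" | "sb x \<le> u" "u < sb y" by linarith
    then show ?thesis
    proof cases
      case 1
      have "u < sb t" if "x \<le> t" for t using sb_mono[OF that] 1 by linarith
      then have "{t. u < sb t} \<inter> ({x..y} - E) = {x..y} - E" by auto
      moreover have "{u<..} \<inter> {sb x..sb y} = {sb x..sb y}" using 1 by auto
      ultimately show ?thesis unfolding N P using emeasure_sb[OF xy] s by simp
    next
      case 2
      have "\<not> u < sb t" if "t \<le> y" for t using sb_mono[OF that] 2 by linarith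
      then have "{t. u < sb t} \<inter> ({x..y} - E) = {}" by auto
      moreover have "{u<..} \<inter> {sb x..sb y} = {}" using 2 by auto
      ultimately show ?thesis unfolding N P by (simp only: emeasure_empty)
    next
      case 3
      \<comment> \<open>Its largest element \<open>v\<close> exists by compactness; the intermediate
        value theorem excludes \<open>sb v < u\<close>.\<close>
      let ?V = "{x..y} \<inter> sb -` {..u}"
      have "compact ?V" by (intro closed_Int_compact[of _ "{x..y}", unfolded Int_commute[of _ "{x..y}"]] closed_vimage closed_atMost sb_continuous compact_Icc)
      moreover have "?V \<noteq> {}" using 3 xy by auto
      ultimately obtain v where v: "v \<in> ?V" "\<forall>t\<in>?V. t \<le> v" using compact_attains_sup by blast
      have uv: "sb v = u"
      proof (rule ccontr)
        assume "sb v \<noteq> u"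
        then have "sb v < u" using v by simp
        obtain w where w: "v \<le> w" "w \<le> y" "sb w = u"
          using IVT'[of sb v u y] v 3 \<open>sb v < u\<close> sb_continuous by (auto simp: less_imp_le)
        then have "w \<in> ?V" using v by auto
        then have "w \<le> v" using v(2) by blast
        then have "w = v" using w(1) by simp
        then show False using w \<open>sb v < u\<close> by simp
      qed
      have set: "{t. u < sb t} \<inter> ({x..y} - E) = ({v..y} - E) - {v}"
      proof (intro equalityI subsetI)
        fix t assume t: "t \<in> {t. u < sb t} \<inter> ({x..y} - E)"
        then have "v < t" using sb_mono[of t v] uv by (force simp: not_le[symmetric])
        then show "t \<in> ({v..y} - E) - {v}" using t by auto
      next
        fix t assume t: "t \<in> ({v..y} - E) - {v}"
        then have "\<not> t \<le> v" by auto
        then have "t \<notin> ?V" using v(2) by blast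
        then show "t \<in> {t. u < sb t} \<inter> ({x..y} - E)" using t v by auto
      qed
      have "emeasure lborel (({v..y} - E) - {v}) = emeasure lborel ({v..y} - E)"
        by (rule emeasure_Diff_null_set) auto
      also have "\<dots> = ennreal (sb y - u)" using emeasure_sb[of v y] v uv by simp
      finally have "emeasure ?N {u<..} = ennreal (sb y - u)" unfolding N set .
      moreover have "{u<..} \<inter> {sb x..sb y} = {u<..sb y}" using 3 by auto
      ultimately show ?thesis unfolding P using 3 by simp
    qed
  qed
  show "emeasure ?N {u<..} < \<infinity>" for u
  proof -
    have "emeasure ?N {u<..} \<le> emeasure lborel ({x..y} - E)"
      unfolding N by (rule emeasure_mono) auto
    also have "\<dots> < \<infinity>" using emeasure_sb[OF xy] by simp
    finally show ?thesis .
  qed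
qed simp_all

text \<open>The substitution \<open>s = sb t\<close> with \<open>ds = off_E t dt\<close>, read off
  from the image measure. It is available on bounded intervals, so global statements need a
  limit.\<close>

lemma subst_sb:
  fixes k :: "real \<Rightarrow> real"
  assumes [measurable]: "k \<in> borel_measurable borel" and xy: "x \<le> y"
  shows "set_integrable lborel {sb x..sb y} k \<longleftrightarrow> set_integrable lborel {x..y} (\<lambda>t. k (sb t) * off_E t)"
    and "set_lebesgue_integral lborel {sb x..sb y} k = set_lebesgue_integral lborel {x..y} (\<lambda>t. k (sb t) * off_E t)"
proof -
  let ?N = "density lborel (\<lambda>t. ennreal (indicator ({x..y} - E) t))" and ?P = "density lborel (\<lambda>s. ennreal (indicator {sb x..sb y} s))"
  have sbm: "sb \<in> measurable ?N borel" by simp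
  have eq: "indicator ({x..y} - E) t *\<^sub>R k (sb t) = indicator {x..y} t *\<^sub>R (k (sb t) * off_E t)" for t
    by (simp add: off_E_def indicator_def)
  have "integrable ?P k \<longleftrightarrow> set_integrable lborel {sb x..sb y} k"
    unfolding set_integrable_def by (rule integrable_density) auto
  moreover have "integrable (distr ?N borel sb) k \<longleftrightarrow> integrable ?N (\<lambda>t. k (sb t))"
    by (rule integrable_distr_eq[OF sbm]) simp
  moreover have "integrable ?N (\<lambda>t. k (sb t)) \<longleftrightarrow> integrable lborel (\<lambda>t. indicator ({x..y} - E) t *\<^sub>R k (sb t))"
    by (rule integrable_density) auto
  ultimately show "set_integrable lborel {sb x..sb y} k \<longleftrightarrow> set_integrable lborel {x..y} (\<lambda>t. k (sb t) * off_E t)"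
    unfolding distr_sb[OF xy] eq set_integrable_def by blast
  have "(\<integral>s. k s \<partial>?P) = set_lebesgue_integral lborel {sb x..sb y} k"
    unfolding set_lebesgue_integral_def by (rule integral_density) auto
  moreover have "(\<integral>s. k s \<partial>distr ?N borel sb) = (\<integral>t. k (sb t) \<partial>?N)"
    by (rule integral_distr[OF sbm]) simp
  moreover have "(\<integral>t. k (sb t) \<partial>?N) = (\<integral>t. indicator ({x..y} - E) t *\<^sub>R k (sb t) \<partial>lborel)"
    by (rule integral_density) auto
  ultimately show "set_lebesgue_integral lborel {sb x..sb y} k = set_lebesgue_integral lborel {x..y} (\<lambda>t. k (sb t) * off_E t)"
    unfolding distr_sb[OF xy] eq set_lebesgue_integral_def by simp
qed

end

lemma finite_erealE:
  assumes "\<bar>a\<bar> \<noteq> (\<infinity>::ereal)"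
  shows "a = ereal (real_of_ereal a)"
  using assms by (simp add: ereal_real)

section \<open>The candidate for the minimal domain\<close>

locale nowhereK = radonK +
  assumes N: "interior E = {}"
begin

text \<open>The step from empty interior to nowhere density. If an interval were contained in the
  closure, removing the finitely many points missing from \<open>E\<close> would leave an open
  subset of \<open>E\<close>, hence nothing.\<close>

lemma interval_minus_E:
  assumes "x < y"
  obtains t e where "0 < e" "{t-e..t+e} \<subseteq> {x<..<y} - E"
proof -
  have "\<not> {x<..<y} \<subseteq> closure E"
  proof
    assume sub: "{x<..<y} \<subseteq> closure E"
    let ?W = "{x<..<y} - (closure E - E)"
    have "open ?W" by (intro open_Diff finite_imp_closed finite_boundary) simp
    moreover have "?W \<subseteq> E" using sub by blast
    ultimately have "?W \<subseteq> interior E" by (rule interior_maximal[rotated])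
    then have "{x<..<y} \<subseteq> closure E - E" using N by blast
    then have "finite {x<..<y}" by (rule finite_subset[OF _ finite_boundary])
    then show False using infinite_Ioo[OF assms] by simp
  qed
  then obtain t where t: "t \<in> {x<..<y} - closure E" by blast
  have "open ({x<..<y} - closure E)" by (intro open_Diff) auto
  then obtain e where e: "0 < e" "cball t e \<subseteq> {x<..<y} - closure E" using t unfolding open_contains_cball by blast
  have "{t-e..t+e} \<subseteq> {x<..<y} - E"
  proof
    fix s assume "s \<in> {t-e..t+e}"
    then have "s \<in> cball t e" by (auto simp: dist_real_def abs_le_iff)
    then show "s \<in> {x<..<y} - E" using e(2) closure_subset[of E] by blast
  qed
  then show thesis by (rule that[OF e(1)])
qed

lemma sb_strict: "x < y \<Longrightarrow> sb x < sb y"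
proof -
  assume xy: "x < y"
  obtain t e where te: "0 < e" "{t-e..t+e} \<subseteq> {x<..<y} - E" by (rule interval_minus_E[OF xy]) (rule that)
  have "ennreal 0 < ennreal (2 * e)" using te(1) by (intro ennreal_lessI) simp_all
  also have "\<dots> = emeasure lborel {t-e..t+e}" using te(1) by simp
  also have "\<dots> \<le> emeasure lborel ({x..y} - E)" by (rule emeasure_mono) (use te(2) in auto)
  also have "\<dots> = ennreal (sb y - sb x)" using emeasure_sb[of x y] xy by simp
  finally have "ennreal 0 < ennreal (sb y - sb x)" .
  then show ?thesis by (simp add: ennreal_less_zero_iff)
qed

lemma sb_strict_on: "\<forall>x\<in>A. \<forall>y\<in>A. x < y \<longrightarrow> sb x < sb y"
  using sb_strict by blast

lemma sb_inj: "inj sb"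
  by (rule injI) (metis linorder_less_linear order_less_irrefl sb_strict)

lemma sb_mono_on: "mono_on A sb"
  by (rule mono_onI) (rule sb_mono)

lemma scale_sb: "scale_fn E sb off_E"
  unfolding scale_fn_def
proof (intro conjI ballI allI impI)
  show "strict_mono_on (intI E) sb" by (rule strict_mono_onI) (rule sb_strict)
  show "off_E x = 0 \<or> off_E x = 1" for x by (simp add: off_E_def indicator_def)
  show "off_E x = 1" if "x \<in> intI E - E" for x using that by (simp add: off_E_def)
qed (simp_all add: off_E_integrable sb_diff)

lemma slope_off_E: "slope E f t * off_E t = slope E f t"
  using slope_in[of t E f] by (cases "t \<in> E") (simp_all add: off_E_def)

text \<open>An intrinsic description of \<open>Fs_space E \<mu> sb off_E\<close>, free of
  \<open>G\<close> and \<open>k\<close>: square-integrable slopes, every increment the sum of the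
  jumps, and vanishing at those missing ends that have a finite position in the scale
  \<open>sb\<close>.\<close>

definition minimal_dom :: "(real \<Rightarrow> real) \<Rightarrow> bool" where
  "minimal_dom f \<longleftrightarrow> (\<forall>x. x \<notin> E \<longrightarrow> f x = 0) \<and> L2 \<mu> f \<and> sqint (slope E f) \<and> primitive E f (slope E f) \<and>
    (lE E \<notin> ereal ` E \<and> \<bar>s_lo E sb\<bar> \<noteq> \<infinity> \<longrightarrow> near_lo E f) \<and>
    (rE E \<notin> ereal ` E \<and> \<bar>s_hi E sb\<bar> \<noteq> \<infinity> \<longrightarrow> near_hi E f)"

lemma minimal_dom_near_lo: "minimal_dom f \<Longrightarrow> lE E \<notin> ereal ` E \<Longrightarrow> \<bar>s_lo E sb\<bar> \<noteq> \<infinity> \<Longrightarrow> near_lo E f"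
  by (simp add: minimal_dom_def)

lemma minimal_dom_near_hi: "minimal_dom f \<Longrightarrow> rE E \<notin> ereal ` E \<Longrightarrow> \<bar>s_hi E sb\<bar> \<noteq> \<infinity> \<Longrightarrow> near_hi E f"
  by (simp add: minimal_dom_def)

text \<open>Kept general in \<open>\<sigma>\<close>, because it is needed for \<open>sb\<close> as
  well as for \<open>id\<close>, the scale of the full domain.\<close>

lemma bdry_iff:
  assumes mono: "mono_on (intI E) \<sigma>" and strict0: "\<forall>x\<in>E. \<forall>y\<in>E. x < y \<longrightarrow> \<sigma> x < \<sigma> y"
    and k0: "\<forall>y z. y \<in> s_hull E \<sigma> \<and> z \<in> s_hull E \<sigma> \<and> z \<le> y \<longrightarrow>
        set_integrable lborel {z..y} k \<and> G y - G z = set_lebesgue_integral lborel {z..y} k"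
    and f0: "\<forall>x\<in>E. f x = G (\<sigma> x)"
  shows "lE E \<notin> ereal ` E \<Longrightarrow> \<bar>s_lo E \<sigma>\<bar> \<noteq> \<infinity> \<Longrightarrow> near_lo E f \<longleftrightarrow> G (real_of_ereal (s_lo E \<sigma>)) = 0"
    and "rE E \<notin> ereal ` E \<Longrightarrow> \<bar>s_hi E \<sigma>\<bar> \<noteq> \<infinity> \<Longrightarrow> near_hi E f \<longleftrightarrow> G (real_of_ereal (s_hi E \<sigma>)) = 0"
proof -
  have strict: "\<sigma> x < \<sigma> y" if "x \<in> E" "y \<in> E" "x < y" for x y using strict0 that by blast
  have k: "set_integrable lborel {z..y} k \<and> G y - G z = set_lebesgue_integral lborel {z..y} k"
    if "y \<in> s_hull E \<sigma>" "z \<in> s_hull E \<sigma>" "z \<le> y" for y z using k0 that by blast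
  have f: "f x = G (\<sigma> x)" if "x \<in> E" for x using f0 that by blast
  obtain x where x: "x \<in> E" using E_nonempty by blast
  have hull: "\<sigma> y \<in> s_hull E \<sigma>" if "y \<in> E" for y
    using s_lo_le[OF intI_I[OF that]] s_hi_ge[OF intI_I[OF that]] by (simp add: s_hull_def)
  have lohi: "s_lo E \<sigma> \<le> s_hi E \<sigma>" using hull[OF x] by (auto simp: s_hull_def intro: order_trans)
  { assume l: "lE E \<notin> ereal ` E" and fin: "\<bar>s_lo E \<sigma>\<bar> \<noteq> \<infinity>"
    note s = finite_erealE[OF fin]
    let ?s = "real_of_ereal (s_lo E \<sigma>)"
    obtain c where c: "c \<in> E" "c < x" using lE_less_intI[OF intI_I[OF x] l] unfolding lE_less_iff by blast
    have "ereal ?s \<le> ereal (\<sigma> c)" using s_lo_le[OF intI_I[OF c(1)], of \<sigma>] by (simp only: s[symmetric])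
    then have sx: "?s < \<sigma> x" using strict[OF c(1) x c(2)] by simp
    have "?s \<in> s_hull E \<sigma>" using lohi s by (simp add: s_hull_def)
    note kk = k[OF _ this] k[OF hull[OF x] this less_imp_le[OF sx]]
    have "continuous_on {?s..\<sigma> x} G"
    proof (rule continuous_on_indefinite)
      show "set_integrable lborel {?s..\<sigma> x} k" using kk(2) by blast
      fix y assume y: "y \<in> {?s..\<sigma> x}"
      have "ereal y \<le> s_hi E \<sigma>" using y hull[OF x] by (auto simp: s_hull_def intro: order_trans[of _ "ereal (\<sigma> x)"])
      moreover have "s_lo E \<sigma> \<le> ereal y" using y by (subst s) simp
      ultimately have "y \<in> s_hull E \<sigma>" by (simp add: s_hull_def)
      then show "G y - G ?s = set_lebesgue_integral lborel {?s..y} k" using kk(1)[of y] y by simp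
    qed
    from near_lo_iff[OF mono l s x sx this] f show "near_lo E f \<longleftrightarrow> G ?s = 0" by blast }
  { assume r: "rE E \<notin> ereal ` E" and fin: "\<bar>s_hi E \<sigma>\<bar> \<noteq> \<infinity>"
    note s = finite_erealE[OF fin]
    let ?s = "real_of_ereal (s_hi E \<sigma>)"
    obtain c where c: "c \<in> E" "x < c" using rE_greater_intI[OF intI_I[OF x] r] unfolding rE_greater_iff by blast
    have "ereal (\<sigma> c) \<le> ereal ?s" using s_hi_ge[OF intI_I[OF c(1)], of \<sigma>] by (simp only: s[symmetric])
    then have sx: "\<sigma> x < ?s" using strict[OF x c(1) c(2)] by simp
    have sh: "?s \<in> s_hull E \<sigma>" using lohi s by (simp add: s_hull_def)
    have "continuous_on {\<sigma> x..?s} G"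
    proof (rule continuous_on_indefinite)
      show "set_integrable lborel {\<sigma> x..?s} k" using k[OF sh hull[OF x] less_imp_le[OF sx]] by blast
      fix y assume y: "y \<in> {\<sigma> x..?s}"
      have "s_lo E \<sigma> \<le> ereal y" using y hull[OF x] by (auto simp: s_hull_def intro: order_trans[of _ "ereal (\<sigma> x)"])
      moreover have "ereal y \<le> s_hi E \<sigma>" using y by (subst s) simp
      ultimately have "y \<in> s_hull E \<sigma>" by (simp add: s_hull_def)
      then show "G y - G (\<sigma> x) = set_lebesgue_integral lborel {\<sigma> x..y} k" using k[OF _ hull[OF x], of y] y by simp
    qed
    from near_hi_iff[OF mono r s x sx this] f show "near_hi E f \<longleftrightarrow> G ?s = 0" by blast }
qed

section \<open>Equivalence of the two descriptions\<close>

text \<open>After the substitution the increments of \<open>f\<close> are dominated by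
  \<open>\<bar>k (sb t)\<bar> * off_E t\<close>, which vanishes on \<open>E\<close>; hence
  \<open>f\<close> is carried by its jumps.\<close>

lemma Fs_imp_minimal_dom:
  assumes "f \<in> Fs_space E \<mu> sb off_E"
  shows "minimal_dom f"
proof -
  obtain G k where f0: "\<forall>x. x \<notin> E \<longrightarrow> f x = 0" "L2 \<mu> f" and rep: "H1s_rep E sb off_E f G k" and bd: "s_bdry E sb G"
    using assms unfolding Fs_space_def by blast
  have kb[measurable]: "k \<in> borel_measurable borel"
    and k: "\<And>y z. y \<in> s_hull E sb \<Longrightarrow> z \<in> s_hull E sb \<Longrightarrow> z \<le> y \<Longrightarrow>
        set_integrable lborel {z..y} k \<and> G y - G z = set_lebesgue_integral lborel {z..y} k"
    and k2: "set_integrable lborel (intI E) (\<lambda>x. (k (sb x))\<^sup>2 * off_E x)" and fG: "\<And>x. x \<in> E \<Longrightarrow> f x = G (sb x)"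
    using rep unfolding H1s_rep_def by blast+
  have hull: "sb y \<in> s_hull E sb" if "y \<in> E" for y
    using s_lo_le[OF intI_I[OF that]] s_hi_ge[OF intI_I[OF that]] by (simp add: s_hull_def)
  define m where "m t = indicator (intI E) t * (\<bar>k (sb t)\<bar> * off_E t)" for t
  have m[measurable]: "m \<in> borel_measurable borel" unfolding m_def by measurable
  have "(\<lambda>t. (m t)\<^sup>2) = (\<lambda>t. indicator (intI E) t *\<^sub>R ((k (sb t))\<^sup>2 * off_E t))"
    by (auto simp: m_def off_E_def indicator_def)
  then have sq: "sqint m" using k2 m by (simp add: sqint_def set_integrable_def)
  have dom: "dominated E f m"
    unfolding dominated_def
  proof (intro conjI ballI impI allI)
    show "0 \<le> m t" for t by (simp add: m_def off_E_def)
    fix x y assume xy: "x \<in> E" "y \<in> E" "x \<le> y"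
    show "set_integrable lborel {x..y} m" by (rule sqintD(3)[OF sq])
    note kk = k[OF hull[OF xy(2)] hull[OF xy(1)] sb_mono[OF xy(3)]]
    have "\<bar>f y - f x\<bar> = \<bar>set_lebesgue_integral lborel {sb x..sb y} k\<bar>" using kk fG xy by simp
    also have "\<dots> \<le> set_lebesgue_integral lborel {sb x..sb y} (\<lambda>s. \<bar>k s\<bar>)"
      using set_integral_norm_bound[of lborel "{sb x..sb y}" k] kk by simp
    also have "\<dots> = set_lebesgue_integral lborel {x..y} (\<lambda>t. \<bar>k (sb t)\<bar> * off_E t)"
      by (rule subst_sb(2)[OF _ xy(3)]) measurable
    also have "\<dots> = set_lebesgue_integral lborel {x..y} m"
    proof (rule set_lebesgue_integral_cong)
      show "\<forall>t. t \<in> {x..y} \<longrightarrow> \<bar>k (sb t)\<bar> * off_E t = m t"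
        using Icc_subset[OF xy(1,2)] by (auto simp: m_def intI_eq)
    qed simp
    finally show "\<bar>f y - f x\<bar> \<le> set_lebesgue_integral lborel {x..y} m" .
  qed (rule m)
  have mE: "m t = 0" if "t \<in> E" for t using that by (simp add: m_def off_E_def)
  have pr: "primitive E f (slope E f)" by (rule dominated_slope_null[OF dom]) (rule mE)
  note sl = slope_square_le(1)[OF dom sq]
  have k0: "\<forall>y z. y \<in> s_hull E sb \<and> z \<in> s_hull E sb \<and> z \<le> y \<longrightarrow>
        set_integrable lborel {z..y} k \<and> G y - G z = set_lebesgue_integral lborel {z..y} k" using k by blast
  have f1: "\<forall>x\<in>E. f x = G (sb x)" using fG by blast
  note b = bdry_iff[OF sb_mono_on sb_strict_on k0 f1]
  show ?thesis
    unfolding minimal_dom_def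
  proof (intro conjI impI f0 pr sl)
    assume "lE E \<notin> ereal ` E \<and> \<bar>s_lo E sb\<bar> \<noteq> \<infinity>"
    then show "near_lo E f" using b(1) bd by (simp add: s_bdry_def)
  next
    assume "rE E \<notin> ereal ` E \<and> \<bar>s_hi E sb\<bar> \<noteq> \<infinity>"
    then show "near_hi E f" using b(2) bd by (simp add: s_bdry_def)
  qed
qed

text \<open>The density in the scale variable is the slope composed with the inverse of
  \<open>sb\<close>. Its square integrability is obtained on the images of bounded intervals by
  substitution and then on the line by Fatou.\<close>

lemma minimal_dom_imp_Fs:
  assumes f: "minimal_dom f"
  shows "f \<in> Fs_space E \<mu> sb off_E"
proof -
  have sl: "sqint (slope E f)" and pr: "primitive E f (slope E f)" using f by (simp_all add: minimal_dom_def)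
  obtain x0 where x0: "x0 \<in> E" using E_nonempty by blast
  define k where "k y = indicator (range sb) y *\<^sub>R slope E f (inv sb y)" for y
  have ksb: "k (sb t) = slope E f t" for t using sb_inj by (simp add: k_def)
  \<comment> \<open>A countable union of compact images, hence Borel; with the monotone inverse this
    makes \<open>k\<close> measurable.\<close>
  have "range sb = (\<Union>n::nat. sb ` {- real n..real n})"
  proof (intro equalityI subsetI)
    fix y assume "y \<in> range sb"
    then obtain t where t: "y = sb t" by blast
    obtain n :: nat where "\<bar>t\<bar> \<le> real n" using real_arch_simple by blast
    then have "t \<in> {- real n..real n}" by auto
    then show "y \<in> (\<Union>n::nat. sb ` {- real n..real n})" using t by blast
  qed blast
  moreover have "(\<Union>n::nat. sb ` {- real n..real n}) \<in> sets borel"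
    by (intro sets.countable_UN'' borel_compact compact_continuous_image sb_continuous) auto
  ultimately have rb: "range sb \<in> sets borel" by simp
  have "mono_on (range sb) (inv sb)"
  proof (rule mono_onI)
    fix a b assume "a \<in> range sb" "b \<in> range sb" "a \<le> b"
    then obtain u v where "a = sb u" "b = sb v" "sb u \<le> sb v" by blast
    then show "inv sb a \<le> inv sb b" using sb_inj sb_strict[of v u] by (simp add: not_less[symmetric]) (metis not_le)
  qed
  then have "inv sb \<in> borel_measurable (restrict_space borel (range sb))" by (rule borel_measurable_mono_on_fnc)
  then have "(\<lambda>y. slope E f (inv sb y)) \<in> borel_measurable (restrict_space borel (range sb))"
    by (rule measurable_compose[OF _ slope_borel])
  then have kb[measurable]: "k \<in> borel_measurable borel"
    unfolding k_def using rb by (subst (asm) borel_measurable_restrict_space_iff) simp_all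
  let ?c = "\<integral>t. (slope E f t)\<^sup>2 \<partial>lborel"
  let ?I = "\<lambda>n::nat. {sb (- real n)..sb (real n)}"
  have bound: "(\<integral>\<^sup>+y. ennreal ((k y)\<^sup>2) * indicator (?I n) y \<partial>lborel) \<le> ennreal ?c" for n
  proof -
    have n: "- real n \<le> real n" by simp
    have si: "set_integrable lborel {- real n..real n} (\<lambda>t. (slope E f t)\<^sup>2 * off_E t)"
    proof -
      have "(\<lambda>t. (slope E f t)\<^sup>2 * off_E t) = (\<lambda>t. (slope E f t)\<^sup>2)"
        by (simp add: power2_eq_square mult.assoc slope_off_E)
      then show ?thesis using integrable_set_integrable[OF sqintD(2)[OF sl], of "{- real n..real n}"] by simp
    qed
    have k2b: "(\<lambda>y. (k y)\<^sup>2) \<in> borel_measurable borel" by measurable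
    note sub = subst_sb[OF k2b n, unfolded ksb]
    have "set_integrable lborel (?I n) (\<lambda>y. (k y)\<^sup>2)" using sub(1) si by blast
    then have "(\<integral>\<^sup>+y. ennreal (indicator (?I n) y *\<^sub>R (k y)\<^sup>2) \<partial>lborel) = ennreal (set_lebesgue_integral lborel (?I n) (\<lambda>y. (k y)\<^sup>2))"
      unfolding set_lebesgue_integral_def set_integrable_def by (rule nn_integral_eq_integral) simp
    also have "(\<integral>\<^sup>+y. ennreal (indicator (?I n) y *\<^sub>R (k y)\<^sup>2) \<partial>lborel) = (\<integral>\<^sup>+y. ennreal ((k y)\<^sup>2) * indicator (?I n) y \<partial>lborel)"
      by (rule nn_integral_cong) (simp add: indicator_def)
    finally have "(\<integral>\<^sup>+y. ennreal ((k y)\<^sup>2) * indicator (?I n) y \<partial>lborel) = ennreal (set_lebesgue_integral lborel {- real n..real n} (\<lambda>t. (slope E f t)\<^sup>2 * off_E t))"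
      unfolding sub(2) .
    also have "\<dots> \<le> ennreal ?c"
      unfolding set_lebesgue_integral_def
    proof (rule ennreal_leI, rule integral_mono_AE)
      show "integrable lborel (\<lambda>t. indicator {- real n..real n} t *\<^sub>R ((slope E f t)\<^sup>2 * off_E t))"
        using si by (simp add: set_integrable_def)
      show "AE t in lborel. indicator {- real n..real n} t *\<^sub>R ((slope E f t)\<^sup>2 * off_E t) \<le> (slope E f t)\<^sup>2"
        by (rule AE_I2) (simp add: indicator_def off_E_def)
    qed (rule sqintD(2)[OF sl])
    finally show ?thesis .
  qed
  have lim: "liminf (\<lambda>n. ennreal ((k y)\<^sup>2) * indicator (?I n) y) = ennreal ((k y)\<^sup>2)" for y
  proof (rule lim_imp_Liminf)
    show "(\<lambda>n. ennreal ((k y)\<^sup>2) * indicator (?I n) y) \<longlonglongrightarrow> ennreal ((k y)\<^sup>2)"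
    proof (cases "y \<in> range sb")
      case True
      then obtain t where t: "y = sb t" by blast
      obtain n :: nat where n: "\<bar>t\<bar> \<le> real n" using real_arch_simple by blast
      have "y \<in> ?I j" if "n \<le> j" for j
      proof -
        have "- real j \<le> t" "t \<le> real j" using n that by auto
        then show ?thesis using sb_mono t by simp
      qed
      then have "\<forall>\<^sub>F j in sequentially. ennreal ((k y)\<^sup>2) * indicator (?I j) y = ennreal ((k y)\<^sup>2)"
        by (intro eventually_sequentiallyI[of n]) simp
      then show ?thesis by (rule tendsto_eventually)
    qed (simp add: k_def)
  qed simp
  have "(\<integral>\<^sup>+y. ennreal ((k y)\<^sup>2) \<partial>lborel) \<le> liminf (\<lambda>n. \<integral>\<^sup>+y. ennreal ((k y)\<^sup>2) * indicator (?I n) y \<partial>lborel)"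
    using nn_integral_liminf[of "\<lambda>n y. ennreal ((k y)\<^sup>2) * indicator (?I n) y" lborel] unfolding lim by simp
  also have "\<dots> \<le> limsup (\<lambda>n. \<integral>\<^sup>+y. ennreal ((k y)\<^sup>2) * indicator (?I n) y \<partial>lborel)"
    by (rule Liminf_le_Limsup) simp
  also have "\<dots> \<le> ennreal ?c" by (rule Limsup_bounded) (intro always_eventually allI bound)
  finally have "integrable lborel (\<lambda>y. (k y)\<^sup>2)"
    by (intro integrableI_bounded) (use le_less_trans in \<open>auto simp: less_top[symmetric] top_unique\<close>)
  then have kq: "sqint k" by (simp add: sqint_def)
  let ?G = "\<lambda>y. f x0 + antideriv k (sb x0) y"
  have kint: "set_integrable lborel {z..y} k \<and> ?G y - ?G z = set_lebesgue_integral lborel {z..y} k" if "z \<le> y" for y z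
    using antideriv_diff[OF sqintD(1,3)[OF kq] that, of "sb x0"] sqintD(3)[OF kq] by simp
  have inc: "set_lebesgue_integral lborel {sb x..sb y} k = f y - f x" if xy: "x \<in> E" "y \<in> E" "x \<le> y" for x y
    using subst_sb(2)[OF kb xy(3)] primitiveD(3)[OF pr xy] by (simp add: ksb slope_off_E)
  have fG: "f x = ?G (sb x)" if "x \<in> E" for x
  proof (cases "x0 \<le> x")
    case True
    then show ?thesis using inc[OF x0 that True] sb_mono[OF True] by (simp add: antideriv_def)
  next
    case False
    then show ?thesis using inc[OF that x0] sb_strict[of x x0] by (simp add: antideriv_def)
  qed
  have "set_integrable lborel (intI E) (\<lambda>x. (k (sb x))\<^sup>2 * off_E x)"
  proof -
    have "(\<lambda>x. (k (sb x))\<^sup>2 * off_E x) = (\<lambda>t. (slope E f t)\<^sup>2)"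
      by (simp add: ksb power2_eq_square mult.assoc slope_off_E)
    then show ?thesis using integrable_set_integrable[OF sqintD(2)[OF sl], of "intI E"] by simp
  qed
  then have "H1s_rep E sb off_E f ?G k"
    unfolding H1s_rep_def using kb kint fG by blast
  moreover have "s_bdry E sb ?G"
  proof -
    have k0: "\<forall>y z. y \<in> s_hull E sb \<and> z \<in> s_hull E sb \<and> z \<le> y \<longrightarrow>
        set_integrable lborel {z..y} k \<and> ?G y - ?G z = set_lebesgue_integral lborel {z..y} k" using kint by blast
    have f1: "\<forall>x\<in>E. f x = ?G (sb x)" using fG by blast
    show ?thesis
      unfolding s_bdry_def
    proof (intro conjI impI)
      assume *: "lE E \<notin> ereal ` E \<and> \<bar>s_lo E sb\<bar> \<noteq> \<infinity>"
      have "near_lo E f" by (rule minimal_dom_near_lo[OF f conjunct1[OF *] conjunct2[OF *]])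
      then show "?G (real_of_ereal (s_lo E sb)) = 0"
        by (rule bdry_iff(1)[OF sb_mono_on sb_strict_on k0 f1 conjunct1[OF *] conjunct2[OF *], THEN iffD1])
    next
      assume *: "rE E \<notin> ereal ` E \<and> \<bar>s_hi E sb\<bar> \<noteq> \<infinity>"
      have "near_hi E f" by (rule minimal_dom_near_hi[OF f conjunct1[OF *] conjunct2[OF *]])
      then show "?G (real_of_ereal (s_hi E sb)) = 0"
        by (rule bdry_iff(2)[OF sb_mono_on sb_strict_on k0 f1 conjunct1[OF *] conjunct2[OF *], THEN iffD1])
    qed
  qed
  ultimately show ?thesis
    unfolding Fs_space_def using f unfolding minimal_dom_def by blast
qed

lemma minimal_dom_iff: "f \<in> Fs_space E \<mu> sb off_E \<longleftrightarrow> minimal_dom f"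
  using Fs_imp_minimal_dom minimal_dom_imp_Fs by blast

text \<open>Only the boundary condition needs an argument. At a finite end point \<open>sb\<close>
  is finite, so by monotonicity that end also has a finite position in the scale, and the condition
  in \<open>minimal_dom\<close> applies to it.\<close>

lemma minimal_dom_imp_F:
  assumes f: "minimal_dom f"
  shows "f \<in> F_space E \<mu>"
proof -
  have sl: "sqint (slope E f)" and pr: "primitive E f (slope E f)" using f by (simp_all add: minimal_dom_def)
  obtain x0 where x0: "x0 \<in> E" using E_nonempty by blast
  let ?k = "slope E f"
  let ?G = "\<lambda>y. f x0 + antideriv ?k x0 y"
  have kint: "set_integrable lborel {z..y} ?k \<and> ?G y - ?G z = set_lebesgue_integral lborel {z..y} ?k" if "z \<le> y" for y z
    using antideriv_diff[OF sqintD(1,3)[OF sl] that, of x0] sqintD(3)[OF sl] by simp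
  have fG: "f x = ?G (id x)" if "x \<in> E" for x
    using primitiveD(3)[OF pr x0 that] primitiveD(3)[OF pr that x0] by (cases "x0 \<le> x") (simp_all add: antideriv_def)
  have "set_integrable lborel (intI E) (\<lambda>x. (?k (id x))\<^sup>2 * 1)"
    using integrable_set_integrable[OF sqintD(2)[OF sl], of "intI E"] by simp
  then have "H1s_rep E id (\<lambda>_. 1) f ?G ?k"
    unfolding H1s_rep_def using slope_borel kint fG by blast
  moreover have "s_bdry E id ?G"
  proof -
    have mono: "mono_on (intI E) id" by (rule mono_onI) simp
    have strict: "\<forall>x\<in>E. \<forall>y\<in>E. x < y \<longrightarrow> id x < id y" by simp
    have k0: "\<forall>y z. y \<in> s_hull E id \<and> z \<in> s_hull E id \<and> z \<le> y \<longrightarrow>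
        set_integrable lborel {z..y} ?k \<and> ?G y - ?G z = set_lebesgue_integral lborel {z..y} ?k" using kint by blast
    have f1: "\<forall>x\<in>E. f x = ?G (id x)" using fG by blast
    have lo: "\<bar>s_lo E sb\<bar> \<noteq> \<infinity>" if fin: "\<bar>s_lo E id\<bar> \<noteq> \<infinity>"
    proof -
      define l where "l = real_of_ereal (s_lo E id)"
      have "ereal l \<le> ereal t" if "t \<in> intI E" for t
        using s_lo_le[OF that, of id] by (simp add: l_def finite_erealE[OF fin, symmetric])
      then have "sb l \<le> sb t" if "t \<in> intI E" for t using that by (intro sb_mono) simp
      then have "ereal (sb l) \<le> s_lo E sb"
        unfolding s_lo_def by (intro Inf_greatest) auto
      moreover have "s_lo E sb \<le> ereal (sb x0)" by (rule s_lo_le[OF intI_I[OF x0]])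
      ultimately show ?thesis by (cases "s_lo E sb") auto
    qed
    have hi: "\<bar>s_hi E sb\<bar> \<noteq> \<infinity>" if fin: "\<bar>s_hi E id\<bar> \<noteq> \<infinity>"
    proof -
      define l where "l = real_of_ereal (s_hi E id)"
      have "ereal t \<le> ereal l" if "t \<in> intI E" for t
        using s_hi_ge[OF that, of id] by (simp add: l_def finite_erealE[OF fin, symmetric])
      then have "sb t \<le> sb l" if "t \<in> intI E" for t using that by (intro sb_mono) simp
      then have "s_hi E sb \<le> ereal (sb l)"
        unfolding s_hi_def by (intro Sup_least) auto
      moreover have "ereal (sb x0) \<le> s_hi E sb" by (rule s_hi_ge[OF intI_I[OF x0]])
      ultimately show ?thesis by (cases "s_hi E sb") auto
    qed
    show ?thesis
      unfolding s_bdry_def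
    proof (intro conjI impI)
      assume *: "lE E \<notin> ereal ` E \<and> \<bar>s_lo E id\<bar> \<noteq> \<infinity>"
      have "near_lo E f" by (rule minimal_dom_near_lo[OF f conjunct1[OF *] lo[OF conjunct2[OF *]]])
      then show "?G (real_of_ereal (s_lo E id)) = 0"
        by (rule bdry_iff(1)[OF mono strict k0 f1 conjunct1[OF *] conjunct2[OF *], THEN iffD1])
    next
      assume *: "rE E \<notin> ereal ` E \<and> \<bar>s_hi E id\<bar> \<noteq> \<infinity>"
      have "near_hi E f" by (rule minimal_dom_near_hi[OF f conjunct1[OF *] hi[OF conjunct2[OF *]]])
      then show "?G (real_of_ereal (s_hi E id)) = 0"
        by (rule bdry_iff(2)[OF mono strict k0 f1 conjunct1[OF *] conjunct2[OF *], THEN iffD1])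
    qed
  qed
  ultimately show ?thesis
    unfolding F_space_def Fs_space_def using f unfolding minimal_dom_def by blast
qed

lemma minimal_dom_D:
  assumes "minimal_dom f"
  shows "x \<notin> E \<Longrightarrow> f x = 0" "L2 \<mu> f" "sqint (slope E f)" "primitive E f (slope E f)"
  using assms by (simp_all add: minimal_dom_def)

lemma minimal_dom_H1: "minimal_dom f \<Longrightarrow> H1 f"
  unfolding H1_iff using minimal_dom_D(3,4) by blast

lemma minimal_dom_der:
  assumes "minimal_dom f"
  shows "AE t in lborel. der f t = slope E f t"
proof -
  have "AE t in lborel. t \<in> E \<longrightarrow> der f t = slope E f t"
    by (rule primitive_unique[OF der_props(2)[OF minimal_dom_H1[OF assms]] minimal_dom_D(4)[OF assms]])
  then show ?thesis by (rule AE_mp) (rule AE_I2, auto simp: der_gap)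
qed

text \<open>Almost everywhere the derivative equals the slope, which is 0 on \<open>E\<close>: the
  strongly local part disappears.\<close>

lemma minimal_dom_form:
  assumes "minimal_dom f" "minimal_dom g"
  shows "form E f g = (\<integral>t. slope E f t * slope E g t \<partial>lborel) / 2" "form E f g = gap_sum E f g / 2"
proof -
  have "(\<integral>t. der f t * der g t \<partial>lborel) = (\<integral>t. slope E f t * slope E g t \<partial>lborel)"
  proof (rule integral_cong_AE)
    show "AE t in lborel. der f t * der g t = slope E f t * slope E g t"
      using minimal_dom_der[OF assms(1)] minimal_dom_der[OF assms(2)] by eventually_elim simp
  qed (use sqintD(1)[OF der_props(1)[OF minimal_dom_H1]] assms in simp_all)
  then show "form E f g = (\<integral>t. slope E f t * slope E g t \<partial>lborel) / 2"
    using form_eq[OF minimal_dom_H1[OF assms(1)] minimal_dom_H1[OF assms(2)]] by simp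
  then show "form E f g = gap_sum E f g / 2"
    using gap_sum_eq[OF minimal_dom_D(3)[OF assms(1)] minimal_dom_D(3)[OF assms(2)]] by simp
qed

lemma minimal_dom_form_self: "minimal_dom f \<Longrightarrow> form E f f = (\<integral>t. (slope E f t)\<^sup>2 \<partial>lborel) / 2"
  using minimal_dom_form(1)[of f f] by (simp add: power2_eq_square)

section \<open>Closure properties of the candidate\<close>

text \<open>The test used for every new member: a square-integrable majorant of the increments that
  vanishes on \<open>E\<close> yields both the slope representation and the finiteness of the
  energy.\<close>

lemma minimal_dom_intro:
  assumes dom: "dominated E w m" and mE: "\<And>t. t \<in> E \<Longrightarrow> m t = 0" and m: "sqint m" and off: "\<And>x. x \<notin> E \<Longrightarrow> w x = 0"
    and L: "L2 \<mu> u" "L2 \<mu> v" and le: "\<And>x. x \<in> E \<Longrightarrow> \<bar>w x\<bar> \<le> \<bar>u x\<bar> + \<bar>v x\<bar>"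
    and lo: "lE E \<notin> ereal ` E \<Longrightarrow> \<bar>s_lo E sb\<bar> \<noteq> \<infinity> \<Longrightarrow> near_lo E w"
    and hi: "rE E \<notin> ereal ` E \<Longrightarrow> \<bar>s_hi E sb\<bar> \<noteq> \<infinity> \<Longrightarrow> near_hi E w"
  shows "minimal_dom w"
proof -
  have pr: "primitive E w (slope E w)" by (rule dominated_slope_null[OF dom]) (rule mE)
  have sl: "sqint (slope E w)" by (rule slope_square_le(1)[OF dom m])
  have "H1 w" unfolding H1_iff using pr sl by blast
  then have "w \<in> borel_measurable \<mu>" by (intro continuous_mu H1_continuous)
  then have "L2 \<mu> w" using L le by (rule L2_dominated)
  then show ?thesis unfolding minimal_dom_def using pr sl off lo hi by simp
qed

lemma near_lo_dom:
  assumes "near_lo E u" "near_lo E v" "0 \<le> c" "\<And>x. x \<in> E \<Longrightarrow> \<bar>w x\<bar> \<le> c * (\<bar>u x\<bar> + \<bar>v x\<bar>)"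
  shows "near_lo E w"
  unfolding near_lo_def
proof (intro allI impI)
  fix e :: real assume e: "0 < e"
  define d where "d = e / (2 * (c + 1))"
  have d: "0 < d" "c * (2 * d) < e" using e assms(3) by (auto simp: d_def field_simps)
  obtain a where a: "a \<in> E" "\<forall>x\<in>E. x \<le> a \<longrightarrow> \<bar>u x\<bar> < d" using assms(1) d(1) unfolding near_lo_def by blast
  obtain b where b: "b \<in> E" "\<forall>x\<in>E. x \<le> b \<longrightarrow> \<bar>v x\<bar> < d" using assms(2) d(1) unfolding near_lo_def by blast
  have "\<bar>w x\<bar> < e" if x: "x \<in> E" "x \<le> min a b" for x
  proof -
    have "\<bar>u x\<bar> < d" "\<bar>v x\<bar> < d" using a(2) b(2) x by auto
    then have "c * (\<bar>u x\<bar> + \<bar>v x\<bar>) \<le> c * (2 * d)" using assms(3) by (intro mult_left_mono) auto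
    then show ?thesis using assms(4)[OF x(1)] d(2) by linarith
  qed
  moreover have "min a b \<in> E" using a b by (simp add: min_def)
  ultimately show "\<exists>c\<in>E. \<forall>x\<in>E. x \<le> c \<longrightarrow> \<bar>w x\<bar> < e" by blast
qed

lemma near_hi_dom:
  assumes "near_hi E u" "near_hi E v" "0 \<le> c" "\<And>x. x \<in> E \<Longrightarrow> \<bar>w x\<bar> \<le> c * (\<bar>u x\<bar> + \<bar>v x\<bar>)"
  shows "near_hi E w"
  unfolding near_hi_def
proof (intro allI impI)
  fix e :: real assume e: "0 < e"
  define d where "d = e / (2 * (c + 1))"
  have d: "0 < d" "c * (2 * d) < e" using e assms(3) by (auto simp: d_def field_simps)
  obtain a where a: "a \<in> E" "\<forall>x\<in>E. a \<le> x \<longrightarrow> \<bar>u x\<bar> < d" using assms(1) d(1) unfolding near_hi_def by blast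
  obtain b where b: "b \<in> E" "\<forall>x\<in>E. b \<le> x \<longrightarrow> \<bar>v x\<bar> < d" using assms(2) d(1) unfolding near_hi_def by blast
  have "\<bar>w x\<bar> < e" if x: "x \<in> E" "max a b \<le> x" for x
  proof -
    have "\<bar>u x\<bar> < d" "\<bar>v x\<bar> < d" using a(2) b(2) x by auto
    then have "c * (\<bar>u x\<bar> + \<bar>v x\<bar>) \<le> c * (2 * d)" using assms(3) by (intro mult_left_mono) auto
    then show ?thesis using assms(4)[OF x(1)] d(2) by linarith
  qed
  moreover have "max a b \<in> E" using a b by (simp add: max_def)
  ultimately show "\<exists>c\<in>E. \<forall>x\<in>E. c \<le> x \<longrightarrow> \<bar>w x\<bar> < e" by blast
qed

lemma L2_scale: "L2 \<mu> u \<Longrightarrow> L2 \<mu> (\<lambda>x. c * u x)"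
  by (auto simp: L2_def power_mult_distrib intro!: borel_measurable_times)

text \<open>Sums, differences, multiples and contractions are all instances: increments and values
  are bounded by those of two members, up to a constant.\<close>

lemma minimal_dom_dom:
  assumes u: "minimal_dom u" and v: "minimal_dom v" and c: "0 \<le> c" and off: "\<And>x. x \<notin> E \<Longrightarrow> w x = 0"
    and inc: "\<And>x y. x \<in> E \<Longrightarrow> y \<in> E \<Longrightarrow> x \<le> y \<Longrightarrow> \<bar>w y - w x\<bar> \<le> c * (\<bar>u y - u x\<bar> + \<bar>v y - v x\<bar>)"
    and le: "\<And>x. x \<in> E \<Longrightarrow> \<bar>w x\<bar> \<le> c * (\<bar>u x\<bar> + \<bar>v x\<bar>)"
  shows "minimal_dom w"
proof -
  let ?m = "\<lambda>t. c * (\<bar>slope E u t\<bar> + \<bar>slope E v t\<bar>)"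
  note du = primitive_dominated[OF minimal_dom_D(4)[OF u]] and dv = primitive_dominated[OF minimal_dom_D(4)[OF v]]
  have dom: "dominated E w ?m"
    unfolding dominated_def
  proof (intro conjI ballI impI allI)
    fix x y assume xy: "x \<in> E" "y \<in> E" "x \<le> y"
    note a = set_integral_add[OF dominatedD(3)[OF du xy] dominatedD(3)[OF dv xy]]
    show "set_integrable lborel {x..y} ?m" by (rule set_integrable_mult_right[OF a(1)])
    have "\<bar>u y - u x\<bar> + \<bar>v y - v x\<bar> \<le> set_lebesgue_integral lborel {x..y} (\<lambda>t. \<bar>slope E u t\<bar> + \<bar>slope E v t\<bar>)"
      unfolding a(2) by (intro add_mono dominatedD(4)[OF du xy] dominatedD(4)[OF dv xy])
    then have "c * (\<bar>u y - u x\<bar> + \<bar>v y - v x\<bar>) \<le> c * set_lebesgue_integral lborel {x..y} (\<lambda>t. \<bar>slope E u t\<bar> + \<bar>slope E v t\<bar>)"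
      by (rule mult_left_mono[OF _ c])
    then show "\<bar>w y - w x\<bar> \<le> set_lebesgue_integral lborel {x..y} ?m"
      using inc[OF xy] by simp
  qed (use c in simp_all)
  have sq: "sqint ?m"
  proof (rule sqint_bound(1)[OF sqint_scale[OF minimal_dom_D(3)[OF u], of c] sqint_scale[OF minimal_dom_D(3)[OF v], of c]])
    show "AE t in lborel. \<bar>?m t\<bar> \<le> \<bar>c * slope E u t\<bar> + \<bar>c * slope E v t\<bar>"
      using c by (intro AE_I2) (simp add: abs_mult distrib_left)
  qed measurable
  show ?thesis
  proof (rule minimal_dom_intro[OF dom _ sq off L2_scale[OF minimal_dom_D(2)[OF u], of c] L2_scale[OF minimal_dom_D(2)[OF v], of c]])
    show "?m t = 0" if "t \<in> E" for t using slope_in[OF that] by simp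
    show "\<bar>w x\<bar> \<le> \<bar>c * u x\<bar> + \<bar>c * v x\<bar>" if "x \<in> E" for x
      using le[OF that] c by (simp add: abs_mult distrib_left)
    show "near_lo E w" if "lE E \<notin> ereal ` E" "\<bar>s_lo E sb\<bar> \<noteq> \<infinity>"
      by (rule near_lo_dom[OF minimal_dom_near_lo[OF u that] minimal_dom_near_lo[OF v that] c le])
    show "near_hi E w" if "rE E \<notin> ereal ` E" "\<bar>s_hi E sb\<bar> \<noteq> \<infinity>"
      by (rule near_hi_dom[OF minimal_dom_near_hi[OF u that] minimal_dom_near_hi[OF v that] c le])
  qed
qed

lemma minimal_dom_diff: "minimal_dom u \<Longrightarrow> minimal_dom v \<Longrightarrow> minimal_dom (\<lambda>x. u x - v x)"
proof -
  assume u: "minimal_dom u" and v: "minimal_dom v"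
  show ?thesis by (rule minimal_dom_dom[OF u v, of 1]) (use minimal_dom_D(1)[OF u] minimal_dom_D(1)[OF v] in auto)
qed

lemma minimal_dom_add: "minimal_dom u \<Longrightarrow> minimal_dom v \<Longrightarrow> minimal_dom (\<lambda>x. u x + v x)"
proof -
  assume u: "minimal_dom u" and v: "minimal_dom v"
  show ?thesis by (rule minimal_dom_dom[OF u v, of 1]) (use minimal_dom_D(1)[OF u] minimal_dom_D(1)[OF v] in auto)
qed

lemma minimal_dom_contract:
  assumes u: "minimal_dom u" and \<phi>: "\<phi> 0 = 0" "\<And>s t. \<bar>\<phi> s - \<phi> t\<bar> \<le> c * \<bar>s - t\<bar>" "0 \<le> c"
  shows "minimal_dom (\<lambda>x. \<phi> (u x))"
proof (rule minimal_dom_dom[OF u u \<phi>(3)])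
  show "\<phi> (u x) = 0" if "x \<notin> E" for x using minimal_dom_D(1)[OF u that] \<phi>(1) by simp
  have c: "c * a \<le> c * (a + a)" if "0 \<le> a" for a using that \<phi>(3) by (intro mult_left_mono) auto
  show "\<bar>\<phi> (u y) - \<phi> (u x)\<bar> \<le> c * (\<bar>u y - u x\<bar> + \<bar>u y - u x\<bar>)" for x y
    using \<phi>(2)[of "u y" "u x"] c[of "\<bar>u y - u x\<bar>"] by simp
  show "\<bar>\<phi> (u x)\<bar> \<le> c * (\<bar>u x\<bar> + \<bar>u x\<bar>)" for x
    using \<phi>(2)[of "u x" 0] \<phi>(1) c[of "\<bar>u x\<bar>"] by simp
qed

lemma minimal_dom_scale: "minimal_dom u \<Longrightarrow> minimal_dom (\<lambda>x. c * u x)"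
  by (rule minimal_dom_contract[where c = "\<bar>c\<bar>" and \<phi> = "\<lambda>t. c * t"]) (simp_all add: abs_mult[symmetric] right_diff_distrib)

lemma minimal_dom_unit: "minimal_dom u \<Longrightarrow> minimal_dom (unit_part u)"
  by (rule minimal_dom_contract[where c = 1 and \<phi> = "\<lambda>t. min 1 (max 0 t)"]) (simp_all add: min_def max_def abs_if)

lemma minimal_dom_zero: "minimal_dom (\<lambda>_. 0)"
proof -
  have "slope E (\<lambda>_. 0) = (\<lambda>_. 0)" by (simp add: slope_def fun_eq_iff)
  moreover have "near_lo E (\<lambda>_. 0)" "near_hi E (\<lambda>_. 0)" using E_nonempty by (auto simp: near_lo_def near_hi_def)
  ultimately show ?thesis
    by (simp add: minimal_dom_def sqint_def L2_def primitive_def set_integrable_def)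
qed

section \<open>Estimates in the scale, and completeness\<close>

text \<open>Cauchy-Schwarz against the density \<open>off_E\<close>: as the slope vanishes on
  \<open>E\<close>, only the length outside \<open>E\<close> counts. With \<open>y - x\<close> in
  place of \<open>sb y - sb x\<close> there would be no bound up to an infinite end with finite
  position in the scale.\<close>

lemma sb_increment:
  assumes g: "primitive E g (slope E g)" "sqint (slope E g)" and xy: "x \<in> E" "y \<in> E" "x \<le> y"
  shows "(g y - g x)\<^sup>2 \<le> (sb y - sb x) * (\<integral>t. (slope E g t)\<^sup>2 \<partial>lborel)"
proof (cases "x = y")
  case False
  let ?I = "\<integral>t. (slope E g t)\<^sup>2 \<partial>lborel"
  define D where "D = sb y - sb x"
  have D: "0 < D" using sb_strict[of x y] False xy(3) by (simp add: D_def)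
  \<comment> \<open>The mean slope per unit of \<open>sb\<close>; the inequality follows from
    integrating \<open>2 * c * s \<le> s\<^sup>2 + c\<^sup>2 * off_E\<close> with \<open>s\<close>
    the slope, and is valid on \<open>E\<close> because there \<open>s\<close> is 0.\<close>
  define c where "c = (g y - g x) / D"
  have s2: "set_integrable lborel {x..y} (\<lambda>t. (slope E g t)\<^sup>2)"
    by (rule integrable_set_integrable[OF sqintD(2)[OF g(2)]]) simp
  have hc: "set_integrable lborel {x..y} (\<lambda>t. c\<^sup>2 * off_E t)" by (rule set_integrable_mult_right[OF off_E_integrable])
  have "2 * c * (g y - g x) = set_lebesgue_integral lborel {x..y} (\<lambda>t. (2 * c) * slope E g t)"
    using primitiveD(3)[OF g(1) xy] by simp
  also have "\<dots> \<le> set_lebesgue_integral lborel {x..y} (\<lambda>t. (slope E g t)\<^sup>2 + c\<^sup>2 * off_E t)"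
  proof (rule set_integral_mono)
    show "set_integrable lborel {x..y} (\<lambda>t. (2 * c) * slope E g t)"
      by (rule set_integrable_mult_right[OF sqintD(3)[OF g(2)]])
    show "set_integrable lborel {x..y} (\<lambda>t. (slope E g t)\<^sup>2 + c\<^sup>2 * off_E t)" by (rule set_integral_add(1)[OF s2 hc])
    show "(2 * c) * slope E g t \<le> (slope E g t)\<^sup>2 + c\<^sup>2 * off_E t" for t
    proof (cases "t \<in> E")
      case True
      then show ?thesis using slope_in[of t E g] by (simp add: off_E_def)
    next
      case False
      then show ?thesis using zero_le_power2[of "slope E g t - c"] by (simp add: off_E_def power2_eq_square algebra_simps)
    qed
  qed
  also have "\<dots> = set_lebesgue_integral lborel {x..y} (\<lambda>t. (slope E g t)\<^sup>2) + c\<^sup>2 * D"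
    using set_integral_add(2)[OF s2 hc] sb_diff[OF xy(3)] by (simp add: D_def)
  also have "set_lebesgue_integral lborel {x..y} (\<lambda>t. (slope E g t)\<^sup>2) \<le> ?I"
    unfolding set_lebesgue_integral_def
  proof (rule integral_mono_AE)
    show "integrable lborel (\<lambda>t. indicator {x..y} t *\<^sub>R (slope E g t)\<^sup>2)" using s2 by (simp add: set_integrable_def)
    show "AE t in lborel. indicator {x..y} t *\<^sub>R (slope E g t)\<^sup>2 \<le> (slope E g t)\<^sup>2"
      by (rule AE_I2) (simp add: indicator_def)
  qed (rule sqintD(2)[OF g(2)])
  finally have "2 * c * (g y - g x) \<le> ?I + c\<^sup>2 * D" by simp
  moreover have "c\<^sup>2 * D = c * (g y - g x)" using D by (simp add: c_def power2_eq_square)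
  ultimately have "c * (g y - g x) \<le> ?I" by linarith
  then have "c * (g y - g x) * D \<le> ?I * D" using D by (intro mult_right_mono) auto
  moreover have "c * (g y - g x) * D = (g y - g x)\<^sup>2" using D by (simp add: c_def power2_eq_square)
  ultimately show ?thesis by (simp add: D_def mult.commute)
qed simp

text \<open>The increment estimate started at the lower end, where \<open>g\<close> vanishes.
  Applied to differences of a Cauchy sequence it is uniform near that end, which is what lets the
  boundary condition survive limits.\<close>

lemma minimal_dom_lo_bound:
  assumes g: "minimal_dom g" and l: "lE E \<notin> ereal ` E" "\<bar>s_lo E sb\<bar> \<noteq> \<infinity>" and x: "x \<in> E"
  shows "(g x)\<^sup>2 \<le> (sb x - real_of_ereal (s_lo E sb)) * (\<integral>t. (slope E g t)\<^sup>2 \<partial>lborel)"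
proof -
  let ?s = "real_of_ereal (s_lo E sb)" and ?I = "\<integral>t. (slope E g t)\<^sup>2 \<partial>lborel"
  have I: "0 \<le> ?I" by (rule integral_nonneg_AE) simp
  have s: "?s \<le> sb y" if "y \<in> E" for y
    using s_lo_le[OF intI_I[OF that], of sb] finite_erealE[OF l(2)] by (metis ereal_less_eq(3))
  have B: "0 \<le> (sb x - ?s) * ?I" using s[OF x] I by simp
  have "\<bar>g x\<bar> \<le> sqrt ((sb x - ?s) * ?I) + e" if e: "0 < e" for e
  proof -
    obtain c where c: "c \<in> E" "\<forall>y\<in>E. y \<le> c \<longrightarrow> \<bar>g y\<bar> < e"
      using minimal_dom_near_lo[OF g l] e unfolding near_lo_def by blast
    let ?y = "min c x"
    have y: "?y \<in> E" "?y \<le> x" using c x by (auto simp: min_def)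
    have "(g x - g ?y)\<^sup>2 \<le> (sb x - sb ?y) * ?I" by (rule sb_increment[OF minimal_dom_D(4,3)[OF g] y(1) x y(2)])
    also have "\<dots> \<le> (sb x - ?s) * ?I" using s[OF y(1)] I by (intro mult_right_mono) auto
    finally have "\<bar>g x - g ?y\<bar> \<le> sqrt ((sb x - ?s) * ?I)" by (intro real_le_rsqrt) simp
    moreover have "\<bar>g ?y\<bar> < e" using c(2) y(1) by simp
    ultimately show ?thesis by linarith
  qed
  then have "\<bar>g x\<bar> \<le> sqrt ((sb x - ?s) * ?I)" by (rule field_le_epsilon)
  then have "\<bar>g x\<bar>\<^sup>2 \<le> (sqrt ((sb x - ?s) * ?I))\<^sup>2" by (intro power_mono) auto
  then show ?thesis using B by simp
qed

lemma minimal_dom_hi_bound: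
  assumes g: "minimal_dom g" and l: "rE E \<notin> ereal ` E" "\<bar>s_hi E sb\<bar> \<noteq> \<infinity>" and x: "x \<in> E"
  shows "(g x)\<^sup>2 \<le> (real_of_ereal (s_hi E sb) - sb x) * (\<integral>t. (slope E g t)\<^sup>2 \<partial>lborel)"
proof -
  let ?s = "real_of_ereal (s_hi E sb)" and ?I = "\<integral>t. (slope E g t)\<^sup>2 \<partial>lborel"
  have I: "0 \<le> ?I" by (rule integral_nonneg_AE) simp
  have s: "sb y \<le> ?s" if "y \<in> E" for y
    using s_hi_ge[OF intI_I[OF that], of sb] finite_erealE[OF l(2)] by (metis ereal_less_eq(3))
  have B: "0 \<le> (?s - sb x) * ?I" using s[OF x] I by simp
  have "\<bar>g x\<bar> \<le> sqrt ((?s - sb x) * ?I) + e" if e: "0 < e" for e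
  proof -
    obtain c where c: "c \<in> E" "\<forall>y\<in>E. c \<le> y \<longrightarrow> \<bar>g y\<bar> < e"
      using minimal_dom_near_hi[OF g l] e unfolding near_hi_def by blast
    let ?y = "max c x"
    have y: "?y \<in> E" "x \<le> ?y" using c x by (auto simp: max_def)
    have "(g ?y - g x)\<^sup>2 \<le> (sb ?y - sb x) * ?I" by (rule sb_increment[OF minimal_dom_D(4,3)[OF g] x y(1) y(2)])
    also have "\<dots> \<le> (?s - sb x) * ?I" using s[OF y(1)] I by (intro mult_right_mono) auto
    finally have "\<bar>g ?y - g x\<bar> \<le> sqrt ((?s - sb x) * ?I)" by (intro real_le_rsqrt) simp
    moreover have "\<bar>g ?y\<bar> < e" using c(2) y(1) by simp
    ultimately show ?thesis by linarith
  qed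
  then have "\<bar>g x\<bar> \<le> sqrt ((?s - sb x) * ?I)" by (rule field_le_epsilon)
  then have "\<bar>g x\<bar>\<^sup>2 \<le> (sqrt ((?s - sb x) * ?I))\<^sup>2" by (intro power_mono) auto
  then show ?thesis using B by simp
qed

end

text \<open>The form of Fatou's lemma by which a Cauchy estimate passes to the limit in one of its
  two indices.\<close>

lemma Fatou_integrable:
  fixes q :: "nat \<Rightarrow> 'a \<Rightarrow> real"
  assumes q: "\<And>m. N \<le> m \<Longrightarrow> integrable M (q m)" "\<And>m x. 0 \<le> q m x" "\<And>m. N \<le> m \<Longrightarrow> (\<integral>x. q m x \<partial>M) \<le> c"
    and lim: "\<And>x. x \<in> space M \<Longrightarrow> (\<lambda>m. q m x) \<longlonglongrightarrow> q' x"
  shows "integrable M q'" "(\<integral>x. q' x \<partial>M) \<le> c"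
proof -
  have c: "0 \<le> c"
  proof -
    have "0 \<le> (\<integral>x. q N x \<partial>M)" by (intro integral_nonneg_AE AE_I2 q(2))
    then show ?thesis using q(3)[of N] by simp
  qed
  let ?r = "\<lambda>m. q (m + N)"
  have rm: "?r m \<in> borel_measurable M" for m using q(1)[of "m + N"] by (intro borel_measurable_integrable) simp
  have rl: "(\<lambda>m. ?r m x) \<longlonglongrightarrow> q' x" if "x \<in> space M" for x using lim[OF that] by (rule LIMSEQ_ignore_initial_segment)
  have m': "q' \<in> borel_measurable M" by (rule borel_measurable_LIMSEQ_real[OF rl rm])
  have q'0: "0 \<le> q' x" if "x \<in> space M" for x
    by (rule LIMSEQ_le_const[OF rl[OF that]]) (use q(2) in auto)
  have "(\<integral>\<^sup>+x. ennreal (q' x) \<partial>M) = (\<integral>\<^sup>+x. liminf (\<lambda>m. ennreal (?r m x)) \<partial>M)"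
  proof (rule nn_integral_cong)
    fix x assume "x \<in> space M"
    then have "(\<lambda>m. ennreal (?r m x)) \<longlonglongrightarrow> ennreal (q' x)" by (intro tendsto_ennrealI rl)
    then show "ennreal (q' x) = liminf (\<lambda>m. ennreal (?r m x))" by (intro lim_imp_Liminf[symmetric]) simp_all
  qed
  also have "\<dots> \<le> liminf (\<lambda>m. \<integral>\<^sup>+x. ennreal (?r m x) \<partial>M)"
    by (rule nn_integral_liminf) (use rm in simp)
  also have "\<dots> \<le> limsup (\<lambda>m. \<integral>\<^sup>+x. ennreal (?r m x) \<partial>M)" by (rule Liminf_le_Limsup) simp
  also have "\<dots> \<le> ennreal c"
  proof (rule Limsup_bounded, intro always_eventually allI)
    fix m
    have "(\<integral>\<^sup>+x. ennreal (?r m x) \<partial>M) = ennreal (\<integral>x. ?r m x \<partial>M)"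
      by (rule nn_integral_eq_integral) (use q(1)[of "m + N"] q(2) in simp_all)
    also have "\<dots> \<le> ennreal c" by (intro ennreal_leI q(3)) simp
    finally show "(\<integral>\<^sup>+x. ennreal (?r m x) \<partial>M) \<le> ennreal c" .
  qed
  finally have *: "(\<integral>\<^sup>+x. ennreal (q' x) \<partial>M) \<le> ennreal c" .
  have nq: "AE x in M. 0 \<le> q' x" by (rule AE_I2) (rule q'0)
  show i: "integrable M q'"
  proof (rule integrableI_nonneg[OF m' nq])
    show "(\<integral>\<^sup>+x. ennreal (q' x) \<partial>M) < \<infinity>" by (rule le_less_trans[OF *]) simp
  qed
  have "ennreal (\<integral>x. q' x \<partial>M) \<le> ennreal c" using * unfolding nn_integral_eq_integral[OF i nq] .
  then show "(\<integral>x. q' x \<partial>M) \<le> c" using c by (simp add: ennreal_le_iff)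
qed

context nowhereK
begin

lemma slope_diff: "slope E (\<lambda>x. f x - g x) t = slope E f t - slope E g t"
  using slope_linear[of 1 f 1 g t] by simp

lemma slope_tendsto:
  assumes "\<And>x. (\<lambda>n. fs n x) \<longlonglongrightarrow> f x"
  shows "(\<lambda>n. slope E (fs n) t) \<longlonglongrightarrow> slope E f t"
  unfolding slope_def divide_inverse
  by (cases "t \<in> \<Omega>") (auto intro!: tendsto_mult tendsto_diff tendsto_const assms)

text \<open>The pointwise bound gives a pointwise limit. Slopes are difference quotients over fixed
  gaps, so they converge pointwise as well, and Fatou carries the Cauchy bounds over to the
  limit.\<close>

lemma minimal_dom_complete:
  assumes fs: "\<And>n. minimal_dom (fs n)" and cau: "\<And>e. 0 < e \<Longrightarrow> \<exists>N. \<forall>m\<ge>N. \<forall>n\<ge>N. E1 E \<mu> (\<lambda>x. fs n x - fs m x) < e"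
  shows "\<exists>f. minimal_dom f \<and> (\<lambda>n. E1 E \<mu> (\<lambda>x. fs n x - f x)) \<longlonglongrightarrow> 0"
proof -
  have d: "minimal_dom (\<lambda>x. fs n x - fs m x)" for n m by (rule minimal_dom_diff[OF fs fs])
  have "convergent (\<lambda>n. fs n x)" if x: "x \<in> E" for x
  proof -
    obtain C where C: "0 \<le> C" "\<And>f. H1 f \<Longrightarrow> L2 \<mu> f \<Longrightarrow> (f x)\<^sup>2 \<le> C * E1 E \<mu> f" by (rule point_bound[OF x]) (rule that)
    have "Cauchy (\<lambda>n. fs n x)"
    proof (rule CauchyI)
      fix e :: real assume e: "0 < e"
      \<comment> \<open>The 1 in the denominator covers \<open>C = 0\<close> and makes
        \<open>C * a\<close> strictly smaller than \<open>e\<^sup>2\<close>.\<close>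
      define a where "a = e\<^sup>2 / (C + 1)"
      have a: "0 < a" "C * a < e\<^sup>2" using e C(1) by (auto simp: a_def field_simps)
      obtain N where N: "\<forall>m\<ge>N. \<forall>n\<ge>N. E1 E \<mu> (\<lambda>x. fs n x - fs m x) < a" using cau[OF a(1)] by blast
      have "norm (fs m x - fs n x) < e" if "N \<le> m" "N \<le> n" for m n
      proof -
        have "(fs m x - fs n x)\<^sup>2 \<le> C * E1 E \<mu> (\<lambda>x. fs m x - fs n x)" by (rule C(2)[OF minimal_dom_H1[OF d] minimal_dom_D(2)[OF d]])
        also have "\<dots> \<le> C * a" using N that by (intro mult_left_mono[OF less_imp_le C(1)]) blast
        finally have "(fs m x - fs n x)\<^sup>2 < e\<^sup>2" using a(2) by linarith
        then have "\<bar>fs m x - fs n x\<bar> < e" using e by (intro power2_less_imp_less[of _ e]) simp_all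
        then show ?thesis by simp
      qed
      then show "\<exists>M. \<forall>m\<ge>M. \<forall>n\<ge>M. norm (fs m x - fs n x) < e" by blast
    qed
    then show ?thesis by (rule Cauchy_convergent)
  qed
  then have lim0: "\<exists>l. (\<lambda>n. fs n x) \<longlonglongrightarrow> l \<and> (x \<notin> E \<longrightarrow> l = 0)" for x
    using minimal_dom_D(1)[OF fs, of x] by (cases "x \<in> E") (auto simp: convergent_def)
  then obtain f where f: "\<And>x. (\<lambda>n. fs n x) \<longlonglongrightarrow> f x" and off: "\<And>x. x \<notin> E \<Longrightarrow> f x = 0"
    by metis
  note sl = slope_tendsto[OF f]
  \<comment> \<open>Fatou in the second index of the Cauchy estimate; the factor 2 compensates for
    the form being half of the square integral.\<close>
  have key: "integrable lborel (\<lambda>t. (slope E (fs n) t - slope E f t)\<^sup>2) \<and> (\<integral>t. (slope E (fs n) t - slope E f t)\<^sup>2 \<partial>lborel) \<le> 2 * e \<and>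
      integrable \<mu> (\<lambda>x. (fs n x - f x)\<^sup>2) \<and> (\<integral>x. (fs n x - f x)\<^sup>2 \<partial>\<mu>) \<le> e"
    if N: "\<forall>m\<ge>N. \<forall>n\<ge>N. E1 E \<mu> (\<lambda>x. fs n x - fs m x) < e" and n: "N \<le> n" for N n e
  proof -
    have E: "E1 E \<mu> (\<lambda>x. fs n x - fs m x) \<le> e" if "N \<le> m" for m using N n that by (simp add: less_imp_le)
    have "integrable lborel (\<lambda>t. (slope E (fs n) t - slope E (fs m) t)\<^sup>2)" for m
      using sqintD(2)[OF minimal_dom_D(3)[OF d[of n m]]] by (simp add: slope_diff)
    moreover have "(\<integral>t. (slope E (fs n) t - slope E (fs m) t)\<^sup>2 \<partial>lborel) \<le> 2 * e" if "N \<le> m" for m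
      using minimal_dom_form_self[OF d[of n m]] form_le_E1[of "\<lambda>x. fs n x - fs m x"] E[OF that] by (simp add: slope_diff)
    moreover have "(\<lambda>m. (slope E (fs n) t - slope E (fs m) t)\<^sup>2) \<longlonglongrightarrow> (slope E (fs n) t - slope E f t)\<^sup>2" for t
      by (intro tendsto_power tendsto_diff tendsto_const sl)
    ultimately have A: "integrable lborel (\<lambda>t. (slope E (fs n) t - slope E f t)\<^sup>2) \<and> (\<integral>t. (slope E (fs n) t - slope E f t)\<^sup>2 \<partial>lborel) \<le> 2 * e"
      using Fatou_integrable[of N lborel "\<lambda>m t. (slope E (fs n) t - slope E (fs m) t)\<^sup>2" "2 * e" "\<lambda>t. (slope E (fs n) t - slope E f t)\<^sup>2"] by simp
    have "integrable \<mu> (\<lambda>x. (fs n x - fs m x)\<^sup>2)" for m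
      using minimal_dom_D(2)[OF d[of n m]] by (simp add: L2_def)
    moreover have "(\<integral>x. (fs n x - fs m x)\<^sup>2 \<partial>\<mu>) \<le> e" if "N \<le> m" for m
      using L2_le_E1[of "\<lambda>x. fs n x - fs m x"] E[OF that] by simp
    moreover have "(\<lambda>m. (fs n x - fs m x)\<^sup>2) \<longlonglongrightarrow> (fs n x - f x)\<^sup>2" for x
      by (intro tendsto_power tendsto_diff tendsto_const f)
    ultimately have B: "integrable \<mu> (\<lambda>x. (fs n x - f x)\<^sup>2) \<and> (\<integral>x. (fs n x - f x)\<^sup>2 \<partial>\<mu>) \<le> e"
      using Fatou_integrable[of N \<mu> "\<lambda>m x. (fs n x - fs m x)\<^sup>2" e "\<lambda>x. (fs n x - f x)\<^sup>2"] by simp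
    show ?thesis using A B by blast
  qed
  obtain N where N: "\<forall>m\<ge>N. \<forall>n\<ge>N. E1 E \<mu> (\<lambda>x. fs n x - fs m x) < 1" using cau[of 1] by auto
  note kN = key[OF N order_refl]
  have fm: "f \<in> borel_measurable \<mu>"
    by (rule borel_measurable_LIMSEQ_real[OF f]) (use minimal_dom_D(2)[OF fs] in \<open>simp add: L2_def\<close>)
  have gsq: "sqint (\<lambda>t. slope E (fs N) t - slope E f t)" using kN by (simp add: sqint_def)
  have fsq: "sqint (slope E f)"
    using sqint_diff[OF minimal_dom_D(3)[OF fs[of N]] gsq] by simp
  have "L2 \<mu> (\<lambda>x. fs N x - f x)" using kN fm minimal_dom_D(2)[OF fs[of N]] by (simp add: L2_def borel_measurable_diff)
  from L2_diff[OF minimal_dom_D(2)[OF fs[of N]] this] have fL: "L2 \<mu> f" by simp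
  \<comment> \<open>Conditional, because the energy of a difference is expressed by slopes for
    members only. Each of the two parts of \<open>E1\<close> is at most \<open>e / 5\<close>, and
    \<open>2 * (e / 5 + e / 5) < e\<close>.\<close>
  have tend0: "(\<lambda>n. 2 * E1 E \<mu> (\<lambda>x. fs n x - f x)) \<longlonglongrightarrow> 0" if mm: "minimal_dom f"
  proof (rule LIMSEQ_I)
    fix e :: real assume e: "0 < e"
    obtain N where N: "\<forall>m\<ge>N. \<forall>n\<ge>N. E1 E \<mu> (\<lambda>x. fs n x - fs m x) < e / 5" using cau[of "e / 5"] e by auto
    have "norm (2 * E1 E \<mu> (\<lambda>x. fs n x - f x) - 0) < e" if "N \<le> n" for n
    proof -
      note k = key[OF N that]
      have "form E (\<lambda>x. fs n x - f x) (\<lambda>x. fs n x - f x) \<le> e / 5"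
        using k minimal_dom_form_self[OF minimal_dom_diff[OF fs mm], of n] by (simp add: slope_diff)
      then have "E1 E \<mu> (\<lambda>x. fs n x - f x) \<le> e / 5 + e / 5" using k by (simp add: E1_def)
      then show ?thesis using E1_nonneg[of "\<lambda>x. fs n x - f x"] e by simp
    qed
    then show "\<exists>N. \<forall>n\<ge>N. norm (2 * E1 E \<mu> (\<lambda>x. fs n x - f x) - 0) < e" by blast
  qed
  have pr: "primitive E f (slope E f)"
    unfolding primitive_def
  proof (intro conjI ballI impI)
    fix x y assume xy: "x \<in> E" "y \<in> E" "x \<le> y"
    show i: "set_integrable lborel {x..y} (slope E f)" by (rule sqintD(3)[OF fsq])
    let ?D = "\<lambda>n. (fs n y - fs n x) - set_lebesgue_integral lborel {x..y} (slope E f)"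
    have "?D \<longlonglongrightarrow> 0"
    proof (rule LIMSEQ_I)
      fix e :: real assume e: "0 < e"
      define a where "a = e\<^sup>2 / (2 * ((y - x) + 1))"
      have a: "0 < a" "(y - x) * (2 * a) < e\<^sup>2" using e xy(3) by (auto simp: a_def field_simps)
      obtain N where N: "\<forall>m\<ge>N. \<forall>n\<ge>N. E1 E \<mu> (\<lambda>x. fs n x - fs m x) < a" using cau[OF a(1)] by blast
      have "norm (?D n - 0) < e" if "N \<le> n" for n
      proof -
        note k = key[OF N that]
        have sq: "sqint (\<lambda>t. slope E (fs n) t - slope E f t)" using k by (simp add: sqint_def)
        have D: "?D n = set_lebesgue_integral lborel {x..y} (\<lambda>t. slope E (fs n) t - slope E f t)"
          using set_integral_diff(2)[OF sqintD(3)[OF minimal_dom_D(3)[OF fs[of n]]] i] primitiveD(3)[OF minimal_dom_D(4)[OF fs[of n]] xy] by simp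
        have "(?D n)\<^sup>2 \<le> (y - x) * set_lebesgue_integral lborel {x..y} (\<lambda>t. (slope E (fs n) t - slope E f t)\<^sup>2)"
          unfolding D by (rule Cauchy_Schwarz_Icc[OF sq xy(3)])
        also have "\<dots> \<le> (y - x) * (2 * a)"
        proof (rule mult_left_mono)
          have "set_lebesgue_integral lborel {x..y} (\<lambda>t. (slope E (fs n) t - slope E f t)\<^sup>2) \<le> (\<integral>t. (slope E (fs n) t - slope E f t)\<^sup>2 \<partial>lborel)"
            unfolding set_lebesgue_integral_def
          proof (rule integral_mono_AE)
            show "integrable lborel (\<lambda>t. indicator {x..y} t *\<^sub>R (slope E (fs n) t - slope E f t)\<^sup>2)"
              by (rule integrable_mult_indicator[OF _ sqintD(2)[OF sq]]) simp
            show "AE t in lborel. indicator {x..y} t *\<^sub>R (slope E (fs n) t - slope E f t)\<^sup>2 \<le> (slope E (fs n) t - slope E f t)\<^sup>2"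
              by (rule AE_I2) (simp add: indicator_def)
          qed (rule sqintD(2)[OF sq])
          also have "\<dots> \<le> 2 * a" using k by blast
          finally show "set_lebesgue_integral lborel {x..y} (\<lambda>t. (slope E (fs n) t - slope E f t)\<^sup>2) \<le> 2 * a" .
        qed (use xy in simp)
        finally have "(?D n)\<^sup>2 < e\<^sup>2" using a(2) by linarith
        then have "\<bar>?D n\<bar> < e" using e by (intro power2_less_imp_less[of _ e]) simp_all
        then show ?thesis by simp
      qed
      then show "\<exists>N. \<forall>n\<ge>N. norm (?D n - 0) < e" by blast
    qed
    moreover have "?D \<longlonglongrightarrow> (f y - f x) - set_lebesgue_integral lborel {x..y} (slope E f)"
      by (intro tendsto_diff tendsto_const f)
    ultimately have "0 = (f y - f x) - set_lebesgue_integral lborel {x..y} (slope E f)" by (rule LIMSEQ_unique)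
    then show "f y - f x = set_lebesgue_integral lborel {x..y} (slope E f)" by simp
  qed simp
  have unif: "(g x)\<^sup>2 \<le> A * (2 * e)" if "(\<lambda>m. fs n x - fs m x) \<longlonglongrightarrow> g x" "0 \<le> A"
     "\<And>m. (fs n x - fs m x)\<^sup>2 \<le> A * (\<integral>t. (slope E (\<lambda>x. fs n x - fs m x) t)\<^sup>2 \<partial>lborel)"
     "\<forall>m\<ge>N. \<forall>n\<ge>N. E1 E \<mu> (\<lambda>x. fs n x - fs m x) < e" "N \<le> n" for g x A e n N
  proof (rule LIMSEQ_le_const2)
    show "(\<lambda>m. (fs n x - fs m x)\<^sup>2) \<longlonglongrightarrow> (g x)\<^sup>2" by (intro tendsto_power that(1))
    show "\<exists>N. \<forall>m\<ge>N. (fs n x - fs m x)\<^sup>2 \<le> A * (2 * e)"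
    proof (intro exI[of _ N] allI impI)
      fix m assume "N \<le> m"
      then have "E1 E \<mu> (\<lambda>x. fs n x - fs m x) < e" using that(4,5) by blast
      then have "(\<integral>t. (slope E (\<lambda>x. fs n x - fs m x) t)\<^sup>2 \<partial>lborel) \<le> 2 * e"
        using minimal_dom_form_self[OF d[of n m]] form_le_E1[of "\<lambda>x. fs n x - fs m x"] by simp
      then have "A * (\<integral>t. (slope E (\<lambda>x. fs n x - fs m x) t)\<^sup>2 \<partial>lborel) \<le> A * (2 * e)" by (rule mult_left_mono[OF _ that(2)])
      then show "(fs n x - fs m x)\<^sup>2 \<le> A * (2 * e)" using that(3)[of m] by linarith
    qed
  qed
  obtain x1 where x1: "x1 \<in> E" using E_nonempty by blast
  have small: "\<exists>b>0. A * (2 * b) < (e / 2)\<^sup>2" if "0 < e" "0 \<le> A" for e A :: real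
    using that by (intro exI[of _ "(e/2)\<^sup>2 / (2 * (A + 1))"]) (auto simp: field_simps)
  have half: "\<bar>f x\<bar> < e" if "\<bar>fs N x\<bar> < e / 2" "(fs N x - f x)\<^sup>2 < (e / 2)\<^sup>2" "0 < e" for x N e
  proof -
    have "\<bar>fs N x - f x\<bar> < e / 2" using that(2,3) by (intro power2_less_imp_less[of _ "e/2"]) simp_all
    then show ?thesis using that(1) by linarith
  qed
  have lo: "near_lo E f" if l: "lE E \<notin> ereal ` E" "\<bar>s_lo E sb\<bar> \<noteq> \<infinity>"
    unfolding near_lo_def
  proof (intro allI impI)
    fix e :: real assume e: "0 < e"
    let ?s = "real_of_ereal (s_lo E sb)"
    have s: "0 \<le> sb y - ?s" if "y \<in> E" for y
      using s_lo_le[OF intI_I[OF that], of sb] finite_erealE[OF l(2)] by (metis diff_ge_0_iff_ge ereal_less_eq(3))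
    \<comment> \<open>Independent of \<open>x\<close>: the bound grows with \<open>sb x\<close>, so
      the point \<open>x1\<close> serves for all points below it.\<close>
    obtain b where b: "0 < b" "(sb x1 - ?s) * (2 * b) < (e / 2)\<^sup>2" using small[OF e s[OF x1]] by blast
    obtain N where N: "\<forall>m\<ge>N. \<forall>n\<ge>N. E1 E \<mu> (\<lambda>x. fs n x - fs m x) < b" using cau[OF b(1)] by blast
    have "0 < e / 2" using e by simp
    then obtain c where c: "c \<in> E" "\<forall>x\<in>E. x \<le> c \<longrightarrow> \<bar>fs N x\<bar> < e / 2"
      using minimal_dom_near_lo[OF fs[of N] l] unfolding near_lo_def by blast
    have "\<bar>f x\<bar> < e" if x: "x \<in> E" "x \<le> min c x1" for x
    proof (rule half[of N])
      show "\<bar>fs N x\<bar> < e / 2" using c(2) x by simp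
      have "(fs N x - f x)\<^sup>2 \<le> (sb x - ?s) * (2 * b)"
        by (rule unif[OF _ s[OF x(1)] minimal_dom_lo_bound[OF d l x(1)] N order_refl]) (intro tendsto_diff tendsto_const f)
      also have "\<dots> \<le> (sb x1 - ?s) * (2 * b)" using sb_mono[of x x1] x b(1) by (intro mult_right_mono) auto
      finally show "(fs N x - f x)\<^sup>2 < (e / 2)\<^sup>2" using b(2) by linarith
    qed (rule e)
    moreover have "min c x1 \<in> E" using c x1 by (simp add: min_def)
    ultimately show "\<exists>c\<in>E. \<forall>x\<in>E. x \<le> c \<longrightarrow> \<bar>f x\<bar> < e" by blast
  qed
  have hi: "near_hi E f" if l: "rE E \<notin> ereal ` E" "\<bar>s_hi E sb\<bar> \<noteq> \<infinity>"
    unfolding near_hi_def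
  proof (intro allI impI)
    fix e :: real assume e: "0 < e"
    let ?s = "real_of_ereal (s_hi E sb)"
    have s: "0 \<le> ?s - sb y" if "y \<in> E" for y
      using s_hi_ge[OF intI_I[OF that], of sb] finite_erealE[OF l(2)] by (metis diff_ge_0_iff_ge ereal_less_eq(3))
    obtain b where b: "0 < b" "(?s - sb x1) * (2 * b) < (e / 2)\<^sup>2" using small[OF e s[OF x1]] by blast
    obtain N where N: "\<forall>m\<ge>N. \<forall>n\<ge>N. E1 E \<mu> (\<lambda>x. fs n x - fs m x) < b" using cau[OF b(1)] by blast
    have "0 < e / 2" using e by simp
    then obtain c where c: "c \<in> E" "\<forall>x\<in>E. c \<le> x \<longrightarrow> \<bar>fs N x\<bar> < e / 2"
      using minimal_dom_near_hi[OF fs[of N] l] unfolding near_hi_def by blast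
    have "\<bar>f x\<bar> < e" if x: "x \<in> E" "max c x1 \<le> x" for x
    proof (rule half[of N])
      show "\<bar>fs N x\<bar> < e / 2" using c(2) x by simp
      have "(fs N x - f x)\<^sup>2 \<le> (?s - sb x) * (2 * b)"
        by (rule unif[OF _ s[OF x(1)] minimal_dom_hi_bound[OF d l x(1)] N order_refl]) (intro tendsto_diff tendsto_const f)
      also have "\<dots> \<le> (?s - sb x1) * (2 * b)" using sb_mono[of x1 x] x b(1) by (intro mult_right_mono) auto
      finally show "(fs N x - f x)\<^sup>2 < (e / 2)\<^sup>2" using b(2) by linarith
    qed (rule e)
    moreover have "max c x1 \<in> E" using c x1 by (simp add: max_def)
    ultimately show "\<exists>c\<in>E. \<forall>x\<in>E. c \<le> x \<longrightarrow> \<bar>f x\<bar> < e" by blast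
  qed
  have mm: "minimal_dom f" unfolding minimal_dom_def using off fL fsq pr lo hi by simp
  have "(\<lambda>n. inverse 2 * (2 * E1 E \<mu> (\<lambda>x. fs n x - f x))) \<longlonglongrightarrow> inverse 2 * 0"
    by (intro tendsto_mult tendsto_const tend0[OF mm])
  then show ?thesis using mm by (intro exI[of _ f]) simp
qed

section \<open>Step functions as a core\<close>

text \<open>Describes a compact relatively open piece of \<open>E\<close> between \<open>b\<close>
  and \<open>q\<close> by two adjacent open intervals free of \<open>E\<close>. The outer ends
  \<open>a\<close> and \<open>c\<close> need not belong to \<open>E\<close>, which covers a piece
  reaching a least or greatest element of \<open>E\<close>.\<close>

definition clopen_cut :: "real \<Rightarrow> real \<Rightarrow> real \<Rightarrow> real \<Rightarrow> bool" where
  "clopen_cut a b q c \<longleftrightarrow> a < b \<and> b \<le> q \<and> q < c \<and> b \<in> E \<and> q \<in> E \<and> E \<inter> {a<..<b} = {} \<and> E \<inter> {q<..<c} = {}"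

definition step :: "real \<Rightarrow> real \<Rightarrow> real \<Rightarrow> real" where
  "step b q x = (if x \<in> E \<and> b \<le> x \<and> x \<le> q then 1 else 0)"

text \<open>The flanks of the trapezoid lie over intervals free of \<open>E\<close>, so
  \<open>E\<close> sees only the values 0 and 1.\<close>

lemma step_trapezoid:
  assumes "clopen_cut a b q c"
  shows "step b q x = (if x \<in> E then trapezoid a b q c x else 0)"
proof (cases "x \<in> E")
  case True
  have le: "a < b" "b \<le> q" "q < c" using assms by (auto simp: clopen_cut_def)
  have "x \<le> a \<or> b \<le> x" "x \<le> q \<or> c \<le> x" using assms True by (auto simp: clopen_cut_def not_le)
  then show ?thesis using trapezoid(2-4)[OF le, of x] True le by (auto simp: step_def)
qed (simp add: step_def)

lemma step_Cc:
  assumes "clopen_cut a b q c"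
  shows "step b q \<in> Cc E"
proof -
  have le: "a < b" "b \<le> q" "q < c" "b \<in> E" "q \<in> E" using assms by (auto simp: clopen_cut_def)
  have "closed (E \<inter> {a..c})"
  proof -
    have "E \<inter> {a..c} = (E \<inter> {b..q}) \<union> (E \<inter> {a}) \<union> (E \<inter> {c})"
    proof (intro equalityI subsetI)
      fix x assume x: "x \<in> E \<inter> {a..c}"
      have "x \<notin> {a<..<b}" "x \<notin> {q<..<c}" using assms x unfolding clopen_cut_def by blast+
      then show "x \<in> (E \<inter> {b..q}) \<union> (E \<inter> {a}) \<union> (E \<inter> {c})" using x by auto
    qed (use le in auto)
    moreover have "closed (E \<inter> {a})" "closed (E \<inter> {c})" by (rule finite_imp_closed, simp)+
    ultimately show ?thesis
      using compact_imp_closed[OF compact_Int[OF le(4,5)]] by (simp only: closed_Un)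
  qed
  moreover have "bounded (E \<inter> {a..c})" by (rule bounded_subset[of "{a..c}"]) auto
  ultimately have "compact (E \<inter> {a..c})" by (simp add: compact_eq_bounded_closed)
  from trapezoid_Cc[OF le(1-3) this] show ?thesis
    by (simp add: step_trapezoid[OF assms, abs_def])
qed

text \<open>The majorant consists of the normalised indicators of \<open>(a, b)\<close> and
  \<open>(q, c)\<close>. Each has integral 1, and whenever the step changes its value between two
  points of \<open>E\<close>, one of these intervals lies between them.\<close>

lemma step_minimal_dom:
  assumes "clopen_cut a b q c"
  shows "minimal_dom (step b q)"
proof -
  have le: "a < b" "b \<le> q" "q < c" "b \<in> E" "q \<in> E" and ga: "E \<inter> {a<..<b} = {}" "E \<inter> {q<..<c} = {}"
    using assms by (auto simp: clopen_cut_def)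
  let ?m1 = "\<lambda>t. indicator {a<..<b} t * inverse (b - a)" and ?m2 = "\<lambda>t. indicator {q<..<c} t * inverse (c - q)"
  let ?m = "\<lambda>t. ?m1 t + ?m2 t"
  have s1: "sqint ?m1"
  proof -
    have "(\<lambda>t. (?m1 t)\<^sup>2) = (\<lambda>t. indicator {a<..<b} t * (inverse (b - a))\<^sup>2)" by (auto simp: indicator_def)
    then show ?thesis using le(1) by (simp add: sqint_def)
  qed
  have s2: "sqint ?m2"
  proof -
    have "(\<lambda>t. (?m2 t)\<^sup>2) = (\<lambda>t. indicator {q<..<c} t * (inverse (c - q))\<^sup>2)" by (auto simp: indicator_def)
    then show ?thesis using le(3) by (simp add: sqint_def)
  qed
  have sq: "sqint ?m" by (rule sqint_bound(1)[OF s1 s2]) (auto intro: AE_I2)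
  have i1: "(\<integral>t. ?m1 t \<partial>lborel) = 1" "(\<integral>t. ?m2 t \<partial>lborel) = 1" using le by simp_all
  have m0: "0 \<le> ?m t" "0 \<le> ?m1 t" "0 \<le> ?m2 t" for t using le by (auto simp: indicator_def)
  have big: "1 \<le> set_lebesgue_integral lborel {x..y} ?m" if "{a<..<b} \<subseteq> {x..y} \<or> {q<..<c} \<subseteq> {x..y}" for x y
  proof -
    have I: "integrable lborel (\<lambda>t. indicator {x..y} t *\<^sub>R ?m t)" using sqintD(3)[OF sq] by (simp add: set_integrable_def)
    from that show ?thesis
    proof
      assume s: "{a<..<b} \<subseteq> {x..y}"
      have "(\<integral>t. ?m1 t \<partial>lborel) \<le> (\<integral>t. indicator {x..y} t *\<^sub>R ?m t \<partial>lborel)"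
      proof (rule integral_mono_AE[OF _ I])
        show "integrable lborel ?m1" using le(1) by simp
        have "?m1 t \<le> indicator {x..y} t *\<^sub>R ?m t" for t
          using s m0[of t] by (cases "t \<in> {a<..<b}") auto
        then show "AE t in lborel. ?m1 t \<le> indicator {x..y} t *\<^sub>R ?m t" by (intro AE_I2)
      qed
      then show ?thesis using i1 by (simp add: set_lebesgue_integral_def)
    next
      assume s: "{q<..<c} \<subseteq> {x..y}"
      have "(\<integral>t. ?m2 t \<partial>lborel) \<le> (\<integral>t. indicator {x..y} t *\<^sub>R ?m t \<partial>lborel)"
      proof (rule integral_mono_AE[OF _ I])
        show "integrable lborel ?m2" using le(3) by simp
        have "?m2 t \<le> indicator {x..y} t *\<^sub>R ?m t" for t
          using s m0[of t] by (cases "t \<in> {q<..<c}") auto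
        then show "AE t in lborel. ?m2 t \<le> indicator {x..y} t *\<^sub>R ?m t" by (intro AE_I2)
      qed
      then show ?thesis using i1 by (simp add: set_lebesgue_integral_def)
    qed
  qed
  have dom: "dominated E (step b q) ?m"
    unfolding dominated_def
  proof (intro conjI ballI impI allI)
    show "0 \<le> ?m t" for t by (rule m0(1))
    fix x y assume xy: "x \<in> E" "y \<in> E" "x \<le> y"
    show "set_integrable lborel {x..y} ?m" by (rule sqintD(3)[OF sq])
    have n: "0 \<le> set_lebesgue_integral lborel {x..y} ?m"
      unfolding set_lebesgue_integral_def by (intro integral_nonneg_AE AE_I2 scaleR_nonneg_nonneg m0) simp
    show "\<bar>step b q y - step b q x\<bar> \<le> set_lebesgue_integral lborel {x..y} ?m"
    proof (cases "step b q y = step b q x")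
      case False
      then have "(x < b \<and> b \<le> y) \<or> (x \<le> q \<and> q < y)" using xy by (auto simp: step_def split: if_splits)
      then have "{a<..<b} \<subseteq> {x..y} \<or> {q<..<c} \<subseteq> {x..y}"
      proof
        assume *: "x < b \<and> b \<le> y"
        then have "x \<le> a" using ga(1) xy(1) by (auto simp: not_le[symmetric])
        then show ?thesis using * by auto
      next
        assume *: "x \<le> q \<and> q < y"
        then have "c \<le> y" using ga(2) xy(2) by (auto simp: not_le[symmetric])
        then show ?thesis using * by auto
      qed
      from big[OF this] show ?thesis by (auto simp: step_def)
    qed (use n in simp)
  qed measurable
  show ?thesis
  proof (rule minimal_dom_intro[OF dom _ sq _ Cc_integrable(2)[OF step_Cc[OF assms]] Cc_integrable(2)[OF step_Cc[OF assms]]])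
    show "?m t = 0" if "t \<in> E" for t using ga that by (auto simp: indicator_def)
    show "step b q x = 0" if "x \<notin> E" for x using that by (simp add: step_def)
    show "\<bar>step b q x\<bar> \<le> \<bar>step b q x\<bar> + \<bar>step b q x\<bar>" for x by simp
    show "near_lo E (step b q)" if l: "lE E \<notin> ereal ` E"
    proof -
      obtain e where "e \<in> E" "e < b" using lE_less_intI[OF intI_I[OF le(4)] l] unfolding lE_less_iff by blast
      then show ?thesis unfolding near_lo_def by (auto simp: step_def intro!: bexI[of _ e])
    qed
    show "near_hi E (step b q)" if r: "rE E \<notin> ereal ` E"
    proof -
      obtain e where "e \<in> E" "q < e" using rE_greater_intI[OF intI_I[OF le(5)] r] unfolding rE_greater_iff by blast
      then show ?thesis unfolding near_hi_def by (auto simp: step_def intro!: bexI[of _ e])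
    qed
  qed
qed

text \<open>Some point shortly to the left of \<open>x\<close> lies outside \<open>E\<close>, and
  its gap is used. If \<open>x\<close> is the least element of \<open>E\<close>, any interval ending
  at \<open>x\<close> is free, and \<open>x - 1\<close> is taken as its start.\<close>

lemma left_cut:
  assumes x: "x \<in> E" and d: "0 < d"
  obtains a b where "a < b" "b \<in> E" "E \<inter> {a<..<b} = {}" "x - d < b" "b \<le> x"
proof (cases "\<exists>e\<in>E. e < x")
  case True
  then obtain e where e: "e \<in> E" "e < x" by blast
  have "max e (x - d) < x" using e d by simp
  then obtain t r where t: "0 < r" "{t-r..t+r} \<subseteq> {max e (x - d)<..<x} - E" using interval_minus_E by metis
  have "t \<in> {t-r..t+r}" using t(1) by simp
  then have "t \<in> {max e (x - d)<..<x} - E" by (rule subsetD[OF t(2)])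
  then have t': "e < t" "x - d < t" "t < x" "t \<notin> E" by auto
  obtain a b where g: "(a, b) \<in> gaps E" "a < t" "t < b" "e \<le> a" "b \<le> x" by (rule gap_between[OF e(1) x t'(1,3,4)]) (rule that)
  note gd = gapsD[OF g(1)]
  show thesis by (rule that[of a b]) (use gd g t' in auto)
next
  case False
  show thesis by (rule that[of "x - 1" x]) (use False x d in auto)
qed

lemma right_cut:
  assumes x: "x \<in> E" and d: "0 < d"
  obtains q c where "q < c" "q \<in> E" "E \<inter> {q<..<c} = {}" "q < x + d" "x \<le> q"
proof (cases "\<exists>e\<in>E. x < e")
  case True
  then obtain e where e: "e \<in> E" "x < e" by blast
  have "x < min e (x + d)" using e d by simp
  then obtain t r where t: "0 < r" "{t-r..t+r} \<subseteq> {x<..<min e (x + d)} - E" using interval_minus_E by metis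
  have "t \<in> {t-r..t+r}" using t(1) by simp
  then have "t \<in> {x<..<min e (x + d)} - E" by (rule subsetD[OF t(2)])
  then have t': "x < t" "t < x + d" "t < e" "t \<notin> E" by auto
  obtain a b where g: "(a, b) \<in> gaps E" "a < t" "t < b" "x \<le> a" "b \<le> e" by (rule gap_between[OF x e(1) t'(1,3,4)]) (rule that)
  note gd = gapsD[OF g(1)]
  show thesis by (rule that[of a b]) (use gd g t' in auto)
next
  case False
  show thesis by (rule that[of x "x + 1"]) (use False x d in auto)
qed

lemma minimal_dom_bump:
  assumes x: "x \<in> E" and d: "0 < d"
  shows "\<exists>\<theta>\<in>Collect minimal_dom \<inter> Cc E. \<exists>\<eta>>0. \<forall>y\<in>E. 0 \<le> \<theta> y \<and> \<theta> y \<le> 1 \<and> (\<bar>y - x\<bar> < \<eta> \<longrightarrow> \<theta> y = 1) \<and> (d \<le> \<bar>y - x\<bar> \<longrightarrow> \<theta> y = 0)"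
proof -
  obtain a b where ab: "a < b" "b \<in> E" "E \<inter> {a<..<b} = {}" "x - d < b" "b \<le> x" by (rule left_cut[OF x d]) (rule that)
  obtain q c where qc: "q < c" "q \<in> E" "E \<inter> {q<..<c} = {}" "q < x + d" "x \<le> q" by (rule right_cut[OF x d]) (rule that)
  have cut: "clopen_cut a b q c" using ab qc by (simp add: clopen_cut_def)
  have "0 \<le> step b q y \<and> step b q y \<le> 1 \<and> (\<bar>y - x\<bar> < min (x - a) (c - x) \<longrightarrow> step b q y = 1) \<and> (d \<le> \<bar>y - x\<bar> \<longrightarrow> step b q y = 0)"
    if y: "y \<in> E" for y
  proof -
    have "b \<le> y \<and> y \<le> q" if "\<bar>y - x\<bar> < min (x - a) (c - x)"
    proof -
      have "a < y" "y < c" using that by (auto simp: abs_less_iff)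
      then show ?thesis using ab(3) qc(3) y by (auto simp: not_le[symmetric])
    qed
    moreover have "\<not> (b \<le> y \<and> y \<le> q)" if "d \<le> \<bar>y - x\<bar>" using that ab qc by auto
    ultimately show ?thesis using y by (auto simp: step_def)
  qed
  moreover have "0 < min (x - a) (c - x)" using ab qc by simp
  moreover have "step b q \<in> Collect minimal_dom \<inter> Cc E" using step_minimal_dom[OF cut] step_Cc[OF cut] by simp
  ultimately show ?thesis by blast
qed

section \<open>Truncation of values and cutoff in the scale\<close>

lemma E1_tendsto_0:
  assumes "\<And>n. minimal_dom (r n)"
    and "(\<lambda>n. \<integral>t. (slope E (r n) t)\<^sup>2 \<partial>lborel) \<longlonglongrightarrow> 0" "(\<lambda>n. \<integral>x. (r n x)\<^sup>2 \<partial>\<mu>) \<longlonglongrightarrow> 0"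
  shows "(\<lambda>n. E1 E \<mu> (r n)) \<longlonglongrightarrow> 0"
proof -
  have "(\<lambda>n. inverse 2 * (\<integral>t. (slope E (r n) t)\<^sup>2 \<partial>lborel) + (\<integral>x. (r n x)\<^sup>2 \<partial>\<mu>)) \<longlonglongrightarrow> inverse 2 * 0 + 0"
    by (intro tendsto_add tendsto_mult tendsto_const assms)
  moreover have "E1 E \<mu> (r n) = inverse 2 * (\<integral>t. (slope E (r n) t)\<^sup>2 \<partial>lborel) + (\<integral>x. (r n x)\<^sup>2 \<partial>\<mu>)" for n
    by (simp add: E1_def minimal_dom_form_self[OF assms(1)])
  ultimately show ?thesis by simp
qed

lemma square_integral_tendsto_0:
  fixes p :: "nat \<Rightarrow> 'a \<Rightarrow> real"
  assumes q: "integrable M (\<lambda>x. (q x)\<^sup>2)" and m: "\<And>n. p n \<in> borel_measurable M"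
    and le: "\<And>n x. x \<in> space M \<Longrightarrow> \<bar>p n x\<bar> \<le> c * \<bar>q x\<bar>" and lim: "\<And>x. x \<in> space M \<Longrightarrow> (\<lambda>n. p n x) \<longlonglongrightarrow> 0"
  shows "(\<lambda>n. \<integral>x. (p n x)\<^sup>2 \<partial>M) \<longlonglongrightarrow> 0"
proof -
  have "(\<lambda>n. \<integral>x. (p n x)\<^sup>2 \<partial>M) \<longlonglongrightarrow> (\<integral>x. 0 \<partial>M)"
  proof (rule integral_dominated_convergence[where w = "\<lambda>x. c\<^sup>2 * (q x)\<^sup>2"])
    show "AE x in M. (\<lambda>n. (p n x)\<^sup>2) \<longlonglongrightarrow> 0"
    proof (rule AE_I2)
      fix x assume "x \<in> space M"
      then have "(\<lambda>n. (p n x)\<^sup>2) \<longlonglongrightarrow> 0\<^sup>2" by (intro tendsto_power lim)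
      then show "(\<lambda>n. (p n x)\<^sup>2) \<longlonglongrightarrow> 0" by simp
    qed
    show "AE x in M. norm ((p n x)\<^sup>2) \<le> c\<^sup>2 * (q x)\<^sup>2" for n
    proof (rule AE_I2)
      fix x assume "x \<in> space M"
      then have "\<bar>p n x\<bar> \<le> c * \<bar>q x\<bar>" by (rule le)
      from power_mono[OF this abs_ge_zero, of 2] show "norm ((p n x)\<^sup>2) \<le> c\<^sup>2 * (q x)\<^sup>2"
        by (simp add: power_mult_distrib)
    qed
  qed (use q m in \<open>auto intro!: borel_measurable_power\<close>)
  then show ?thesis by simp
qed

lemma slope_zero_fun: "slope E (\<lambda>_. 0) t = 0"
  by (simp add: slope_def)

lemma slope_scale_abs_le:
  assumes "\<And>x y. x \<in> E \<Longrightarrow> y \<in> E \<Longrightarrow> x \<le> y \<Longrightarrow> \<bar>w y - w x\<bar> \<le> c * \<bar>u y - u x\<bar>" "0 \<le> c"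
  shows "\<bar>slope E w t\<bar> \<le> c * \<bar>slope E u t\<bar>"
proof (cases "t \<in> \<Omega>")
  case True
  then obtain a b where g: "(a, b) \<in> gaps E" "a < t" "t < b" by (rule gapU_E)
  note ab = gapsD[OF g(1)]
  have "\<bar>w b - w a\<bar> / (b - a) \<le> (c * \<bar>u b - u a\<bar>) / (b - a)"
    using assms(1)[OF ab(1,2)] ab(3) by (intro divide_right_mono) auto
  then show ?thesis unfolding slope_gap[OF g] using ab(3) by (simp add: abs_divide)
qed (simp add: slope_outside)

lemma abs_diff_diff_le:
  fixes a b c d e :: real
  assumes "\<bar>a - b\<bar> \<le> e" "\<bar>c - d\<bar> \<le> e"
  shows "\<bar>(a - c) - (b - d)\<bar> \<le> 2 * e"
  using assms by linarith

lemma abs_diff_diff_le3: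
  fixes a b c d :: real
  assumes "\<bar>c - d\<bar> \<le> 2 * \<bar>a - b\<bar>"
  shows "\<bar>(a - c) - (b - d)\<bar> \<le> 3 * \<bar>a - b\<bar>"
proof -
  have "(a - c) - (b - d) = (a - b) - (c - d)" by simp
  moreover have "\<bar>(a - b) - (c - d)\<bar> \<le> \<bar>a - b\<bar> + 2 * \<bar>a - b\<bar>"
    by (rule order_trans[OF abs_triangle_ineq4 add_left_mono[OF assms]])
  moreover have "u + 2 * u = 3 * u" for u :: real by simp
  ultimately show ?thesis by (simp only:)
qed

lemma clamp_to_zero: "0 \<le> C \<Longrightarrow> clamp_to C (0::real) = 0"
  by simp

lemma diff_diff_regroup: "a - (b - c) = (a - b) + (c::real)"
  by simp

text \<open>Clamping at \<open>n\<close> makes the function bounded, as the later multiplication by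
  a cutoff requires; subtracting the clamp at \<open>1 / n\<close> makes it vanish where
  \<open>\<bar>f\<bar>\<close> is small, in particular near an end where \<open>f\<close> tends to
  0. Both remainders vanish pointwise and are dominated by multiples of \<open>f\<close> and of its
  slope.\<close>

lemma minimal_dom_truncate:
  assumes f: "minimal_dom f" and e: "0 < e"
  obtains n :: nat where "0 < n" "minimal_dom (\<lambda>x. clamp_to (real n) (f x) - clamp_to (1 / real n) (f x))"
    "E1 E \<mu> (\<lambda>x. f x - (clamp_to (real n) (f x) - clamp_to (1 / real n) (f x))) < e"
proof -
  let ?\<phi> = "\<lambda>n t. clamp_to (real (Suc n)) t - clamp_to (1 / real (Suc n)) t"
  let ?r = "\<lambda>n x. f x - ?\<phi> n (f x)"
  have lip: "\<bar>?\<phi> n s - ?\<phi> n t\<bar> \<le> 2 * \<bar>s - t\<bar>" for n s t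
    by (rule abs_diff_diff_le[OF clamp_to_contract clamp_to_contract])
  have w: "minimal_dom (\<lambda>x. ?\<phi> n (f x))" for n
    by (rule minimal_dom_contract[OF f, of "?\<phi> n" 2]) (simp_all only: clamp_to_zero of_nat_0_le_iff zero_le_divide_1_iff diff_self lip zero_le_numeral)
  have r: "minimal_dom (?r n)" for n by (rule minimal_dom_diff[OF f w])
  have rle: "\<bar>?r n x\<bar> \<le> 3 * \<bar>f x\<bar>" for n x
  proof -
    have z: "?\<phi> n 0 = 0" by (simp only: clamp_to_zero of_nat_0_le_iff zero_le_divide_1_iff diff_self)
    have "\<bar>?\<phi> n (f x)\<bar> \<le> 2 * \<bar>f x\<bar>" using lip[of n "f x" 0] unfolding z diff_0_right .
    then have "\<bar>u - ?\<phi> n (f x)\<bar> \<le> \<bar>u\<bar> + 2 * \<bar>f x\<bar>" for u by (rule order_trans[OF abs_triangle_ineq4 add_left_mono])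
    from this[of "f x"] show ?thesis by simp
  qed
  have rlim: "(\<lambda>n. ?r n x) \<longlonglongrightarrow> 0" for x
  proof -
    have 1: "(\<lambda>n. clamp_to (1 / real (Suc n)) (f x)) \<longlonglongrightarrow> 0"
    proof (rule tendsto_rabs_zero_cancel, rule tendsto_sandwich[of "\<lambda>_. 0" _ _ "\<lambda>n. inverse (real (Suc n))"])
      show "\<forall>\<^sub>F n in sequentially. \<bar>clamp_to (1 / real (Suc n)) (f x)\<bar> \<le> inverse (real (Suc n))"
        using clamp_to_abs[of "1 / real (Suc n)" "f x" for n] by (intro always_eventually allI) (simp add: inverse_eq_divide)
    qed (rule tendsto_const LIMSEQ_inverse_real_of_nat | simp)+
    have 2: "(\<lambda>n. f x - clamp_to (real (Suc n)) (f x)) \<longlonglongrightarrow> 0"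
    proof (rule tendsto_eventually)
      obtain N :: nat where N: "\<bar>f x\<bar> \<le> real N" using real_arch_simple by blast
      show "\<forall>\<^sub>F n in sequentially. f x - clamp_to (real (Suc n)) (f x) = 0"
      proof (rule eventually_sequentiallyI[of N])
        fix n assume "N \<le> n"
        then have "\<bar>f x\<bar> \<le> real (Suc n)" using N by simp
        from clamp_to_id[OF this] show "f x - clamp_to (real (Suc n)) (f x) = 0" by (simp only: diff_self)
      qed
    qed
    have "(\<lambda>n. (f x - clamp_to (real (Suc n)) (f x)) + clamp_to (1 / real (Suc n)) (f x)) \<longlonglongrightarrow> 0 + 0"
      by (intro tendsto_add 1 2)
    moreover have "?r n x = (f x - clamp_to (real (Suc n)) (f x)) + clamp_to (1 / real (Suc n)) (f x)" for n by (rule diff_diff_regroup)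
    ultimately show ?thesis by (simp only: add_0_left)
  qed
  have "(\<lambda>n. E1 E \<mu> (?r n)) \<longlonglongrightarrow> 0"
  proof (rule E1_tendsto_0[OF r])
    show "(\<lambda>n. \<integral>t. (slope E (?r n) t)\<^sup>2 \<partial>lborel) \<longlonglongrightarrow> 0"
    proof (rule square_integral_tendsto_0[OF sqintD(2)[OF minimal_dom_D(3)[OF f]], where c = 3])
      show "\<bar>slope E (?r n) t\<bar> \<le> 3 * \<bar>slope E f t\<bar>" for n t
      proof (rule slope_scale_abs_le)
        show "\<bar>?r n y - ?r n x\<bar> \<le> 3 * \<bar>f y - f x\<bar>" for x y
          by (rule abs_diff_diff_le3[OF lip])
      qed simp
      show "(\<lambda>n. slope E (?r n) t) \<longlonglongrightarrow> 0" for t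
        using slope_tendsto[of ?r "\<lambda>_. 0" t, OF rlim] by (simp only: slope_zero_fun)
    qed simp
    show "(\<lambda>n. \<integral>x. (?r n x)\<^sup>2 \<partial>\<mu>) \<longlonglongrightarrow> 0"
    proof (rule square_integral_tendsto_0[where c = 3 and q = f])
      show "integrable \<mu> (\<lambda>x. (f x)\<^sup>2)" using minimal_dom_D(2)[OF f] by (simp add: L2_def)
      show "?r n \<in> borel_measurable \<mu>" for n using minimal_dom_D(2)[OF r[of n]] by (simp only: L2_def)
    qed (rule rle rlim)+
  qed
  then have "\<forall>\<^sub>F n in sequentially. E1 E \<mu> (?r n) < e" by (rule order_tendstoD(2)) (rule e)
  then obtain n where "E1 E \<mu> (?r n) < e" unfolding eventually_sequentially by blast
  then show thesis using that[of "Suc n"] w[of n] by simp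
qed

text \<open>Equal to 1 for \<open>\<bar>sb x\<bar> \<le> j\<close> and to 0 for
  \<open>\<bar>sb x\<bar> \<ge> 2 * j\<close>, where \<open>j > 0\<close>. Falling at the rate
  \<open>1 / j\<close> over a length of order \<open>j\<close> in the scale, it has an energy of
  order \<open>1 / j\<close>.\<close>

definition cutoff :: "nat \<Rightarrow> real \<Rightarrow> real" where
  "cutoff j x = min 1 (max 0 (2 - \<bar>sb x\<bar> / real j))"

text \<open>A majorant, not the exact derivative: it is supported on all of
  \<open>\<bar>sb t\<bar> \<le> 2 * j\<close>, plateau included, which costs a constant factor
  only.\<close>

definition cutoff_der :: "nat \<Rightarrow> real \<Rightarrow> real" where
  "cutoff_der j t = inverse (real j) * (indicator {- 2 * real j..2 * real j} (sb t) * off_E t)"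

lemma cutoff_der_borel [measurable]: "cutoff_der j \<in> borel_measurable borel"
  unfolding cutoff_der_def by measurable

lemma cutoff_der_integral:
  assumes "x \<le> y"
  shows "set_lebesgue_integral lborel {x..y} (cutoff_der j) = inverse (real j) * measure lborel ({sb x..sb y} \<inter> {- 2 * real j..2 * real j})"
proof -
  have "set_lebesgue_integral lborel {x..y} (cutoff_der j) = inverse (real j) * set_lebesgue_integral lborel {x..y} (\<lambda>t. indicator {- 2 * real j..2 * real j} (sb t) * off_E t)"
    unfolding cutoff_der_def by simp
  also have "set_lebesgue_integral lborel {x..y} (\<lambda>t. indicator {- 2 * real j..2 * real j} (sb t) * off_E t) = set_lebesgue_integral lborel {sb x..sb y} (indicator {- 2 * real j..2 * real j})"
    by (rule subst_sb(2)[OF _ assms, symmetric]) measurable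
  also have "\<dots> = (\<integral>s. indicator ({sb x..sb y} \<inter> {- 2 * real j..2 * real j}) s \<partial>lborel)"
    unfolding set_lebesgue_integral_def by (rule Bochner_Integration.integral_cong) (auto simp: indicator_def)
  also have "\<dots> = measure lborel ({sb x..sb y} \<inter> {- 2 * real j..2 * real j})" by simp
  finally show ?thesis .
qed

lemma cutoff_der_bounds: "0 \<le> cutoff_der j t" "t \<in> E \<Longrightarrow> cutoff_der j t = 0" "cutoff_der j t * cutoff_der j t = inverse (real j) * cutoff_der j t"
  by (auto simp: cutoff_der_def off_E_def indicator_def)

text \<open>In the scale variable this is \<open>1 / j\<^sup>2\<close> integrated over a length of
  at most \<open>4 * j\<close>. The computation is made on bounded intervals and extended by
  Fatou.\<close>

lemma cutoff_der_sqint: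
  assumes j: "0 < j"
  shows "sqint (cutoff_der j)" "(\<integral>t. (cutoff_der j t)\<^sup>2 \<partial>lborel) \<le> 4 / real j"
proof -
  let ?q = "\<lambda>m t. indicator {- real m..real m} t * (cutoff_der j t)\<^sup>2"
  have eq: "?q m t = inverse (real j) * (indicator {- real m..real m} t *\<^sub>R cutoff_der j t)" for m t
    using cutoff_der_bounds(3)[of j t] by (simp add: power2_eq_square)
  have si: "set_integrable lborel {- real m..real m} (cutoff_der j)" for m
    unfolding cutoff_der_def
  proof (intro set_integrable_mult_right)
    show "set_integrable lborel {- real m..real m} (\<lambda>t. indicator {- 2 * real j..2 * real j} (sb t) * off_E t)"
      unfolding set_integrable_def
    proof (rule Bochner_Integration.integrable_bound)
      show "integrable lborel (indicator {- real m..real m} :: real \<Rightarrow> real)" by simp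
      show "AE t in lborel. norm (indicator {- real m..real m} t *\<^sub>R (indicator {- 2 * real j..2 * real j} (sb t) * off_E t)) \<le> norm (indicat_real {- real m..real m} t)"
        by (rule AE_I2) (simp add: off_E_def indicator_def)
    qed measurable
  qed
  have qi: "integrable lborel (?q m)" for m
    unfolding eq using si[of m] by (intro integrable_mult_right) (simp only: set_integrable_def)
  have qb: "(\<integral>t. ?q m t \<partial>lborel) \<le> 4 / real j" for m
  proof -
    have "(\<integral>t. ?q m t \<partial>lborel) = inverse (real j) * set_lebesgue_integral lborel {- real m..real m} (cutoff_der j)"
      unfolding eq set_lebesgue_integral_def by simp
    also have "\<dots> = inverse (real j) * (inverse (real j) * measure lborel ({sb (- real m)..sb (real m)} \<inter> {- 2 * real j..2 * real j}))"
      by (subst cutoff_der_integral) simp_all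
    also have "\<dots> \<le> inverse (real j) * (inverse (real j) * (4 * real j))"
    proof (intro mult_left_mono)
      have "measure lborel ({sb (- real m)..sb (real m)} \<inter> {- 2 * real j..2 * real j}) \<le> measure lborel {- 2 * real j..2 * real j}"
        by (rule measure_mono_fmeasurable) (auto simp: fmeasurable_def emeasure_lborel_Icc_eq)
      then show "measure lborel ({sb (- real m)..sb (real m)} \<inter> {- 2 * real j..2 * real j}) \<le> 4 * real j" by simp
    qed simp_all
    also have "\<dots> = 4 / real j" using j by (simp add: field_simps)
    finally show ?thesis .
  qed
  have lim: "(\<lambda>m. ?q m t) \<longlonglongrightarrow> (cutoff_der j t)\<^sup>2" for t
  proof (rule tendsto_eventually)
    obtain N :: nat where N: "\<bar>t\<bar> \<le> real N" using real_arch_simple by blast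
    show "\<forall>\<^sub>F m in sequentially. ?q m t = (cutoff_der j t)\<^sup>2"
    proof (rule eventually_sequentiallyI[of N])
      fix m assume "N \<le> m"
      then have "t \<in> {- real m..real m}" using N by auto
      then show "?q m t = (cutoff_der j t)\<^sup>2" by simp
    qed
  qed
  have q0: "0 \<le> ?q m t" for m t by simp
  show "sqint (cutoff_der j)" "(\<integral>t. (cutoff_der j t)\<^sup>2 \<partial>lborel) \<le> 4 / real j"
    using Fatou_integrable[of 0 lborel ?q "4 / real j" "\<lambda>t. (cutoff_der j t)\<^sup>2", OF qi q0 qb lim] by (simp_all add: sqint_def)
qed

lemma cutoff_dominated:
  assumes j: "0 < j"
  shows "dominated E (cutoff j) (cutoff_der j)"
  unfolding dominated_def
proof (intro conjI ballI impI allI)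
  fix x y assume xy: "x \<in> E" "y \<in> E" "x \<le> y"
  show "set_integrable lborel {x..y} (cutoff_der j)" by (rule sqintD(3)[OF cutoff_der_sqint(1)[OF j]])
  let ?J = "2 * real j"
  let ?\<zeta> = "\<lambda>u. min 1 (max 0 (2 - \<bar>u\<bar> / real j))"
  \<comment> \<open>The profile does not notice a clamping of its argument at \<open>2 * j\<close>,
    and the increments of the clamped scale are lengths inside
    \<open>[- 2 * j, 2 * j]\<close>.\<close>
  have z: "?\<zeta> u = ?\<zeta> (clamp_to ?J u)" for u
  proof (cases "\<bar>u\<bar> \<le> ?J")
    case False
    then have "2 \<le> \<bar>u\<bar> / real j" using j by (simp add: pos_le_divide_eq)
    moreover have "\<bar>clamp_to ?J u\<bar> = ?J" using False by (auto simp: min_def max_def)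
    then have "\<bar>clamp_to ?J u\<bar> / real j = 2" using j by simp
    ultimately show ?thesis by simp
  qed (simp only: clamp_to_id)
  have lip: "\<bar>?\<zeta> u - ?\<zeta> v\<bar> \<le> \<bar>u - v\<bar> / real j" for u v
  proof -
    have "\<bar>?\<zeta> u - ?\<zeta> v\<bar> \<le> \<bar>\<bar>u\<bar> / real j - \<bar>v\<bar> / real j\<bar>" by (simp add: min_def max_def abs_if)
    also have "\<dots> = \<bar>\<bar>u\<bar> - \<bar>v\<bar>\<bar> / real j" using j by (simp add: abs_divide flip: diff_divide_distrib)
    also have "\<dots> \<le> \<bar>u - v\<bar> / real j" using j by (intro divide_right_mono) auto
    finally show ?thesis .
  qed
  have s: "sb x \<le> sb y" by (rule sb_mono[OF xy(3)])
  have "\<bar>cutoff j y - cutoff j x\<bar> = \<bar>?\<zeta> (clamp_to ?J (sb y)) - ?\<zeta> (clamp_to ?J (sb x))\<bar>"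
    unfolding cutoff_def z[symmetric] ..
  also have "\<dots> \<le> \<bar>clamp_to ?J (sb y) - clamp_to ?J (sb x)\<bar> / real j" by (rule lip)
  also have "\<dots> \<le> measure lborel ({sb x..sb y} \<inter> {- ?J..?J}) / real j"
  proof (rule divide_right_mono)
    have I: "{sb x..sb y} \<inter> {- ?J..?J} = {max (sb x) (- ?J)..min (sb y) ?J}" by auto
    have "measure lborel {u..v} = max 0 (v - u)" for u v :: real by (cases "u \<le> v") simp_all
    then have m: "measure lborel ({sb x..sb y} \<inter> {- ?J..?J}) = max 0 (min (sb y) ?J - max (sb x) (- ?J))" unfolding I .
    show "\<bar>clamp_to ?J (sb y) - clamp_to ?J (sb x)\<bar> \<le> measure lborel ({sb x..sb y} \<inter> {- ?J..?J})"
      unfolding m using s by (auto simp: min_def max_def)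
  qed simp
  also have "\<dots> = set_lebesgue_integral lborel {x..y} (cutoff_der j)"
    by (subst cutoff_der_integral[OF xy(3)]) (simp add: divide_inverse mult.commute)
  finally show "\<bar>cutoff j y - cutoff j x\<bar> \<le> set_lebesgue_integral lborel {x..y} (cutoff_der j)" .
qed (simp_all add: cutoff_der_bounds)

lemma cutoff_range: "0 \<le> cutoff j x" "cutoff j x \<le> 1"
  by (simp_all add: cutoff_def)

lemma cutoff_tendsto: "(\<lambda>j. cutoff (Suc j) x) \<longlonglongrightarrow> 1"
proof (rule tendsto_eventually)
  obtain N :: nat where N: "\<bar>sb x\<bar> \<le> real N" using real_arch_simple by blast
  show "\<forall>\<^sub>F j in sequentially. cutoff (Suc j) x = 1"
  proof (rule eventually_sequentiallyI[of N])
    fix j assume "N \<le> j"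
    then have "\<bar>sb x\<bar> \<le> real (Suc j)" using N by simp
    then have "\<bar>sb x\<bar> / real (Suc j) \<le> 1" by (subst pos_divide_le_eq) simp_all
    moreover have "min 1 (max 0 (2 - u)) = 1" if "u \<le> 1" for u :: real using that by simp
    ultimately show "cutoff (Suc j) x = 1" unfolding cutoff_def by blast
  qed
qed

text \<open>The product rule for increments: boundedness of \<open>w\<close> lets the variation of
  the cutoff enter with the factor \<open>B\<close>.\<close>

lemma minimal_dom_cutoff:
  assumes w: "minimal_dom w" and B: "0 \<le> B" "\<And>x. \<bar>w x\<bar> \<le> B" and j: "0 < j"
  shows "minimal_dom (\<lambda>x. w x * cutoff j x)"
proof -
  let ?m = "\<lambda>t. \<bar>slope E w t\<bar> + B * cutoff_der j t"
  note dw = primitive_dominated[OF minimal_dom_D(4)[OF w]] and dc = cutoff_dominated[OF j]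
  have dom: "dominated E (\<lambda>x. w x * cutoff j x) ?m"
    unfolding dominated_def
  proof (intro conjI ballI impI allI)
    show "0 \<le> ?m t" for t using B(1) cutoff_der_bounds(1) by simp
    fix x y assume xy: "x \<in> E" "y \<in> E" "x \<le> y"
    note a = set_integral_add[OF dominatedD(3)[OF dw xy] set_integrable_mult_right[of B, OF dominatedD(3)[OF dc xy]]]
    show "set_integrable lborel {x..y} ?m" by (rule a(1))
    have "w y * cutoff j y - w x * cutoff j x = (w y - w x) * cutoff j y + w x * (cutoff j y - cutoff j x)"
      by (simp add: algebra_simps)
    then have "\<bar>w y * cutoff j y - w x * cutoff j x\<bar> \<le> \<bar>w y - w x\<bar> * cutoff j y + \<bar>w x\<bar> * \<bar>cutoff j y - cutoff j x\<bar>"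
      using abs_triangle_ineq[of "(w y - w x) * cutoff j y" "w x * (cutoff j y - cutoff j x)"] cutoff_range(1)[of j y]
      by (simp add: abs_mult)
    also have "\<dots> \<le> \<bar>w y - w x\<bar> + B * \<bar>cutoff j y - cutoff j x\<bar>"
      using cutoff_range[of j y] B by (intro add_mono mult_right_mono mult_left_le) simp_all
    also have "\<dots> \<le> set_lebesgue_integral lborel {x..y} (\<lambda>t. \<bar>slope E w t\<bar>) + B * set_lebesgue_integral lborel {x..y} (cutoff_der j)"
      by (intro add_mono mult_left_mono dominatedD(4)[OF dw xy] dominatedD(4)[OF dc xy] B(1))
    also have "\<dots> = set_lebesgue_integral lborel {x..y} ?m" unfolding a(2) by simp
    finally show "\<bar>w y * cutoff j y - w x * cutoff j x\<bar> \<le> set_lebesgue_integral lborel {x..y} ?m" .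
  qed measurable
  have sq: "sqint ?m"
  proof (rule sqint_bound(1)[OF minimal_dom_D(3)[OF w] sqint_scale[OF cutoff_der_sqint(1)[OF j], of B]])
    show "AE t in lborel. \<bar>?m t\<bar> \<le> \<bar>slope E w t\<bar> + \<bar>B * cutoff_der j t\<bar>" by (rule AE_I2) simp
  qed measurable
  have wle: "\<bar>w x * cutoff j x\<bar> \<le> 1 * (\<bar>w x\<bar> + \<bar>w x\<bar>)" for x
  proof -
    have "\<bar>w x * cutoff j x\<bar> \<le> \<bar>w x\<bar>" using cutoff_range[of j x] by (simp add: abs_mult mult_left_le)
    also have "\<dots> \<le> 1 * (\<bar>w x\<bar> + \<bar>w x\<bar>)" by simp
    finally show ?thesis .
  qed
  show ?thesis
  proof (rule minimal_dom_intro[OF dom _ sq _ minimal_dom_D(2)[OF w] minimal_dom_D(2)[OF w]])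
    show "?m t = 0" if "t \<in> E" for t using slope_in[OF that] cutoff_der_bounds(2)[OF that] by simp
    show "w x * cutoff j x = 0" if "x \<notin> E" for x using minimal_dom_D(1)[OF w that] by simp
    show "\<bar>w x * cutoff j x\<bar> \<le> \<bar>w x\<bar> + \<bar>w x\<bar>" for x using wle[of x] by simp
    show "near_lo E (\<lambda>x. w x * cutoff j x)" if "lE E \<notin> ereal ` E" "\<bar>s_lo E sb\<bar> \<noteq> \<infinity>"
      by (rule near_lo_dom[OF minimal_dom_near_lo[OF w that] minimal_dom_near_lo[OF w that] _ wle]) simp
    show "near_hi E (\<lambda>x. w x * cutoff j x)" if "rE E \<notin> ereal ` E" "\<bar>s_hi E sb\<bar> \<noteq> \<infinity>"
      by (rule near_hi_dom[OF minimal_dom_near_hi[OF w that] minimal_dom_near_hi[OF w that] _ wle]) simp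
  qed
qed

text \<open>The slope of the remainder is at most \<open>\<bar>slope E w t\<bar>\<close> plus
  \<open>B\<close> times the slope of the cutoff. The second term tends to 0 in L2, but no common
  majorant is at hand, so it is split off before dominated convergence is used.\<close>

lemma minimal_dom_cutoff_approx:
  assumes w: "minimal_dom w" and B: "0 \<le> B" "\<And>x. \<bar>w x\<bar> \<le> B" and e: "0 < e"
  obtains j where "0 < j" "E1 E \<mu> (\<lambda>x. w x - w x * cutoff j x) < e"
proof -
  let ?c = "\<lambda>j. cutoff (Suc j)"
  let ?r = "\<lambda>j x. w x - w x * ?c j x"
  have r: "minimal_dom (?r j)" for j by (rule minimal_dom_diff[OF w minimal_dom_cutoff[OF w B]]) simp
  have rlim: "(\<lambda>j. ?r j x) \<longlonglongrightarrow> 0" for x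
  proof -
    have "(\<lambda>j. ?r j x) \<longlonglongrightarrow> w x - w x * 1" by (intro tendsto_diff tendsto_mult tendsto_const cutoff_tendsto)
    then show ?thesis by simp
  qed
  have rle: "\<bar>?r j x\<bar> \<le> 1 * \<bar>w x\<bar>" for j x
  proof -
    have "?r j x = w x * (1 - ?c j x)" by (simp add: algebra_simps)
    then show ?thesis using cutoff_range[of "Suc j" x] by (simp add: abs_mult mult_left_le)
  qed
  have sc: "sqint (slope E (?c j))" "(\<integral>t. (slope E (?c j) t)\<^sup>2 \<partial>lborel) \<le> 4 / real (Suc j)" for j
    using slope_square_le[OF cutoff_dominated[of "Suc j"] cutoff_der_sqint(1)[of "Suc j"]] cutoff_der_sqint(2)[of "Suc j"] by simp_all
  have sl: "\<bar>slope E (?r j) t\<bar> \<le> \<bar>slope E w t\<bar> + B * \<bar>slope E (?c j) t\<bar>" for j t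
  proof -
    have "\<bar>slope E (?r j) t\<bar> \<le> \<bar>slope E w t\<bar> + \<bar>slope E (\<lambda>x. B * ?c j x - 0 * w x) t\<bar>"
    proof (rule slope_abs_le)
      fix x y
      have "?r j y - ?r j x = (w y - w x) * (1 - ?c j y) - w x * (?c j y - ?c j x)" by (simp add: algebra_simps)
      then have "\<bar>?r j y - ?r j x\<bar> \<le> \<bar>w y - w x\<bar> * (1 - ?c j y) + \<bar>w x\<bar> * \<bar>?c j y - ?c j x\<bar>"
        using abs_triangle_ineq4[of "(w y - w x) * (1 - ?c j y)" "w x * (?c j y - ?c j x)"] cutoff_range(2)[of "Suc j" y]
        by (simp add: abs_mult)
      also have "\<dots> \<le> \<bar>w y - w x\<bar> + B * \<bar>?c j y - ?c j x\<bar>"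
        using cutoff_range[of "Suc j" y] B by (intro add_mono mult_right_mono mult_left_le) simp_all
      also have "B * \<bar>?c j y - ?c j x\<bar> = \<bar>(B * ?c j y - 0 * w y) - (B * ?c j x - 0 * w x)\<bar>"
        using B(1) by (simp add: abs_mult flip: right_diff_distrib)
      finally show "\<bar>?r j y - ?r j x\<bar> \<le> \<bar>w y - w x\<bar> + \<bar>(B * ?c j y - 0 * w y) - (B * ?c j x - 0 * w x)\<bar>" .
    qed
    then show ?thesis unfolding slope_linear using B(1) by (simp add: abs_mult)
  qed
  \<comment> \<open>The part of the slope in excess of the cutoff term: dominated by the slope of
    \<open>w\<close> and tending to 0 pointwise.\<close>
  let ?p = "\<lambda>j t. max 0 (\<bar>slope E (?r j) t\<bar> - B * \<bar>slope E (?c j) t\<bar>)"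
  have p0: "(\<lambda>j. \<integral>t. (?p j t)\<^sup>2 \<partial>lborel) \<longlonglongrightarrow> 0"
  proof (rule square_integral_tendsto_0[OF sqintD(2)[OF minimal_dom_D(3)[OF w]], where c = 1])
    show "\<bar>?p j t\<bar> \<le> 1 * \<bar>slope E w t\<bar>" for j t using sl[of j t] by simp
    show "(\<lambda>j. ?p j t) \<longlonglongrightarrow> 0" for t
    proof (rule tendsto_sandwich[of "\<lambda>_. 0" _ _ "\<lambda>j. \<bar>slope E (?r j) t\<bar>"])
      have "0 \<le> B * \<bar>slope E (?c j) t\<bar>" for j using B(1) by simp
      then show "\<forall>\<^sub>F j in sequentially. ?p j t \<le> \<bar>slope E (?r j) t\<bar>" by (intro always_eventually allI) simp
      have "(\<lambda>j. slope E (?r j) t) \<longlonglongrightarrow> 0"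
        using slope_tendsto[of ?r "\<lambda>_. 0" t, OF rlim] by (simp only: slope_zero_fun)
      then show "(\<lambda>j. \<bar>slope E (?r j) t\<bar>) \<longlonglongrightarrow> 0" by (rule tendsto_rabs_zero)
    qed simp_all
  qed measurable
  have "(\<lambda>j. \<integral>t. (slope E (?r j) t)\<^sup>2 \<partial>lborel) \<longlonglongrightarrow> 0"
  proof (rule tendsto_sandwich[of "\<lambda>_. 0" _ _ "\<lambda>j. 2 * (\<integral>t. (?p j t)\<^sup>2 \<partial>lborel) + 2 * (B\<^sup>2 * (4 * inverse (real (Suc j))))"])
    show "\<forall>\<^sub>F j in sequentially. 0 \<le> (\<integral>t. (slope E (?r j) t)\<^sup>2 \<partial>lborel)"
      by (intro always_eventually allI integral_nonneg_AE AE_I2) simp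
    show "\<forall>\<^sub>F j in sequentially. (\<integral>t. (slope E (?r j) t)\<^sup>2 \<partial>lborel) \<le> 2 * (\<integral>t. (?p j t)\<^sup>2 \<partial>lborel) + 2 * (B\<^sup>2 * (4 * inverse (real (Suc j))))"
    proof (intro always_eventually allI)
      fix j
      have sp: "sqint (?p j)"
      proof (rule sqint_bound(1)[OF minimal_dom_D(3)[OF w] sqint_zero])
        show "AE t in lborel. \<bar>?p j t\<bar> \<le> \<bar>slope E w t\<bar> + \<bar>0\<bar>" 
        proof (rule AE_I2)
          fix t show "\<bar>?p j t\<bar> \<le> \<bar>slope E w t\<bar> + \<bar>0\<bar>" using sl[of j t] by simp
        qed
      qed measurable
      have "(\<integral>t. (slope E (?r j) t)\<^sup>2 \<partial>lborel) \<le> 2 * (\<integral>t. (?p j t)\<^sup>2 \<partial>lborel) + 2 * (\<integral>t. (B * slope E (?c j) t)\<^sup>2 \<partial>lborel)"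
      proof (rule sqint_bound(2)[OF sp sqint_scale[OF sc(1)] slope_borel])
        show "AE t in lborel. \<bar>slope E (?r j) t\<bar> \<le> \<bar>?p j t\<bar> + \<bar>B * slope E (?c j) t\<bar>"
          using B(1) by (intro AE_I2) (simp add: abs_mult)
      qed
      also have "(\<integral>t. (B * slope E (?c j) t)\<^sup>2 \<partial>lborel) = B\<^sup>2 * (\<integral>t. (slope E (?c j) t)\<^sup>2 \<partial>lborel)"
        by (simp add: power_mult_distrib)
      also have "\<dots> \<le> B\<^sup>2 * (4 * inverse (real (Suc j)))"
        using sc(2)[of j] by (intro mult_left_mono) (simp_all add: divide_inverse)
      finally show "(\<integral>t. (slope E (?r j) t)\<^sup>2 \<partial>lborel) \<le> 2 * (\<integral>t. (?p j t)\<^sup>2 \<partial>lborel) + 2 * (B\<^sup>2 * (4 * inverse (real (Suc j))))" by simp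
    qed
    have "(\<lambda>j. 2 * (\<integral>t. (?p j t)\<^sup>2 \<partial>lborel) + 2 * (B\<^sup>2 * (4 * inverse (real (Suc j))))) \<longlonglongrightarrow> 2 * 0 + 2 * (B\<^sup>2 * (4 * 0))"
      by (intro tendsto_add tendsto_mult tendsto_const p0 LIMSEQ_inverse_real_of_nat)
    then show "(\<lambda>j. 2 * (\<integral>t. (?p j t)\<^sup>2 \<partial>lborel) + 2 * (B\<^sup>2 * (4 * inverse (real (Suc j))))) \<longlonglongrightarrow> 0" by simp
  qed simp
  moreover have "(\<lambda>j. \<integral>x. (?r j x)\<^sup>2 \<partial>\<mu>) \<longlonglongrightarrow> 0"
  proof (rule square_integral_tendsto_0[where c = 1 and q = w])
    show "integrable \<mu> (\<lambda>x. (w x)\<^sup>2)" using minimal_dom_D(2)[OF w] by (simp add: L2_def)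
    show "?r j \<in> borel_measurable \<mu>" for j using minimal_dom_D(2)[OF r[of j]] by (simp only: L2_def)
  qed (rule rle rlim)+
  ultimately have "(\<lambda>j. E1 E \<mu> (?r j)) \<longlonglongrightarrow> 0" by (rule E1_tendsto_0[OF r])
  then have "\<forall>\<^sub>F j in sequentially. E1 E \<mu> (?r j) < e" by (rule order_tendstoD(2)) (rule e)
  then obtain j where "E1 E \<mu> (?r j) < e" unfolding eventually_sequentially by blast
  then show thesis using that[of "Suc j"] by simp
qed

lemma minimal_dom_E1_triangle:
  assumes "minimal_dom u" "minimal_dom v" "minimal_dom w"
  shows "E1 E \<mu> (\<lambda>x. u x - w x) \<le> 2 * E1 E \<mu> (\<lambda>x. u x - v x) + 2 * E1 E \<mu> (\<lambda>x. v x - w x)"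
proof (rule E1_le2)
  note d = minimal_dom_diff[OF assms(1,2)] minimal_dom_diff[OF assms(2,3)] minimal_dom_diff[OF assms(1,3)]
  show "H1 (\<lambda>x. u x - v x)" "H1 (\<lambda>x. v x - w x)" "H1 (\<lambda>x. u x - w x)" by (rule minimal_dom_H1, rule d)+
  show "L2 \<mu> (\<lambda>x. u x - v x)" "L2 \<mu> (\<lambda>x. v x - w x)" "L2 \<mu> (\<lambda>x. u x - w x)" by (rule minimal_dom_D(2), rule d)+
qed linarith+

lemma cutoff_zero:
  assumes "0 < j" "2 * real j \<le> \<bar>sb x\<bar>"
  shows "cutoff j x = 0"
proof -
  have "2 \<le> \<bar>sb x\<bar> / real j" using assms by (simp add: pos_le_divide_eq)
  then show ?thesis by (simp add: cutoff_def)
qed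

text \<open>Each end falls under one of three cases. If it belongs to \<open>E\<close>, nothing is
  needed; if it is missing at a finite position in the scale, \<open>f\<close> tends to 0 there and
  the truncation at \<open>1 / n\<close> removes a neighbourhood; if it is missing at an infinite
  position, the cutoff does.\<close>

lemma minimal_dom_compact_approx:
  assumes f: "minimal_dom f" and e: "0 < e"
  obtains g p q where "minimal_dom g" "E1 E \<mu> (\<lambda>x. f x - g x) < e" "p \<in> E" "q \<in> E"
    "\<forall>x. x < p \<longrightarrow> g x = 0" "\<forall>x. q < x \<longrightarrow> g x = 0"
proof -
  have e4: "0 < e / 4" using e by simp
  obtain n where n: "0 < n" "minimal_dom (\<lambda>x. clamp_to (real n) (f x) - clamp_to (1 / real n) (f x))"
    "E1 E \<mu> (\<lambda>x. f x - (clamp_to (real n) (f x) - clamp_to (1 / real n) (f x))) < e / 4"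
    by (rule minimal_dom_truncate[OF f e4]) (rule that)
  define w where "w x = clamp_to (real n) (f x) - clamp_to (1 / real n) (f x)" for x
  have w: "minimal_dom w" and fw: "E1 E \<mu> (\<lambda>x. f x - w x) < e / 4" using n(2,3) unfolding w_def[abs_def] by simp_all
  have n1: "1 / real n \<le> real n" using n(1) by (intro order_trans[of "1 / real n" 1 "real n"]) simp_all
  have w0: "w x = 0" if "\<bar>f x\<bar> < 1 / real n" for x
    unfolding w_def using that n1 by (subst (1 2) clamp_to_id) simp_all
  have wb: "\<bar>w x\<bar> \<le> real n + 1 / real n" for x
    unfolding w_def by (rule order_trans[OF abs_triangle_ineq4 add_mono[OF clamp_to_abs clamp_to_abs]]) simp_all
  have B: "0 \<le> real n + 1 / real n" by simp
  obtain j where j: "0 < j" and wg: "E1 E \<mu> (\<lambda>x. w x - w x * cutoff j x) < e / 4"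
    by (rule minimal_dom_cutoff_approx[OF w B wb e4]) (rule that)
  define g where "g x = w x * cutoff j x" for x
  have g: "minimal_dom g" unfolding g_def[abs_def] by (rule minimal_dom_cutoff[OF w B wb j])
  have ofE: "\<forall>x. P x \<longrightarrow> g x = 0" if "\<forall>x\<in>E. P x \<longrightarrow> g x = 0" for P using that minimal_dom_D(1)[OF g] by blast
  obtain x0 where x0: "x0 \<in> E" using E_nonempty by blast
  have lo: "\<exists>p\<in>E. \<forall>x\<in>E. x < p \<longrightarrow> g x = 0"
  proof (cases "lE E \<in> ereal ` E")
    case True
    then obtain p where p: "p \<in> E" "lE E = ereal p" by blast
    have "\<not> x < p" if "x \<in> E" for x using lE_le[OF that] unfolding p(2) by simp
    then show ?thesis using p(1) by blast
  next
    case l: False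
    show ?thesis
    proof (cases "\<bar>s_lo E sb\<bar> = \<infinity>")
      case False
      have "0 < 1 / real n" using n(1) by simp
      then obtain p where p: "p \<in> E" "\<forall>x\<in>E. x \<le> p \<longrightarrow> \<bar>f x\<bar> < 1 / real n"
        using minimal_dom_near_lo[OF f l False] unfolding near_lo_def by blast
      have "g x = 0" if "x \<in> E" "x < p" for x using w0[of x] p(2) that by (simp add: g_def)
      then show ?thesis using p(1) by blast
    next
      case True
      have "s_lo E sb \<noteq> \<infinity>" using s_lo_le[OF intI_I[OF x0], of sb] by auto
      then have "s_lo E sb < ereal (- 2 * real j)" using True by auto
      then obtain p where p: "p \<in> E" "sb p < - 2 * real j" by (rule below_lo[OF sb_mono_on l]) (rule that)
      have "g x = 0" if "x \<in> E" "x < p" for x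
      proof -
        have "sb x \<le> sb p" by (rule sb_mono) (use that in simp)
        then have "2 * real j \<le> \<bar>sb x\<bar>" using p(2) by simp
        then show ?thesis by (simp add: g_def cutoff_zero[OF j])
      qed
      then show ?thesis using p(1) by blast
    qed
  qed
  have hi: "\<exists>q\<in>E. \<forall>x\<in>E. q < x \<longrightarrow> g x = 0"
  proof (cases "rE E \<in> ereal ` E")
    case True
    then obtain p where p: "p \<in> E" "rE E = ereal p" by blast
    have "\<not> p < x" if "x \<in> E" for x using rE_ge[OF that] unfolding p(2) by simp
    then show ?thesis using p(1) by blast
  next
    case l: False
    show ?thesis
    proof (cases "\<bar>s_hi E sb\<bar> = \<infinity>")
      case False
      have "0 < 1 / real n" using n(1) by simp
      then obtain p where p: "p \<in> E" "\<forall>x\<in>E. p \<le> x \<longrightarrow> \<bar>f x\<bar> < 1 / real n"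
        using minimal_dom_near_hi[OF f l False] unfolding near_hi_def by blast
      have "g x = 0" if "x \<in> E" "p < x" for x using w0[of x] p(2) that by (simp add: g_def)
      then show ?thesis using p(1) by blast
    next
      case True
      have "s_hi E sb \<noteq> - \<infinity>" using s_hi_ge[OF intI_I[OF x0], of sb] by auto
      then have "ereal (2 * real j) < s_hi E sb" using True by auto
      then obtain p where p: "p \<in> E" "2 * real j < sb p" by (rule above_hi[OF sb_mono_on l]) (rule that)
      have "g x = 0" if "x \<in> E" "p < x" for x
      proof -
        have "sb p \<le> sb x" by (rule sb_mono) (use that in simp)
        then have "2 * real j \<le> \<bar>sb x\<bar>" using p(2) by simp
        then show ?thesis by (simp add: g_def cutoff_zero[OF j])
      qed
      then show ?thesis using p(1) by blast
    qed
  qed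
  have fg: "E1 E \<mu> (\<lambda>x. f x - g x) < e"
  proof -
    have "E1 E \<mu> (\<lambda>x. w x - g x) < e / 4" using wg unfolding g_def .
    then show ?thesis using minimal_dom_E1_triangle[OF f w g] fw by linarith
  qed
  obtain p where p: "p \<in> E" "\<forall>x\<in>E. x < p \<longrightarrow> g x = 0" using lo by blast
  obtain q where q: "q \<in> E" "\<forall>x\<in>E. q < x \<longrightarrow> g x = 0" using hi by blast
  show thesis by (rule that[OF g fg p(1) q(1) ofE[OF p(2)] ofE[OF q(2)]])
qed

section \<open>Approximation by finite combinations of steps\<close>

inductive stepspan :: "(real \<Rightarrow> real) \<Rightarrow> bool" where
  stepspan_zero: "stepspan (\<lambda>_. 0)"
| stepspan_add: "stepspan h \<Longrightarrow> clopen_cut a b q c \<Longrightarrow> stepspan (\<lambda>x. h x + \<alpha> * step b q x)"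

lemma stepspan_minimal_dom: "stepspan h \<Longrightarrow> minimal_dom h"
  by (induction rule: stepspan.induct) (intro minimal_dom_zero minimal_dom_add minimal_dom_scale step_minimal_dom | assumption)+

lemma stepspan_Cc: "stepspan h \<Longrightarrow> h \<in> Cc E"
  by (induction rule: stepspan.induct) (intro Cc_zero Cc_add Cc_scale step_Cc | assumption)+

lemma stepspan_sum:
  assumes "finite D" "stepspan h" "\<And>p. p \<in> D \<Longrightarrow> clopen_cut (fst p) (snd p) q c"
  shows "stepspan (\<lambda>x. h x + (\<Sum>p\<in>D. \<alpha> p * step (snd p) q x))"
  using assms(1,3)
proof (induction D rule: finite_induct)
  case (insert p D)
  have "stepspan (\<lambda>x. (h x + (\<Sum>p\<in>D. \<alpha> p * step (snd p) q x)) + \<alpha> p * step (snd p) q x)"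
    by (rule stepspan_add[OF insert.IH insert.prems]) (simp_all add: insert.prems)
  moreover have "(h x + (\<Sum>p\<in>D. \<alpha> p * step (snd p) q x)) + \<alpha> p * step (snd p) q x
    = h x + (\<Sum>p\<in>insert p D. \<alpha> p * step (snd p) q x)" for x
    using insert.hyps by simp
  ultimately show ?case by (simp only:)
qed (simp add: assms(2))

lemma step_in_S:
  assumes S: "fukushima_subspace E \<mu> S" and cut: "clopen_cut a b q c"
  shows "step b q \<in> S"
proof -
  obtain \<theta> where \<theta>: "\<theta> \<in> S" "\<forall>y\<in>E. (step b q y = 1 \<longrightarrow> \<theta> y = 1) \<and> (step b q y = 0 \<longrightarrow> \<theta> y = 0)"
    using S_threshold[OF S step_Cc[OF cut]] by blast
  have "\<theta> y = step b q y" for y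
  proof (cases "y \<in> E")
    case True
    have "step b q y = 1 \<or> step b q y = 0" by (simp add: step_def)
    then show ?thesis using \<theta>(2) True by metis
  next
    case False
    then show ?thesis using S_off[OF S \<theta>(1) False] by (simp add: step_def)
  qed
  then have "\<theta> = step b q" by (rule ext)
  then show ?thesis using \<theta>(1) by simp
qed

lemma stepspan_in_S:
  assumes S: "fukushima_subspace E \<mu> S"
  shows "stepspan h \<Longrightarrow> h \<in> S"
proof (induction rule: stepspan.induct)
  case (stepspan_add h a b q c \<alpha>)
  show ?case by (rule S_add[OF S stepspan_add.IH S_scale[OF S step_in_S[OF S stepspan_add.hyps(2)]]])
qed (rule S_zero[OF S])

lemma set_integral_gap_indicator:
  fixes k :: "real \<Rightarrow> real"
  assumes p: "p \<in> gaps E" and xy: "x \<in> E" "y \<in> E" "x \<le> y"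
  shows "set_lebesgue_integral lborel {x..y} (\<lambda>t. indicator {fst p<..<snd p} t * k t)
    = (if x \<le> fst p \<and> snd p \<le> y then set_lebesgue_integral lborel {fst p<..<snd p} k else 0)"
proof -
  have p': "(fst p, snd p) \<in> gaps E" using p by simp
  have "indicator {x..y} t *\<^sub>R (indicator {fst p<..<snd p} t * k t)
    = (if x \<le> fst p \<and> snd p \<le> y then indicator {fst p<..<snd p} t *\<^sub>R k t else 0)" for t
    using gap_cases[OF p' xy(1,2)] gapsD(3)[OF p'] gap_cases[OF p' xy(2,1)] by (auto simp: indicator_def)
  then show ?thesis unfolding set_lebesgue_integral_def by (cases "x \<le> fst p \<and> snd p \<le> y") (simp_all only: if_True if_False integral_zero simp_thms)
qed

text \<open>Inside \<open>[b, q]\<close> the increments are controlled by \<open>m\<close>, and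
  \<open>r b = 0\<close> leaves no jump on the left. The remaining jump from \<open>r q\<close> to 0
  is charged to the free interval \<open>(q, c)\<close> as a density of total mass
  \<open>\<tau>\<close>.\<close>

lemma dominated_cut:
  assumes cut: "clopen_cut a b q c" and m: "m \<in> borel_measurable borel" "\<And>t. 0 \<le> m t" "\<And>x y. set_integrable lborel {x..y} m"
    and r: "\<And>x. x < b \<Longrightarrow> r x = 0" "\<And>x. q < x \<Longrightarrow> r x = 0" "r b = 0"
    and inc: "\<And>x y. x \<in> E \<Longrightarrow> y \<in> E \<Longrightarrow> b \<le> x \<Longrightarrow> x \<le> y \<Longrightarrow> y \<le> q \<Longrightarrow> \<bar>r y - r x\<bar> \<le> set_lebesgue_integral lborel {x..y} m"
    and \<tau>: "\<And>x. \<bar>r x\<bar> \<le> \<tau>"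
  shows "dominated E r (\<lambda>t. m t + \<tau> / (c - q) * indicator {q<..<c} t)"
proof -
  have le: "a < b" "b \<le> q" "q < c" "b \<in> E" "q \<in> E" and ga: "E \<inter> {a<..<b} = {}" "E \<inter> {q<..<c} = {}"
    using cut by (auto simp: clopen_cut_def)
  have t0: "0 \<le> \<tau>" using \<tau>[of b] by simp
  let ?m2 = "\<lambda>t. \<tau> / (c - q) * indicator {q<..<c} t"
  have m20: "0 \<le> ?m2 t" for t using t0 le by simp
  have i2: "set_integrable lborel {x..y} ?m2" for x y
  proof (rule set_integrable_mult_right)
    show "set_integrable lborel {x..y} (indicat_real {q<..<c})"
      unfolding set_integrable_def by (rule integrable_mult_indicator) (use le in simp_all)
  qed
  note a = set_integral_add[OF m(3) i2]
  have sub: "set_lebesgue_integral lborel {u..v} m \<le> set_lebesgue_integral lborel {x..y} m" if "x \<le> u" "v \<le> y" for u v x y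
    unfolding set_lebesgue_integral_def
  proof (rule integral_mono)
    show "integrable lborel (\<lambda>t. indicator {u..v} t *\<^sub>R m t)" "integrable lborel (\<lambda>t. indicator {x..y} t *\<^sub>R m t)"
      using m(3) by (simp_all only: set_integrable_def)
    show "indicator {u..v} t *\<^sub>R m t \<le> indicator {x..y} t *\<^sub>R m t" for t
      using that m(2)[of t] by (auto simp: indicator_def)
  qed
  have nn: "0 \<le> set_lebesgue_integral lborel {x..y} m" "0 \<le> set_lebesgue_integral lborel {x..y} ?m2" for x y
    unfolding set_lebesgue_integral_def by (intro integral_nonneg_AE AE_I2 scaleR_nonneg_nonneg indicator_pos_le m20 m(2))+
  show ?thesis unfolding dominated_def
  proof (intro conjI ballI impI allI)
    show "(\<lambda>t. m t + ?m2 t) \<in> borel_measurable borel" using m(1) by measurable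
    show "0 \<le> m t + ?m2 t" for t using m(2) m20 by (intro add_nonneg_nonneg)
    fix x y assume xy: "x \<in> E" "y \<in> E" "x \<le> y"
    show "set_integrable lborel {x..y} (\<lambda>t. m t + ?m2 t)" by (rule a(1))
    have "\<bar>r y - r x\<bar> \<le> set_lebesgue_integral lborel {x..y} m + set_lebesgue_integral lborel {x..y} ?m2"
    proof (cases "q < y")
      case True
      have cy: "c \<le> y" using True ga(2) xy(2) by (auto simp: not_le[symmetric])
      show ?thesis
      proof (cases "q < x")
        case False
        have eq: "indicator {x..y} t *\<^sub>R ?m2 t = ?m2 t" for t using False cy by (auto simp: indicator_def)
        have "set_lebesgue_integral lborel {x..y} ?m2 = \<tau>" unfolding set_lebesgue_integral_def eq using le by simp
        then show ?thesis using \<tau>[of x] nn(1)[of x y] r(2)[OF True] by simp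
      qed (use True nn[of x y] r(2) in simp)
    next
      case False
      then have yq: "y \<le> q" by simp
      have "\<bar>r y - r x\<bar> \<le> set_lebesgue_integral lborel {x..y} m"
      proof (cases "x < b")
        case True
        show ?thesis
        proof (cases "y < b")
          case False
          then have by': "b \<le> y" by simp
          have "\<bar>r y - r x\<bar> = \<bar>r y - r b\<bar>" using r(1)[OF True] r(3) by simp
          also have "\<dots> \<le> set_lebesgue_integral lborel {b..y} m" by (rule inc[OF le(4) xy(2) order_refl by' yq])
          also have "\<dots> \<le> set_lebesgue_integral lborel {x..y} m" by (rule sub) (use True in auto)
          finally show ?thesis .
        qed (use True r(1) nn in simp)
      next
        case False
        then show ?thesis using inc[OF xy(1,2) _ xy(3) yq] by simp
      qed
      then show ?thesis using nn(2)[of x y] by simp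
    qed
    then show "\<bar>r y - r x\<bar> \<le> set_lebesgue_integral lborel {x..y} (\<lambda>t. m t + ?m2 t)" unfolding a(2) .
  qed
qed

lemma gap_indicator_sum:
  assumes "finite D" "D \<subseteq> gaps E"
  shows "(\<Sum>p\<in>D. indicator {fst p<..<snd p} t) = (0::real) \<or> (\<Sum>p\<in>D. indicator {fst p<..<snd p} t) = (1::real)"
proof (cases "\<exists>p\<in>D. fst p < t \<and> t < snd p")
  case True
  then obtain p where p: "p \<in> D" "fst p < t" "t < snd p" by blast
  have "indicator {fst p'<..<snd p'} t = (if p' = p then 1 else 0 :: real)" if p': "p' \<in> D" for p'
  proof (cases "fst p' < t \<and> t < snd p'")
    case True
    have "(fst p', snd p') \<in> gaps E" "(fst p, snd p) \<in> gaps E" using p(1) p' assms(2) by auto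
    from gaps_unique[OF this, of t] have "p' = p" using True p by (simp add: prod_eq_iff)
    then show ?thesis using True by simp
  qed (use p in auto)
  then have "(\<Sum>p\<in>D. indicator {fst p<..<snd p} t) = (\<Sum>p'\<in>D. if p' = p then 1 else 0 :: real)" by (rule sum.cong[OF refl])
  then show ?thesis using assms(1) p(1) by simp
next
  case False
  then have "indicator {fst p<..<snd p} t = (0::real)" if "p \<in> D" for p using that by auto
  then show ?thesis by simp
qed

text \<open>\<open>\<psi>\<close> is the indicator of the complement of the finitely many gaps in
  \<open>D\<close>. A gap lies inside \<open>[x, y]\<close> or does not meet it, so each contributes
  its whole integral or nothing.\<close>

lemma set_integral_minus_gaps:
  fixes k :: "real \<Rightarrow> real"
  assumes D: "finite D" "D \<subseteq> gaps E" and k: "set_integrable lborel {x..y} k" and xy: "x \<in> E" "y \<in> E" "x \<le> y"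
  defines "\<psi> \<equiv> \<lambda>t. 1 - (\<Sum>p\<in>D. indicator {fst p<..<snd p} t)"
  shows "set_integrable lborel {x..y} (\<lambda>t. \<psi> t * k t)"
    and "set_lebesgue_integral lborel {x..y} (\<lambda>t. \<psi> t * k t) = set_lebesgue_integral lborel {x..y} k
      - (\<Sum>p\<in>D. if x \<le> fst p \<and> snd p \<le> y then set_lebesgue_integral lborel {fst p<..<snd p} k else 0)"
proof -
  let ?q = "\<lambda>p t. indicator {x..y} t *\<^sub>R (indicator {fst p<..<snd p} t * k t)"
  have eq: "indicator {x..y} t *\<^sub>R (\<psi> t * k t) = indicator {x..y} t *\<^sub>R k t - (\<Sum>p\<in>D. ?q p t)" for t
    by (simp add: \<psi>_def algebra_simps sum_distrib_left sum_distrib_right)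
  have i: "integrable lborel (\<lambda>t. indicator {x..y} t *\<^sub>R k t)" using k by (simp only: set_integrable_def)
  have q: "integrable lborel (?q p)" for p
  proof -
    have "integrable lborel (\<lambda>t. indicator {fst p<..<snd p} t *\<^sub>R (indicator {x..y} t *\<^sub>R k t))"
      by (rule integrable_mult_indicator[OF _ i]) simp
    moreover have "indicator {fst p<..<snd p} t *\<^sub>R (indicator {x..y} t *\<^sub>R k t) = ?q p t" for t by simp
    ultimately show ?thesis by (simp only:)
  qed
  have s: "integrable lborel (\<lambda>t. \<Sum>p\<in>D. ?q p t)" by (intro Bochner_Integration.integrable_sum q)
  show "set_integrable lborel {x..y} (\<lambda>t. \<psi> t * k t)"
    unfolding set_integrable_def eq by (rule Bochner_Integration.integrable_diff[OF i s])
  have "set_lebesgue_integral lborel {x..y} (\<lambda>t. \<psi> t * k t) = set_lebesgue_integral lborel {x..y} k - (\<integral>t. (\<Sum>p\<in>D. ?q p t) \<partial>lborel)"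
    unfolding set_lebesgue_integral_def eq by (rule Bochner_Integration.integral_diff[OF i s])
  also have "(\<integral>t. (\<Sum>p\<in>D. ?q p t) \<partial>lborel) = (\<Sum>p\<in>D. set_lebesgue_integral lborel {x..y} (\<lambda>t. indicator {fst p<..<snd p} t * k t))"
    unfolding set_lebesgue_integral_def by (rule Bochner_Integration.integral_sum[OF q])
  also have "\<dots> = (\<Sum>p\<in>D. if x \<le> fst p \<and> snd p \<le> y then set_lebesgue_integral lborel {fst p<..<snd p} k else 0)"
    by (rule sum.cong[OF refl], rule set_integral_gap_indicator[OF _ xy]) (use D(2) in blast)
  finally show "set_lebesgue_integral lborel {x..y} (\<lambda>t. \<psi> t * k t) = set_lebesgue_integral lborel {x..y} k
      - (\<Sum>p\<in>D. if x \<le> fst p \<and> snd p \<le> y then set_lebesgue_integral lborel {fst p<..<snd p} k else 0)" .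
qed

text \<open>As \<open>k\<close> vanishes on \<open>E\<close>, its integral is an unordered sum over
  gaps, and finitely many of them already account for it up to \<open>\<tau>\<close>.\<close>

lemma exhausting_gaps:
  fixes k :: "real \<Rightarrow> real"
  assumes xy: "x \<in> E" "y \<in> E" "x \<le> y" and k: "set_integrable lborel {x..y} k" "\<And>t. t \<in> E \<Longrightarrow> k t = 0" and \<tau>: "0 < \<tau>"
  obtains D where "finite D" "D \<subseteq> {p \<in> gaps E. x \<le> fst p \<and> snd p \<le> y}"
    "set_lebesgue_integral lborel {x..y} (\<lambda>t. (1 - (\<Sum>p\<in>D. indicator {fst p<..<snd p} t)) * k t) \<le> \<tau>"
proof -
  obtain D where D: "finite D" "D \<subseteq> {p \<in> gaps E. x \<le> fst p \<and> snd p \<le> y}"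
    "dist (\<Sum>p\<in>D. set_lebesgue_integral lborel {fst p<..<snd p} k) (set_lebesgue_integral lborel (\<Omega> \<inter> {x..y}) k) \<le> \<tau>"
    using has_sum_finite_approximation[OF has_sum_gaps_Icc[OF xy(1,2) k(1)] \<tau>] by blast
  have Dg: "D \<subseteq> gaps E" using D(2) by blast
  have "set_lebesgue_integral lborel (E \<inter> {x..y}) k = 0"
    unfolding set_lebesgue_integral_def by (rule integral_eq_zero_AE, rule AE_I2) (auto simp: indicator_def k(2))
  then have "set_lebesgue_integral lborel {x..y} k = set_lebesgue_integral lborel (\<Omega> \<inter> {x..y}) k"
    using set_integral_split_gaps[OF xy(1,2) k(1)] by simp
  moreover have "(\<Sum>p\<in>D. if x \<le> fst p \<and> snd p \<le> y then set_lebesgue_integral lborel {fst p<..<snd p} k else 0)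
    = (\<Sum>p\<in>D. set_lebesgue_integral lborel {fst p<..<snd p} k)"
    by (rule sum.cong[OF refl]) (use D(2) in auto)
  ultimately have "set_lebesgue_integral lborel {x..y} (\<lambda>t. (1 - (\<Sum>p\<in>D. indicator {fst p<..<snd p} t)) * k t) \<le> \<tau>"
    unfolding set_integral_minus_gaps(2)[OF D(1) Dg k(1) xy] using D(3) by (simp add: dist_real_def)
  then show thesis using that D(1,2) by blast
qed

text \<open>The step function \<open>h\<close> starts at the value \<open>g b\<close> and copies the
  jumps of \<open>g\<close> across the finitely many gaps in \<open>D\<close>. On
  \<open>[b, d]\<close> the remainder then has the slope of \<open>g\<close> outside these gaps as
  its density, which is small both in L1 and in L2.\<close>

lemma minimal_dom_step_approx:
  assumes g: "minimal_dom g" and pq: "p \<in> E" "q \<in> E" "\<forall>x. x < p \<longrightarrow> g x = 0" "\<forall>x. q < x \<longrightarrow> g x = 0" and e: "0 < e"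
  obtains h where "stepspan h" "E1 E \<mu> (\<lambda>x. g x - h x) < e"
proof -
  \<comment> \<open>Nothing orders \<open>p\<close> and \<open>q\<close>; the maximum secures a
    right end that is not to the left of \<open>p\<close>.\<close>
  have Q: "max p q \<in> E" using pq by (simp add: max_def)
  obtain a b where ab: "a < b" "b \<in> E" "E \<inter> {a<..<b} = {}" "p - 1 < b" "b \<le> p"
    by (rule left_cut[OF pq(1) zero_less_one]) (rule that)
  obtain d c where dc: "d < c" "d \<in> E" "E \<inter> {d<..<c} = {}" "d < max p q + 1" "max p q \<le> d"
    by (rule right_cut[OF Q zero_less_one]) (rule that)
  have bd: "b \<le> d" using ab(5) dc(5) by simp
  have cut: "clopen_cut a b d c" using ab dc bd by (simp add: clopen_cut_def)
  let ?A = "E \<inter> {b..d}"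
  have cA: "compact ?A" by (rule compact_Int[OF ab(2) dc(2)])
  define M where "M = measure \<mu> ?A"
  have M0: "0 \<le> M" unfolding M_def by (rule measure_nonneg)
  \<comment> \<open>Collects the final bounds: energy at most
    \<open>\<tau> + \<tau> / (c - d)\<close> and squared norm at most \<open>\<tau> * M\<close>. The
    cap \<open>\<tau> \<le> 1\<close> below allows \<open>\<tau>\<^sup>2\<close> to be replaced by
    \<open>\<tau>\<close>.\<close>
  define C where "C = 1 + 1 / (c - d) + M"
  have C: "0 < C" unfolding C_def using dc(1) M0 by (intro add_pos_nonneg) simp_all
  define \<tau> where "\<tau> = min 1 (e / (2 * C))"
  have t0: "0 < \<tau>" "\<tau> \<le> 1" unfolding \<tau>_def using e C by simp_all
  have tC: "\<tau> * C < e"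
  proof -
    have "\<tau> * C \<le> e / (2 * C) * C" unfolding \<tau>_def using C by (intro mult_right_mono) simp_all
    also have "\<dots> = e / 2" using C by simp
    finally show ?thesis using e by simp
  qed
  let ?s = "slope E g"
  note sq = minimal_dom_D(3)[OF g]
  have s2: "set_integrable lborel {x..y} (\<lambda>t. (?s t)\<^sup>2)" for x y
    unfolding set_integrable_def by (rule integrable_mult_indicator[OF _ sqintD(2)[OF sq]]) simp
  \<comment> \<open>The first summand controls the uniform size of the remainder, the second one its
    energy; exhausting their sum achieves both with a single set \<open>D\<close>.\<close>
  define k where "k t = \<bar>?s t\<bar> + (?s t)\<^sup>2" for t
  have ki: "set_integrable lborel {x..y} k" for x y
    unfolding k_def by (intro set_integral_add(1) set_integrable_abs s2 sqintD(3)[OF sq])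
  have k0: "k t = 0" if "t \<in> E" for t unfolding k_def by (simp add: slope_in[OF that])
  obtain D where D: "finite D" "D \<subseteq> {p \<in> gaps E. b \<le> fst p \<and> snd p \<le> d}"
    and small: "set_lebesgue_integral lborel {b..d} (\<lambda>t. (1 - (\<Sum>p\<in>D. indicator {fst p<..<snd p} t)) * k t) \<le> \<tau>"
    by (rule exhausting_gaps[OF ab(2) dc(2) bd ki k0 t0(1)]) (assumption, rule that)
  have Dg: "D \<subseteq> gaps E" using D(2) by blast
  define \<psi> where "\<psi> t = (1::real) - (\<Sum>p\<in>D. indicator {fst p<..<snd p} t)" for t :: real
  have psi: "\<psi> t = 0 \<or> \<psi> t = 1" for t using gap_indicator_sum[OF D(1) Dg, of t] by (auto simp: \<psi>_def)
  have [measurable]: "\<psi> \<in> borel_measurable borel" unfolding \<psi>_def[abs_def] by measurable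
  note small = small[folded \<psi>_def]
  have pe: "b \<le> fst p" "fst p < snd p" "snd p \<le> d" "(fst p, snd p) \<in> gaps E" if "p \<in> D" for p
  proof -
    have "(fst p, snd p) \<in> gaps E" using Dg that by auto
    then show "b \<le> fst p" "fst p < snd p" "snd p \<le> d" "(fst p, snd p) \<in> gaps E"
      using D(2) that gapsD(3) by blast+
  qed
  define \<Delta> where "\<Delta> p = g (snd p) - g (fst p)" for p
  define h where "h x = (0 + g b * step b d x) + (\<Sum>p\<in>D. \<Delta> p * step (snd p) d x)" for x
  have h: "stepspan h" unfolding h_def[abs_def]
  proof (rule stepspan_sum[OF D(1) stepspan_add[OF stepspan_zero cut]])
    \<comment> \<open>Each step begins at the right end of a gap in \<open>D\<close> and runs to the
      common right end \<open>d\<close>, so the free interval on its left is the gap itself.\<close>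
    fix p assume p: "p \<in> D"
    note gd = gapsD[OF pe(4)[OF p]]
    have "E \<inter> {fst p<..<snd p} = {}" using gd(4) by auto
    then show "clopen_cut (fst p) (snd p) d c" using dc gd pe[OF p] by (simp add: clopen_cut_def)
  qed
  define r where "r x = g x - h x" for x
  have r: "minimal_dom r" unfolding r_def[abs_def] by (rule minimal_dom_diff[OF g stepspan_minimal_dom[OF h]])
  have rlo: "r x = 0" if "x < b" for x
  proof -
    have "step (snd p) d x = 0" if "p \<in> D" for p using pe[OF that] \<open>x < b\<close> by (simp add: step_def)
    moreover have "step b d x = 0" using that by (simp add: step_def)
    moreover have "g x = 0" using pq(3) that ab(5) by simp
    ultimately show ?thesis by (simp add: r_def h_def)
  qed
  have rhi: "r x = 0" if "d < x" for x
    using pq(4) that dc(5) by (simp add: r_def h_def step_def)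
  have rb: "r b = 0"
  proof -
    have "step (snd p) d b = 0" if "p \<in> D" for p using pe[OF that] by (simp add: step_def)
    moreover have "step b d b = 1" using ab bd by (simp add: step_def)
    ultimately show ?thesis by (simp add: r_def h_def)
  qed
  define m where "m t = indicator {b..d} t * (\<psi> t * \<bar>?s t\<bar>)" for t
  have mb [measurable]: "m \<in> borel_measurable borel" unfolding m_def[abs_def] by measurable
  have m0: "0 \<le> m t" for t using psi[of t] by (auto simp: m_def indicator_def)
  have mle: "\<bar>m t\<bar> \<le> \<bar>?s t\<bar> + \<bar>0\<bar>" for t using psi[of t] by (auto simp: m_def indicator_def)
  have sm: "sqint m" by (rule sqint_bound(1)[OF sq sqint_zero _ AE_I2[OF mle]]) measurable
  note pk = set_integral_minus_gaps[OF D(1) Dg ki ab(2) dc(2) bd, folded \<psi>_def]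
  have ipk: "integrable lborel (\<lambda>t. indicator {b..d} t *\<^sub>R (\<psi> t * k t))" using pk(1) by (simp only: set_integrable_def)
  have bound: "(\<integral>t. u t \<partial>lborel) \<le> \<tau>" if "integrable lborel u" "\<And>t. u t \<le> indicator {b..d} t *\<^sub>R (\<psi> t * k t)" for u
    by (rule order_trans[OF integral_mono[OF that(1) ipk that(2)] small[unfolded set_lebesgue_integral_def]])
  \<comment> \<open>Since \<open>\<psi>\<close> takes only the values 0 and 1, it equals its square,
    and the same majorant serves \<open>m\<close> and its square.\<close>
  have mk: "\<bar>m t\<bar> \<le> indicator {b..d} t *\<^sub>R (\<psi> t * k t)" "(m t)\<^sup>2 \<le> indicator {b..d} t *\<^sub>R (\<psi> t * k t)" for t
    using psi[of t] by (auto simp: m_def k_def indicator_def)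
  have m2: "(\<integral>t. (m t)\<^sup>2 \<partial>lborel) \<le> \<tau>" by (rule bound[OF sqintD(2)[OF sm] mk(2)])
  have m1: "set_lebesgue_integral lborel {x..y} m \<le> \<tau>" for x y
    unfolding set_lebesgue_integral_def
  proof (rule bound)
    show "integrable lborel (\<lambda>t. indicator {x..y} t *\<^sub>R m t)" using sqintD(3)[OF sm] by (simp only: set_integrable_def)
    have "indicator {x..y} t *\<^sub>R m t \<le> \<bar>m t\<bar>" for t using m0[of t] by (simp add: indicator_def)
    then show "indicator {x..y} t *\<^sub>R m t \<le> indicator {b..d} t *\<^sub>R (\<psi> t * k t)" for t using mk(1)[of t] by (rule order_trans)
  qed
  have inc: "\<bar>r y - r x\<bar> \<le> set_lebesgue_integral lborel {x..y} m"
    if xy: "x \<in> E" "y \<in> E" "b \<le> x" "x \<le> y" "y \<le> d" for x y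
  proof -
    note ps = set_integral_minus_gaps[OF D(1) Dg sqintD(3)[OF sq] xy(1,2,4), folded \<psi>_def]
    have "h y - h x = (\<Sum>p\<in>D. \<Delta> p * step (snd p) d y) - (\<Sum>p\<in>D. \<Delta> p * step (snd p) d x)"
      using xy by (simp add: h_def step_def)
    also have "\<dots> = (\<Sum>p\<in>D. \<Delta> p * (step (snd p) d y - step (snd p) d x))"
      by (simp add: sum_subtractf right_diff_distrib)
    also have "\<dots> = (\<Sum>p\<in>D. if x \<le> fst p \<and> snd p \<le> y then set_lebesgue_integral lborel {fst p<..<snd p} ?s else 0)"
    proof (rule sum.cong[OF refl])
      fix p assume p: "p \<in> D"
      have "x \<le> fst p \<or> snd p \<le> x" using gap_cases[OF pe(4)[OF p] xy(1) xy(1)] pe[OF p] by auto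
      then have "step (snd p) d y - step (snd p) d x = (if x \<le> fst p \<and> snd p \<le> y then 1 else 0)"
        using pe[OF p] xy by (auto simp: step_def)
      then show "\<Delta> p * (step (snd p) d y - step (snd p) d x) = (if x \<le> fst p \<and> snd p \<le> y then set_lebesgue_integral lborel {fst p<..<snd p} ?s else 0)"
        unfolding slope_integral_gap(1)[OF pe(4)[OF p]] \<Delta>_def by simp
    qed
    finally have "r y - r x = set_lebesgue_integral lborel {x..y} (\<lambda>t. \<psi> t * ?s t)"
      unfolding ps(2) r_def using primitiveD(3)[OF minimal_dom_D(4)[OF g] xy(1,2,4)] by linarith
    also have "\<bar>\<dots>\<bar> \<le> set_lebesgue_integral lborel {x..y} (\<lambda>t. \<bar>\<psi> t * ?s t\<bar>)"
      using set_integral_norm_bound[OF ps(1)] by (simp only: real_norm_def)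
    also have "\<dots> = set_lebesgue_integral lborel {x..y} m"
      unfolding set_lebesgue_integral_def
    proof (rule Bochner_Integration.integral_cong[OF refl])
      show "indicator {x..y} t *\<^sub>R \<bar>\<psi> t * ?s t\<bar> = indicator {x..y} t *\<^sub>R m t" for t
        using psi[of t] xy by (auto simp: m_def indicator_def)
    qed
    finally show ?thesis .
  qed
  have rt: "\<bar>r x\<bar> \<le> \<tau>" for x
  proof (cases "x \<in> E \<and> b \<le> x \<and> x \<le> d")
    case True
    then have "\<bar>r x - r b\<bar> \<le> set_lebesgue_integral lborel {b..x} m" using ab(2) by (intro inc) simp_all
    then show ?thesis using m1[of b x] rb by simp
  next
    case False
    then have "r x = 0" using rlo rhi minimal_dom_D(1)[OF r] by (meson linorder_not_le)
    then show ?thesis using t0(1) by simp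
  qed
  have dom: "dominated E r (\<lambda>t. m t + \<tau> / (c - d) * indicator {d<..<c} t)"
    by (rule dominated_cut[OF cut mb m0 sqintD(3)[OF sm] rlo rhi rb inc rt])
  let ?m2 = "\<lambda>t. \<tau> / (c - d) * indicator {d<..<c} t"
  have e2: "(?m2 t)\<^sup>2 = (\<tau> / (c - d))\<^sup>2 * indicator {d<..<c} t" for t by (simp add: indicator_def)
  have q2: "sqint ?m2" unfolding sqint_def e2 using dc(1) by simp
  have v2: "(\<integral>t. (?m2 t)\<^sup>2 \<partial>lborel) = \<tau>\<^sup>2 * (1 / (c - d))"
    unfolding e2 using dc(1) by (simp add: power2_eq_square)
  have bm: "(\<lambda>t. m t + ?m2 t) \<in> borel_measurable borel" by measurable
  have sb2: "sqint (\<lambda>t. m t + ?m2 t)" "(\<integral>t. (m t + ?m2 t)\<^sup>2 \<partial>lborel) \<le> 2 * (\<integral>t. (m t)\<^sup>2 \<partial>lborel) + 2 * (\<integral>t. (?m2 t)\<^sup>2 \<partial>lborel)"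
    by (rule sqint_bound[OF sm q2 bm AE_I2[OF abs_triangle_ineq]])+
  have tt: "\<tau>\<^sup>2 \<le> \<tau>" using t0 by (simp add: power2_eq_square mult_left_le)
  have F: "form E r r \<le> \<tau> + \<tau> * (1 / (c - d))"
  proof -
    have "\<tau>\<^sup>2 * (1 / (c - d)) \<le> \<tau> * (1 / (c - d))" using tt dc(1) by (intro mult_right_mono) simp_all
    then show ?thesis
      using slope_square_le(2)[OF dom sb2(1)] sb2(2) m2 unfolding v2 minimal_dom_form_self[OF r] by linarith
  qed
  have L: "(\<integral>x. (r x)\<^sup>2 \<partial>\<mu>) \<le> \<tau> * M"
    unfolding M_def
  proof (rule integrable_bounded_compact(2)[OF _ cA])
    show "(\<lambda>x. (r x)\<^sup>2) \<in> borel_measurable \<mu>" using minimal_dom_D(2)[OF r] by (auto simp: L2_def)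
    show "\<bar>(r x)\<^sup>2\<bar> \<le> \<tau>" for x
      using power_mono[OF rt[of x] abs_ge_zero, of 2] tt by simp
    show "(r x)\<^sup>2 = 0" if "x \<in> E" "x \<notin> ?A" for x
    proof -
      have "x < b \<or> d < x" using that by auto
      then show ?thesis using rlo rhi by auto
    qed
  qed auto
  have "E1 E \<mu> r \<le> \<tau> * C" unfolding E1_def C_def using F L by (simp only: distrib_left mult_1_right)
  then have "E1 E \<mu> (\<lambda>x. g x - h x) < e" using tC unfolding r_def[abs_def] by linarith
  then show thesis using that h by blast
qed

lemma minimal_dom_core:
  assumes f: "minimal_dom f" and e: "0 < e"
  obtains h where "stepspan h" "E1 E \<mu> (\<lambda>x. f x - h x) < e"
proof -
  have e4: "0 < e / 4" using e by simp
  obtain g p q where g: "minimal_dom g" "E1 E \<mu> (\<lambda>x. f x - g x) < e / 4" "p \<in> E" "q \<in> E"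
    "\<forall>x. x < p \<longrightarrow> g x = 0" "\<forall>x. q < x \<longrightarrow> g x = 0"
    by (rule minimal_dom_compact_approx[OF f e4]) (rule that)
  obtain h where h: "stepspan h" "E1 E \<mu> (\<lambda>x. g x - h x) < e / 4"
    by (rule minimal_dom_step_approx[OF g(1,3-6) e4]) (rule that)
  have "E1 E \<mu> (\<lambda>x. f x - h x) < e"
    using minimal_dom_E1_triangle[OF f g(1) stepspan_minimal_dom[OF h(1)]] g(2) h(2) by linarith
  then show thesis using that h(1) by blast
qed

end

section \<open>The characteristic set\<close>

lemma set_integral_const_interior:
  fixes k :: "real \<Rightarrow> real"
  assumes ab: "a \<le> b" and [measurable]: "k \<in> borel_measurable borel" and c: "\<And>x. a < x \<Longrightarrow> x < b \<Longrightarrow> k x = c"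
  shows "set_lebesgue_integral lborel {a..b} k = c * (b - a)"
proof -
  have "set_lebesgue_integral lborel {a..b} k = (\<integral>t. c * indicator {a..b} t \<partial>lborel)"
    unfolding set_lebesgue_integral_def
  proof (rule integral_cong_AE)
    show "AE t in lborel. indicator {a..b} t *\<^sub>R k t = c * indicator {a..b} t"
      using AE_lborel_singleton[of a] AE_lborel_singleton[of b]
    proof eventually_elim
      case (elim t)
      then show ?case using c[of t] by (cases "t \<in> {a..b}") auto
    qed
  qed measurable
  then show ?thesis using ab by simp
qed

definition tent :: "real \<Rightarrow> real \<Rightarrow> real \<Rightarrow> real \<Rightarrow> real" where
  "tent a b c y = (if y \<le> a then 0 else if y \<le> b then inverse (b - a) * (y - a)
     else if y \<le> c then 1 - inverse (c - b) * (y - b) else 0)"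

definition tent_der :: "real \<Rightarrow> real \<Rightarrow> real \<Rightarrow> real \<Rightarrow> real" where
  "tent_der a b c y = inverse (b - a) * indicator {a<..<b} y - inverse (c - b) * indicator {b<..<c} y"

lemma tent_borel [measurable]: "tent a b c \<in> borel_measurable borel"
  unfolding tent_def[abs_def] by measurable

lemma tent_der_borel [measurable]: "tent_der a b c \<in> borel_measurable borel"
  unfolding tent_der_def[abs_def] by measurable

lemma tent_bounds:
  assumes "a < b" "b < c"
  shows "\<bar>tent a b c y\<bar> \<le> 1"
proof -
  have "0 \<le> inverse (b - a) * (y - a) \<and> inverse (b - a) * (y - a) \<le> 1" if "a \<le> y" "y \<le> b"
    using assms that by (simp add: field_simps)
  moreover have "0 \<le> inverse (c - b) * (y - b) \<and> inverse (c - b) * (y - b) \<le> 1" if "b \<le> y" "y \<le> c"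
    using assms that by (simp add: field_simps)
  ultimately show ?thesis by (auto simp: tent_def)
qed

lemma tent_integrable: "set_integrable lborel {x..y} (tent_der a b c)"
proof -
  have i: "set_integrable lborel {x..y} (indicat_real {u<..<v})" for u v :: real
    unfolding set_integrable_def
  proof (rule Bochner_Integration.integrable_bound)
    show "integrable lborel (indicat_real {x..y})" by (simp add: emeasure_lborel_Icc_eq)
    show "AE t in lborel. norm (indicat_real {x..y} t *\<^sub>R indicat_real {u<..<v} t) \<le> norm (indicat_real {x..y} t)"
      by (rule AE_I2) (simp add: indicator_def)
  qed measurable
  show ?thesis unfolding tent_der_def[abs_def] by (intro set_integral_diff(1) set_integrable_mult_right i)
qed

text \<open>The antiderivative of \<open>tent_der\<close> based at the left foot is evaluated piece
  by piece and found to be the tent; its values 1 at \<open>b\<close> and 0 at \<open>c\<close> link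
  the pieces.\<close>

lemma tent_integral:
  assumes abc: "a < b" "b < c" and "z \<le> y"
  shows "tent a b c y - tent a b c z = set_lebesgue_integral lborel {z..y} (tent_der a b c)"
proof -
  let ?k = "tent_der a b c"
  have d: "antideriv ?k a v - antideriv ?k a u = set_lebesgue_integral lborel {u..v} ?k" if "u \<le> v" for u v
    by (rule antideriv_diff[OF tent_der_borel tent_integrable that])
  note I = set_integral_const_interior[OF _ tent_der_borel]
  have "antideriv ?k a y = tent a b c y" for y
  proof -
    have b: "antideriv ?k a b = 1"
      using d[of a b] I[of a b a b c "inverse (b - a)"] abc by (simp add: tent_der_def)
    have c: "antideriv ?k a c = 0"
      using d[of b c] I[of b c a b c "- inverse (c - b)"] abc b by (simp add: tent_der_def)
    consider "y \<le> a" | "a < y" "y \<le> b" | "b < y" "y \<le> c" | "c < y" by linarith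
    then show ?thesis
    proof cases
      case 1
      then show ?thesis using d[of y a] I[of y a a b c 0] abc by (simp add: tent_der_def tent_def)
    next
      case 2
      then show ?thesis using d[of a y] I[of a y a b c "inverse (b - a)"] abc by (simp add: tent_der_def tent_def)
    next
      case 3
      then show ?thesis using d[of b y] I[of b y a b c "- inverse (c - b)"] abc b by (simp add: tent_der_def tent_def)
    next
      case 4
      then show ?thesis using d[of c y] I[of c y a b c 0] abc c by (simp add: tent_der_def tent_def)
    qed
  qed
  then show ?thesis using d[OF \<open>z \<le> y\<close>] by simp
qed

context nowhereK
begin

section \<open>The least Fukushima subspace\<close>

lemma minimal_dom_fukushima: "fukushima_subspace E \<mu> (Collect minimal_dom)"
  unfolding fukushima_subspace_def
proof
  show "Collect minimal_dom \<subseteq> F_space E \<mu>" using minimal_dom_imp_F by blast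
  show "regular_dirichlet E \<mu> (Collect minimal_dom)"
  proof (rule regular_dirichletI)
    show "(\<forall>x. x \<notin> E \<longrightarrow> f x = 0) \<and> L2 \<mu> f \<and> H1 f" if "f \<in> Collect minimal_dom" for f
      using that minimal_dom_D(1,2) minimal_dom_H1 by simp
    show "\<exists>f\<in>Collect minimal_dom. (\<lambda>n. E1 E \<mu> (\<lambda>x. fs n x - f x)) \<longlonglongrightarrow> 0"
      if a: "\<And>n. fs n \<in> Collect minimal_dom" and b: "\<And>\<epsilon>. \<epsilon> > 0 \<Longrightarrow> \<exists>N. \<forall>m\<ge>N. \<forall>n\<ge>N. E1 E \<mu> (\<lambda>x. fs n x - fs m x) < \<epsilon>" for fs
    proof -
      have "minimal_dom (fs n)" for n using a[of n] by simp
      from minimal_dom_complete[OF this b] show ?thesis by simp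
    qed
    show "\<exists>g\<in>Collect minimal_dom \<inter> Cc E. E1 E \<mu> (\<lambda>x. f x - g x) < e" if fe: "f \<in> Collect minimal_dom" "0 < e" for f e
    proof -
      have f: "minimal_dom f" using fe(1) by simp
      obtain h where "stepspan h" "E1 E \<mu> (\<lambda>x. f x - h x) < e" by (rule minimal_dom_core[OF f fe(2)]) (rule that)
      then show ?thesis using stepspan_minimal_dom[of h] stepspan_Cc[of h] by (intro bexI[of _ h]) simp_all
    qed
  qed (simp_all add: minimal_dom_zero minimal_dom_add minimal_dom_scale minimal_dom_unit minimal_dom_bump)
qed

lemma minimal_dom_least:
  assumes S: "fukushima_subspace E \<mu> S"
  shows "Collect minimal_dom \<subseteq> S"
proof
  fix f assume "f \<in> Collect minimal_dom"
  then have f: "minimal_dom f" by simp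
  show "f \<in> S"
  proof (rule S_closed[OF S minimal_dom_H1[OF f] minimal_dom_D(2)[OF f] minimal_dom_D(1)[OF f]])
    fix e :: real assume "0 < e"
    then obtain h where "stepspan h" "E1 E \<mu> (\<lambda>x. f x - h x) < e" by (rule minimal_dom_core[OF f]) (rule that)
    then show "\<exists>g\<in>S. E1 E \<mu> (\<lambda>x. f x - g x) < e" using stepspan_in_S[OF S] by blast
  qed assumption
qed

lemma minimal_iff: "minimal_fukushima E \<mu> S \<longleftrightarrow> S = Collect minimal_dom"
proof
  assume "minimal_fukushima E \<mu> S"
  then show "S = Collect minimal_dom" unfolding minimal_fukushima_def using minimal_dom_fukushima minimal_dom_least by blast
next
  assume "S = Collect minimal_dom"
  then show "minimal_fukushima E \<mu> S" unfolding minimal_fukushima_def using minimal_dom_fukushima minimal_dom_least by blast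
qed

lemma minimal_dom_represented: "represented_by E \<mu> (Collect minimal_dom) sb off_E"
  unfolding represented_by_def using scale_sb minimal_dom_iff by blast

text \<open>A tent in the variable \<open>\<sigma>\<close> belongs to the space; minimality forces its derivative, which is a
  nonzero multiple of \<open>h\<close> on \<open>E\<close> below the tent, to vanish on \<open>E\<close>.\<close>

lemma char_set_null:
  assumes rep: "represented_by E \<mu> (Collect minimal_dom) \<sigma> h"
  shows "char_set E h \<in> null_sets lborel"
proof -
  have sc: "scale_fn E \<sigma> h" and S: "Collect minimal_dom = Fs_space E \<mu> \<sigma> h" using rep by (simp_all add: represented_by_def)
  have hb [measurable]: "h \<in> borel_measurable borel" and h01: "h x = 0 \<or> h x = 1" for x
    using sc by (auto simp: scale_fn_def)
  have sm: "\<sigma> x < \<sigma> y" if "x \<in> intI E" "y \<in> intI E" "x < y" for x y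
    using sc that unfolding scale_fn_def strict_mono_on_def by blast
  have si: "set_integrable lborel {x..y} h" "\<sigma> y - \<sigma> x = set_lebesgue_integral lborel {x..y} h"
    if "x \<in> E" "y \<in> E" "x \<le> y" for x y
    using sc intI_I[OF that(1)] intI_I[OF that(2)] that(3) unfolding scale_fn_def by blast+
  have pr: "primitive E (\<lambda>x. u + v * (\<sigma> x - w)) (\<lambda>t. v * h t)" for u v w
    unfolding primitive_def
  proof (intro conjI ballI impI)
    fix x y assume xy: "x \<in> E" "y \<in> E" "x \<le> y"
    show "set_integrable lborel {x..y} (\<lambda>t. v * h t)" by (intro set_integrable_mult_right si(1)[OF xy])
    show "u + v * (\<sigma> y - w) - (u + v * (\<sigma> x - w)) = set_lebesgue_integral lborel {x..y} (\<lambda>t. v * h t)"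
    proof -
      have "u + v * (\<sigma> y - w) - (u + v * (\<sigma> x - w)) = v * (\<sigma> y - \<sigma> x)" by (simp add: algebra_simps)
      then show ?thesis unfolding si(2)[OF xy] by simp
    qed
  qed measurable
  \<comment> \<open>Peak over \<open>x1\<close> and feet over \<open>x0\<close> and
    \<open>x2\<close>, all in \<open>E\<close>: on either flank \<open>f\<close> is an affine
    function of \<open>\<sigma>\<close>, so its density there is a constant multiple of
    \<open>h\<close> that can be compared with \<open>slope E f\<close>.\<close>
  have three: "AE t in lborel. t \<in> E \<inter> {x0..x2} \<longrightarrow> h t = 0"
    if x: "x0 \<in> E" "x1 \<in> E" "x2 \<in> E" "x0 < x1" "x1 < x2" for x0 x1 x2
  proof -
    note xI = intI_I[OF x(1)] intI_I[OF x(2)] intI_I[OF x(3)]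
    let ?y0 = "\<sigma> x0" and ?y1 = "\<sigma> x1" and ?y2 = "\<sigma> x2"
    have y: "?y0 < ?y1" "?y1 < ?y2" by (rule sm[OF xI(1,2) x(4)], rule sm[OF xI(2,3) x(5)])
    have lt: "?y0 < \<sigma> t \<longleftrightarrow> x0 < t" "\<sigma> t < ?y1 \<longleftrightarrow> t < x1" "?y1 < \<sigma> t \<longleftrightarrow> x1 < t" "\<sigma> t < ?y2 \<longleftrightarrow> t < x2" if "t \<in> intI E" for t
      using sm[OF that] sm[OF _ that] xI by (metis less_irrefl linorder_neqE_linordered_idom less_asym)+
    let ?G = "tent ?y0 ?y1 ?y2" and ?k = "tent_der ?y0 ?y1 ?y2"
    define f where "f t = (if t \<in> E then ?G (\<sigma> t) else 0)" for t
    have fG: "f t = ?G (\<sigma> t)" if "t \<in> E" for t using that by (simp add: f_def)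
    have H: "H1s_rep E \<sigma> h f ?G ?k" unfolding H1s_rep_def
    proof (intro conjI allI impI ballI)
      show "set_integrable lborel {z..u} ?k" for z u by (rule tent_integrable)
      show "?G u - ?G z = set_lebesgue_integral lborel {z..u} ?k" if "u \<in> s_hull E \<sigma> \<and> z \<in> s_hull E \<sigma> \<and> z \<le> u" for z u
        using tent_integral[OF y] that by blast
      have kk: "?k (\<sigma> t) = inverse (?y1 - ?y0) * indicator {x0<..<x1} t - inverse (?y2 - ?y1) * indicator {x1<..<x2} t"
        if "t \<in> intI E" for t using lt[OF that] by (simp add: tent_der_def indicator_def)
      have inI: "t \<in> intI E" if "x0 < t" "t < x2" for t
      proof -
        have "t \<in> {x0..x2}" using that by simp
        then show ?thesis unfolding intI_eq by (rule subsetD[OF Icc_subset[OF x(1,3)]])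
      qed
      let ?c = "\<lambda>t. (inverse (?y1 - ?y0) * indicator {x0<..<x1} t - inverse (?y2 - ?y1) * indicator {x1<..<x2} t :: real)"
      have "indicator (intI E) t *\<^sub>R ((?k (\<sigma> t))\<^sup>2 * h t) = (?c t)\<^sup>2 * h t" for t
      proof (cases "t \<in> intI E")
        case False
        then have "\<not> (x0 < t \<and> t < x2)" using inI by blast
        then show ?thesis using False x by (auto simp: indicator_def)
      qed (simp add: kk)
      moreover have "integrable lborel (\<lambda>t. (?c t)\<^sup>2 * h t)"
      proof (rule Bochner_Integration.integrable_bound)
        show "integrable lborel (\<lambda>t. ((inverse (?y1 - ?y0))\<^sup>2 + (inverse (?y2 - ?y1))\<^sup>2) * indicator {x0..x2} t)" by (simp add: emeasure_lborel_Icc_eq)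
        show "AE t in lborel. norm ((?c t)\<^sup>2 * h t) \<le> norm (((inverse (?y1 - ?y0))\<^sup>2 + (inverse (?y2 - ?y1))\<^sup>2) * indicator {x0..x2} t)"
        proof (rule AE_I2)
          fix t
          have "(?c t)\<^sup>2 \<le> ((inverse (?y1 - ?y0))\<^sup>2 + (inverse (?y2 - ?y1))\<^sup>2) * indicator {x0..x2} t"
            using x by (auto simp: indicator_def)
          moreover have "norm ((?c t)\<^sup>2 * h t) \<le> (?c t)\<^sup>2" using h01[of t] by auto
          ultimately show "norm ((?c t)\<^sup>2 * h t) \<le> norm (((inverse (?y1 - ?y0))\<^sup>2 + (inverse (?y2 - ?y1))\<^sup>2) * indicator {x0..x2} t)"
            by (simp only: real_norm_def)
        qed
      qed measurable
      ultimately show "set_integrable lborel (intI E) (\<lambda>t. (?k (\<sigma> t))\<^sup>2 * h t)" by (simp only: set_integrable_def)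
    qed (simp_all add: fG)
    have bd: "s_bdry E \<sigma> ?G" unfolding s_bdry_def
    proof (intro conjI impI)
      assume "lE E \<notin> ereal ` E \<and> \<bar>s_lo E \<sigma>\<bar> \<noteq> \<infinity>"
      then have "real_of_ereal (s_lo E \<sigma>) \<le> ?y0" using s_lo_le[OF xI(1), of \<sigma>] finite_erealE[of "s_lo E \<sigma>"] by (metis ereal_less_eq(3))
      then show "?G (real_of_ereal (s_lo E \<sigma>)) = 0" by (simp add: tent_def)
    next
      assume "rE E \<notin> ereal ` E \<and> \<bar>s_hi E \<sigma>\<bar> \<noteq> \<infinity>"
      then have "?y2 \<le> real_of_ereal (s_hi E \<sigma>)" using s_hi_ge[OF xI(3), of \<sigma>] finite_erealE[of "s_hi E \<sigma>"] by (metis ereal_less_eq(3))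
      then show "?G (real_of_ereal (s_hi E \<sigma>)) = 0" using y by (simp add: tent_def)
    qed
    have fm: "f \<in> borel_measurable \<mu>"
    proof -
      \<comment> \<open>Monotonicity on \<open>E\<close> provides the measurability of
        \<open>\<sigma>\<close> there.\<close>
      have "mono_on E \<sigma>" using sm intI_I by (intro mono_onI) (metis less_le order_refl)
      then have "\<sigma> \<in> borel_measurable (restrict_space borel E)" by (rule borel_measurable_mono_on_fnc)
      then have "(\<lambda>t. ?G (\<sigma> t)) \<in> borel_measurable (restrict_space borel E)" by (rule measurable_compose) measurable
      then have "(\<lambda>t. ?G (\<sigma> t)) \<in> borel_measurable \<mu>" by (simp only: measurable_cong_sets[OF sets_mu refl])
      moreover have "f \<in> borel_measurable \<mu> \<longleftrightarrow> (\<lambda>t. ?G (\<sigma> t)) \<in> borel_measurable \<mu>"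
        by (rule measurable_cong) (simp add: space_mu fG)
      ultimately show ?thesis by blast
    qed
    have "integrable \<mu> (\<lambda>t. (f t)\<^sup>2)"
    proof (rule integrable_bounded_compact(1)[OF _ compact_Int[OF x(1,3)]])
      show "(\<lambda>t. (f t)\<^sup>2) \<in> borel_measurable \<mu>" using fm by measurable
      show "\<bar>(f t)\<^sup>2\<bar> \<le> 1" for t
        using power_mono[OF tent_bounds[OF y, of "\<sigma> t"] abs_ge_zero, of 2] by (simp add: f_def)
      show "(f t)\<^sup>2 = 0" if "t \<in> E" "t \<notin> E \<inter> {x0..x2}" for t
      proof -
        have "\<not> (?y0 < \<sigma> t \<and> \<sigma> t < ?y2)" using lt(1,4)[OF intI_I[OF that(1)]] that by auto
        then show ?thesis using y by (auto simp: fG[OF that(1)] tent_def)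
      qed
    qed auto
    then have "f \<in> Fs_space E \<mu> \<sigma> h" unfolding Fs_space_def L2_def using H bd fm by (auto simp: f_def)
    then have f: "minimal_dom f" using S by blast
    \<comment> \<open>The slope is 0 at points of \<open>E\<close>; if it equals a nonzero multiple
      of \<open>h\<close> there, then \<open>h\<close> vanishes.\<close>
    have z: "h t = 0" if "t \<in> E" "slope E f t = v * h t" "v \<noteq> 0" for t v using that slope_in[OF that(1), of f] by simp
    have "AE t in lborel. t \<in> E \<inter> {x0..x1} \<longrightarrow> slope E f t = inverse (?y1 - ?y0) * h t"
    proof (rule der_local[OF x(1,2,4) _ minimal_dom_D(4)[OF f] pr[of 0 _ ?y0]])
      fix t assume t: "t \<in> E" "x0 \<le> t" "t \<le> x1"
      have "?y0 \<le> \<sigma> t" "\<sigma> t \<le> ?y1" using lt(2)[OF intI_I[OF t(1)]] lt(1)[OF intI_I[OF t(1)]] lt(3)[OF intI_I[OF t(1)]] t sm[OF xI(1) intI_I[OF t(1)]]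
        by (auto simp: le_less)
      then show "f t = 0 + inverse (?y1 - ?y0) * (\<sigma> t - ?y0)" using y by (auto simp: fG[OF t(1)] tent_def)
    qed
    moreover have "AE t in lborel. t \<in> E \<inter> {x1..x2} \<longrightarrow> slope E f t = - inverse (?y2 - ?y1) * h t"
    proof (rule der_local[OF x(2,3,5) _ minimal_dom_D(4)[OF f] pr[of 1 _ ?y1]])
      fix t assume t: "t \<in> E" "x1 \<le> t" "t \<le> x2"
      have "?y1 \<le> \<sigma> t" "\<sigma> t \<le> ?y2" using t sm[OF xI(2) intI_I[OF t(1)]] sm[OF intI_I[OF t(1)] xI(3)]
        by (auto simp: le_less)
      then show "f t = 1 + - inverse (?y2 - ?y1) * (\<sigma> t - ?y1)" using y by (auto simp: fG[OF t(1)] tent_def)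
    qed
    ultimately show ?thesis
    proof eventually_elim
      case (elim t)
      show ?case
      proof
        assume t: "t \<in> E \<inter> {x0..x2}"
        show "h t = 0"
        proof (cases "t \<le> x1")
          case True
          show ?thesis by (rule z[of t "inverse (?y1 - ?y0)"]) (use t True elim y in auto)
        next
          case False
          show ?thesis by (rule z[of t "- inverse (?y2 - ?y1)"]) (use t False elim y in auto)
        qed
      qed
    qed
  qed
  have "AE t in lborel. t \<in> E \<longrightarrow> h t = 0"
  proof (rule AE_E_I[where P = "\<lambda>t. h t = 0"])
    fix x y assume xy: "x \<in> E" "y \<in> E"
    show "AE t in lborel. t \<in> E \<inter> {x..y} \<longrightarrow> h t = 0"
    proof (cases "\<exists>z\<in>E. x < z \<and> z < y")
      case True
      then show ?thesis using three[OF xy(1) _ xy(2)] by blast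
    next
      case False
      \<comment> \<open>Without a point of \<open>E\<close> strictly between them, \<open>x\<close>
        and \<open>y\<close> are the only possible points of
        \<open>E \<inter> {x..y}\<close>.\<close>
      show ?thesis using AE_lborel_singleton[of x] AE_lborel_singleton[of y]
        by eventually_elim (use False in force)
    qed
  qed
  then have "AE t in lborel. t \<notin> char_set E h"
    by eventually_elim (auto simp: char_set_def)
  moreover have "char_set E h \<in> sets lborel"
  proof -
    have "char_set E h = E \<inter> (h -` {1} \<inter> space borel)" by (auto simp: char_set_def)
    then show ?thesis using E_borel measurable_sets[OF hb, of "{1}"] by simp
  qed
  ultimately show ?thesis by (simp add: AE_iff_null_sets)
qed

end

theorem theorem5p5:
  fixes E :: "real set" and \<mu> :: "real measure"
  assumes "class_K E"
    and "full_radon_on E \<mu>"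
  shows "((\<exists>S. minimal_fukushima E \<mu> S) \<longleftrightarrow> interior E = {}) \<and>
         (interior E = {} \<longrightarrow>
            (\<exists>!S. minimal_fukushima E \<mu> S) \<and>
            (\<forall>S. minimal_fukushima E \<mu> S \<longrightarrow>
               (\<exists>sb h. represented_by E \<mu> S sb h) \<and>
               (\<forall>sb h. represented_by E \<mu> S sb h \<longrightarrow> char_set E h \<in> null_sets lborel) \<and>
               (\<forall>f \<in> S. \<forall>g \<in> S. form E f g = 1/2 * gap_sum E f g)))"
proof (cases "interior E = {}")
  case True
  interpret nowhereK E \<mu> by unfold_locales (rule assms True)+
  have "form E f g = 1/2 * gap_sum E f g" if "f \<in> Collect minimal_dom" "g \<in> Collect minimal_dom" for f g
    using minimal_dom_form(2)[of f g] that by simp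
  moreover have "\<exists>sb h. represented_by E \<mu> (Collect minimal_dom) sb h" using minimal_dom_represented by blast
  ultimately show ?thesis unfolding minimal_iff using True char_set_null by simp
next
  case False
  interpret radonK E \<mu> by unfold_locales (rule assms)+
  have "\<not> minimal_fukushima E \<mu> S" for S
    using not_minimal[OF False] unfolding minimal_fukushima_def by blast
  then show ?thesis using False by simp
qed

end
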